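(* Let $\mathcal D$ be a special datum of type $A_1\times\cdots\times A_1$, and let $\mu$ and $\lambda$ be root vector parameters and linking parameters for $\mathcal D$. Let $$\sigma:=\sigma_{\lambda,\mu}*e^{\sum_i\mu_i\zeta_i}\colon u(\mathcal D,0,0)\otimes u(\mathcal D,0,0)\to k .$$ Then $\sigma$ is a multiplicative cocycle and $u(\mathcal D,0,0)_\sigma=u(\mathcal D,\lambda,\mu)$.
   Context: $k$ is an algebraically closed field of characteristic $0$; $G$ is a finite abelian group, $\widehat G=\mathrm{Hom}(G,k^\times)$, $\varepsilon$ denotes trivial characters and counits, $*$ is convolution. Datum: $\mathcal D$ is given by $g_1,\dots,g_\theta\in G$, $\chi_1,\dots,\chi_\theta\in\widehat G$ with $\chi_i(g_j)\chi_j(g_i)=1$ for $i\ne j$ and $\chi_i(g_i)\ne1$ of odd order $N_i$. Root vector parameters: $\mu=(\mu_i)$, $\mu_i\in k$, with $\mu_i=0$ if $\chi_i^{N_i}\ne\varepsilon$. Indices $i\ne j$ are linkable if $\chi_i\chi_j=\varepsilon$, $g_ig_j\neq1$ (and $\chi_i(g_j)\chi_j(g_i)=1$). Linking parameters: $\lambda=(\lambda_{ij})_{i<j}$, $\lambda_{ij}\in k$, with $\lambda_{ij}=0$ unless $i,j$ are linkable. $u(\mathcal D,\lambda,\mu)$ is the Hopf algebra generated by $G$ and $x_1,\dots,x_\theta$ with the relations of $G$, $gx_i=\chi_i(g)x_ig$, $x_i^{N_i}=\mu_i(1-g_i^{N_i})$ and $x_ix_j-\chi_j(g_i)x_jx_i=\lambda_{ij}(1-g_ig_j)$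 for $i<j$, with $\Delta(g)=g\otimes g$, $\Delta(x_i)=x_i\otimes1+g_i\otimes x_i$. It has PBW basis $x^ag=x_1^{a_1}\cdots x_\theta^{a_\theta}g$, $0\le a_i<N_i$, $g\in G$. A multiplicative cocycle on a Hopf algebra $B$ is a convolution invertible $\sigma:B\otimes B\to k$ with $(\varepsilon\otimes\sigma)*\sigma(1\otimes m)=(\sigma\otimes\varepsilon)*\sigma(m\otimes1)$ and $\sigma(1,b)=\varepsilon(b)=\sigma(b,1)$; $B_\sigma$ is $B$ as a coalgebra with multiplication $\sigma*m*\sigma^{-1}$. Equalities of Hopf algebras mean that the generators $g\in G$, $x_i$ of the deformed algebra satisfy, and are presented by, the stated relations. Root vector part: on $A=u(\mathcal D,0,0)$, $\zeta_i(x^ag,x^bh)=\chi_i^{b_i}(g)$ if $a=a_ie_i$, $b=b_ie_i$ and $a_i+b_i=N_i$, and $0$ otherwise ($e_i$ the $i$-th unit vector). $e^\zeta=\sum_{n\ge0}\zeta^{*n}/n!$. The Hopf algebra $u(\mathcal D,0,\mu)$ is identified with $A_{e^{\zeta}}$, $\zeta=\sum_i\mu_i\zeta_i$; in particular it has the same underlying coalgebra as $A$, so functionals on $u(\mathcal D,0,\mu)^{\otimes2}$ and on $A^{\otimes 2}$ are identified. Linking part: let $G_0\subseteq G$ be the subgroup generated by the $g_i^{N_i}$ with $\chi_i^{N_i}=\varepsilon$ and $g_i^{N_i}\ne1$; $\mathcal D'$ is the datum obtained from $\mathcal D$ by replacing $G$ by $G'=G/G_0$ (the $\chi_i$ are trivial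 on $G_0$). $I_\mu$ is the ideal of $u(\mathcal D,0,\mu)$ generated by the augmentation ideal $(kG_0)^+$ and $\pi_\mu:u(\mathcal D,0,\mu)\to u(\mathcal D,0,\mu)/I_\mu=u(\mathcal D',0,0)$ the projection. On $A'=u(\mathcal D',0,0)$ put $\chi_i(x^ag)=\varepsilon(x^a)\chi_i(g)$, and let $d_i:A'\to k$ be the functional with $d_i(x_ig)=1$ for all $g$ and $d_i=0$ on all other PBW basis elements; put $\eta_{i,j}=(d_i*\chi_j)\otimes d_j:A'\otimes A'\to k$. For $q$ a primitive $\ell$-th root of unity, $\exp_q(y)=\sum_{m=0}^{\ell-1}y^m/(m)!_q$, where $(m)!_q=\prod_{r=1}^m(1+q+\dots+q^{r-1})$. Then $\sigma_\lambda$ is the convolution product of the pairwise commuting functionals $\exp_{\chi_j(g_i)}(\lambda_{ij}\eta_{i,j})$ over linkable pairs $i<j$, and $\sigma_{\lambda,\mu}=\sigma_\lambda\circ(\pi_\mu\otimes\pi_\mu)$. *)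

theory Defs
  imports
    "HOL-Algebra.Module"
    "HOL-Algebra.QuotRing"
    "HOL-Algebra.Generated_Groups"
    "HOL-Algebra.Multiplicative_Group"
    "HOL-Library.Poly_Mapping"
    "HOL-Library.Product_Plus"
    "HOL-Computational_Algebra.Polynomial"
begin

section \<open>Bialgebras and convolution\<close>

text \<open>
  An element of a tensor square is represented by a formal linear combination of pairs; such a
  combination represents zero iff all bilinear forms vanish on it (\<open>tensor_eq\<close> below), which over a
  field is equality in the tensor product.  Functionals on a tensor square are bilinear forms.
  An antipode is not recorded: it is determined by the bialgebra structure, and bialgebra
  isomorphisms preserve it.
\<close>

record (overloaded) ('k :: zero, 'a) bialgebra = "('k, 'a) module" +
  comult :: "'a \<Rightarrow> ('a \<times> 'a) \<Rightarrow>\<^sub>0 'k"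
  counit :: "'a \<Rightarrow> 'k"

definition linear_form :: "('k::field, 'a) bialgebra \<Rightarrow> ('a \<Rightarrow> 'k) \<Rightarrow> bool" where
  "linear_form H f \<longleftrightarrow>
     (\<forall>a\<in>carrier H. \<forall>b\<in>carrier H. f (a \<oplus>\<^bsub>H\<^esub> b) = f a + f b) \<and>
     (\<forall>c. \<forall>a\<in>carrier H. f (c \<odot>\<^bsub>H\<^esub> a) = c * f a)"

definition bilinear_form :: "('k::field, 'a) bialgebra \<Rightarrow> ('a \<Rightarrow> 'a \<Rightarrow> 'k) \<Rightarrow> bool" where
  "bilinear_form H \<beta> \<longleftrightarrow>
     (\<forall>a\<in>carrier H. linear_form H (\<beta> a)) \<and> (\<forall>b\<in>carrier H. linear_form H (\<lambda>a. \<beta> a b))"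

text \<open>Sums in Sweedler notation: \<open>sweedler (comult H a) f\<close> is \<open>f\<close> summed over the two legs of the
  coproduct of \<open>a\<close>, in the ground field; \<open>sweedler_in H\<close> is the analogue for \<open>H\<close>-valued \<open>f\<close>.\<close>

definition sweedler :: "(('a \<times> 'a) \<Rightarrow>\<^sub>0 'k::field) \<Rightarrow> ('a \<Rightarrow> 'a \<Rightarrow> 'k) \<Rightarrow> 'k" where
  "sweedler t f = (\<Sum>z\<in>Poly_Mapping.keys t. Poly_Mapping.lookup t z * f (fst z) (snd z))"

definition sweedler_in ::
  "('k::field, 'a) bialgebra \<Rightarrow> (('a \<times> 'a) \<Rightarrow>\<^sub>0 'k) \<Rightarrow> ('a \<Rightarrow> 'a \<Rightarrow> 'a) \<Rightarrow> 'a" where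
  "sweedler_in H t f = (\<Oplus>\<^bsub>H\<^esub> z\<in>Poly_Mapping.keys t. Poly_Mapping.lookup t z \<odot>\<^bsub>H\<^esub> f (fst z) (snd z))"

definition tensor_eq ::
  "('k::field, 'a) bialgebra \<Rightarrow> (('a \<times> 'a) \<Rightarrow>\<^sub>0 'k) \<Rightarrow> (('a \<times> 'a) \<Rightarrow>\<^sub>0 'k) \<Rightarrow> bool" where
  "tensor_eq H s t \<longleftrightarrow> (\<forall>\<beta>. bilinear_form H \<beta> \<longrightarrow> sweedler s \<beta> = sweedler t \<beta>)"

definition push :: "('b \<Rightarrow> 'c) \<Rightarrow> ('b \<Rightarrow>\<^sub>0 'k::field) \<Rightarrow> ('c \<Rightarrow>\<^sub>0 'k)" where
  "push f t = (\<Sum>z\<in>Poly_Mapping.keys t. Poly_Mapping.single (f z) (Poly_Mapping.lookup t z))"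

definition bialgebra_iso ::
  "('k::field, 'a) bialgebra \<Rightarrow> ('k, 'b) bialgebra \<Rightarrow> ('a \<Rightarrow> 'b) \<Rightarrow> bool" where
  "bialgebra_iso H K \<phi> \<longleftrightarrow>
     \<phi> \<in> ring_iso H K \<and>
     (\<forall>c. \<forall>a\<in>carrier H. \<phi> (c \<odot>\<^bsub>H\<^esub> a) = c \<odot>\<^bsub>K\<^esub> \<phi> a) \<and>
     (\<forall>a\<in>carrier H. tensor_eq K (comult K (\<phi> a)) (push (map_prod \<phi> \<phi>) (comult H a))) \<and>
     (\<forall>a\<in>carrier H. counit K (\<phi> a) = counit H a)"

definition conv1 ::
  "('k::field, 'a) bialgebra \<Rightarrow> ('a \<Rightarrow> 'k) \<Rightarrow> ('a \<Rightarrow> 'k) \<Rightarrow> 'a \<Rightarrow> 'k" where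
  "conv1 H f g a = sweedler (comult H a) (\<lambda>a1 a2. f a1 * g a2)"

definition conv2 :: "('k::field, 'a) bialgebra \<Rightarrow>
    ('a \<Rightarrow> 'a \<Rightarrow> 'k) \<Rightarrow> ('a \<Rightarrow> 'a \<Rightarrow> 'k) \<Rightarrow> 'a \<Rightarrow> 'a \<Rightarrow> 'k" where
  "conv2 H \<sigma> \<tau> a b =
     sweedler (comult H a) (\<lambda>a1 a2. sweedler (comult H b) (\<lambda>b1 b2. \<sigma> a1 b1 * \<tau> a2 b2))"

definition conv3 :: "('k::field, 'a) bialgebra \<Rightarrow>
    ('a \<Rightarrow> 'a \<Rightarrow> 'a \<Rightarrow> 'k) \<Rightarrow> ('a \<Rightarrow> 'a \<Rightarrow> 'a \<Rightarrow> 'k) \<Rightarrow> 'a \<Rightarrow> 'a \<Rightarrow> 'a \<Rightarrow> 'k" where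
  "conv3 H S T a b c =
     sweedler (comult H a) (\<lambda>a1 a2. sweedler (comult H b) (\<lambda>b1 b2.
       sweedler (comult H c) (\<lambda>c1 c2. S a1 b1 c1 * T a2 b2 c2)))"

definition conv2_unit :: "('k::field, 'a) bialgebra \<Rightarrow> 'a \<Rightarrow> 'a \<Rightarrow> 'k" where
  "conv2_unit H a b = counit H a * counit H b"

definition conv2_power ::
  "('k::field, 'a) bialgebra \<Rightarrow> ('a \<Rightarrow> 'a \<Rightarrow> 'k) \<Rightarrow> nat \<Rightarrow> 'a \<Rightarrow> 'a \<Rightarrow> 'k" where
  "conv2_power H \<sigma> n = (conv2 H \<sigma> ^^ n) (conv2_unit H)"

definition is_conv2_inverse ::
  "('k::field, 'a) bialgebra \<Rightarrow> ('a \<Rightarrow> 'a \<Rightarrow> 'k) \<Rightarrow> ('a \<Rightarrow> 'a \<Rightarrow> 'k) \<Rightarrow> bool" where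
  "is_conv2_inverse H \<sigma> \<tau> \<longleftrightarrow>
     bilinear_form H \<tau> \<and>
     (\<forall>a\<in>carrier H. \<forall>b\<in>carrier H.
        conv2 H \<sigma> \<tau> a b = conv2_unit H a b \<and> conv2 H \<tau> \<sigma> a b = conv2_unit H a b)"

definition conv2_inverse ::
  "('k::field, 'a) bialgebra \<Rightarrow> ('a \<Rightarrow> 'a \<Rightarrow> 'k) \<Rightarrow> 'a \<Rightarrow> 'a \<Rightarrow> 'k" where
  "conv2_inverse H \<sigma> = (SOME \<tau>. is_conv2_inverse H \<sigma> \<tau>)"

definition multiplicative_cocycle ::
  "('k::field, 'a) bialgebra \<Rightarrow> ('a \<Rightarrow> 'a \<Rightarrow> 'k) \<Rightarrow> bool" where
  "multiplicative_cocycle H \<sigma> \<longleftrightarrow>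
     bilinear_form H \<sigma> \<and>
     (\<exists>\<tau>. is_conv2_inverse H \<sigma> \<tau>) \<and>
     (\<forall>a\<in>carrier H. \<forall>b\<in>carrier H. \<forall>c\<in>carrier H.
        conv3 H (\<lambda>x y z. counit H x * \<sigma> y z) (\<lambda>x y z. \<sigma> x (y \<otimes>\<^bsub>H\<^esub> z)) a b c =
        conv3 H (\<lambda>x y z. \<sigma> x y * counit H z) (\<lambda>x y z. \<sigma> (x \<otimes>\<^bsub>H\<^esub> y) z) a b c) \<and>
     (\<forall>b\<in>carrier H. \<sigma> \<one>\<^bsub>H\<^esub> b = counit H b \<and> \<sigma> b \<one>\<^bsub>H\<^esub> = counit H b)"

text \<open>The deformation \<open>H\<^sub>\<sigma>\<close>: the coalgebra \<open>H\<close> with multiplication \<open>\<sigma> * m * \<sigma>\<^sup>-\<^sup>1\<close>.\<close>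

definition twist ::
  "('k::field, 'a) bialgebra \<Rightarrow> ('a \<Rightarrow> 'a \<Rightarrow> 'k) \<Rightarrow> ('k, 'a) bialgebra" where
  "twist H \<sigma> = H\<lparr>monoid.mult := (\<lambda>a b.
     sweedler_in H (comult H a) (\<lambda>a1 a'. sweedler_in H (comult H a') (\<lambda>a2 a3.
       sweedler_in H (comult H b) (\<lambda>b1 b'. sweedler_in H (comult H b') (\<lambda>b2 b3.
         (\<sigma> a1 b1 * conv2_inverse H \<sigma> a3 b3) \<odot>\<^bsub>H\<^esub> (a2 \<otimes>\<^bsub>H\<^esub> b2))))))\<rparr>"

text \<open>\<open>Sum_any\<close> adds up the finitely many nonzero terms of a pointwise finite series.\<close>

definition conv2_exp ::
  "('k::field_char_0, 'a) bialgebra \<Rightarrow> ('a \<Rightarrow> 'a \<Rightarrow> 'k) \<Rightarrow> 'a \<Rightarrow> 'a \<Rightarrow> 'k" where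
  "conv2_exp H \<sigma> a b = Sum_any (\<lambda>n. conv2_power H \<sigma> n a b / fact n)"

definition kstar :: "'k::field monoid" where
  "kstar = \<lparr>carrier = UNIV - {0}, monoid.mult = (*), one = 1\<rparr>"

definition q_fact :: "'k::field \<Rightarrow> nat \<Rightarrow> 'k" where
  "q_fact q m = (\<Prod>r=1..m. \<Sum>s<r. q ^ s)"

definition conv2_q_exp ::
  "('k::field, 'a) bialgebra \<Rightarrow> 'k \<Rightarrow> ('a \<Rightarrow> 'a \<Rightarrow> 'k) \<Rightarrow> 'a \<Rightarrow> 'a \<Rightarrow> 'k" where
  "conv2_q_exp H q \<sigma> a b = (\<Sum>m<group.ord kstar q. conv2_power H \<sigma> m a b / q_fact q m)"

section \<open>Data and parameters\<close>

text \<open>Indices run over \<open>0, \<dots>, \<theta> - 1\<close>.\<close>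

record ('g, 'k) datum =
  grp :: "'g monoid"
  theta :: nat
  gg :: "nat \<Rightarrow> 'g"
  chi :: "nat \<Rightarrow> 'g \<Rightarrow> 'k"

definition NN :: "('g, 'k::field) datum \<Rightarrow> nat \<Rightarrow> nat" where
  "NN D i = group.ord kstar (chi D i (gg D i))"

definition special_datum :: "('g, 'k::field) datum \<Rightarrow> bool" where
  "special_datum D \<longleftrightarrow>
     comm_group (grp D) \<and> finite (carrier (grp D)) \<and>
     (\<forall>i<theta D. gg D i \<in> carrier (grp D) \<and> chi D i \<in> hom (grp D) kstar) \<and>
     (\<forall>i<theta D. \<forall>j<theta D. i \<noteq> j \<longrightarrow> chi D i (gg D j) * chi D j (gg D i) = 1) \<and>
     (\<forall>i<theta D. chi D i (gg D i) \<noteq> 1 \<and> odd (NN D i))"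

definition root_vector_parameters :: "('g, 'k::field) datum \<Rightarrow> (nat \<Rightarrow> 'k) \<Rightarrow> bool" where
  "root_vector_parameters D \<mu> \<longleftrightarrow>
     (\<forall>i<theta D. (\<exists>h\<in>carrier (grp D). chi D i h ^ NN D i \<noteq> 1) \<longrightarrow> \<mu> i = 0)"

definition linkable :: "('g, 'k::field) datum \<Rightarrow> nat \<Rightarrow> nat \<Rightarrow> bool" where
  "linkable D i j \<longleftrightarrow>
     i < theta D \<and> j < theta D \<and> i \<noteq> j \<and>
     (\<forall>h\<in>carrier (grp D). chi D i h * chi D j h = 1) \<and>
     gg D i \<otimes>\<^bsub>grp D\<^esub> gg D j \<noteq> \<one>\<^bsub>grp D\<^esub> \<and>
     chi D i (gg D j) * chi D j (gg D i) = 1"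

definition linking_parameters :: "('g, 'k::field) datum \<Rightarrow> (nat \<Rightarrow> nat \<Rightarrow> 'k) \<Rightarrow> bool" where
  "linking_parameters D l \<longleftrightarrow>
     (\<forall>i j. i < j \<and> j < theta D \<and> \<not> linkable D i j \<longrightarrow> l i j = 0)"

section \<open>The Hopf algebras by generators and relations\<close>

datatype 'g letter = Grp 'g | Var nat

instantiation list :: (type) monoid_add
begin
definition zero_list :: "'a list" where "zero_list = []"
definition plus_list :: "'a list \<Rightarrow> 'a list \<Rightarrow> 'a list" where "plus_list = (@)"
instance by standard (simp_all add: zero_list_def plus_list_def)
end

text \<open>
  With concatenation as addition of words, the convolution ring \<open>'x list \<Rightarrow>\<^sub>0 'k\<close> is the free algebra on
  \<open>'x\<close>, and \<open>('x list \<times> 'x list) \<Rightarrow>\<^sub>0 'k\<close> (with the componentwise addition of pairs) is its tensor square as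
  an algebra.
\<close>

definition letters :: "('g, 'k) datum \<Rightarrow> 'g letter set" where
  "letters D = Grp ` carrier (grp D) \<union> Var ` {..<theta D}"

definition free_alg :: "('g, 'k::field) datum \<Rightarrow> ('g letter list \<Rightarrow>\<^sub>0 'k) ring" where
  "free_alg D = \<lparr>carrier = {p. Poly_Mapping.keys p \<subseteq> lists (letters D)},
                 monoid.mult = (*), one = 1, zero = 0, add = (+)\<rparr>"

abbreviation const :: "'k::field \<Rightarrow> ('g letter list \<Rightarrow>\<^sub>0 'k)" where
  "const c \<equiv> Poly_Mapping.single [] c"

abbreviation mon :: "'g letter list \<Rightarrow> ('g letter list \<Rightarrow>\<^sub>0 'k::field)" where
  "mon w \<equiv> Poly_Mapping.single w 1"

definition relators ::
  "('g, 'k::field) datum \<Rightarrow> (nat \<Rightarrow> nat \<Rightarrow> 'k) \<Rightarrow> (nat \<Rightarrow> 'k) \<Rightarrow> ('g letter list \<Rightarrow>\<^sub>0 'k) set" where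
  "relators D l \<mu> =
     {mon [Grp \<one>\<^bsub>grp D\<^esub>] - 1} \<union>
     {mon [Grp g] * mon [Grp h] - mon [Grp (g \<otimes>\<^bsub>grp D\<^esub> h)] | g h.
        g \<in> carrier (grp D) \<and> h \<in> carrier (grp D)} \<union>
     {mon [Grp g] * mon [Var i] - const (chi D i g) * mon [Var i] * mon [Grp g] | g i.
        g \<in> carrier (grp D) \<and> i < theta D} \<union>
     {mon [Var i] ^ NN D i - const (\<mu> i) * (1 - mon [Grp (gg D i [^]\<^bsub>grp D\<^esub> NN D i)]) | i.
        i < theta D} \<union>
     {mon [Var i] * mon [Var j] - const (chi D j (gg D i)) * mon [Var j] * mon [Var i]
        - const (l i j) * (1 - mon [Grp (gg D i \<otimes>\<^bsub>grp D\<^esub> gg D j)]) | i j.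
        i < j \<and> j < theta D}"

definition rel_ideal ::
  "('g, 'k::field) datum \<Rightarrow> (nat \<Rightarrow> nat \<Rightarrow> 'k) \<Rightarrow> (nat \<Rightarrow> 'k) \<Rightarrow> ('g letter list \<Rightarrow>\<^sub>0 'k) set" where
  "rel_ideal D l \<mu> = genideal (free_alg D) (relators D l \<mu>)"

definition cls :: "('g, 'k::field) datum \<Rightarrow> (nat \<Rightarrow> nat \<Rightarrow> 'k) \<Rightarrow> (nat \<Rightarrow> 'k) \<Rightarrow>
    ('g letter list \<Rightarrow>\<^sub>0 'k) \<Rightarrow> ('g letter list \<Rightarrow>\<^sub>0 'k) set" where
  "cls D l \<mu> p = rel_ideal D l \<mu> +>\<^bsub>free_alg D\<^esub> p"

fun free_comult_letter ::
  "('g, 'k::field) datum \<Rightarrow> 'g letter \<Rightarrow> ('g letter list \<times> 'g letter list) \<Rightarrow>\<^sub>0 'k" where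
  "free_comult_letter D (Grp g) = Poly_Mapping.single ([Grp g], [Grp g]) 1"
| "free_comult_letter D (Var i) =
     Poly_Mapping.single ([Var i], []) 1 + Poly_Mapping.single ([Grp (gg D i)], [Var i]) 1"

fun free_counit_letter :: "'g letter \<Rightarrow> 'k::field" where
  "free_counit_letter (Grp g) = 1"
| "free_counit_letter (Var i) = 0"

definition free_comult :: "('g, 'k::field) datum \<Rightarrow> ('g letter list \<Rightarrow>\<^sub>0 'k) \<Rightarrow>
    ('g letter list \<times> 'g letter list) \<Rightarrow>\<^sub>0 'k" where
  "free_comult D p = (\<Sum>w\<in>Poly_Mapping.keys p.
     Poly_Mapping.single ([], []) (Poly_Mapping.lookup p w) * prod_list (map (free_comult_letter D) w))"

definition free_counit :: "('g letter list \<Rightarrow>\<^sub>0 'k::field) \<Rightarrow> 'k" where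
  "free_counit p = (\<Sum>w\<in>Poly_Mapping.keys p. Poly_Mapping.lookup p w * prod_list (map free_counit_letter w))"

text \<open>\<open>u(D, \<lambda>, \<mu>)\<close>: comultiplication and counit are induced from the free algebra, hence computed
  on a representative of the residue class.\<close>

definition u_alg :: "('g, 'k::field) datum \<Rightarrow> (nat \<Rightarrow> nat \<Rightarrow> 'k) \<Rightarrow> (nat \<Rightarrow> 'k) \<Rightarrow>
    ('k, ('g letter list \<Rightarrow>\<^sub>0 'k) set) bialgebra" where
  "u_alg D l \<mu> = (let Q = free_alg D Quot rel_ideal D l \<mu> in
     \<lparr>carrier = carrier Q, monoid.mult = monoid.mult Q, one = one Q, zero = zero Q, add = add Q,
      module.smult = (\<lambda>c a. cls D l \<mu> (const c) \<otimes>\<^bsub>Q\<^esub> a),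
      comult = (\<lambda>a. push (\<lambda>(v, w). (cls D l \<mu> (mon v), cls D l \<mu> (mon w)))
                     (free_comult D (SOME p. p \<in> a))),
      counit = (\<lambda>a. free_counit (SOME p. p \<in> a))\<rparr>)"

abbreviation u0 :: "('g, 'k::field) datum \<Rightarrow> ('k, ('g letter list \<Rightarrow>\<^sub>0 'k) set) bialgebra" where
  "u0 D \<equiv> u_alg D (\<lambda>_ _. 0) (\<lambda>_. 0)"

text \<open>\<open>canonical_iso D l \<mu> K \<phi>\<close>: for \<open>K\<close> with the underlying coalgebra of \<open>u(D, 0, 0)\<close>, the map \<open>\<phi>\<close> is an
  isomorphism \<open>u(D, l, \<mu>) \<rightarrow> K\<close> sending each generator \<open>g\<close>, \<open>x\<^sub>i\<close> to the element of the same name.\<close>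

definition canonical_iso :: "('g, 'k::field) datum \<Rightarrow> (nat \<Rightarrow> nat \<Rightarrow> 'k) \<Rightarrow> (nat \<Rightarrow> 'k) \<Rightarrow>
    ('k, ('g letter list \<Rightarrow>\<^sub>0 'k) set) bialgebra \<Rightarrow>
    (('g letter list \<Rightarrow>\<^sub>0 'k) set \<Rightarrow> ('g letter list \<Rightarrow>\<^sub>0 'k) set) \<Rightarrow> bool" where
  "canonical_iso D l \<mu> K \<phi> \<longleftrightarrow>
     bialgebra_iso (u_alg D l \<mu>) K \<phi> \<and>
     (\<forall>s\<in>letters D. \<phi> (cls D l \<mu> (mon [s])) = cls D (\<lambda>_ _. 0) (\<lambda>_. 0) (mon [s]))"

section \<open>Functionals given on the PBW basis\<close>

definition pbw_exponent :: "('g, 'k::field) datum \<Rightarrow> (nat \<Rightarrow> nat) \<Rightarrow> bool" where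
  "pbw_exponent D a \<longleftrightarrow> (\<forall>i<theta D. a i < NN D i)"

text \<open>\<open>x\<^sub>0\<^bsup>a 0\<^esup> \<cdots> x\<^sub>\<theta>\<^sub>-\<^sub>1\<^bsup>a (\<theta>-1)\<^esup> g\<close> in \<open>u(D, 0, 0)\<close>\<close>

definition pbw :: "('g, 'k::field) datum \<Rightarrow> (nat \<Rightarrow> nat) \<Rightarrow> 'g \<Rightarrow> ('g letter list \<Rightarrow>\<^sub>0 'k) set" where
  "pbw D a g = cls D (\<lambda>_ _. 0) (\<lambda>_. 0)
     (mon (concat (map (\<lambda>i. replicate (a i) (Var i)) [0..<theta D]) @ [Grp g]))"

definition pbw_form :: "('g, 'k::field) datum \<Rightarrow> ((nat \<Rightarrow> nat) \<Rightarrow> 'g \<Rightarrow> 'k) \<Rightarrow>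
    ('g letter list \<Rightarrow>\<^sub>0 'k) set \<Rightarrow> 'k" where
  "pbw_form D v = (SOME f. linear_form (u0 D) f \<and>
     (\<forall>a g. pbw_exponent D a \<and> g \<in> carrier (grp D) \<longrightarrow> f (pbw D a g) = v a g))"

definition pbw_form2 ::
  "('g, 'k::field) datum \<Rightarrow> ((nat \<Rightarrow> nat) \<Rightarrow> 'g \<Rightarrow> (nat \<Rightarrow> nat) \<Rightarrow> 'g \<Rightarrow> 'k) \<Rightarrow>
    ('g letter list \<Rightarrow>\<^sub>0 'k) set \<Rightarrow> ('g letter list \<Rightarrow>\<^sub>0 'k) set \<Rightarrow> 'k" where
  "pbw_form2 D v = (SOME \<beta>. bilinear_form (u0 D) \<beta> \<and>
     (\<forall>a g b h. pbw_exponent D a \<and> g \<in> carrier (grp D) \<and> pbw_exponent D b \<and> h \<in> carrier (grp D)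
        \<longrightarrow> \<beta> (pbw D a g) (pbw D b h) = v a g b h))"

section \<open>The root vector part\<close>

definition zeta :: "('g, 'k::field) datum \<Rightarrow> nat \<Rightarrow>
    ('g letter list \<Rightarrow>\<^sub>0 'k) set \<Rightarrow> ('g letter list \<Rightarrow>\<^sub>0 'k) set \<Rightarrow> 'k" where
  "zeta D i = pbw_form2 D (\<lambda>a g b h.
     if (\<forall>j<theta D. j \<noteq> i \<longrightarrow> a j = 0 \<and> b j = 0) \<and> a i + b i = NN D i
     then chi D i g ^ b i else 0)"

definition exp_zeta :: "('g, 'k::field_char_0) datum \<Rightarrow> (nat \<Rightarrow> 'k) \<Rightarrow>
    ('g letter list \<Rightarrow>\<^sub>0 'k) set \<Rightarrow> ('g letter list \<Rightarrow>\<^sub>0 'k) set \<Rightarrow> 'k" where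
  "exp_zeta D \<mu> = conv2_exp (u0 D) (\<lambda>a b. \<Sum>i<theta D. \<mu> i * zeta D i a b)"

text \<open>The identification of \<open>u(D, 0, \<mu>)\<close> with the deformation of \<open>u(D, 0, 0)\<close> by \<open>exp_zeta D \<mu>\<close>;
  it is unique because it is prescribed on generators.\<close>

definition root_ident :: "('g, 'k::field_char_0) datum \<Rightarrow> (nat \<Rightarrow> 'k) \<Rightarrow>
    ('g letter list \<Rightarrow>\<^sub>0 'k) set \<Rightarrow> ('g letter list \<Rightarrow>\<^sub>0 'k) set" where
  "root_ident D \<mu> =
     (SOME \<phi>. canonical_iso D (\<lambda>_ _. 0) \<mu> (twist (u0 D) (exp_zeta D \<mu>)) \<phi>)"

section \<open>The linking part\<close>

definition G0 :: "('g, 'k::field) datum \<Rightarrow> 'g set" where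
  "G0 D = generate (grp D) {gg D i [^]\<^bsub>grp D\<^esub> NN D i | i.
     i < theta D \<and> (\<forall>h\<in>carrier (grp D). chi D i h ^ NN D i = 1) \<and>
     gg D i [^]\<^bsub>grp D\<^esub> NN D i \<noteq> \<one>\<^bsub>grp D\<^esub>}"

definition quot_datum :: "('g, 'k::field) datum \<Rightarrow> ('g set, 'k) datum" where
  "quot_datum D = \<lparr>grp = grp D Mod G0 D, theta = theta D,
     gg = (\<lambda>i. G0 D #>\<^bsub>grp D\<^esub> gg D i),
     chi = (\<lambda>i C. chi D i (SOME h. h \<in> C))\<rparr>"

text \<open>The projection \<open>u(D, 0, \<mu>) \<rightarrow> u(D, 0, \<mu>) / I\<^sub>\<mu> = u(D', 0, 0)\<close>, i.e. the algebra map induced by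
  \<open>g \<mapsto> G\<^sub>0 g\<close> and \<open>x\<^sub>i \<mapsto> x\<^sub>i\<close>, computed on a representative.  Its kernel is the ideal \<open>I\<^sub>\<mu>\<close> generated
  by the \<open>h - 1\<close> with \<open>h \<in> G\<^sub>0\<close>.\<close>

definition proj_mu :: "('g, 'k::field) datum \<Rightarrow> (nat \<Rightarrow> 'k) \<Rightarrow>
    ('g letter list \<Rightarrow>\<^sub>0 'k) set \<Rightarrow> ('g set letter list \<Rightarrow>\<^sub>0 'k) set" where
  "proj_mu D \<mu> a = cls (quot_datum D) (\<lambda>_ _. 0) (\<lambda>_. 0)
     (push (map (map_letter (\<lambda>g. G0 D #>\<^bsub>grp D\<^esub> g))) (SOME p. p \<in> a))"

text \<open>The functionals \<open>\<chi>\<^sub>i\<close>, \<open>d\<^sub>i\<close> and \<open>\<eta>\<^sub>i\<^sub>j\<close> live on \<open>u(D', 0, 0)\<close>: the argument \<open>D\<close> stands for \<open>D'\<close>.\<close>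

definition chi_fun :: "('g, 'k::field) datum \<Rightarrow> nat \<Rightarrow> ('g letter list \<Rightarrow>\<^sub>0 'k) set \<Rightarrow> 'k" where
  "chi_fun D i = pbw_form D (\<lambda>a g. if \<forall>j<theta D. a j = 0 then chi D i g else 0)"

definition d_fun :: "('g, 'k::field) datum \<Rightarrow> nat \<Rightarrow> ('g letter list \<Rightarrow>\<^sub>0 'k) set \<Rightarrow> 'k" where
  "d_fun D i = pbw_form D (\<lambda>a g. if \<forall>j<theta D. a j = (if j = i then 1 else 0) then 1 else 0)"

definition eta :: "('g, 'k::field) datum \<Rightarrow> nat \<Rightarrow> nat \<Rightarrow>
    ('g letter list \<Rightarrow>\<^sub>0 'k) set \<Rightarrow> ('g letter list \<Rightarrow>\<^sub>0 'k) set \<Rightarrow> 'k" where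
  "eta D i j a b = conv1 (u0 D) (d_fun D i) (chi_fun D j) a * d_fun D j b"

text \<open>The factors of \<open>\<sigma>\<^sub>\<lambda>\<close> commute, so the order chosen here is immaterial.\<close>

definition sigma_link :: "('g, 'k::field) datum \<Rightarrow> (nat \<Rightarrow> nat \<Rightarrow> 'k) \<Rightarrow>
    ('g set letter list \<Rightarrow>\<^sub>0 'k) set \<Rightarrow> ('g set letter list \<Rightarrow>\<^sub>0 'k) set \<Rightarrow> 'k" where
  "sigma_link D l = foldr
     (\<lambda>(i, j). conv2 (u0 (quot_datum D))
        (conv2_q_exp (u0 (quot_datum D)) (chi D j (gg D i))
           (\<lambda>a b. l i j * eta (quot_datum D) i j a b)))
     [(i, j). j \<leftarrow> [0..<theta D], i \<leftarrow> [0..<j], linkable D i j]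
     (conv2_unit (u0 (quot_datum D)))"

definition sigma_link_mu ::
  "('g, 'k::field) datum \<Rightarrow> (nat \<Rightarrow> nat \<Rightarrow> 'k) \<Rightarrow> (nat \<Rightarrow> 'k) \<Rightarrow>
    ('g letter list \<Rightarrow>\<^sub>0 'k) set \<Rightarrow> ('g letter list \<Rightarrow>\<^sub>0 'k) set \<Rightarrow> 'k" where
  "sigma_link_mu D l \<mu> a b = sigma_link D l (proj_mu D \<mu> a) (proj_mu D \<mu> b)"

text \<open>\<open>\<sigma> = \<sigma>\<^sub>\<lambda>\<^sub>,\<^sub>\<mu> * e\<^sup>\<zeta>\<close>, the form \<open>\<sigma>\<^sub>\<lambda>\<^sub>,\<^sub>\<mu>\<close> on \<open>u(D, 0, \<mu>)\<close> being transported to \<open>u(D, 0, 0)\<close>.\<close>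

definition sigma :: "('g, 'k::field_char_0) datum \<Rightarrow> (nat \<Rightarrow> nat \<Rightarrow> 'k) \<Rightarrow> (nat \<Rightarrow> 'k) \<Rightarrow>
    ('g letter list \<Rightarrow>\<^sub>0 'k) set \<Rightarrow> ('g letter list \<Rightarrow>\<^sub>0 'k) set \<Rightarrow> 'k" where
  "sigma D l \<mu> =
     (let \<psi> = inv_into (carrier (u_alg D (\<lambda>_ _. 0) \<mu>)) (root_ident D \<mu>) in
      conv2 (u0 D) (\<lambda>a b. sigma_link_mu D l \<mu> (\<psi> a) (\<psi> b)) (exp_zeta D \<mu>))"

end

theory Submission
  imports Defs
begin

text \<open>
  Functionals on the free algebra are functions on words, and a functional on a quotient
  \<open>u(D, l, \<mu>)\<close> is one whose translates respect the relations.  Pulled back to words, both factors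
  of \<open>\<sigma>\<close> become coboundaries \<open>(P \<otimes> P) * (P\<^sup>-\<^sup>1 \<circ> m)\<close>.  For \<open>e\<^sup>\<zeta>\<close> take \<open>P = F\<close> with
  \<open>F(x\<^sub>i w) = -\<mu>\<^sub>i (d\<^sub>i\<^sup>(\<^sup>N\<^sup>-\<^sup>1\<^sup>) * F)(w)\<close>, where \<open>d\<^sub>i\<^sup>(\<^sup>a\<^sup>)\<close> reads off the coefficient of \<open>x\<^sub>i\<^sup>a\<close>, and for the linking
  part \<open>P = L\<close> with \<open>L(x\<^sub>i w) = -(\<Sum>\<^sub>j \<lambda>\<^sub>i\<^sub>j d\<^sub>j * L)(w)\<close>: left translation by a letter is a skew
  derivation of the convolution algebra, so each identity of functionals reduces to an identity of
  its translates.  Hence \<open>\<sigma>\<close> is the coboundary of \<open>P = F * L\<close>.  A coboundary is a cocycle, and the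
  deformed product is the free product conjugated by \<open>P\<close>: the relations of the deformed algebra are
  those functionals \<open>P\<^sup>-\<^sup>1 * s * P\<close> vanish on, which one evaluates on the defining relators.  That the
  deformed algebra has no further relations follows by comparing leading terms with the PBW basis.
\<close>

section \<open>Convolution of functionals on words\<close>

text \<open>Words are forced on the proof: \<open>F\<close> and \<open>L\<close> do not descend to
  \<open>u0 D\<close>. A functional on \<open>u0 D\<close> vanishes on x_i^N_i, but \<open>F\<close>
  takes the value \<open>- \<mu> i\<close> there; \<open>L\<close> takes \<open>- l i j\<close> on
  x_i x_j and 0 on x_j x_i. Only the combination of \<open>P\<close> with its inverse descends. The
  same values produce the deformed relations: conjugating s by P adds \<mu>_i (s(1) - s(g_i^N_i)) to
  its value on x_i^N_i, and likewise for linking. The two coboundaries combine because transporting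
  a form from u(D,0,\<mu>) to \<open>u0 D\<close> conjugates it by F \<otimes> F. The inner factors
  then cancel against those of \<open>exp_zeta\<close>, and neither F nor L has to commute with
  anything. Oddness of N_i acts through N_i \<ge> 3: linking partners become unique, so the linking
  pairs are disjoint, and F is trivial up to degree 2, so it does not touch the linking relations.
  Conversely L is trivial on words in a single x_i and does not touch the root vector
  relations.\<close>

definition dsum :: "('a \<times> 'b) list \<Rightarrow> ('a \<Rightarrow> 'b \<Rightarrow> 'k::field) \<Rightarrow> 'k" where
  "dsum xs F = (\<Sum>(x, y)\<leftarrow>xs. F x y)"

lemma dsum_simps [simp]:
  "dsum [] F = 0"
  "dsum ((x, y) # xs) F = F x y + dsum xs F"
  "dsum (xs @ ys) F = dsum xs F + dsum ys F"
  by (simp_all add: dsum_def)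

lemma dsum_map: "dsum (map (\<lambda>(x, y). (f x y, h x y)) xs) F = dsum xs (\<lambda>x y. F (f x y) (h x y))"
  by (simp add: dsum_def o_def case_prod_unfold)

lemma dsum_cong:
  "(\<And>x y. (x, y) \<in> set xs \<Longrightarrow> F x y = F' x y) \<Longrightarrow> dsum xs F = dsum xs F'"
  unfolding dsum_def by (intro arg_cong[of _ _ sum_list] map_cong) auto

lemma dsum_zero [simp]: "dsum xs (\<lambda>x y. 0) = 0"
  by (induction xs) auto

lemma dsum_add: "dsum xs (\<lambda>x y. F x y + H x y) = dsum xs F + dsum xs H"
  by (induction xs) (auto simp: algebra_simps)

lemma dsum_minus: "dsum xs (\<lambda>x y. - F x y) = - dsum xs F"
  by (induction xs) (auto simp: algebra_simps)

lemma dsum_diff: "dsum xs (\<lambda>x y. F x y - H x y) = dsum xs F - dsum xs H"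
  by (induction xs) (auto simp: algebra_simps)

lemma dsum_mult_left: "dsum xs (\<lambda>x y. c * F x y) = c * dsum xs F"
  by (induction xs) (auto simp: algebra_simps)

lemma dsum_mult_right: "dsum xs (\<lambda>x y. F x y * c) = dsum xs F * c"
  by (induction xs) (auto simp: algebra_simps)

lemma dsum_sum: "dsum xs (\<lambda>x y. \<Sum>i\<in>I. F i x y) = (\<Sum>i\<in>I. dsum xs (F i))"
  by (induction xs) (auto simp: sum.distrib)

lemma dsum_swap:
  "dsum xs (\<lambda>x y. dsum ys (F x y)) = dsum ys (\<lambda>x' y'. dsum xs (\<lambda>x y. F x y x' y'))"
  by (induction xs) (auto simp: dsum_add)

text \<open>A functional is a function on a basis, and \<Delta> lists the pairs in the coproduct of
  a basis element. Repetition in the list stands for multiplicity, so no coefficients are carried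
  along.\<close>

definition conv :: "('a \<Rightarrow> 'k::field) \<Rightarrow> ('a \<Rightarrow> ('a \<times> 'a) list) \<Rightarrow> ('a \<Rightarrow> 'k) \<Rightarrow> 'a \<Rightarrow> 'k"
    ("_ \<star>\<^bsub>_\<^esub> _" [70, 0, 71] 70) where
  "(f \<star>\<^bsub>\<Delta>\<^esub> h) a = dsum (\<Delta> a) (\<lambda>x y. f x * h y)"

lemma conv_cong:
  assumes "\<And>x y. (x, y) \<in> set (\<Delta> a) \<Longrightarrow> f x = f' x" "\<And>x y. (x, y) \<in> set (\<Delta> a) \<Longrightarrow> h y = h' y"
  shows "(f \<star>\<^bsub>\<Delta>\<^esub> h) a = (f' \<star>\<^bsub>\<Delta>\<^esub> h') a"
  unfolding conv_def by (intro dsum_cong) (metis assms)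

lemma conv_linear:
  "(\<lambda>a. f a + f' a) \<star>\<^bsub>\<Delta>\<^esub> h = (\<lambda>a. (f \<star>\<^bsub>\<Delta>\<^esub> h) a + (f' \<star>\<^bsub>\<Delta>\<^esub> h) a)"
  "(\<lambda>a. f a - f' a) \<star>\<^bsub>\<Delta>\<^esub> h = (\<lambda>a. (f \<star>\<^bsub>\<Delta>\<^esub> h) a - (f' \<star>\<^bsub>\<Delta>\<^esub> h) a)"
  "(\<lambda>a. - f a) \<star>\<^bsub>\<Delta>\<^esub> h = (\<lambda>a. - (f \<star>\<^bsub>\<Delta>\<^esub> h) a)"
  "(\<lambda>a. c * f a) \<star>\<^bsub>\<Delta>\<^esub> h = (\<lambda>a. c * (f \<star>\<^bsub>\<Delta>\<^esub> h) a)"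
  "(\<lambda>a. \<Sum>i\<in>I. F i a) \<star>\<^bsub>\<Delta>\<^esub> h = (\<lambda>a. \<Sum>i\<in>I. (F i \<star>\<^bsub>\<Delta>\<^esub> h) a)"
  "(\<lambda>a. 0) \<star>\<^bsub>\<Delta>\<^esub> h = (\<lambda>a. 0)"
  "f \<star>\<^bsub>\<Delta>\<^esub> (\<lambda>a. h a + h' a) = (\<lambda>a. (f \<star>\<^bsub>\<Delta>\<^esub> h) a + (f \<star>\<^bsub>\<Delta>\<^esub> h') a)"
  "f \<star>\<^bsub>\<Delta>\<^esub> (\<lambda>a. h a - h' a) = (\<lambda>a. (f \<star>\<^bsub>\<Delta>\<^esub> h) a - (f \<star>\<^bsub>\<Delta>\<^esub> h') a)"
  "f \<star>\<^bsub>\<Delta>\<^esub> (\<lambda>a. - h a) = (\<lambda>a. - (f \<star>\<^bsub>\<Delta>\<^esub> h) a)"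
  "f \<star>\<^bsub>\<Delta>\<^esub> (\<lambda>a. c * h a) = (\<lambda>a. c * (f \<star>\<^bsub>\<Delta>\<^esub> h) a)"
  "f \<star>\<^bsub>\<Delta>\<^esub> (\<lambda>a. \<Sum>i\<in>I. F i a) = (\<lambda>a. \<Sum>i\<in>I. (f \<star>\<^bsub>\<Delta>\<^esub> F i) a)"
  "f \<star>\<^bsub>\<Delta>\<^esub> (\<lambda>a. 0) = (\<lambda>a. 0)"
  by (simp_all add: fun_eq_iff conv_def distrib_right distrib_left left_diff_distrib right_diff_distrib
      dsum_add dsum_diff dsum_minus mult.assoc mult.left_commute[of _ c] dsum_mult_left
      sum_distrib_left sum_distrib_right dsum_sum)

text \<open>Coassociativity is tested against arbitrary functions of three basis elements, so that
  no type of threefold tensors is needed.\<close>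

locale coalg =
  fixes \<Delta> :: "'a \<Rightarrow> ('a \<times> 'a) list" and e :: "'a \<Rightarrow> 'k::field"
  assumes coassoc: "\<And>a (F :: 'a \<Rightarrow> 'a \<Rightarrow> 'a \<Rightarrow> 'k).
      dsum (\<Delta> a) (\<lambda>x z. dsum (\<Delta> x) (\<lambda>x y. F x y z)) = dsum (\<Delta> a) (\<lambda>x y. dsum (\<Delta> y) (F x))"
    and counit_left: "\<And>a f. dsum (\<Delta> a) (\<lambda>x y. e x * f y) = f a"
    and counit_right: "\<And>a f. dsum (\<Delta> a) (\<lambda>x y. f x * e y) = f a"
begin

lemma conv_assoc: "(f \<star>\<^bsub>\<Delta>\<^esub> h) \<star>\<^bsub>\<Delta>\<^esub> k = f \<star>\<^bsub>\<Delta>\<^esub> (h \<star>\<^bsub>\<Delta>\<^esub> (k :: 'a \<Rightarrow> 'k))"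
proof
  fix a
  show "((f \<star>\<^bsub>\<Delta>\<^esub> h) \<star>\<^bsub>\<Delta>\<^esub> k) a = (f \<star>\<^bsub>\<Delta>\<^esub> (h \<star>\<^bsub>\<Delta>\<^esub> k)) a"
    using coassoc[of a "\<lambda>x y z. f x * h y * k z"]
    by (simp add: conv_def dsum_mult_right[symmetric] dsum_mult_left[symmetric] mult.assoc)
qed

lemma conv_unit [simp]: "e \<star>\<^bsub>\<Delta>\<^esub> f = f" "f \<star>\<^bsub>\<Delta>\<^esub> e = f"
  by (auto simp: conv_def counit_left counit_right)

text \<open>Each of the n exchanges of X with a factor S costs one q. The case q = 1 serves the
  ordinary exponential, a root of unity q the q-exponential.\<close>

lemma conv_commute_pow:
  assumes "X \<star>\<^bsub>\<Delta>\<^esub> S = (\<lambda>a. q * (S \<star>\<^bsub>\<Delta>\<^esub> X) a)"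
  shows "X \<star>\<^bsub>\<Delta>\<^esub> ((conv S \<Delta> ^^ n) e) = (\<lambda>a. q ^ n * (((conv S \<Delta> ^^ n) e) \<star>\<^bsub>\<Delta>\<^esub> X) a)"
proof (induction n)
  case (Suc n)
  show ?case (is "X \<star>\<^bsub>\<Delta>\<^esub> ?S' = _")
  proof -
    have "X \<star>\<^bsub>\<Delta>\<^esub> ?S' = (X \<star>\<^bsub>\<Delta>\<^esub> S) \<star>\<^bsub>\<Delta>\<^esub> ((conv S \<Delta> ^^ n) e)"
      by (simp add: conv_assoc)
    also have "\<dots> = (\<lambda>a. q * (S \<star>\<^bsub>\<Delta>\<^esub> (X \<star>\<^bsub>\<Delta>\<^esub> ((conv S \<Delta> ^^ n) e))) a)"
      by (simp add: assms conv_linear conv_assoc)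
    also have "\<dots> = (\<lambda>a. q * (S \<star>\<^bsub>\<Delta>\<^esub> (\<lambda>a. q ^ n * (((conv S \<Delta> ^^ n) e) \<star>\<^bsub>\<Delta>\<^esub> X) a)) a)"
      by (simp add: Suc.IH)
    finally show ?thesis by (simp add: conv_linear conv_assoc mult.assoc)
  qed
qed simp

text \<open>Pigeonhole: n factors share a total degree below n, so one of them is evaluated in
  degree 0, where S vanishes. This makes the exponential series locally finite.\<close>

lemma conv_pow_vanish:
  assumes "\<And>a x y. (x, y) \<in> set (\<Delta> a) \<Longrightarrow> d x + d y = (d a :: nat)" "\<And>a. d a = 0 \<Longrightarrow> S a = 0"
    and "d a < n"
  shows "(conv S \<Delta> ^^ n) e a = 0"
  using assms(3)
proof (induction n arbitrary: a)
  case (Suc n)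
  have "S x * (conv S \<Delta> ^^ n) e y = 0" if "(x, y) \<in> set (\<Delta> a)" for x y
    using assms(1)[OF that] assms(2)[of x] Suc.IH[of y] Suc.prems by (cases "d x = 0") auto
  then have "dsum (\<Delta> a) (\<lambda>x y. S x * (conv S \<Delta> ^^ n) e y) = dsum (\<Delta> a) (\<lambda>x y. 0)"
    by (intro dsum_cong) auto
  then show ?case by (simp add: conv_def[of _ _ "(conv S \<Delta> ^^ n) e"])
qed simp

end

section \<open>Tensor products of coalgebras\<close>

definition prod_coalg ::
    "('a \<Rightarrow> ('a \<times> 'a) list) \<Rightarrow> ('b \<Rightarrow> ('b \<times> 'b) list) \<Rightarrow> 'a \<times> 'b \<Rightarrow> (('a \<times> 'b) \<times> 'a \<times> 'b) list"
    (infixr "\<otimes>\<^sub>c" 75) where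
  "(\<Delta> \<otimes>\<^sub>c \<Gamma>) z = concat (map (\<lambda>(x, y). map (\<lambda>(x', y'). ((x, x'), (y, y'))) (\<Gamma> (snd z))) (\<Delta> (fst z)))"

definition tens :: "('a \<Rightarrow> 'k::field) \<Rightarrow> ('b \<Rightarrow> 'k) \<Rightarrow> 'a \<times> 'b \<Rightarrow> 'k" (infixr "\<otimes>\<^sub>t" 75) where
  "(f \<otimes>\<^sub>t h) z = f (fst z) * h (snd z)"

lemma tens_apply [simp]: "(f \<otimes>\<^sub>t h) (a, b) = f a * h b"
  by (simp add: tens_def)

lemma dsum_prod_coalg:
  "dsum ((\<Delta> \<otimes>\<^sub>c \<Gamma>) (a, b)) F = dsum (\<Delta> a) (\<lambda>x y. dsum (\<Gamma> b) (\<lambda>x' y'. F (x, x') (y, y')))"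
proof -
  have "dsum (concat (map (\<lambda>(x, y). map (\<lambda>(x', y'). ((x, x'), (y, y'))) (\<Gamma> b)) xs)) F =
     dsum xs (\<lambda>x y. dsum (\<Gamma> b) (\<lambda>x' y'. F (x, x') (y, y')))" for xs
    by (induction xs) (auto simp: dsum_map)
  then show ?thesis by (simp add: prod_coalg_def)
qed

lemma set_prod_coalg:
  "((x, x'), (y, y')) \<in> set ((\<Delta> \<otimes>\<^sub>c \<Gamma>) (a, b)) \<longleftrightarrow> (x, y) \<in> set (\<Delta> a) \<and> (x', y') \<in> set (\<Gamma> b)"
  by (force simp: prod_coalg_def)

lemma conv_prod_coalg:
  "(S \<star>\<^bsub>\<Delta> \<otimes>\<^sub>c \<Gamma>\<^esub> T) (a, b) =
     dsum (\<Delta> a) (\<lambda>x y. dsum (\<Gamma> b) (\<lambda>x' y'. S (x, x') * T (y, y')))"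
  by (simp add: conv_def dsum_prod_coalg)

lemma coalg_prod:
  fixes \<Delta> :: "'a \<Rightarrow> ('a \<times> 'a) list" and \<Gamma> :: "'b \<Rightarrow> ('b \<times> 'b) list" and e :: "'a \<Rightarrow> 'k::field"
  assumes "coalg \<Delta> e" "coalg \<Gamma> e'"
  shows "coalg (\<Delta> \<otimes>\<^sub>c \<Gamma>) (e \<otimes>\<^sub>t e')"
proof -
  interpret A: coalg \<Delta> e by fact
  interpret B: coalg \<Gamma> e' by fact
  show ?thesis
  proof
    fix z :: "'a \<times> 'b" and F :: "'a \<times> 'b \<Rightarrow> 'a \<times> 'b \<Rightarrow> 'a \<times> 'b \<Rightarrow> 'k"
    obtain a b where z: "z = (a, b)" by fastforce
    have "dsum ((\<Delta> \<otimes>\<^sub>c \<Gamma>) z) (\<lambda>x z. dsum ((\<Delta> \<otimes>\<^sub>c \<Gamma>) x) (\<lambda>x y. F x y z)) =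
      dsum (\<Delta> a) (\<lambda>x y. dsum (\<Gamma> b) (\<lambda>x' y'. dsum (\<Delta> x) (\<lambda>p q. dsum (\<Gamma> x') (\<lambda>p' q'. F (p, p') (q, q') (y, y')))))"
      by (simp add: z dsum_prod_coalg)
    \<comment> \<open>The sums over b and over x are exchanged, so that each factor's
      coassociativity meets its own nested pair of sums.\<close>
    also have "\<dots> = dsum (\<Delta> a) (\<lambda>x y. dsum (\<Delta> x) (\<lambda>p q. dsum (\<Gamma> b) (\<lambda>x' y'. dsum (\<Gamma> x') (\<lambda>p' q'. F (p, p') (q, q') (y, y')))))"
      by (subst dsum_swap) simp
    also have "\<dots> = dsum (\<Delta> a) (\<lambda>x y. dsum (\<Delta> y) (\<lambda>p q. dsum (\<Gamma> b) (\<lambda>x' y'. dsum (\<Gamma> y') (\<lambda>p' q'. F (x, x') (p, p') (q, q')))))"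
      by (subst B.coassoc, subst A.coassoc) simp
    also have "\<dots> = dsum (\<Delta> a) (\<lambda>x y. dsum (\<Gamma> b) (\<lambda>x' y'. dsum (\<Delta> y) (\<lambda>p q. dsum (\<Gamma> y') (\<lambda>p' q'. F (x, x') (p, p') (q, q')))))"
      by (subst dsum_swap) simp
    also have "\<dots> = dsum ((\<Delta> \<otimes>\<^sub>c \<Gamma>) z) (\<lambda>x y. dsum ((\<Delta> \<otimes>\<^sub>c \<Gamma>) y) (F x))"
      by (simp add: z dsum_prod_coalg)
    finally show "dsum ((\<Delta> \<otimes>\<^sub>c \<Gamma>) z) (\<lambda>x z. dsum ((\<Delta> \<otimes>\<^sub>c \<Gamma>) x) (\<lambda>x y. F x y z)) =
       dsum ((\<Delta> \<otimes>\<^sub>c \<Gamma>) z) (\<lambda>x y. dsum ((\<Delta> \<otimes>\<^sub>c \<Gamma>) y) (F x))" .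
  next
    fix z :: "'a \<times> 'b" and f :: "'a \<times> 'b \<Rightarrow> 'k"
    obtain a b where z: "z = (a, b)" by fastforce
    have "dsum ((\<Delta> \<otimes>\<^sub>c \<Gamma>) z) (\<lambda>x y. (e \<otimes>\<^sub>t e') x * f y) =
        dsum (\<Delta> a) (\<lambda>x y. e x * dsum (\<Gamma> b) (\<lambda>x' y'. e' x' * f (y, y')))"
      by (simp add: z dsum_prod_coalg mult.assoc dsum_mult_left)
    then show "dsum ((\<Delta> \<otimes>\<^sub>c \<Gamma>) z) (\<lambda>x y. (e \<otimes>\<^sub>t e') x * f y) = f z"
      by (simp add: z A.counit_left B.counit_left)
    have "dsum ((\<Delta> \<otimes>\<^sub>c \<Gamma>) z) (\<lambda>x y. f x * (e \<otimes>\<^sub>t e') y) =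
        dsum (\<Delta> a) (\<lambda>x y. dsum (\<Gamma> b) (\<lambda>x' y'. f (x, x') * e' y') * e y)"
      by (simp add: z dsum_prod_coalg ac_simps dsum_mult_left)
    then show "dsum ((\<Delta> \<otimes>\<^sub>c \<Gamma>) z) (\<lambda>x y. f x * (e \<otimes>\<^sub>t e') y) = f z"
      by (simp add: z A.counit_right B.counit_right)
  qed
qed

lemma conv_tens:
  fixes f f' :: "'a \<Rightarrow> 'k::field" and h h' :: "'b \<Rightarrow> 'k"
  shows "(f \<otimes>\<^sub>t h) \<star>\<^bsub>\<Delta> \<otimes>\<^sub>c \<Gamma>\<^esub> (f' \<otimes>\<^sub>t h') = (f \<star>\<^bsub>\<Delta>\<^esub> f') \<otimes>\<^sub>t (h \<star>\<^bsub>\<Gamma>\<^esub> h')"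
proof
  fix z :: "'a \<times> 'b"
  obtain a b where z: "z = (a, b)" by fastforce
  have "((f \<otimes>\<^sub>t h) \<star>\<^bsub>\<Delta> \<otimes>\<^sub>c \<Gamma>\<^esub> (f' \<otimes>\<^sub>t h')) (a, b) =
    dsum (\<Delta> a) (\<lambda>x y. dsum (\<Gamma> b) (\<lambda>x' y'. (f x * f' y) * (h x' * h' y')))"
    by (simp add: conv_prod_coalg ac_simps)
  then show "((f \<otimes>\<^sub>t h) \<star>\<^bsub>\<Delta> \<otimes>\<^sub>c \<Gamma>\<^esub> (f' \<otimes>\<^sub>t h')) z = ((f \<star>\<^bsub>\<Delta>\<^esub> f') \<otimes>\<^sub>t (h \<star>\<^bsub>\<Gamma>\<^esub> h')) z"
    by (simp add: z conv_def dsum_mult_left dsum_mult_right)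
qed

section \<open>Coproduct, counit and degree of words\<close>

primrec split :: "(nat \<Rightarrow> 'g) \<Rightarrow> 'g letter list \<Rightarrow> ('g letter list \<times> 'g letter list) list" where
  "split g [] = [([], [])]"
| "split g (s # w) = (case s of
     Grp h \<Rightarrow> map (\<lambda>(u, v). (Grp h # u, Grp h # v)) (split g w)
   | Var i \<Rightarrow> map (\<lambda>(u, v). (Var i # u, v)) (split g w) @
              map (\<lambda>(u, v). (Grp (g i) # u, Var i # v)) (split g w))"

primrec eps :: "'g letter list \<Rightarrow> 'k::field" where
  "eps [] = 1"
| "eps (s # w) = (case s of Grp h \<Rightarrow> eps w | Var i \<Rightarrow> 0)"

primrec deg :: "'g letter list \<Rightarrow> nat" where
  "deg [] = 0"
| "deg (s # w) = (case s of Grp h \<Rightarrow> deg w | Var i \<Rightarrow> Suc (deg w))"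

lemma deg_append [simp]: "deg (u @ v) = deg u + deg v"
  by (induction u) (auto split: letter.split)

lemma eps_append [simp]: "eps (u @ v) = eps u * eps v"
  by (induction u) (auto split: letter.split)

lemma eps_deg: "eps w = (if deg w = 0 then 1 else 0)"
  by (induction w) (auto split: letter.split)

lemma dsum_split [simp]:
  "dsum (split g []) F = F [] []"
  "dsum (split g (Grp h # w)) F = dsum (split g w) (\<lambda>u v. F (Grp h # u) (Grp h # v))"
  "dsum (split g (Var i # w)) F =
     dsum (split g w) (\<lambda>u v. F (Var i # u) v) + dsum (split g w) (\<lambda>u v. F (Grp (g i) # u) (Var i # v))"
  by (simp_all add: dsum_map)

text \<open>Multiplicativity of the coproduct: with concatenation as product, words span a bialgebra
  in which no relation holds yet.\<close>

lemma dsum_split_append: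
  "dsum (split g (w @ w')) F =
     dsum (split g w) (\<lambda>u v. dsum (split g w') (\<lambda>u' v'. F (u @ u') (v @ v')))"
  by (induction w arbitrary: F) (auto simp: dsum_map split: letter.split)

lemma split_deg: "(u, v) \<in> set (split g w) \<Longrightarrow> deg u + deg v = deg w"
  by (induction w arbitrary: u v) (auto split: letter.splits)

text \<open>Group letters are never multiplied: the left leg replaces each \<open>Var i\<close> that
  it gives away by \<open>Grp (g i)\<close> and so keeps its length. The recursions over either leg
  terminate for this reason.\<close>

lemma split_length: "(u, v) \<in> set (split g w) \<Longrightarrow> length u = length w \<and> length v \<le> length w"
  by (induction w arbitrary: u v) (fastforce split: letter.splits)+

lemma split_letters:
  assumes "(u, v) \<in> set (split g w)" "w \<in> lists (Grp ` G \<union> Var ` I)" "\<And>i. i \<in> I \<Longrightarrow> g i \<in> G"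
  shows "u \<in> lists (Grp ` G \<union> Var ` I) \<and> v \<in> lists (Grp ` G \<union> Var ` I)"
  using assms by (induction w arbitrary: u v) (fastforce split: letter.splits)+

text \<open>Group letters are group-like and \<open>Var i\<close> is skew-primitive. The letters
  already read are absorbed into the test function, which is therefore arbitrary in the
  induction.\<close>

lemma coalg_split: "coalg (split g) eps"
proof
  show "dsum (split g w) (\<lambda>x z. dsum (split g x) (\<lambda>x y. F x y z)) =
      dsum (split g w) (\<lambda>x y. dsum (split g y) (F x))" for w and F :: "_ \<Rightarrow> _ \<Rightarrow> _ \<Rightarrow> 'b"
  proof (induction w arbitrary: F)
    case (Cons s w)
    then show ?case
      by (cases s) (simp_all add: dsum_map dsum_add ac_simps)
  qed simp
  show "dsum (split g w) (\<lambda>x y. eps x * f y) = f w" for w and f :: "_ \<Rightarrow> 'b"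
  proof (induction w arbitrary: f)
    case (Cons s w)
    then show ?case by (cases s) (simp_all add: dsum_map)
  qed simp
  show "dsum (split g w) (\<lambda>x y. f x * eps y) = f w" for w and f :: "_ \<Rightarrow> 'b"
  proof (induction w arbitrary: f)
    case (Cons s w)
    then show ?case using Cons.IH[of "\<lambda>u. f (s # u)"] by (cases s) (simp_all add: dsum_map)
  qed simp
qed

section \<open>Divided powers of skew derivations\<close>

text \<open>On a word without variables other than x_i, move the group letters to the right past the
  x_i; the result is a scalar times x_i^n h. The functional returns that scalar times \<omega>(h) if
  n = a and 0 otherwise, where \<omega> is multiplied up letter by letter.\<close>

primrec dp :: "(nat \<Rightarrow> 'g \<Rightarrow> 'k::field) \<Rightarrow> nat \<Rightarrow> nat \<Rightarrow> ('g \<Rightarrow> 'k) \<Rightarrow> 'g letter list \<Rightarrow> 'k" where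
  "dp \<chi> i a \<omega> [] = (if a = 0 then 1 else 0)"
| "dp \<chi> i a \<omega> (s # w) = (case s of
     Grp h \<Rightarrow> \<chi> i h ^ a * \<omega> h * dp \<chi> i a \<omega> w
   | Var k \<Rightarrow> if k = i \<and> 0 < a then dp \<chi> i (a - 1) \<omega> w else 0)"

text \<open>The Gaussian binomial coefficient of a + b over a. The recursion is the one met by the
  coproduct of x_i^(a+b): the first x_i goes to the left leg, or it goes to the right leg and its
  g_i passes the x_i^a on the left at the cost of q^a.\<close>

fun q_binom :: "'k::field \<Rightarrow> nat \<Rightarrow> nat \<Rightarrow> 'k" where
  "q_binom q 0 b = 1"
| "q_binom q (Suc a) 0 = 1"
| "q_binom q (Suc a) (Suc b) = q_binom q a (Suc b) + q ^ Suc a * q_binom q (Suc a) b"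

lemma q_binom_0 [simp]: "q_binom q a 0 = 1"
  by (cases a) auto

lemma q_fact_Suc: "q_fact q (Suc m) = (\<Sum>s<Suc m. q ^ s) * q_fact q m"
  by (simp add: q_fact_def)

lemma sum_power_add: "(\<Sum>s<a + b. q ^ s) = (\<Sum>s<a. q ^ s) + q ^ a * (\<Sum>s<b. (q :: 'k::field) ^ s)"
  by (induction b) (auto simp: algebra_simps power_add)

text \<open>The identity is kept free of division because the factorials vanish at a root of unity
  from its order on.\<close>

lemma q_binom_fact: "q_binom q a b * q_fact q a * q_fact q b = q_fact q (a + b)"
proof (induction q a b rule: q_binom.induct)
  case (3 q a b)
  let ?n = "\<lambda>m. \<Sum>s<m. q ^ s"
  have "q_binom q (Suc a) (Suc b) * q_fact q (Suc a) * q_fact q (Suc b) =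
     ?n (Suc a) * (q_binom q a (Suc b) * q_fact q a * q_fact q (Suc b))
     + q ^ Suc a * ?n (Suc b) * (q_binom q (Suc a) b * q_fact q (Suc a) * q_fact q b)"
    unfolding q_binom.simps q_fact_Suc[of q a] q_fact_Suc[of q b] by (simp only: ring_distribs mult_ac)
  also have "\<dots> = (?n (Suc a) + q ^ Suc a * ?n (Suc b)) * q_fact q (Suc (a + b))"
    unfolding 3 add_Suc add_Suc_right by (simp only: ring_distribs mult_ac)
  also have "\<dots> = q_fact q (Suc a + Suc b)"
    using sum_power_add[of q "Suc a" "Suc b"] q_fact_Suc[of q "Suc (a + b)"] by simp
  finally show ?case .
qed (auto simp: q_fact_def)

lemma q_fact_nonzero:
  assumes "q \<noteq> 1" "\<And>k. 0 < k \<Longrightarrow> k < n \<Longrightarrow> q ^ k \<noteq> 1" "m < n"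
  shows "q_fact q m \<noteq> 0"
proof -
  have "(\<Sum>s<r. q ^ s) \<noteq> 0" if "0 < r" "r \<le> m" for r
    using assms that geometric_sum[OF assms(1), of r] by auto
  then show ?thesis by (auto simp: q_fact_def)
qed

lemma q_fact_zero:
  assumes "q \<noteq> 1" "q ^ n = 1" "0 < n" "n \<le> m"
  shows "q_fact q m = 0"
proof -
  have "(\<Sum>s<n. q ^ s) = 0" using geometric_sum[OF assms(1), of n] assms by auto
  then show ?thesis using assms by (auto simp: q_fact_def intro!: bexI[of _ n])
qed

text \<open>In \<open>q_binom_fact\<close> the factorial of a + b is 0, while those of a and b are
  not.\<close>

lemma q_binom_zero:
  assumes "q \<noteq> 1" "q ^ n = 1" "\<And>k. 0 < k \<Longrightarrow> k < n \<Longrightarrow> q ^ k \<noteq> 1" "a < n" "b < n" "n \<le> a + b"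
  shows "q_binom q a b = 0"
  using q_binom_fact[of q a b] q_fact_nonzero[OF assms(1,3) assms(4)]
    q_fact_nonzero[OF assms(1,3) assms(5)] q_fact_zero[OF assms(1,2) _ assms(6)] assms(4) by auto

abbreviation conv_w :: "('g letter list \<Rightarrow> 'k::field) \<Rightarrow> (nat \<Rightarrow> 'g) \<Rightarrow> ('g letter list \<Rightarrow> 'k) \<Rightarrow> 'g letter list \<Rightarrow> 'k"
    ("_ \<diamondop>\<^bsub>_\<^esub> _" [70, 0, 71] 70) where
  "f \<diamondop>\<^bsub>g\<^esub> h \<equiv> f \<star>\<^bsub>split g\<^esub> h"

abbreviation conv_w2 :: "('g letter list \<times> 'g letter list \<Rightarrow> 'k::field) \<Rightarrow> (nat \<Rightarrow> 'g) \<Rightarrow>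
    ('g letter list \<times> 'g letter list \<Rightarrow> 'k) \<Rightarrow> 'g letter list \<times> 'g letter list \<Rightarrow> 'k"
    ("_ \<bullet>\<^bsub>_\<^esub> _" [70, 0, 71] 70) where
  "S \<bullet>\<^bsub>g\<^esub> T \<equiv> S \<star>\<^bsub>split g \<otimes>\<^sub>c split g\<^esub> T"

abbreviation eps2 :: "'g letter list \<times> 'g letter list \<Rightarrow> 'k::field" where
  "eps2 \<equiv> eps \<otimes>\<^sub>t eps"

interpretation cw: coalg "split g" eps for g by (rule coalg_split)
interpretation cw2: coalg "split g \<otimes>\<^sub>c split g" eps2 for g by (intro coalg_prod coalg_split)

lemma conv_letter [simp]:
  "(f \<diamondop>\<^bsub>g\<^esub> h) [] = f [] * h []"
  "(f \<diamondop>\<^bsub>g\<^esub> h) (Grp k # w) = ((\<lambda>u. f (Grp k # u)) \<diamondop>\<^bsub>g\<^esub> (\<lambda>u. h (Grp k # u))) w"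
  "(f \<diamondop>\<^bsub>g\<^esub> h) (Var i # w) = ((\<lambda>u. f (Var i # u)) \<diamondop>\<^bsub>g\<^esub> h) w
     + ((\<lambda>u. f (Grp (g i) # u)) \<diamondop>\<^bsub>g\<^esub> (\<lambda>u. h (Var i # u))) w"
  unfolding conv_def dsum_split by simp_all

text \<open>Only the first argument is translated: the functionals on pairs below satisfy recursions
  in it, with the empty word as base case.\<close>

lemma conv2_letter:
  "(S \<bullet>\<^bsub>g\<^esub> T) ([], v) = ((\<lambda>v. S ([], v)) \<diamondop>\<^bsub>g\<^esub> (\<lambda>v. T ([], v))) v"
  "(S \<bullet>\<^bsub>g\<^esub> T) (Grp k # u, v) =
     ((\<lambda>(u, v). S (Grp k # u, v)) \<bullet>\<^bsub>g\<^esub> (\<lambda>(u, v). T (Grp k # u, v))) (u, v)"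
  "(S \<bullet>\<^bsub>g\<^esub> T) (Var i # u, v) = ((\<lambda>(u, v). S (Var i # u, v)) \<bullet>\<^bsub>g\<^esub> T) (u, v)
     + ((\<lambda>(u, v). S (Grp (g i) # u, v)) \<bullet>\<^bsub>g\<^esub> (\<lambda>(u, v). T (Var i # u, v))) (u, v)"
  unfolding conv_prod_coalg dsum_split by (simp_all add: conv_def)

text \<open>Dual to the multiplicativity of the coproduct: composing with multiplication is a
  homomorphism of convolution algebras.\<close>

lemma conv_append:
  "(\<lambda>(u, v). f (u @ v)) \<bullet>\<^bsub>g\<^esub> (\<lambda>(u, v). h (u @ v)) = (\<lambda>(u, v). (f \<diamondop>\<^bsub>g\<^esub> h) (u @ v))"
  by (auto simp: fun_eq_iff conv_prod_coalg) (simp add: conv_def dsum_split_append)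

lemma dp_0_eps: "dp \<chi> i 0 (\<lambda>_. 1) = eps"
proof
  fix w show "dp \<chi> i 0 (\<lambda>_. 1) w = eps w" by (induction w) (auto split: letter.split)
qed

text \<open>In degree 0 no x_i is read. The free choice of index lets \<open>dp_same\<close> handle
  products of a character with a skew derivation.\<close>

lemma dp_0_index: "dp \<chi> i 0 \<omega> = dp \<chi> k 0 \<omega>"
proof
  fix w show "dp \<chi> i 0 \<omega> w = dp \<chi> k 0 \<omega> w" by (induction w) (auto split: letter.split)
qed

text \<open>If v contributes x_i^b, the group letters of u still have to pass these b letters; this
  is the character \<open>\<lambda>h. \<chi> i h ^ b\<close> on the first factor.\<close>

lemma dp_append:
  "dp \<chi> i n (\<lambda>_. 1) (u @ v) = (\<Sum>b\<le>n. dp \<chi> i (n - b) (\<lambda>h. \<chi> i h ^ b) u * dp \<chi> i b (\<lambda>_. 1) v)"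
proof (induction u arbitrary: n)
  case Nil
  have "(\<Sum>b\<le>n. dp \<chi> i (n - b) (\<lambda>h. \<chi> i h ^ b) [] * dp \<chi> i b (\<lambda>_. 1) v) =
    (\<Sum>b\<in>{n}. dp \<chi> i (n - b) (\<lambda>h. \<chi> i h ^ b) [] * dp \<chi> i b (\<lambda>_. 1) v)"
    by (intro sum.mono_neutral_right) auto
  then show ?case by simp
next
  case (Cons s u)
  show ?case
  proof (cases s)
    case (Grp h)
    have "\<chi> i h ^ (n - b) * \<chi> i h ^ b = \<chi> i h ^ n" if "b \<le> n" for b
      using that by (simp flip: power_add)
    then show ?thesis using Cons.IH[of n]
      by (simp add: Grp sum_distrib_left mult.assoc[symmetric])
  next
    case (Var k)
    show ?thesis
    proof (cases "k = i \<and> 0 < n")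
      case True
      then obtain m where n: "n = Suc m" by (cases n) auto
      show ?thesis using Cons.IH[of m] True
        by (auto simp: Var n intro!: sum.cong)
    qed (auto simp: Var)
  qed
qed

text \<open>Each of the b letters x_i in the right leg leaves a g_i in the left leg. There it is
  evaluated by \<omega>, and passing the x_i gives the Gaussian binomial.\<close>

lemma dp_same:
  "(dp \<chi> i a \<omega> \<diamondop>\<^bsub>g\<^esub> dp \<chi> i b \<omega>') =
     (\<lambda>w. \<omega> (g i) ^ b * q_binom (\<chi> i (g i)) a b * dp \<chi> i (a + b) (\<lambda>h. \<omega> h * \<omega>' h) w)"
proof
  fix w
  show "(dp \<chi> i a \<omega> \<diamondop>\<^bsub>g\<^esub> dp \<chi> i b \<omega>') w =
     \<omega> (g i) ^ b * q_binom (\<chi> i (g i)) a b * dp \<chi> i (a + b) (\<lambda>h. \<omega> h * \<omega>' h) w"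
  proof (induction w arbitrary: a b)
    case Nil then show ?case by auto
  next
    case (Cons s w)
    show ?case
    proof (cases s)
      case (Grp h)
      then show ?thesis by (simp add: conv_linear Cons.IH power_add mult_ac)
    next
      case (Var k)
      show ?thesis
      proof (cases "k = i")
        case True
        show ?thesis
        proof (cases a; cases b)
          fix a' b' assume ab: "a = Suc a'" "b = Suc b'"
          show ?thesis unfolding Var True ab
            by (simp add: conv_linear Cons.IH ring_distribs)
        qed (simp_all add: Var True conv_linear Cons.IH)
      qed (simp add: Var conv_linear)
    qed
  qed
qed

text \<open>The factor \<open>\<omega> (g j) ^ b\<close> stays on the left-hand side, so that
  \<omega> need not be invertible there.\<close>

lemma dp_comm:
  assumes "i \<noteq> j" "\<chi> i (g j) * \<chi> j (g i) = (1 :: 'k::field)"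
  shows "\<omega> (g j) ^ b * (dp \<chi> j b \<omega>' \<diamondop>\<^bsub>g\<^esub> dp \<chi> i a \<omega>) w =
     \<chi> j (g i) ^ (a * b) * \<omega>' (g i) ^ a * (dp \<chi> i a \<omega> \<diamondop>\<^bsub>g\<^esub> dp \<chi> j b \<omega>') w"
proof (induction w arbitrary: a b)
  case Nil then show ?case by auto
next
  case (Cons s w)
  show ?case
  proof (cases s)
    case (Grp h)
    then show ?thesis using Cons.IH[of b a] by (simp add: conv_linear mult_ac)
  next
    case (Var k)
    consider (i) "k = i" | (j) "k = j" | "k \<noteq> i" "k \<noteq> j" by auto
    then show ?thesis
    proof cases
      case i
      show ?thesis
      proof (cases a)
        case (Suc a')
        have "\<omega> (g j) ^ b * (dp \<chi> j b \<omega>' \<diamondop>\<^bsub>g\<^esub> dp \<chi> i a \<omega>) (s # w)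
          = \<chi> j (g i) ^ b * \<omega>' (g i) * (\<omega> (g j) ^ b * (dp \<chi> j b \<omega>' \<diamondop>\<^bsub>g\<^esub> dp \<chi> i a' \<omega>) w)"
          using \<open>i \<noteq> j\<close> by (simp add: Var i Suc conv_linear)
        also have "\<dots> = \<chi> j (g i) ^ b * \<omega>' (g i) * (\<chi> j (g i) ^ (a' * b) * \<omega>' (g i) ^ a' * (dp \<chi> i a' \<omega> \<diamondop>\<^bsub>g\<^esub> dp \<chi> j b \<omega>') w)"
          by (simp only: Cons.IH)
        also have "\<dots> = \<chi> j (g i) ^ (a * b) * \<omega>' (g i) ^ a * (dp \<chi> i a \<omega> \<diamondop>\<^bsub>g\<^esub> dp \<chi> j b \<omega>') (s # w)"
          using \<open>i \<noteq> j\<close> by (simp add: Var i Suc conv_linear power_add)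
        finally show ?thesis .
      qed (use \<open>i \<noteq> j\<close> in \<open>simp add: Var i conv_linear\<close>)
    next
      case j
      show ?thesis
      proof (cases b)
        case (Suc b')
        \<comment> \<open>On the right-hand side the letter g_j passes x_i^a and yields
          \<open>\<chi> i (g j) ^ a\<close>; the missing factor of exponent a is supplied by the
          braiding condition.\<close>
        have *: "\<chi> j (g i) ^ a * \<chi> i (g j) ^ a = 1"
          using assms(2) by (metis mult.commute power_mult_distrib power_one)
        have "\<omega> (g j) ^ b * (dp \<chi> j b \<omega>' \<diamondop>\<^bsub>g\<^esub> dp \<chi> i a \<omega>) (s # w)
          = \<omega> (g j) * (\<omega> (g j) ^ b' * (dp \<chi> j b' \<omega>' \<diamondop>\<^bsub>g\<^esub> dp \<chi> i a \<omega>) w)"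
          using \<open>i \<noteq> j\<close> by (simp add: Var j Suc conv_linear)
        also have "\<dots> = (\<chi> j (g i) ^ a * \<chi> i (g j) ^ a) * \<omega> (g j) * (\<chi> j (g i) ^ (a * b') * \<omega>' (g i) ^ a * (dp \<chi> i a \<omega> \<diamondop>\<^bsub>g\<^esub> dp \<chi> j b' \<omega>') w)"
          unfolding * by (simp add: Cons.IH)
        also have "\<dots> = \<chi> j (g i) ^ (a * b) * \<omega>' (g i) ^ a * (dp \<chi> i a \<omega> \<diamondop>\<^bsub>g\<^esub> dp \<chi> j b \<omega>') (s # w)"
          using \<open>i \<noteq> j\<close> by (simp add: Var j Suc conv_linear power_add)
        finally show ?thesis .
      qed (use \<open>i \<noteq> j\<close> in \<open>simp add: Var j conv_linear\<close>)
    qed (simp add: Var conv_linear)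
  qed
qed

section \<open>Coboundaries of functionals on words\<close>

text \<open>Left translation of functionals by a letter is a skew derivation for convolution, so a
  functional is determined by its value at the empty word and its translates.\<close>

function cob :: "(nat \<Rightarrow> 'g) \<Rightarrow> (nat \<Rightarrow> 'g letter list \<Rightarrow> 'k::field) \<Rightarrow> 'g letter list \<Rightarrow> 'k" where
  "cob g d [] = 1"
| "cob g d (Grp h # w) = cob g d w"
| "cob g d (Var i # w) = - (\<Sum>z\<leftarrow>split g w. d i (fst z) * cob g d (snd z))"
  by pat_completeness auto
termination by (relation "measure (\<lambda>(_, _, w). length w)") (auto dest: split_length)

text \<open>The convolution inverse of \<open>cob\<close>: applying the skew derivation x_i to F' *
  F = eps forces the x_i-translate of F' to be F' * d_i. The explicit sum exposes the recursive
  calls to the termination proof.\<close>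

function cob' :: "(nat \<Rightarrow> 'g) \<Rightarrow> (nat \<Rightarrow> 'g letter list \<Rightarrow> 'k::field) \<Rightarrow> 'g letter list \<Rightarrow> 'k" where
  "cob' g d [] = 1"
| "cob' g d (Grp h # w) = cob' g d w"
| "cob' g d (Var i # w) = (\<Sum>z\<leftarrow>split g w. cob' g d (fst z) * d i (snd z))"
  by pat_completeness auto
termination by (relation "measure (\<lambda>(_, _, w). length w)") (auto dest: split_length)

lemma cob_Var: "cob g d (Var i # w) = - (d i \<diamondop>\<^bsub>g\<^esub> cob g d) w"
  by (simp add: conv_def dsum_def case_prod_unfold)

lemma cob'_Var: "cob' g d (Var i # w) = (cob' g d \<diamondop>\<^bsub>g\<^esub> d i) w"
  by (simp add: conv_def dsum_def case_prod_unfold)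

declare cob.simps(3) [simp del] cob'.simps(3) [simp del] cob_Var [simp] cob'_Var [simp]

lemma cob'_cob: "cob' g d \<diamondop>\<^bsub>g\<^esub> cob g d = eps"
proof
  fix w show "(cob' g d \<diamondop>\<^bsub>g\<^esub> cob g d) w = eps w"
  proof (induction w)
    case (Cons s w)
    then show ?case by (cases s) (simp_all add: conv_linear cw.conv_assoc)
  qed simp
qed

text \<open>In this order the translate by x_i is (F * F') * d_i - d_i * (F * F'), which vanishes
  only once F * F' = eps is known on all legs. Hence the strong induction on length.\<close>

lemma cob_cob': "cob g d \<diamondop>\<^bsub>g\<^esub> cob' g d = eps"
proof
  fix w show "(cob g d \<diamondop>\<^bsub>g\<^esub> cob' g d) w = eps w"
  proof (induction w rule: measure_induct_rule[of length])
    case (less w)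
    show ?case
    proof (cases w)
      case w: (Cons s w')
      show ?thesis
      proof (cases s)
        case (Grp h)
        then show ?thesis using less w by simp
      next
        case (Var i)
        have "(d i \<diamondop>\<^bsub>g\<^esub> (cob g d \<diamondop>\<^bsub>g\<^esub> cob' g d)) w' = (d i \<diamondop>\<^bsub>g\<^esub> eps) w'"
          by (intro conv_cong refl less) (auto simp: w dest: split_length)
        moreover have "((cob g d \<diamondop>\<^bsub>g\<^esub> cob' g d) \<diamondop>\<^bsub>g\<^esub> d i) w' = (eps \<diamondop>\<^bsub>g\<^esub> d i) w'"
          by (intro conv_cong refl less) (auto simp: w dest: split_length)
        ultimately show ?thesis using w Var by (simp add: conv_linear cw.conv_assoc)
      qed
    qed simp
  qed
qed

text \<open>Translate both sides by x_i. The term S * (d_i after multiplication) from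
  \<open>var\<close> cancels against the recursion of \<open>cob\<close>, leaving -S * (d_i
  \<otimes> eps) * (F after multiplication). By \<open>comm\<close> the factor d_i \<otimes> eps
  moves to the front, where the induction hypothesis applies.\<close>

lemma coboundary_eqI:
  assumes nil: "\<And>v. S ([], v) = eps v"
    and grp: "\<And>h u v. S (Grp h # u, v) = S (u, v)"
    and var: "\<And>i u v. S (Var i # u, v) = (S \<bullet>\<^bsub>g\<^esub> (\<lambda>(u, v). d i (u @ v) - (d i \<otimes>\<^sub>t eps) (u, v))) (u, v)"
    and comm: "\<And>i. (d i \<otimes>\<^sub>t eps) \<bullet>\<^bsub>g\<^esub> S = S \<bullet>\<^bsub>g\<^esub> (d i \<otimes>\<^sub>t eps)"
  shows "S \<bullet>\<^bsub>g\<^esub> (\<lambda>(u, v). cob g d (u @ v)) = cob g d \<otimes>\<^sub>t cob g d"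
proof -
  let ?L = "cob g d" and ?Lm = "\<lambda>(u, v). cob g d (u @ v)"
  have "(S \<bullet>\<^bsub>g\<^esub> ?Lm) (u, v) = (?L \<otimes>\<^sub>t ?L) (u, v)" for u v
  proof (induction u arbitrary: v rule: measure_induct_rule[of length])
    case (less u)
    show ?case
    proof (cases u)
      case Nil
      then show ?thesis by (simp add: conv2_letter nil)
    next
      case u: (Cons s u')
      show ?thesis
      proof (cases s)
        case (Grp h)
        then show ?thesis using less[of u'] by (simp add: u conv2_letter grp)
      next
        case (Var i)
        let ?dm = "\<lambda>(u, v). d i (u @ v)" and ?dt = "d i \<otimes>\<^sub>t eps"
        have \<kappa>: "(\<lambda>(u, v). d i (u @ v) - d i u * eps v) = (\<lambda>z. ?dm z - ?dt z)" by auto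
        have varf: "(\<lambda>(u, v). S (Var i # u, v)) = (\<lambda>z. (S \<bullet>\<^bsub>g\<^esub> ?dm) z - (S \<bullet>\<^bsub>g\<^esub> ?dt) z)"
          by (auto simp: var \<kappa> conv_linear)
        have neg: "(\<lambda>(u, v). - (d i \<diamondop>\<^bsub>g\<^esub> ?L) (u @ v)) = (\<lambda>z. - (?dm \<bullet>\<^bsub>g\<^esub> ?Lm) z)"
          by (auto simp: conv_append)
        have "(S \<bullet>\<^bsub>g\<^esub> ?Lm) (u, v) =
          ((S \<bullet>\<^bsub>g\<^esub> ?dm) \<bullet>\<^bsub>g\<^esub> ?Lm) (u', v) - ((S \<bullet>\<^bsub>g\<^esub> ?dt) \<bullet>\<^bsub>g\<^esub> ?Lm) (u', v)
             - (S \<bullet>\<^bsub>g\<^esub> (?dm \<bullet>\<^bsub>g\<^esub> ?Lm)) (u', v)"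
          by (simp add: u Var conv2_letter varf grp neg conv_linear)
        also have "\<dots> = - (S \<bullet>\<^bsub>g\<^esub> (?dt \<bullet>\<^bsub>g\<^esub> ?Lm)) (u', v)"
          by (simp add: conv_linear cw2.conv_assoc)
        also have "\<dots> = - (?dt \<bullet>\<^bsub>g\<^esub> (S \<bullet>\<^bsub>g\<^esub> ?Lm)) (u', v)"
          by (simp add: comm flip: cw2.conv_assoc)
        also have "(?dt \<bullet>\<^bsub>g\<^esub> (S \<bullet>\<^bsub>g\<^esub> ?Lm)) (u', v) = (?dt \<bullet>\<^bsub>g\<^esub> (?L \<otimes>\<^sub>t ?L)) (u', v)"
        proof (rule conv_cong)
          fix x y assume "(x, y) \<in> set ((split g \<otimes>\<^sub>c split g) (u', v))"
          then show "(S \<bullet>\<^bsub>g\<^esub> ?Lm) y = (?L \<otimes>\<^sub>t ?L) y"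
            using less by (cases x; cases y) (auto simp: set_prod_coalg u less_Suc_eq_le dest: split_length)
        qed simp
        finally show ?thesis by (simp add: u Var conv_tens)
      qed
    qed
  qed
  then show ?thesis by (auto simp: fun_eq_iff)
qed

section \<open>The exponentials on words\<close>

abbreviation cpow :: "(nat \<Rightarrow> 'g) \<Rightarrow> ('g letter list \<times> 'g letter list \<Rightarrow> 'k::field) \<Rightarrow> nat \<Rightarrow>
    'g letter list \<times> 'g letter list \<Rightarrow> 'k" where
  "cpow g Z n \<equiv> (conv Z (split g \<otimes>\<^sub>c split g) ^^ n) eps2"

text \<open>The series is cut at the total degree of the argument, beyond which the powers vanish if
  Z vanishes in degree 0.\<close>

definition exp_w :: "(nat \<Rightarrow> 'g) \<Rightarrow> ('g letter list \<times> 'g letter list \<Rightarrow> 'k::field_char_0) \<Rightarrow>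
    'g letter list \<times> 'g letter list \<Rightarrow> 'k" where
  "exp_w g Z z = (\<Sum>n\<le>deg (fst z) + deg (snd z). cpow g Z n z / fact n)"

definition q_exp_w :: "(nat \<Rightarrow> 'g) \<Rightarrow> 'k \<Rightarrow> nat \<Rightarrow> ('g letter list \<times> 'g letter list \<Rightarrow> 'k::field) \<Rightarrow>
    'g letter list \<times> 'g letter list \<Rightarrow> 'k" where
  "q_exp_w g q n Z z = (\<Sum>m<n. cpow g Z m z / q_fact q m)"

lemma split2_deg:
  "(x, y) \<in> set ((split g \<otimes>\<^sub>c split g) z) \<Longrightarrow>
     (deg (fst x) + deg (snd x)) + (deg (fst y) + deg (snd y)) = deg (fst z) + deg (snd z)"
  by (cases x; cases y; cases z) (auto simp: set_prod_coalg dest!: split_deg)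

lemma cpow_vanish:
  assumes "\<And>z. deg (fst z) + deg (snd z) = 0 \<Longrightarrow> Z z = 0" "deg (fst z) + deg (snd z) < n"
  shows "cpow g Z n z = 0"
proof (rule cw2.conv_pow_vanish[where d = "\<lambda>z. deg (fst z) + deg (snd z)"])
  show "deg (fst z) + deg (snd z) < n" by (fact assms(2))
  show "Z z = 0" if "deg (fst z) + deg (snd z) = 0" for z by (rule assms(1)) (rule that)
qed (use split2_deg in blast)+

lemma cpow_nil:
  assumes "\<And>v. Z ([], v) = 0"
  shows "cpow g Z n ([], v) = (if n = 0 then eps v else 0)"
  by (cases n) (auto simp: conv2_letter assms conv_linear)

lemma cpow_Grp:
  assumes "\<And>h u v. Z (Grp h # u, v) = Z (u, v)"
  shows "cpow g Z n (Grp h # u, v) = cpow g Z n (u, v)"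
proof (induction n arbitrary: u v h)
  case (Suc n)
  then show ?case by (simp add: conv2_letter assms)
qed simp

text \<open>The derivative of a power: group letters fix Z, so the Leibniz rule gives the sum of Z^k
  * \<kappa> * Z^(n-1-k), and moving each \<kappa> to the right collects the q-integer of n.
  Dividing by factorials, an exponential of Z satisfies x_i exp = exp * \<kappa>.\<close>

lemma cpow_Var:
  assumes grp: "\<And>h u v. Z (Grp h # u, v) = Z (u, v)"
    and var: "\<And>u v. Z (Var i # u, v) = \<kappa> (u, v)"
    and comm: "\<kappa> \<bullet>\<^bsub>g\<^esub> Z = (\<lambda>z. q * (Z \<bullet>\<^bsub>g\<^esub> \<kappa>) z)"
  shows "cpow g Z n (Var i # u, v) = (\<Sum>s<n. q ^ s) * (cpow g Z (n - 1) \<bullet>\<^bsub>g\<^esub> \<kappa>) (u, v)"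
proof (induction n arbitrary: u v)
  case (Suc n)
  have IH: "(\<lambda>(u, v). cpow g Z n (Var i # u, v)) = (\<lambda>z. (\<Sum>s<n. q ^ s) * (cpow g Z (n - 1) \<bullet>\<^bsub>g\<^esub> \<kappa>) z)"
    by (auto simp: Suc.IH)
  have "cpow g Z (Suc n) (Var i # u, v) =
    q ^ n * (cpow g Z n \<bullet>\<^bsub>g\<^esub> \<kappa>) (u, v) + (\<Sum>s<n. q ^ s) * (Z \<bullet>\<^bsub>g\<^esub> (cpow g Z (n - 1) \<bullet>\<^bsub>g\<^esub> \<kappa>)) (u, v)"
    using cw2.conv_commute_pow[OF comm] by (simp add: conv2_letter grp var IH conv_linear)
  also have "(\<Sum>s<n. q ^ s) * (Z \<bullet>\<^bsub>g\<^esub> (cpow g Z (n - 1) \<bullet>\<^bsub>g\<^esub> \<kappa>)) (u, v) =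
     (\<Sum>s<n. q ^ s) * (cpow g Z n \<bullet>\<^bsub>g\<^esub> \<kappa>) (u, v)"
    by (cases n) (simp_all add: cw2.conv_assoc)
  finally show ?case by (simp add: algebra_simps)
qed simp

lemma exp_w_bound:
  assumes "\<And>z. deg (fst z) + deg (snd z) = 0 \<Longrightarrow> Z z = 0" "deg (fst z) + deg (snd z) \<le> M"
  shows "exp_w g Z z = (\<Sum>n\<le>M. cpow g Z n z / fact n)"
proof -
  have "cpow g Z n z = 0" if "n \<notin> {..deg (fst z) + deg (snd z)}" for n
    by (rule cpow_vanish) (use assms(1) that in auto)
  then show ?thesis unfolding exp_w_def by (intro sum.mono_neutral_left) (use assms(2) in auto)
qed

lemma exp_w_rec:
  assumes nil: "\<And>v. Z ([], v) = 0"
    and grp: "\<And>h u v. Z (Grp h # u, v) = Z (u, v)"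
    and var: "\<And>i u v. Z (Var i # u, v) = \<kappa> i (u, v)"
    and comm: "\<And>i. \<kappa> i \<bullet>\<^bsub>g\<^esub> Z = Z \<bullet>\<^bsub>g\<^esub> \<kappa> i"
  shows "exp_w g Z ([], v) = eps v"
    and "exp_w g Z (Grp h # u, v) = exp_w g Z (u, v)"
    and "exp_w g Z (Var i # u, v) = (exp_w g Z \<bullet>\<^bsub>g\<^esub> \<kappa> i) (u, v)"
    and "X \<bullet>\<^bsub>g\<^esub> Z = Z \<bullet>\<^bsub>g\<^esub> X \<Longrightarrow> X \<bullet>\<^bsub>g\<^esub> exp_w g Z = exp_w g Z \<bullet>\<^bsub>g\<^esub> X"
proof -
  have "Z (u, v) = 0" if "deg u = 0" for u v
    using that by (induction u) (auto simp: nil grp split: letter.splits)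
  then have van: "Z z = 0" if "deg (fst z) + deg (snd z) = 0" for z
    using that by (cases z) auto
  show "exp_w g Z ([], v) = eps v"
    by (simp add: exp_w_def cpow_nil nil if_distrib[of "\<lambda>x. x / _"] cong: if_cong)
  show "exp_w g Z (Grp h # u, v) = exp_w g Z (u, v)"
    by (simp add: exp_w_def cpow_Grp grp)
  let ?d = "\<lambda>z. deg (fst z) + deg (snd z)"
  \<comment> \<open>The cut-off in \<open>exp_w\<close> depends on the argument. A common bound M
    for all legs turns it into one finite sum, to which linearity of convolution applies.\<close>
  have conv_exp: "(X \<bullet>\<^bsub>g\<^esub> exp_w g Z) z = (\<Sum>n\<le>M. (X \<bullet>\<^bsub>g\<^esub> cpow g Z n) z / fact n)"
    "(exp_w g Z \<bullet>\<^bsub>g\<^esub> X) z = (\<Sum>n\<le>M. (cpow g Z n \<bullet>\<^bsub>g\<^esub> X) z / fact n)" if "?d z \<le> M" for X z M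
  proof -
    have *: "exp_w g Z x = (\<Sum>n\<le>M. inverse (fact n) * cpow g Z n x)" "exp_w g Z y = (\<Sum>n\<le>M. inverse (fact n) * cpow g Z n y)"
      if "(x, y) \<in> set ((split g \<otimes>\<^sub>c split g) z)" for x y
    proof -
      have "?d x \<le> M" "?d y \<le> M" using split2_deg[OF that] \<open>?d z \<le> M\<close> by linarith+
      then have "exp_w g Z x = (\<Sum>n\<le>M. cpow g Z n x / fact n)" "exp_w g Z y = (\<Sum>n\<le>M. cpow g Z n y / fact n)"
        using exp_w_bound[of Z] van by blast+
      then show "exp_w g Z x = (\<Sum>n\<le>M. inverse (fact n) * cpow g Z n x)"
        "exp_w g Z y = (\<Sum>n\<le>M. inverse (fact n) * cpow g Z n y)" by (simp_all add: field_simps)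
    qed
    have "(X \<bullet>\<^bsub>g\<^esub> exp_w g Z) z = (X \<bullet>\<^bsub>g\<^esub> (\<lambda>x. \<Sum>n\<le>M. inverse (fact n) * cpow g Z n x)) z"
      by (intro conv_cong refl *)
    then show "(X \<bullet>\<^bsub>g\<^esub> exp_w g Z) z = (\<Sum>n\<le>M. (X \<bullet>\<^bsub>g\<^esub> cpow g Z n) z / fact n)"
      by (simp add: conv_linear divide_inverse mult.commute)
    have "(exp_w g Z \<bullet>\<^bsub>g\<^esub> X) z = ((\<lambda>x. \<Sum>n\<le>M. inverse (fact n) * cpow g Z n x) \<bullet>\<^bsub>g\<^esub> X) z"
      by (intro conv_cong refl *)
    then show "(exp_w g Z \<bullet>\<^bsub>g\<^esub> X) z = (\<Sum>n\<le>M. (cpow g Z n \<bullet>\<^bsub>g\<^esub> X) z / fact n)"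
      by (simp add: conv_linear divide_inverse mult.commute)
  qed
  have "exp_w g Z (Var i # u, v) = (\<Sum>n\<le>Suc (deg u + deg v). cpow g Z n (Var i # u, v) / fact n)"
    by (simp add: exp_w_def)
  also have "\<dots> = (\<Sum>n\<le>deg u + deg v. cpow g Z (Suc n) (Var i # u, v) / fact (Suc n))"
    by (subst sum.atMost_Suc_shift) simp
  also have "\<dots> = (\<Sum>n\<le>deg u + deg v. (cpow g Z n \<bullet>\<^bsub>g\<^esub> \<kappa> i) (u, v) / fact n)"
  proof (rule sum.cong[OF refl])
    fix n
    have "cpow g Z (Suc n) (Var i # u, v) = of_nat (Suc n) * (cpow g Z n \<bullet>\<^bsub>g\<^esub> \<kappa> i) (u, v)"
      using cpow_Var[OF grp var, where q = 1 and i = i and n = "Suc n"] comm[of i] by simp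
    then show "cpow g Z (Suc n) (Var i # u, v) / fact (Suc n) = (cpow g Z n \<bullet>\<^bsub>g\<^esub> \<kappa> i) (u, v) / fact n"
      by (simp add: field_simps del: of_nat_Suc funpow.simps)
  qed
  also have "\<dots> = (exp_w g Z \<bullet>\<^bsub>g\<^esub> \<kappa> i) (u, v)"
    by (subst conv_exp[of "(u, v)" "deg u + deg v"]) auto
  finally show "exp_w g Z (Var i # u, v) = (exp_w g Z \<bullet>\<^bsub>g\<^esub> \<kappa> i) (u, v)" .
  show "X \<bullet>\<^bsub>g\<^esub> exp_w g Z = exp_w g Z \<bullet>\<^bsub>g\<^esub> X" if "X \<bullet>\<^bsub>g\<^esub> Z = Z \<bullet>\<^bsub>g\<^esub> X"
  proof
    fix z
    have "X \<bullet>\<^bsub>g\<^esub> cpow g Z n = cpow g Z n \<bullet>\<^bsub>g\<^esub> X" for n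
      using cw2.conv_commute_pow[of X g Z 1 n] that by simp
    then show "(X \<bullet>\<^bsub>g\<^esub> exp_w g Z) z = (exp_w g Z \<bullet>\<^bsub>g\<^esub> X) z"
      using conv_exp[OF order.refl, of X z] by simp
  qed
qed

section \<open>Quantum linear spaces without the group: the root vector exponential\<close>

locale qls =
  fixes g :: "nat \<Rightarrow> 'g" and \<chi> :: "nat \<Rightarrow> 'g \<Rightarrow> 'k::field_char_0" and \<theta> :: nat and N :: "nat \<Rightarrow> nat"
  assumes braid: "\<And>i j. i < \<theta> \<Longrightarrow> j < \<theta> \<Longrightarrow> i \<noteq> j \<Longrightarrow> \<chi> i (g j) * \<chi> j (g i) = 1"
    and root: "\<And>i. i < \<theta> \<Longrightarrow> \<chi> i (g i) ^ N i = 1"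
    and prim: "\<And>i k. i < \<theta> \<Longrightarrow> 0 < k \<Longrightarrow> k < N i \<Longrightarrow> \<chi> i (g i) ^ k \<noteq> 1"
    and q_neq_1: "\<And>i. i < \<theta> \<Longrightarrow> \<chi> i (g i) \<noteq> 1"
    and N_gt_1: "\<And>i. i < \<theta> \<Longrightarrow> 1 < N i"
begin

lemma dp_same_zero:
  assumes "i < \<theta>" "a < N i" "b < N i" "N i \<le> a + b"
  shows "dp \<chi> i a \<omega> \<diamondop>\<^bsub>g\<^esub> dp \<chi> i b \<omega>' = (\<lambda>w. 0)"
proof -
  have "q_binom (\<chi> i (g i)) a b = 0"
    using assms by (intro q_binom_zero[of _ "N i"]) (auto simp: q_neq_1 root prim)
  then show ?thesis by (simp add: dp_same)
qed

text \<open>The pullback of the sum of \<mu>_i \<zeta>_i. The range of b is 1 to N_i - 1 because the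
  PBW exponents a and b are both below N_i while a + b = N_i.\<close>

definition zeta_w :: "(nat \<Rightarrow> 'k) \<Rightarrow> 'g letter list \<times> 'g letter list \<Rightarrow> 'k" where
  "zeta_w \<mu> z = (\<Sum>i<\<theta>. \<mu> i *
     (\<Sum>b\<in>{1..<N i}. (dp \<chi> i (N i - b) (\<lambda>h. \<chi> i h ^ b) \<otimes>\<^sub>t dp \<chi> i b (\<lambda>_. 1)) z))"

text \<open>The exponent N_i - 1 is what remains of x_i^N_i after one letter has been read; the
  induced \<open>cob\<close> then takes the value -\<mu>_i on x_i^N_i.\<close>

definition d_root :: "(nat \<Rightarrow> 'k) \<Rightarrow> nat \<Rightarrow> 'g letter list \<Rightarrow> 'k" where
  "d_root \<mu> i w = (if i < \<theta> then \<mu> i * dp \<chi> i (N i - 1) (\<lambda>_. 1) w else 0)"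

text \<open>The translate of \<open>zeta_w\<close> by x_i, which lowers the first exponent by
  one.\<close>

definition kappa_root :: "(nat \<Rightarrow> 'k) \<Rightarrow> nat \<Rightarrow> 'g letter list \<times> 'g letter list \<Rightarrow> 'k" where
  "kappa_root \<mu> i z = (if i < \<theta> then
     \<mu> i * (\<Sum>b\<in>{1..<N i}. (dp \<chi> i (N i - Suc b) (\<lambda>h. \<chi> i h ^ b) \<otimes>\<^sub>t dp \<chi> i b (\<lambda>_. 1)) z) else 0)"

text \<open>The summand b = 0 of \<open>dp_append\<close> is exactly \<open>d_root\<close> \<otimes>
  eps; the others make up the translate of \<open>zeta_w\<close>.\<close>

lemma kappa_root: "(\<lambda>(u, v). d_root \<mu> i (u @ v) - (d_root \<mu> i \<otimes>\<^sub>t eps) (u, v)) = kappa_root \<mu> i"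
proof (cases "i < \<theta>")
  case True
  then have *: "{..N i - Suc 0} = insert 0 {Suc 0..<N i}" using N_gt_1[of i] by auto
  show ?thesis using True
    by (auto simp: fun_eq_iff d_root_def kappa_root_def dp_append * dp_0_eps algebra_simps)
qed (auto simp: d_root_def kappa_root_def)

text \<open>For i = j both products are zero: the exponents add up to at least N in the first leg if
  b + c \<le> N - 1, and in the second leg otherwise. For i \<noteq> j the scalars of the two legs
  cancel, because their exponents complete to multiples of N_j and \<chi>_j^N_j is trivial.\<close>

lemma root_commute:
  assumes "i < \<theta>" "j < \<theta>" "c < N i" "b \<in> {1..<N j}" "\<And>h. \<chi> j h ^ N j = 1"
  shows "(dp \<chi> i (N i - Suc c) (\<lambda>h. \<chi> i h ^ c) \<otimes>\<^sub>t dp \<chi> i c (\<lambda>_. 1)) \<bullet>\<^bsub>g\<^esub>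
      (dp \<chi> j (N j - b) (\<lambda>h. \<chi> j h ^ b) \<otimes>\<^sub>t dp \<chi> j b (\<lambda>_. 1)) =
    (dp \<chi> j (N j - b) (\<lambda>h. \<chi> j h ^ b) \<otimes>\<^sub>t dp \<chi> j b (\<lambda>_. 1)) \<bullet>\<^bsub>g\<^esub>
      (dp \<chi> i (N i - Suc c) (\<lambda>h. \<chi> i h ^ c) \<otimes>\<^sub>t dp \<chi> i c (\<lambda>_. 1))"
proof (cases "i = j")
  case True
  have "(dp \<chi> j (N j - Suc c) \<omega> \<diamondop>\<^bsub>g\<^esub> dp \<chi> j (N j - b) \<omega>') = (\<lambda>w. 0) \<and>
     (dp \<chi> j (N j - b) \<omega>' \<diamondop>\<^bsub>g\<^esub> dp \<chi> j (N j - Suc c) \<omega>) = (\<lambda>w. 0)" if "b + c \<le> N j - 1" for \<omega> \<omega>'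
    using assms that True by (intro conjI dp_same_zero) auto
  moreover have "(dp \<chi> j c \<omega> \<diamondop>\<^bsub>g\<^esub> dp \<chi> j b \<omega>') = (\<lambda>w. 0) \<and>
     (dp \<chi> j b \<omega>' \<diamondop>\<^bsub>g\<^esub> dp \<chi> j c \<omega>) = (\<lambda>w. 0)" if "\<not> b + c \<le> N j - 1" for \<omega> \<omega>'
    using assms that True by (intro conjI dp_same_zero) auto
  ultimately show ?thesis unfolding True conv_tens by (cases "b + c \<le> N j - 1") (simp_all add: tens_def fun_eq_iff)
next
  case False
  let ?a = "N i - Suc c" and ?B = "N j - b"
  let ?p = "\<chi> j (g i)" and ?r = "\<chi> i (g j)"
  let ?X1 = "dp \<chi> i ?a (\<lambda>h. \<chi> i h ^ c)" and ?Y1 = "dp \<chi> j ?B (\<lambda>h. \<chi> j h ^ b)"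
  let ?X2 = "dp \<chi> i c (\<lambda>_. 1)" and ?Y2 = "dp \<chi> j b (\<lambda>_. 1)"
  have rp: "?r * ?p = 1" using braid[of i j] assms False by auto
  have rp_pow: "?r ^ m * ?p ^ m = 1" for m using rp by (simp flip: power_mult_distrib)
  have pN: "?p ^ N j = 1" by (rule assms(5))
  have rN: "?r ^ N j = 1" using rp_pow[of "N j"] pN by simp
  have pm: "?p ^ (N j * m) = 1" for m by (simp add: power_mult pN)
  have rm: "?r ^ (N j * m) = 1" for m by (simp add: power_mult rN)
  have Bb: "?B + b = N j" using assms(4) by simp
  have "b * ?a + ?B * ?a = N j * ?a" by (metis Bb add.commute add_mult_distrib)
  then have 1: "?r ^ (c * ?B) * (?Y1 \<diamondop>\<^bsub>g\<^esub> ?X1) w = (?X1 \<diamondop>\<^bsub>g\<^esub> ?Y1) w" for w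
    using dp_comm[where i = i and j = j and \<chi> = \<chi> and g = g, OF False rp, of "\<lambda>h. \<chi> i h ^ c" ?B "\<lambda>h. \<chi> j h ^ b" ?a w] pm[of ?a]
    by (simp flip: power_mult power_add add: mult.commute)
  have 2: "(?Y2 \<diamondop>\<^bsub>g\<^esub> ?X2) w = ?p ^ (c * b) * (?X2 \<diamondop>\<^bsub>g\<^esub> ?Y2) w" for w
    using dp_comm[where i = i and j = j and \<chi> = \<chi> and g = g, OF False rp, of "\<lambda>h. 1" b "\<lambda>h. 1" c w] by simp
  have "b * c + c * ?B = N j * c" by (metis Bb add.commute add_mult_distrib mult.commute)
  then have "?r ^ (c * ?B) * ?r ^ (c * b) = ?p ^ (c * b) * ?r ^ (c * b)"
    using rm[of c] rp_pow[of "c * b"] by (simp flip: power_add add: mult.commute)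
  then have 3: "?r ^ (c * ?B) = ?p ^ (c * b)" "?p ^ (c * b) \<noteq> 0" using rp by auto
  show ?thesis unfolding conv_tens
    by (simp only: fun_eq_iff tens_def 1[symmetric] 2 3(1) mult_ac simp_thms)
qed

context
  fixes \<mu> :: "nat \<Rightarrow> 'k"
  assumes \<mu>: "\<And>i h. i < \<theta> \<Longrightarrow> \<mu> i \<noteq> 0 \<Longrightarrow> \<chi> i h ^ N i = 1"
begin

text \<open>The range of c covers two uses: c = 0 is the functional \<open>d_root\<close> \<otimes>
  eps up to a scalar, and c \<ge> 1 gives the summands of \<open>kappa_root\<close>.\<close>

lemma zeta_w_commute:
  assumes "i < \<theta>" "c < N i"
  shows "(dp \<chi> i (N i - Suc c) (\<lambda>h. \<chi> i h ^ c) \<otimes>\<^sub>t dp \<chi> i c (\<lambda>_. 1)) \<bullet>\<^bsub>g\<^esub> zeta_w \<mu> =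
     zeta_w \<mu> \<bullet>\<^bsub>g\<^esub> (dp \<chi> i (N i - Suc c) (\<lambda>h. \<chi> i h ^ c) \<otimes>\<^sub>t dp \<chi> i c (\<lambda>_. 1))"
proof -
  have zeta: "zeta_w \<mu> = (\<lambda>z. \<Sum>j<\<theta>. \<mu> j *
     (\<Sum>b\<in>{1..<N j}. (dp \<chi> j (N j - b) (\<lambda>h. \<chi> j h ^ b) \<otimes>\<^sub>t dp \<chi> j b (\<lambda>_. 1)) z))"
    by (simp add: fun_eq_iff zeta_w_def)
  show ?thesis unfolding zeta conv_linear
  proof (intro ext sum.cong refl)
    fix z j assume "j \<in> {..<\<theta>}"
    then show "\<mu> j * (\<Sum>b\<in>{1..<N j}. ((dp \<chi> i (N i - Suc c) (\<lambda>h. \<chi> i h ^ c) \<otimes>\<^sub>t dp \<chi> i c (\<lambda>_. 1)) \<bullet>\<^bsub>g\<^esub>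
         (dp \<chi> j (N j - b) (\<lambda>h. \<chi> j h ^ b) \<otimes>\<^sub>t dp \<chi> j b (\<lambda>_. 1))) z) =
       \<mu> j * (\<Sum>b\<in>{1..<N j}. ((dp \<chi> j (N j - b) (\<lambda>h. \<chi> j h ^ b) \<otimes>\<^sub>t dp \<chi> j b (\<lambda>_. 1)) \<bullet>\<^bsub>g\<^esub>
          (dp \<chi> i (N i - Suc c) (\<lambda>h. \<chi> i h ^ c) \<otimes>\<^sub>t dp \<chi> i c (\<lambda>_. 1))) z)"
      using \<mu>[of j] assms
      by (cases "\<mu> j = 0") (auto intro!: sum.cong fun_cong[OF root_commute])
  qed
qed

text \<open>A group letter h contributes \<chi>_i(h)^(N_i - b) directly and \<chi>_i(h)^b through
  the character, in total \<chi>_i(h)^N_i = 1 wherever \<mu>_i \<noteq> 0.\<close>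

lemma zeta_w_letter:
  "zeta_w \<mu> ([], v) = 0"
  "zeta_w \<mu> (Grp h # u, v) = zeta_w \<mu> (u, v)"
  "zeta_w \<mu> (Var i # u, v) = kappa_root \<mu> i (u, v)"
proof -
  show "zeta_w \<mu> ([], v) = 0" by (auto simp: zeta_w_def intro!: sum.neutral)
  show "zeta_w \<mu> (Grp h # u, v) = zeta_w \<mu> (u, v)"
    unfolding zeta_w_def
  proof (intro sum.cong refl)
    fix i assume "i \<in> {..<\<theta>}"
    then show "\<mu> i * (\<Sum>b\<in>{1..<N i}. (dp \<chi> i (N i - b) (\<lambda>h. \<chi> i h ^ b) \<otimes>\<^sub>t dp \<chi> i b (\<lambda>_. 1)) (Grp h # u, v)) =
       \<mu> i * (\<Sum>b\<in>{1..<N i}. (dp \<chi> i (N i - b) (\<lambda>h. \<chi> i h ^ b) \<otimes>\<^sub>t dp \<chi> i b (\<lambda>_. 1)) (u, v))"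
      using \<mu>[of i h] by (cases "\<mu> i = 0") (auto intro!: sum.cong simp flip: power_add)
  qed
  have "zeta_w \<mu> (Var i # u, v) = (\<Sum>k<\<theta>. if k = i then kappa_root \<mu> i (u, v) else 0)"
    unfolding zeta_w_def by (intro sum.cong refl) (auto simp: kappa_root_def)
  then show "zeta_w \<mu> (Var i # u, v) = kappa_root \<mu> i (u, v)"
    by (simp add: kappa_root_def)
qed

lemma root_coboundary:
  "exp_w g (zeta_w \<mu>) \<bullet>\<^bsub>g\<^esub> (\<lambda>(u, v). cob g (d_root \<mu>) (u @ v)) = cob g (d_root \<mu>) \<otimes>\<^sub>t cob g (d_root \<mu>)"
proof (rule coboundary_eqI)
  have comm: "kappa_root \<mu> i \<bullet>\<^bsub>g\<^esub> zeta_w \<mu> = zeta_w \<mu> \<bullet>\<^bsub>g\<^esub> kappa_root \<mu> i" for i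
  proof (cases "i < \<theta>")
    case True
    then have "kappa_root \<mu> i = (\<lambda>z. \<mu> i * (\<Sum>b\<in>{1..<N i}. (dp \<chi> i (N i - Suc b) (\<lambda>h. \<chi> i h ^ b) \<otimes>\<^sub>t dp \<chi> i b (\<lambda>_. 1)) z))"
      by (simp add: fun_eq_iff kappa_root_def)
    then show ?thesis using True by (simp add: conv_linear zeta_w_commute)
  next
    case False
    then have "kappa_root \<mu> i = (\<lambda>z. 0)" by (simp add: fun_eq_iff kappa_root_def)
    then show ?thesis by (simp add: conv_linear)
  qed
  note rec = exp_w_rec[of "zeta_w \<mu>" "kappa_root \<mu>", OF zeta_w_letter comm]
  show "exp_w g (zeta_w \<mu>) ([], v) = eps v" for v by (rule rec)
  show "exp_w g (zeta_w \<mu>) (Grp h # u, v) = exp_w g (zeta_w \<mu>) (u, v)" for h u v by (rule rec)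
  show "exp_w g (zeta_w \<mu>) (Var i # u, v) =
      (exp_w g (zeta_w \<mu>) \<bullet>\<^bsub>g\<^esub> (\<lambda>(u, v). d_root \<mu> i (u @ v) - (d_root \<mu> i \<otimes>\<^sub>t eps) (u, v))) (u, v)" for i u v
    unfolding kappa_root by (rule rec)
  show "(d_root \<mu> i \<otimes>\<^sub>t eps) \<bullet>\<^bsub>g\<^esub> exp_w g (zeta_w \<mu>) = exp_w g (zeta_w \<mu>) \<bullet>\<^bsub>g\<^esub> (d_root \<mu> i \<otimes>\<^sub>t eps)" for i
  proof (rule rec, cases "i < \<theta>")
    case True
    have "(d_root \<mu> i \<otimes>\<^sub>t eps) = (\<lambda>z. \<mu> i * (dp \<chi> i (N i - Suc 0) (\<lambda>h. \<chi> i h ^ 0) \<otimes>\<^sub>t dp \<chi> i 0 (\<lambda>_. 1)) z)"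
      using True by (simp add: fun_eq_iff d_root_def tens_def dp_0_eps)
    then show "(d_root \<mu> i \<otimes>\<^sub>t eps) \<bullet>\<^bsub>g\<^esub> zeta_w \<mu> = zeta_w \<mu> \<bullet>\<^bsub>g\<^esub> (d_root \<mu> i \<otimes>\<^sub>t eps)"
      using zeta_w_commute[OF True, of 0] N_gt_1[OF True] by (simp add: conv_linear)
  next
    case False
    then have "(d_root \<mu> i \<otimes>\<^sub>t (eps :: 'g letter list \<Rightarrow> 'k)) = (\<lambda>z. 0)" by (simp add: fun_eq_iff d_root_def tens_def)
    then show "(d_root \<mu> i \<otimes>\<^sub>t eps) \<bullet>\<^bsub>g\<^esub> zeta_w \<mu> = zeta_w \<mu> \<bullet>\<^bsub>g\<^esub> (d_root \<mu> i \<otimes>\<^sub>t eps)"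
      by (simp add: conv_linear)
  qed
qed

end

section \<open>The linking q-exponentials\<close>

definition eta_w :: "nat \<Rightarrow> nat \<Rightarrow> 'g letter list \<times> 'g letter list \<Rightarrow> 'k" where
  "eta_w i j = dp \<chi> i 1 (\<chi> j) \<otimes>\<^sub>t dp \<chi> j 1 (\<lambda>_. 1)"

definition link_factor :: "(nat \<Rightarrow> nat \<Rightarrow> 'k) \<Rightarrow> nat \<times> nat \<Rightarrow> 'g letter list \<times> 'g letter list \<Rightarrow> 'k" where
  "link_factor l p =
     (case p of (i, j) \<Rightarrow> q_exp_w g (\<chi> j (g i)) (N j) (\<lambda>z. l i j * eta_w i j z))"

definition link_w :: "(nat \<Rightarrow> nat \<Rightarrow> 'k) \<Rightarrow> (nat \<times> nat) list \<Rightarrow> 'g letter list \<times> 'g letter list \<Rightarrow> 'k" where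
  "link_w l ps = foldr (\<lambda>p S. link_factor l p \<bullet>\<^bsub>g\<^esub> S) ps eps2"

definition d_link :: "(nat \<Rightarrow> nat \<Rightarrow> 'k) \<Rightarrow> (nat \<times> nat) list \<Rightarrow> nat \<Rightarrow> 'g letter list \<Rightarrow> 'k" where
  "d_link l ps k w = (\<Sum>(i, j)\<leftarrow>ps. if i = k then l i j * dp \<chi> j 1 (\<lambda>_. 1) w else 0)"

text \<open>The translate of \<open>l i j * eta_w i j\<close> by x_i; what is left of d_i * \<chi>_j
  is the character \<chi>_j.\<close>

definition kappa_link :: "(nat \<Rightarrow> nat \<Rightarrow> 'k) \<Rightarrow> nat \<times> nat \<Rightarrow> 'g letter list \<times> 'g letter list \<Rightarrow> 'k" where
  "kappa_link l p z = (case p of (i, j) \<Rightarrow> l i j * (dp \<chi> j 0 (\<chi> j) \<otimes>\<^sub>t dp \<chi> j 1 (\<lambda>_. 1)) z)"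

definition link_pair :: "nat \<times> nat \<Rightarrow> bool" where
  "link_pair p \<longleftrightarrow> (case p of (i, j) \<Rightarrow> i < \<theta> \<and> j < \<theta> \<and> i \<noteq> j \<and> (\<forall>h. \<chi> i h * \<chi> j h = 1))"

text \<open>Both scalars are inverse to \<chi>_i(g_j). Hence the parameter of the q-exponential is a
  primitive N_j-th root of unity.\<close>

lemma link_pair_q:
  assumes "link_pair (i, j)"
  shows "\<chi> j (g i) = \<chi> j (g j)"
proof -
  have "\<chi> i (g j) * \<chi> j (g i) = 1" "\<chi> i (g j) * \<chi> j (g j) = 1"
    using assms braid[of i j] by (auto simp: link_pair_def)
  then show ?thesis by (metis mult_cancel_left zero_neq_one mult_zero_left)
qed

lemma eta_w_letter:
  assumes "link_pair (i, j)"
  shows "eta_w i j ([], v) = 0"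
    and "eta_w i j (Grp h # u, v) = eta_w i j (u, v)"
    and "eta_w i j (Var k # u, v) =
      (if k = i then (dp \<chi> j 0 (\<chi> j) \<otimes>\<^sub>t dp \<chi> j 1 (\<lambda>_. 1)) (u, v) else 0)"
  using assms unfolding link_pair_def eta_w_def by (auto simp: dp_0_index[of \<chi> i _ j])

text \<open>Both sides are inverse to \<chi>_k(g_j), one by linkability and the other by the
  braiding.\<close>

lemma link_chi_eq:
  assumes "link_pair (i, j)" "link_pair (k, l)" "k \<noteq> j"
  shows "\<chi> l (g j) = \<chi> j (g k)"
proof -
  have "\<chi> k (g j) * \<chi> l (g j) = 1" "\<chi> k (g j) * \<chi> j (g k) = 1"
    using assms braid[of k j] by (auto simp: link_pair_def)
  then show ?thesis by (metis mult_cancel_left zero_neq_one mult_zero_left)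
qed

text \<open>The character in the first leg passes d_k with the scalar \<chi>_j(g_k). For the same
  pair this is the q of the q-exponential; for disjoint pairs the second leg contributes the inverse
  scalar by \<open>link_chi_eq\<close>.\<close>

lemma kappa_eta_comm:
  assumes "link_pair (i, j)" "link_pair (k, l)" "(i, j) = (k, l) \<or> {i, j} \<inter> {k, l} = {}"
  shows "(dp \<chi> j 0 (\<chi> j) \<otimes>\<^sub>t dp \<chi> j 1 (\<lambda>_. 1)) \<bullet>\<^bsub>g\<^esub> eta_w k l =
     (\<lambda>z. (if (i, j) = (k, l) then \<chi> j (g i) else 1) *
       (eta_w k l \<bullet>\<^bsub>g\<^esub> (dp \<chi> j 0 (\<chi> j) \<otimes>\<^sub>t dp \<chi> j 1 (\<lambda>_. 1))) z)"
proof -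
  have jk: "j \<noteq> k" using assms by (auto simp: link_pair_def)
  have leg1: "dp \<chi> j 0 (\<chi> j) \<diamondop>\<^bsub>g\<^esub> dp \<chi> k 1 (\<chi> l) = (\<lambda>w. \<chi> j (g k) * (dp \<chi> k 1 (\<chi> l) \<diamondop>\<^bsub>g\<^esub> dp \<chi> j 0 (\<chi> j)) w)"
    by (simp add: dp_0_index[of \<chi> j _ k] dp_same mult.commute)
  show ?thesis
  proof (cases "(i, j) = (k, l)")
    case True
    then show ?thesis unfolding eta_w_def conv_tens leg1 by (auto simp: fun_eq_iff tens_def)
  next
    case False
    then have "j \<noteq> l" using assms by auto
    then have "(dp \<chi> l 1 (\<lambda>_. 1) \<diamondop>\<^bsub>g\<^esub> dp \<chi> j 1 (\<lambda>_. 1)) w = \<chi> l (g j) * (dp \<chi> j 1 (\<lambda>_. 1) \<diamondop>\<^bsub>g\<^esub> dp \<chi> l 1 (\<lambda>_. 1)) w" for w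
      using dp_comm[where i = j and j = l and \<chi> = \<chi> and g = g, of "\<lambda>_. 1" 1 "\<lambda>_. 1" 1 w] braid[of j l] assms
      by (auto simp: link_pair_def)
    then show ?thesis unfolding eta_w_def conv_tens leg1
      using False link_chi_eq[OF assms(1,2)] jk by (auto simp: fun_eq_iff tens_def)
  qed
qed

lemma d_eta_comm:
  assumes "link_pair (i, j)" "link_pair (k, l)" "(i, j) = (k, l) \<or> {i, j} \<inter> {k, l} = {}"
  shows "(dp \<chi> j 1 (\<lambda>_. 1) \<otimes>\<^sub>t eps) \<bullet>\<^bsub>g\<^esub> eta_w k l = eta_w k l \<bullet>\<^bsub>g\<^esub> (dp \<chi> j 1 (\<lambda>_. 1) \<otimes>\<^sub>t eps)"
proof -
  have jk: "k \<noteq> j" using assms by (auto simp: link_pair_def)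
  have "\<chi> l (g j) * (dp \<chi> j 1 (\<lambda>_. 1) \<diamondop>\<^bsub>g\<^esub> dp \<chi> k 1 (\<chi> l)) w = \<chi> j (g k) * (dp \<chi> k 1 (\<chi> l) \<diamondop>\<^bsub>g\<^esub> dp \<chi> j 1 (\<lambda>_. 1)) w" for w
    using dp_comm[where i = k and j = j and \<chi> = \<chi> and g = g, of "\<chi> l" 1 "\<lambda>_. 1" 1 w] braid[of k j] assms jk
    by (auto simp: link_pair_def)
  moreover have "\<chi> l (g j) = \<chi> j (g k)" "\<chi> l (g j) \<noteq> 0"
    using link_chi_eq[OF assms(1,2) jk] assms(2) by (auto simp: link_pair_def) (metis mult_zero_right zero_neq_one)
  ultimately show ?thesis unfolding eta_w_def conv_tens by (auto simp: fun_eq_iff tens_def)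
qed

lemma conv_q_exp_w:
  "X \<bullet>\<^bsub>g\<^esub> q_exp_w g q n Z = (\<lambda>z. \<Sum>m<n. inverse (q_fact q m) * (X \<bullet>\<^bsub>g\<^esub> cpow g Z m) z)"
  "q_exp_w g q n Z \<bullet>\<^bsub>g\<^esub> X = (\<lambda>z. \<Sum>m<n. inverse (q_fact q m) * (cpow g Z m \<bullet>\<^bsub>g\<^esub> X) z)"
proof -
  have *: "q_exp_w g q n Z = (\<lambda>z. \<Sum>m<n. inverse (q_fact q m) * cpow g Z m z)"
    by (simp add: fun_eq_iff q_exp_w_def divide_inverse mult.commute)
  show "X \<bullet>\<^bsub>g\<^esub> q_exp_w g q n Z = (\<lambda>z. \<Sum>m<n. inverse (q_fact q m) * (X \<bullet>\<^bsub>g\<^esub> cpow g Z m) z)"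
    "q_exp_w g q n Z \<bullet>\<^bsub>g\<^esub> X = (\<lambda>z. \<Sum>m<n. inverse (q_fact q m) * (cpow g Z m \<bullet>\<^bsub>g\<^esub> X) z)"
    unfolding * by (simp_all add: conv_linear)
qed

lemma link_factor_comm:
  assumes "X \<bullet>\<^bsub>g\<^esub> eta_w i j = eta_w i j \<bullet>\<^bsub>g\<^esub> X"
  shows "X \<bullet>\<^bsub>g\<^esub> link_factor l (i, j) = link_factor l (i, j) \<bullet>\<^bsub>g\<^esub> X"
proof -
  have "X \<bullet>\<^bsub>g\<^esub> (\<lambda>z. l i j * eta_w i j z) = (\<lambda>z. 1 * ((\<lambda>z. l i j * eta_w i j z) \<bullet>\<^bsub>g\<^esub> X) z)"
    by (simp add: conv_linear assms)
  then show ?thesis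
    unfolding link_factor_def by (simp add: conv_q_exp_w cw2.conv_commute_pow[where q = 1])
qed

text \<open>The q-exponential is its own derivative up to \<kappa>, although it is truncated: the
  term lost at the top is Z^(N_j - 1) * \<kappa>, and its second leg d_j^(N_j - 1) * d_j is
  zero.\<close>

lemma link_factor_letter:
  assumes ij: "link_pair (i, j)"
  shows "link_factor l (i, j) ([], v) = eps v"
    and "link_factor l (i, j) (Grp h # u, v) = link_factor l (i, j) (u, v)"
    and "link_factor l (i, j) (Var k # u, v) =
      (if k = i then (link_factor l (i, j) \<bullet>\<^bsub>g\<^esub> kappa_link l (i, j)) (u, v) else 0)"
proof -
  let ?Z = "\<lambda>z. l i j * eta_w i j z" and ?q = "\<chi> j (g i)"
  have j: "j < \<theta>" using ij by (auto simp: link_pair_def)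
  have N: "0 < N j" "1 < N j" using N_gt_1[OF j] by auto
  have q: "?q \<noteq> 1" "?q ^ N j = 1" "\<And>k. 0 < k \<Longrightarrow> k < N j \<Longrightarrow> ?q ^ k \<noteq> 1"
    using link_pair_q[OF ij] q_neq_1[OF j] root[OF j] prim[OF j] by auto
  note letter = eta_w_letter[OF ij]
  show "link_factor l (i, j) ([], v) = eps v"
    using N by (simp add: link_factor_def q_exp_w_def cpow_nil letter if_distrib[of "\<lambda>x. x / _"] q_fact_def cong: if_cong)
  show "link_factor l (i, j) (Grp h # u, v) = link_factor l (i, j) (u, v)"
    by (simp add: link_factor_def q_exp_w_def cpow_Grp letter)
  show "link_factor l (i, j) (Var k # u, v) =
      (if k = i then (link_factor l (i, j) \<bullet>\<^bsub>g\<^esub> kappa_link l (i, j)) (u, v) else 0)"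
  proof (cases "k = i")
    case False
    have "cpow g ?Z m (Var k # u, v) = 0" for m
    proof -
      have "cpow g ?Z m (Var k # u, v) = (\<Sum>s<m. 1 ^ s) * (cpow g ?Z (m - 1) \<bullet>\<^bsub>g\<^esub> (\<lambda>z. 0)) (u, v)"
        by (rule cpow_Var) (use False in \<open>auto simp: letter conv_linear\<close>)
      then show ?thesis by (simp add: conv_linear)
    qed
    then show ?thesis using False by (simp add: link_factor_def q_exp_w_def)
  next
    case True
    let ?K = "kappa_link l (i, j)"
    have K: "?K = (\<lambda>z. l i j * (dp \<chi> j 0 (\<chi> j) \<otimes>\<^sub>t dp \<chi> j 1 (\<lambda>_. 1)) z)"
      by (simp add: fun_eq_iff kappa_link_def)
    have step: "cpow g ?Z m (Var i # u, v) = (\<Sum>s<m. ?q ^ s) * (cpow g ?Z (m - 1) \<bullet>\<^bsub>g\<^esub> ?K) (u, v)" for m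
      by (rule cpow_Var) (use kappa_eta_comm[OF ij ij] in \<open>simp_all add: letter K conv_linear mult_ac\<close>)
    \<comment> \<open>Only the shape of the second leg matters for the vanishing at the top, so the
      first leg stays anonymous.\<close>
    have "\<exists>f. cpow g ?Z m = f \<otimes>\<^sub>t dp \<chi> j m (\<lambda>_. 1)" for m
    proof (induction m)
      case 0 show ?case by (auto simp: dp_0_eps)
    next
      case (Suc m)
      then obtain f where f: "cpow g ?Z m = f \<otimes>\<^sub>t dp \<chi> j m (\<lambda>_. 1)" by blast
      let ?f = "\<lambda>w. l i j * q_binom (\<chi> j (g j)) 1 m * (dp \<chi> i 1 (\<chi> j) \<diamondop>\<^bsub>g\<^esub> f) w"
      have "cpow g ?Z (Suc m) = ?f \<otimes>\<^sub>t dp \<chi> j (Suc m) (\<lambda>_. 1)"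
        unfolding funpow.simps comp_apply unfolding f unfolding eta_w_def conv_linear conv_tens dp_same
        by (auto simp: fun_eq_iff tens_def)
      then show ?case by blast
    qed
    then obtain f where f: "cpow g ?Z (N j - 1) = f \<otimes>\<^sub>t dp \<chi> j (N j - 1) (\<lambda>_. 1)" by blast
    have top: "cpow g ?Z (N j - 1) \<bullet>\<^bsub>g\<^esub> ?K = (\<lambda>z. 0)"
    proof -
      have "dp \<chi> j (N j - 1) (\<lambda>_. 1) \<diamondop>\<^bsub>g\<^esub> dp \<chi> j 1 (\<lambda>_. 1) = (\<lambda>w. 0)"
        by (rule dp_same_zero) (use j N in auto)
      then show ?thesis unfolding f K conv_linear conv_tens by (auto simp: tens_def)
    qed
    obtain M where M: "N j = Suc M" using N by (cases "N j") auto
    \<comment> \<open>The numerator is the last factor of the factorial, which is nonzero below the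
      order of q.\<close>
    have fact: "(\<Sum>s<Suc m. ?q ^ s) / q_fact ?q (Suc m) = inverse (q_fact ?q m)" if "m < M" for m
    proof -
      have "q_fact ?q (Suc m) \<noteq> 0" using q_fact_nonzero[where n = "N j" and m = "Suc m", OF q(1) q(3)] that M by auto
      then show ?thesis unfolding q_fact_Suc by (simp add: divide_simps del: sum.lessThan_Suc)
    qed
    have "link_factor l (i, j) (Var i # u, v) = (\<Sum>m<M. cpow g ?Z (Suc m) (Var i # u, v) / q_fact ?q (Suc m))"
      unfolding link_factor_def q_exp_w_def M prod.case by (subst sum.lessThan_Suc_shift) simp
    also have "\<dots> = (\<Sum>m<M. inverse (q_fact ?q m) * (cpow g ?Z m \<bullet>\<^bsub>g\<^esub> ?K) (u, v))"
    proof (rule sum.cong[OF refl])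
      fix m assume "m \<in> {..<M}"
      then have m: "m < M" by simp
      have "cpow g ?Z (Suc m) (Var i # u, v) / q_fact ?q (Suc m) =
         ((\<Sum>s<Suc m. ?q ^ s) / q_fact ?q (Suc m)) * (cpow g ?Z m \<bullet>\<^bsub>g\<^esub> ?K) (u, v)"
        by (subst step) simp
      then show "cpow g ?Z (Suc m) (Var i # u, v) / q_fact ?q (Suc m) =
         inverse (q_fact ?q m) * (cpow g ?Z m \<bullet>\<^bsub>g\<^esub> ?K) (u, v)"
        unfolding fact[OF m] .
    qed
    also have "\<dots> = (link_factor l (i, j) \<bullet>\<^bsub>g\<^esub> ?K) (u, v)"
      using top unfolding link_factor_def prod.case conv_q_exp_w M by simp
    finally show ?thesis using True by simp
  qed
qed

text \<open>Disjointness of different pairs is what makes their factors commute; a pair meets its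
  own \<kappa> only inside its own q-exponential.\<close>

definition link_pairs :: "(nat \<times> nat) list \<Rightarrow> bool" where
  "link_pairs ps \<longleftrightarrow> distinct ps \<and> (\<forall>p\<in>set ps. link_pair p) \<and>
     (\<forall>p\<in>set ps. \<forall>p'\<in>set ps. p = p' \<or> {fst p, snd p} \<inter> {fst p', snd p'} = {})"

lemma link_pairsD:
  assumes "link_pairs ps" "(i, j) \<in> set ps" "(k, l) \<in> set ps"
  shows "link_pair (i, j)" "link_pair (k, l)" "(i, j) = (k, l) \<or> {i, j} \<inter> {k, l} = {}"
proof -
  show "link_pair (i, j)" "link_pair (k, l)" 
    using bspec[OF assms(1)[unfolded link_pairs_def, THEN conjunct2, THEN conjunct1]] assms(2,3) by auto
  show "(i, j) = (k, l) \<or> {i, j} \<inter> {k, l} = {}"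
    using bspec[OF bspec[OF assms(1)[unfolded link_pairs_def, THEN conjunct2, THEN conjunct2] assms(2)] assms(3)]
    unfolding fst_conv snd_conv .
qed

lemma link_pairs_Cons:
  assumes "link_pairs (p # ps)"
  shows "link_pair p" "link_pairs ps" "p \<notin> set ps"
proof -
  note a = assms[unfolded link_pairs_def]
  show "link_pair p" using a by (meson list.set_intros(1))
  show "p \<notin> set ps" using a by (meson distinct.simps(2))
  show "link_pairs ps" unfolding link_pairs_def
  proof (intro conjI ballI)
    fix p q assume "p \<in> set ps" "q \<in> set ps"
    then show "p = q \<or> {fst p, snd p} \<inter> {fst q, snd q} = {}" using a by (meson list.set_intros(2))
  qed (use a in auto)
qed

lemma link_w_comm:
  assumes "\<And>i j. (i, j) \<in> set ps \<Longrightarrow> X \<bullet>\<^bsub>g\<^esub> eta_w i j = eta_w i j \<bullet>\<^bsub>g\<^esub> X"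
  shows "X \<bullet>\<^bsub>g\<^esub> link_w l ps = link_w l ps \<bullet>\<^bsub>g\<^esub> X"
  using assms
proof (induction ps)
  case Nil
  then show ?case by (simp add: link_w_def)
next
  case (Cons p ps)
  obtain i j where p: "p = (i, j)" by fastforce
  have 1: "X \<bullet>\<^bsub>g\<^esub> link_factor l p = link_factor l p \<bullet>\<^bsub>g\<^esub> X"
    unfolding p by (rule link_factor_comm) (use Cons.prems p in auto)
  have 2: "X \<bullet>\<^bsub>g\<^esub> link_w l ps = link_w l ps \<bullet>\<^bsub>g\<^esub> X" by (rule Cons.IH) (use Cons.prems in auto)
  have "X \<bullet>\<^bsub>g\<^esub> (link_factor l p \<bullet>\<^bsub>g\<^esub> link_w l ps) = link_factor l p \<bullet>\<^bsub>g\<^esub> (X \<bullet>\<^bsub>g\<^esub> link_w l ps)"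
    by (metis 1 cw2.conv_assoc)
  then show ?case using 2 by (simp add: link_w_def cw2.conv_assoc)
qed

text \<open>The coproduct of d_j dual to multiplication has two terms, d_j \<otimes> eps and
  \<chi>_j \<otimes> d_j; subtracting the first leaves the \<kappa> of each pair starting in
  k.\<close>

lemma kappa_link: "(\<lambda>(u, v). d_link l ps k (u @ v) - (d_link l ps k \<otimes>\<^sub>t eps) (u, v)) =
   (\<lambda>z. \<Sum>p\<leftarrow>ps. if fst p = k then kappa_link l p z else 0)"
proof -
  have 1: "dp \<chi> j 1 (\<lambda>_. 1) (u @ v) = dp \<chi> j 1 (\<lambda>_. 1) u * eps v + dp \<chi> j 0 (\<chi> j) u * dp \<chi> j 1 (\<lambda>_. 1) v" for j u v
    by (simp only: dp_append) (simp add: dp_0_eps)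
  show ?thesis
  proof (intro ext, clarify)
    fix u v
    show "d_link l ps k (u @ v) - (d_link l ps k \<otimes>\<^sub>t eps) (u, v) =
       (\<Sum>p\<leftarrow>ps. if fst p = k then kappa_link l p (u, v) else 0)"
      by (induction ps) (auto simp: d_link_def kappa_link_def 1[unfolded One_nat_def] algebra_simps)
  qed
qed

text \<open>The Leibniz rule leaves the \<kappa> of the first factor between that factor and the
  rest of the product; disjointness of the pairs allows moving it to the right end.\<close>

lemma link_w_letter:
  assumes "link_pairs ps"
  shows "link_w l ps ([], v) = eps v"
    and "link_w l ps (Grp h # u, v) = link_w l ps (u, v)"
    and "link_w l ps (Var k # u, v) =
      (link_w l ps \<bullet>\<^bsub>g\<^esub> (\<lambda>z. \<Sum>p\<leftarrow>ps. if fst p = k then kappa_link l p z else 0)) (u, v)"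
  using assms
proof (induction ps arbitrary: u v)
  case Nil
  { case 1 show ?case by (simp add: link_w_def) }
  { case 2 show ?case by (simp add: link_w_def) }
  { case 3 show ?case by (simp add: link_w_def conv_linear) }
next
  case (Cons p ps)
  { case 1
    note link_pairs_Cons[OF this]
    then show ?case
      using Cons.IH(1) by (cases p) (auto simp: link_w_def conv2_letter link_factor_letter) }
  { case 2
    note link_pairs_Cons[OF this]
    then show ?case
      using Cons.IH(2) by (cases p) (auto simp: link_w_def conv2_letter link_factor_letter) }
  { case (3 u v)
    note p = link_pairs_Cons(1)[OF this] and ps = link_pairs_Cons(2)[OF this] and np = link_pairs_Cons(3)[OF this]
    obtain i j where ij: "p = (i, j)" by fastforce
    let ?E = "link_factor l p" and ?S = "link_w l ps"
    let ?\<kappa> = "\<lambda>z. \<Sum>p\<leftarrow>ps. if fst p = k then kappa_link l p z else 0"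
    have K: "kappa_link l p = (\<lambda>z. l i j * (dp \<chi> j 0 (\<chi> j) \<otimes>\<^sub>t dp \<chi> j 1 (\<lambda>_. 1)) z)"
      by (simp add: fun_eq_iff kappa_link_def ij)
    have comm: "kappa_link l p \<bullet>\<^bsub>g\<^esub> ?S = ?S \<bullet>\<^bsub>g\<^esub> kappa_link l p"
    proof (rule link_w_comm)
      fix i' j' assume *: "(i', j') \<in> set ps"
      then have "(i, j) \<noteq> (i', j')" using np ij by auto
      moreover have "link_pair (i, j)" "link_pair (i', j')" "(i, j) = (i', j') \<or> {i, j} \<inter> {i', j'} = {}"
        using link_pairsD[OF 3, of i j i' j'] * ij by simp_all
      ultimately show "kappa_link l p \<bullet>\<^bsub>g\<^esub> eta_w i' j' = eta_w i' j' \<bullet>\<^bsub>g\<^esub> kappa_link l p"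
        unfolding K conv_linear by (auto simp: kappa_eta_comm simp del: One_nat_def)
    qed
    have E_grp: "(\<lambda>(u, v). ?E (Grp h # u, v)) = ?E" for h
      using link_factor_letter(2)[OF p[unfolded ij]] by (auto simp: ij)
    have S_var: "(\<lambda>(u, v). ?S (Var k # u, v)) = ?S \<bullet>\<^bsub>g\<^esub> ?\<kappa>" using Cons.IH(3)[OF ps] by auto
    show ?case
    proof (cases "fst p = k")
      case True
      then have E_var: "(\<lambda>(u, v). ?E (Var k # u, v)) = ?E \<bullet>\<^bsub>g\<^esub> kappa_link l p"
        using link_factor_letter(3)[OF p[unfolded ij]] by (auto simp: ij)
      have "link_w l (p # ps) (Var k # u, v) =
          (?E \<bullet>\<^bsub>g\<^esub> (kappa_link l p \<bullet>\<^bsub>g\<^esub> ?S)) (u, v) + (?E \<bullet>\<^bsub>g\<^esub> (?S \<bullet>\<^bsub>g\<^esub> ?\<kappa>)) (u, v)"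
        by (simp add: link_w_def[of l "p # ps"] link_w_def[of l ps, symmetric] conv2_letter E_var E_grp S_var cw2.conv_assoc)
      then show ?thesis using True
        by (simp add: comm link_w_def[of l "p # ps"] link_w_def[of l ps, symmetric] conv_linear cw2.conv_assoc)
    next
      case False
      then have E_var: "(\<lambda>(u, v). ?E (Var k # u, v)) = (\<lambda>z. 0)"
        using link_factor_letter(3)[OF p[unfolded ij]] by (auto simp: ij)
      show ?thesis using False
        by (simp add: link_w_def[of l "p # ps"] link_w_def[of l ps, symmetric] conv2_letter E_var E_grp S_var cw2.conv_assoc conv_linear)
    qed }
qed

lemma link_coboundary:
  assumes ps: "link_pairs ps"
  shows "link_w l ps \<bullet>\<^bsub>g\<^esub> (\<lambda>(u, v). cob g (d_link l ps) (u @ v)) = cob g (d_link l ps) \<otimes>\<^sub>t cob g (d_link l ps)"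
proof (rule coboundary_eqI)
  show "link_w l ps (Var i # u, v) =
      (link_w l ps \<bullet>\<^bsub>g\<^esub> (\<lambda>(u, v). d_link l ps i (u @ v) - (d_link l ps i \<otimes>\<^sub>t eps) (u, v))) (u, v)" for i u v
    unfolding kappa_link by (rule link_w_letter[OF ps])
  show "(d_link l ps i \<otimes>\<^sub>t eps) \<bullet>\<^bsub>g\<^esub> link_w l ps = link_w l ps \<bullet>\<^bsub>g\<^esub> (d_link l ps i \<otimes>\<^sub>t eps)" for i
  proof (rule link_w_comm)
    fix k m assume km: "(k, m) \<in> set ps"
    have "(d_link l qs i \<otimes>\<^sub>t eps) \<bullet>\<^bsub>g\<^esub> eta_w k m = eta_w k m \<bullet>\<^bsub>g\<^esub> (d_link l qs i \<otimes>\<^sub>t eps)" if "set qs \<subseteq> set ps" for qs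
      using that
    proof (induction qs)
      case Nil
      have "(d_link l [] i \<otimes>\<^sub>t (eps :: 'g letter list \<Rightarrow> 'k)) = (\<lambda>z. 0)" by (auto simp: d_link_def fun_eq_iff tens_def)
      then show ?case by (simp add: conv_linear)
    next
      case (Cons q qs)
      obtain a b where q: "q = (a, b)" by fastforce
      have *: "(d_link l (q # qs) i \<otimes>\<^sub>t (eps :: 'g letter list \<Rightarrow> 'k)) =
        (\<lambda>z. (if a = i then l a b else 0) * (dp \<chi> b 1 (\<lambda>_. 1) \<otimes>\<^sub>t eps) z + (d_link l qs i \<otimes>\<^sub>t eps) z)"
        by (auto simp: d_link_def fun_eq_iff tens_def q algebra_simps)
      have "link_pair (a, b)" "link_pair (k, m)" "(a, b) = (k, m) \<or> {a, b} \<inter> {k, m} = {}"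
        using link_pairsD[OF ps _ km, of a b] Cons.prems by (simp_all add: q)
      note c = d_eta_comm[OF this]
      show ?case unfolding * conv_linear c using Cons by simp
    qed
    then show "(d_link l ps i \<otimes>\<^sub>t eps) \<bullet>\<^bsub>g\<^esub> eta_w k m = eta_w k m \<bullet>\<^bsub>g\<^esub> (d_link l ps i \<otimes>\<^sub>t eps)" by simp
  qed
  show "link_w l ps ([], v) = eps v" for v by (rule link_w_letter(1)[OF ps])
  show "link_w l ps (Grp h # u, v) = link_w l ps (u, v)" for h u v by (rule link_w_letter(2)[OF ps])
qed

end

section \<open>Functionals on the free algebra\<close>

definition ext :: "('a \<Rightarrow> 'k::field) \<Rightarrow> ('a \<Rightarrow>\<^sub>0 'k) \<Rightarrow> 'k" where
  "ext f p = (\<Sum>z\<in>Poly_Mapping.keys p. Poly_Mapping.lookup p z * f z)"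

lemma ext_superset:
  assumes "finite A" "Poly_Mapping.keys p \<subseteq> A"
  shows "ext f p = (\<Sum>z\<in>A. Poly_Mapping.lookup p z * f z)"
  unfolding ext_def by (intro sum.mono_neutral_left assms) (auto simp: in_keys_iff)

lemma ext_zero [simp]: "ext f 0 = 0"
  by (simp add: ext_def)

lemma ext_single [simp]: "ext f (Poly_Mapping.single w c) = c * f w"
  by (simp add: ext_def)

lemma ext_one [simp]: "ext f (1 :: 'a::monoid_add \<Rightarrow>\<^sub>0 'k::field) = f 0"
  unfolding single_one[symmetric] ext_single by simp

lemma ext_add [simp]: "ext f (p + q) = ext f p + ext f q"
proof -
  let ?A = "Poly_Mapping.keys p \<union> Poly_Mapping.keys q"
  have "Poly_Mapping.keys (p + q) \<subseteq> ?A" by (rule keys_add)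
  then have "ext f (p + q) = (\<Sum>z\<in>?A. Poly_Mapping.lookup (p + q) z * f z)" by (intro ext_superset) auto
  also have "\<dots> = ext f p + ext f q"
    by (simp add: ext_superset[of ?A p] ext_superset[of ?A q] lookup_add distrib_right sum.distrib)
  finally show ?thesis .
qed

lemma ext_uminus [simp]: "ext f (- p) = - ext f p"
  using ext_add[of f "- p" p] by (simp add: eq_neg_iff_add_eq_0)

lemma ext_diff [simp]: "ext f (p - q) = ext f p - ext f q"
  using ext_add[of f p "- q"] by simp

lemma ext_sum: "ext f (\<Sum>i\<in>I. P i) = (\<Sum>i\<in>I. ext f (P i))"
  by (induction I rule: infinite_finite_induct) auto

lemma ext_cong: "(\<And>z. z \<in> Poly_Mapping.keys p \<Longrightarrow> f z = h z) \<Longrightarrow> ext f p = ext h p"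
  unfolding ext_def by (intro sum.cong) auto

lemma ext_fun:
  "ext (\<lambda>z. 0) p = 0"
  "ext (\<lambda>z. f z + h z) p = ext f p + ext h p"
  "ext (\<lambda>z. f z - h z) p = ext f p - ext h p"
  "ext (\<lambda>z. - f z) p = - ext f p"
  "ext (\<lambda>z. c * f z) p = c * ext f p"
  "ext (\<lambda>z. f z * c) p = ext f p * c"
  "ext (\<lambda>z. \<Sum>i\<in>I. F i z) p = (\<Sum>i\<in>I. ext (F i) p)"
  by (simp_all add: ext_def algebra_simps sum.distrib sum_subtractf sum_negf sum_distrib_left
      sum_distrib_right sum.swap[of _ _ I])

lemma ext_dsum: "ext (\<lambda>z. dsum xs (F z)) p = dsum xs (\<lambda>x y. ext (\<lambda>z. F z x y) p)"
  by (induction xs) (auto simp: ext_fun)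

lemma ext_swap: "ext (\<lambda>u. ext (F u) q) p = ext (\<lambda>v. ext (\<lambda>u. F u v) p) q"
  unfolding ext_def by (simp add: sum_distrib_left mult_ac) (subst sum.swap, simp add: mult_ac)

lemma poly_mapping_decomp: "p = (\<Sum>w\<in>Poly_Mapping.keys p. Poly_Mapping.single w (Poly_Mapping.lookup p w))"
  by (rule poly_mapping_eqI)
    (simp add: lookup_sum lookup_single when_def in_keys_iff if_distrib[of "\<lambda>x. x = _"] sum.delta')

lemma poly_mapping_words_induct [consumes 1, case_names zero single add]:
  assumes "Poly_Mapping.keys p \<subseteq> A"
    and "P 0" "\<And>w c. w \<in> A \<Longrightarrow> P (Poly_Mapping.single w c)"
    and add: "\<And>p q. P p \<Longrightarrow> P q \<Longrightarrow> P (p + q)"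
  shows "P (p :: 'a \<Rightarrow>\<^sub>0 'k::field)"
proof -
  have "P (\<Sum>w\<in>B. Poly_Mapping.single w (Poly_Mapping.lookup p w))" if "finite B" "B \<subseteq> A" for B
    using that by (induction B) (auto simp: assms)
  then show ?thesis using assms(1) by (subst poly_mapping_decomp) auto
qed

lemma ext_mult: "ext f (p * q) = ext (\<lambda>u. ext (\<lambda>v. f (u + v)) q) p"
proof -
  have 1: "ext f (Poly_Mapping.single u c * q) = c * ext (\<lambda>v. f (u + v)) q" for u c
  proof -
    have "Poly_Mapping.keys q \<subseteq> UNIV" by simp
    then show ?thesis
      by (induction q rule: poly_mapping_words_induct) (auto simp: mult_single algebra_simps)
  qed
  have "Poly_Mapping.keys p \<subseteq> UNIV" by simp
  then show ?thesis
    by (induction p rule: poly_mapping_words_induct) (auto simp: 1 algebra_simps)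
qed

lemma ext_push [simp]: "ext f (push h t) = ext (\<lambda>z. f (h z)) t"
  by (simp add: push_def ext_sum) (simp add: ext_def)

lemma sweedler_ext: "sweedler t f = ext (\<lambda>z. f (fst z) (snd z)) t"
  by (simp add: sweedler_def ext_def)

lemma plus_list [simp]: "u + v = u @ v" "(0 :: 'a list) = []"
  by (simp_all add: plus_list_def zero_list_def)

lemma mon_Nil [simp]: "mon [] = 1"
  by (metis plus_list(2) single_one)

lemma mon_mult: "mon u * mon v = mon (u @ v)"
  by (simp add: mult_single)

lemma const_mult: "const c * Poly_Mapping.single w d = Poly_Mapping.single w (c * d)"
  by (simp add: mult_single)

lemma mon_power: "mon [s] ^ n = mon (replicate n s)"
  by (induction n) (auto simp: mon_mult)

lemma ext_const_mult [simp]: "ext f (const c * p) = c * ext f p"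
  by (simp add: ext_mult)

lemma keys_const_mult: "Poly_Mapping.keys (const c * p) \<subseteq> Poly_Mapping.keys p"
  using keys_mult[of "const c" p] by (auto split: if_splits dest!: subsetD)

lemma keys_uminus: "Poly_Mapping.keys (- p) = Poly_Mapping.keys (p :: 'a \<Rightarrow>\<^sub>0 'k::field)"
  by (auto simp: in_keys_iff)

lemma keys_minus: "Poly_Mapping.keys (p - q) \<subseteq> Poly_Mapping.keys p \<union> Poly_Mapping.keys (q :: 'a \<Rightarrow>\<^sub>0 'k::field)"
  using keys_add[of p "- q"] by (auto simp: keys_uminus)

lemma free_alg_simps [simp]:
  "p \<in> carrier (free_alg D) \<longleftrightarrow> Poly_Mapping.keys p \<subseteq> lists (letters D)"
  "p \<otimes>\<^bsub>free_alg D\<^esub> q = p * q" "p \<oplus>\<^bsub>free_alg D\<^esub> q = p + q"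
  "\<one>\<^bsub>free_alg D\<^esub> = 1" "\<zero>\<^bsub>free_alg D\<^esub> = 0"
  by (simp_all add: free_alg_def)

lemma keys_free_alg:
  assumes "Poly_Mapping.keys p \<subseteq> lists A" "Poly_Mapping.keys q \<subseteq> lists A"
  shows "Poly_Mapping.keys (p + q) \<subseteq> lists A" "Poly_Mapping.keys (p - q) \<subseteq> lists A"
    "Poly_Mapping.keys (- p) \<subseteq> lists A" "Poly_Mapping.keys (p * q) \<subseteq> lists A"
    "Poly_Mapping.keys (const c * p) \<subseteq> lists A"
proof -
  show "Poly_Mapping.keys (p + q) \<subseteq> lists A" using keys_add[of p q] assms by blast
  show "Poly_Mapping.keys (p - q) \<subseteq> lists A" using keys_minus[of p q] assms by blast
  show "Poly_Mapping.keys (- p) \<subseteq> lists A" using assms by (simp add: keys_uminus)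
  show "Poly_Mapping.keys (p * q) \<subseteq> lists A" using keys_mult[of p q] assms by fastforce
  show "Poly_Mapping.keys (const c * p) \<subseteq> lists A" using keys_const_mult[of c p] assms by blast
qed

lemma ring_free_alg: "ring (free_alg D)"
proof (rule ringI)
  show "abelian_group (free_alg D)"
  proof (rule abelian_groupI)
    show "\<exists>q\<in>carrier (free_alg D). q \<oplus>\<^bsub>free_alg D\<^esub> p = \<zero>\<^bsub>free_alg D\<^esub>" if "p \<in> carrier (free_alg D)" for p
      using that by (intro bexI[of _ "- p"]) (auto simp: keys_uminus)
  qed (simp_all add: keys_free_alg add.assoc add.commute)
  show "monoid (free_alg D)"
    by (rule monoidI) (simp_all add: keys_free_alg mult.assoc)
qed (auto simp: distrib_left distrib_right)

lemma a_minus_free_alg: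
  assumes "p \<in> carrier (free_alg D)" "q \<in> carrier (free_alg D)"
  shows "p \<ominus>\<^bsub>free_alg D\<^esub> q = p - q"
proof -
  interpret ring "free_alg D" by (rule ring_free_alg)
  have "\<ominus>\<^bsub>free_alg D\<^esub> q = - q"
    by (rule minus_equality) (use assms in \<open>auto simp: keys_uminus\<close>)
  then show ?thesis by (simp add: a_minus_def)
qed

text \<open>Identities in the free algebra thereby become identities of scalars, where the
  simplifier evaluates \<open>ext\<close> on sums and products.\<close>

lemma poly_mapping_separate:
  assumes "\<And>s. ext s p = ext s q"
  shows "p = q"
proof (rule poly_mapping_eqI)
  have *: "ext (\<lambda>z. if z = w then 1 else 0) r = Poly_Mapping.lookup r w" for r :: "'a \<Rightarrow>\<^sub>0 'b" and w
    by (simp add: ext_def if_distrib[of "\<lambda>x. _ * x"] sum.delta in_keys_iff cong: if_cong)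
  show "Poly_Mapping.lookup p w = Poly_Mapping.lookup q w" for w
    using assms[of "\<lambda>z. if z = w then 1 else 0"] by (simp add: *)
qed

text \<open>The bridge from the formal coproduct, an element of an algebra, to the list of legs on
  which all convolution computations take place.\<close>

lemma ext_free_comult:
  fixes p :: "'g letter list \<Rightarrow>\<^sub>0 'k::field"
  shows "ext F (free_comult D p) = ext (\<lambda>w. dsum (split (gg D) w) (\<lambda>u v. F (u, v))) p"
proof -
  have 1: "ext F (prod_list (map (free_comult_letter D) w)) = dsum (split (gg D) w) (\<lambda>u v. F (u, v))" for w F
  proof (induction w arbitrary: F)
    case (Cons s w)
    have pair: "(a, b) + z = (a @ fst z, b @ snd z)" for a b :: "'g letter list" and z by (cases z) simp
    have "ext F (prod_list (map (free_comult_letter D) (s # w))) =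
        ext (\<lambda>z. ext (\<lambda>z'. F (z + z')) (prod_list (map (free_comult_letter D) w))) (free_comult_letter D s)"
      by (simp add: ext_mult)
    then show ?case
      by (cases s) (simp_all add: Cons.IH dsum_map pair)
  qed (simp add: zero_prod_def)
  show ?thesis
  proof -
    have "Poly_Mapping.single ([], []) c * q = Poly_Mapping.single 0 c * q" for c and q :: "('g letter list \<times> 'g letter list) \<Rightarrow>\<^sub>0 'k"
      by (simp add: zero_prod_def)
    then show ?thesis
      unfolding free_comult_def ext_sum by (simp add: ext_mult zero_prod_def 1 ext_def[of _ p])
  qed
qed

lemma free_counit_ext:
  fixes p :: "'g letter list \<Rightarrow>\<^sub>0 'k::field"
  shows "free_counit p = ext eps p"
proof -
  have "prod_list (map free_counit_letter w) = (eps w :: 'k)" for w :: "'g letter list"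
    by (induction w) (auto split: letter.split)
  then show ?thesis by (simp add: free_counit_def ext_def)
qed

section \<open>The quotient algebras\<close>

text \<open>These are the pullbacks to words of the functionals on u(D, l, \<mu>).\<close>

definition good :: "('g, 'k::field) datum \<Rightarrow> (nat \<Rightarrow> nat \<Rightarrow> 'k) \<Rightarrow> (nat \<Rightarrow> 'k) \<Rightarrow> ('g letter list \<Rightarrow> 'k) \<Rightarrow> bool" where
  "good D l \<mu> s \<longleftrightarrow> (\<forall>p\<in>rel_ideal D l \<mu>. ext s p = 0)"

text \<open>Vanishing on the relators themselves, written as equations between values on words;
  unlike \<open>good\<close> it ignores what stands to the left and right of a relator.\<close>

definition kills :: "('g, 'k::field) datum \<Rightarrow> (nat \<Rightarrow> nat \<Rightarrow> 'k) \<Rightarrow> (nat \<Rightarrow> 'k) \<Rightarrow> ('g letter list \<Rightarrow> 'k) \<Rightarrow> bool" where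
  "kills D l \<mu> s \<longleftrightarrow>
     s [Grp \<one>\<^bsub>grp D\<^esub>] = s [] \<and>
     (\<forall>g\<in>carrier (grp D). \<forall>h\<in>carrier (grp D). s [Grp g, Grp h] = s [Grp (g \<otimes>\<^bsub>grp D\<^esub> h)]) \<and>
     (\<forall>g\<in>carrier (grp D). \<forall>i<theta D. s [Grp g, Var i] = chi D i g * s [Var i, Grp g]) \<and>
     (\<forall>i<theta D. s (replicate (NN D i) (Var i)) =
        \<mu> i * (s [] - s [Grp (gg D i [^]\<^bsub>grp D\<^esub> NN D i)])) \<and>
     (\<forall>i j. i < j \<longrightarrow> j < theta D \<longrightarrow> s [Var i, Var j] = chi D j (gg D i) * s [Var j, Var i] +
        l i j * (s [] - s [Grp (gg D i \<otimes>\<^bsub>grp D\<^esub> gg D j)]))"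

lemma kills_iff: "kills D l \<mu> s \<longleftrightarrow> (\<forall>r\<in>relators D l \<mu>. ext s r = 0)"
proof -
  have e: "ext s (mon [Grp \<one>\<^bsub>grp D\<^esub>] - 1) = s [Grp \<one>\<^bsub>grp D\<^esub>] - s []"
    "\<And>g h. ext s (mon [Grp g] * mon [Grp h] - mon [Grp (g \<otimes>\<^bsub>grp D\<^esub> h)]) =
       s [Grp g, Grp h] - s [Grp (g \<otimes>\<^bsub>grp D\<^esub> h)]"
    "\<And>g i. ext s (mon [Grp g] * mon [Var i] - const (chi D i g) * mon [Var i] * mon [Grp g]) =
       s [Grp g, Var i] - chi D i g * s [Var i, Grp g]"
    "\<And>i. ext s (mon [Var i] ^ NN D i - const (\<mu> i) * (1 - mon [Grp (gg D i [^]\<^bsub>grp D\<^esub> NN D i)])) =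
       s (replicate (NN D i) (Var i)) - \<mu> i * (s [] - s [Grp (gg D i [^]\<^bsub>grp D\<^esub> NN D i)])"
    "\<And>i j. ext s (mon [Var i] * mon [Var j] - const (chi D j (gg D i)) * mon [Var j] * mon [Var i]
        - const (l i j) * (1 - mon [Grp (gg D i \<otimes>\<^bsub>grp D\<^esub> gg D j)])) =
       s [Var i, Var j] - (chi D j (gg D i) * s [Var j, Var i] +
        l i j * (s [] - s [Grp (gg D i \<otimes>\<^bsub>grp D\<^esub> gg D j)]))"
    by (simp_all add: mon_mult mult.assoc mon_power)
  show ?thesis
  proof
    assume k: "kills D l \<mu> s"
    show "\<forall>r\<in>relators D l \<mu>. ext s r = 0"
    proof
      fix r assume "r \<in> relators D l \<mu>"
      then show "ext s r = 0"
        using k unfolding relators_def kills_def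
        by (elim UnE CollectE exE conjE singletonE; hypsubst; simp only: e right_minus_eq)
    qed
  next
    assume *: "\<forall>r\<in>relators D l \<mu>. ext s r = 0"
    show "kills D l \<mu> s"
      unfolding kills_def
    proof (intro conjI ballI allI impI)
      show "s [Grp \<one>\<^bsub>grp D\<^esub>] = s []"
        unfolding right_minus_eq[symmetric, of "s [Grp \<one>\<^bsub>grp D\<^esub>]"] e(1)[symmetric] by (rule bspec[OF *]) (unfold relators_def, blast)
      show "s [Grp g, Grp h] = s [Grp (g \<otimes>\<^bsub>grp D\<^esub> h)]" if "g \<in> carrier (grp D)" "h \<in> carrier (grp D)" for g h
        using that unfolding right_minus_eq[symmetric, of "s [Grp g, Grp h]"] e(2)[symmetric] by (intro bspec[OF *]) (unfold relators_def, blast)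
      show "s [Grp g, Var i] = chi D i g * s [Var i, Grp g]" if "g \<in> carrier (grp D)" "i < theta D" for g i
        using that unfolding right_minus_eq[symmetric, of "s [Grp g, Var i]"] e(3)[symmetric] by (intro bspec[OF *]) (unfold relators_def, blast)
      show "s (replicate (NN D i) (Var i)) = \<mu> i * (s [] - s [Grp (gg D i [^]\<^bsub>grp D\<^esub> NN D i)])" if "i < theta D" for i
        using that unfolding right_minus_eq[symmetric, of "s (replicate (NN D i) (Var i))"] e(4)[symmetric]
        by (intro bspec[OF *]) (unfold relators_def, blast)
      show "s [Var i, Var j] = chi D j (gg D i) * s [Var j, Var i] +
        l i j * (s [] - s [Grp (gg D i \<otimes>\<^bsub>grp D\<^esub> gg D j)])" if "i < j" "j < theta D" for i j
        using that unfolding right_minus_eq[symmetric, of "s [Var i, Var j]"] e(5)[symmetric]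
        by (intro bspec[OF *]) (unfold relators_def, blast)
    qed
  qed
qed

lemma group_kstar: "group (kstar :: 'k::field monoid)"
proof (rule groupI)
  show "\<exists>y\<in>carrier kstar. y \<otimes>\<^bsub>kstar\<^esub> x = \<one>\<^bsub>kstar\<^esub>" if "x \<in> carrier (kstar :: 'k monoid)" for x
    using that by (intro bexI[of _ "inverse x"]) (auto simp: kstar_def)
qed (auto simp: kstar_def)

lemma ord_kstar:
  assumes "q \<noteq> (0 :: 'k::field)"
  shows "q ^ k = 1 \<longleftrightarrow> group.ord kstar q dvd k"
proof -
  interpret K: group "kstar :: 'k monoid" by (rule group_kstar)
  have "q [^]\<^bsub>kstar\<^esub> k = q ^ k"
    by (induction k) (auto simp: kstar_def nat_pow_def)
  then show ?thesis using K.pow_eq_id[of q k] assms by (simp add: kstar_def)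
qed

locale sdatum =
  fixes D :: "('g, 'k::field_char_0) datum"
  assumes special: "special_datum D"
begin

abbreviation G :: "'g set" where "G \<equiv> carrier (grp D)"
abbreviation W :: "'g letter list set" where "W \<equiv> lists (letters D)"
abbreviation \<theta> :: nat where "\<theta> \<equiv> theta D"
abbreviation N :: "nat \<Rightarrow> nat" where "N \<equiv> NN D"
abbreviation g :: "nat \<Rightarrow> 'g" where "g \<equiv> gg D"
abbreviation \<chi> :: "nat \<Rightarrow> 'g \<Rightarrow> 'k" where "\<chi> \<equiv> chi D"

sublocale G: comm_group "grp D"
  using special by (simp add: special_datum_def)

lemma finite_G: "finite G"
  using special by (simp add: special_datum_def)

lemma g_closed [simp]: "i < \<theta> \<Longrightarrow> g i \<in> G"
  using special by (simp add: special_datum_def)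

lemma chi_hom: "i < \<theta> \<Longrightarrow> \<chi> i \<in> hom (grp D) kstar"
  using special by (simp add: special_datum_def)

lemma chi_nonzero: "i < \<theta> \<Longrightarrow> h \<in> G \<Longrightarrow> \<chi> i h \<noteq> 0"
  using chi_hom[of i] by (auto simp: hom_def kstar_def Pi_def)

lemma chi_mult: "i < \<theta> \<Longrightarrow> h \<in> G \<Longrightarrow> h' \<in> G \<Longrightarrow> \<chi> i (h \<otimes>\<^bsub>grp D\<^esub> h') = \<chi> i h * \<chi> i h'"
  using chi_hom[of i] by (simp add: hom_mult kstar_def)

lemma chi_one: "i < \<theta> \<Longrightarrow> \<chi> i \<one>\<^bsub>grp D\<^esub> = 1"
  using chi_mult[of i "\<one>\<^bsub>grp D\<^esub>" "\<one>\<^bsub>grp D\<^esub>"] chi_nonzero[of i "\<one>\<^bsub>grp D\<^esub>"] by simp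

lemma chi_pow: "i < \<theta> \<Longrightarrow> h \<in> G \<Longrightarrow> \<chi> i (h [^]\<^bsub>grp D\<^esub> (n :: nat)) = \<chi> i h ^ n"
  by (induction n) (auto simp: chi_one chi_mult)

lemma chi_braid: "i < \<theta> \<Longrightarrow> j < \<theta> \<Longrightarrow> i \<noteq> j \<Longrightarrow> \<chi> i (g j) * \<chi> j (g i) = 1"
  using special by (simp add: special_datum_def)

lemma chi_power_eq_1: "i < \<theta> \<Longrightarrow> \<chi> i (g i) ^ k = 1 \<longleftrightarrow> N i dvd k"
  using ord_kstar[of "\<chi> i (g i)" k] chi_nonzero[of i "g i"] by (simp add: NN_def)

lemma q_neq_1: "i < \<theta> \<Longrightarrow> \<chi> i (g i) \<noteq> 1"
  using special by (simp add: special_datum_def)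

text \<open>Oddness excludes 2. Both the uniqueness of linking partners and the triviality of the
  root vector functionals in degree 2 rest on this bound.\<close>

lemma N_ge: "i < \<theta> \<Longrightarrow> 3 \<le> N i"
proof -
  assume i: "i < \<theta>"
  have "odd (N i)" using i special by (simp add: special_datum_def)
  moreover have "N i \<noteq> 1" using chi_power_eq_1[OF i, of 1] q_neq_1[OF i] by auto
  moreover have "N i \<noteq> 0" "N i \<noteq> 2" using \<open>odd (N i)\<close> by (intro notI; simp)+
  ultimately show "3 \<le> N i" by linarith
qed

lemma letters_iff [simp]: "Grp h \<in> letters D \<longleftrightarrow> h \<in> G" "Var i \<in> letters D \<longleftrightarrow> i < \<theta>"
  by (auto simp: letters_def)

lemma split_W: "(u, v) \<in> set (split g w) \<Longrightarrow> w \<in> W \<Longrightarrow> u \<in> W \<and> v \<in> W"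
  unfolding letters_def by (rule split_letters) auto

lemma keys_single_W: "w \<in> W \<Longrightarrow> Poly_Mapping.keys (Poly_Mapping.single w c) \<subseteq> W"
  by auto

lemma keys_one_W: "Poly_Mapping.keys (1 :: 'g letter list \<Rightarrow>\<^sub>0 'k) \<subseteq> W"
  by simp

lemma relators_carrier: "r \<in> relators D l \<mu> \<Longrightarrow> Poly_Mapping.keys r \<subseteq> W"
  unfolding relators_def mon_power
  by (elim UnE CollectE exE conjE singletonE; hypsubst; intro keys_free_alg keys_single_W keys_one_W)
    (auto simp: in_lists_conv_set)

lemma ideal_rel: "ideal (rel_ideal D l \<mu>) (free_alg D)"
  unfolding rel_ideal_def
  by (rule ring.genideal_ideal[OF ring_free_alg]) (use relators_carrier in auto)

lemma rel_ideal_gen: "relators D l \<mu> \<subseteq> rel_ideal D l \<mu>"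
  unfolding rel_ideal_def by (rule ring.genideal_self[OF ring_free_alg]) (use relators_carrier in auto)

lemma rel_ideal_keys: "p \<in> rel_ideal D l \<mu> \<Longrightarrow> Poly_Mapping.keys p \<subseteq> W"
  using ideal.Icarr[OF ideal_rel] by simp

lemma rel_ideal_closed:
  assumes "p \<in> rel_ideal D l \<mu>"
  shows "q \<in> rel_ideal D l \<mu> \<Longrightarrow> p + q \<in> rel_ideal D l \<mu>"
    and "Poly_Mapping.keys r \<subseteq> W \<Longrightarrow> r * p \<in> rel_ideal D l \<mu>"
    and "Poly_Mapping.keys r \<subseteq> W \<Longrightarrow> p * r \<in> rel_ideal D l \<mu>"
    and "- p \<in> rel_ideal D l \<mu>"
    and "const c * p \<in> rel_ideal D l \<mu>"
    and "q \<in> rel_ideal D l \<mu> \<Longrightarrow> p - q \<in> rel_ideal D l \<mu>"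
proof -
  interpret I: ideal "rel_ideal D l \<mu>" "free_alg D" by (rule ideal_rel)
  have l: "r * p \<in> rel_ideal D l \<mu>" if "p \<in> rel_ideal D l \<mu>" "Poly_Mapping.keys r \<subseteq> W" for r p
    using I.I_l_closed[of p r] that by simp
  have c: "const c * p \<in> rel_ideal D l \<mu>" if "p \<in> rel_ideal D l \<mu>" for c p
    using l[OF that, of "const c"] by (auto split: if_splits)
  have neg: "- p \<in> rel_ideal D l \<mu>" if "p \<in> rel_ideal D l \<mu>" for p
    using c[OF that, of "- 1"] by (simp add: single_uminus)
  show add: "p + q \<in> rel_ideal D l \<mu>" if "q \<in> rel_ideal D l \<mu>"
    using additive_subgroup.a_closed[OF I.additive_subgroup_axioms assms that] by simp
  show "p - q \<in> rel_ideal D l \<mu>" if "q \<in> rel_ideal D l \<mu>"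
    using additive_subgroup.a_closed[OF I.additive_subgroup_axioms assms neg[OF that]] by simp
  show "p * r \<in> rel_ideal D l \<mu>" if "Poly_Mapping.keys r \<subseteq> W"
    using I.I_r_closed[OF assms, of r] that by simp
  show "Poly_Mapping.keys r \<subseteq> W \<Longrightarrow> r * p \<in> rel_ideal D l \<mu>" by (rule l[OF assms])
  show "- p \<in> rel_ideal D l \<mu>" "const c * p \<in> rel_ideal D l \<mu>" by (rule neg[OF assms], rule c[OF assms])
qed

lemma ext_mon_mult:
  assumes "Poly_Mapping.keys p \<subseteq> W"
  shows "ext f (mon u * p * mon v) = ext (\<lambda>w. f (u @ w @ v)) p"
  by (simp add: ext_mult)

lemma good_translate:
  assumes "good D l \<mu> s" "u \<in> W" "v \<in> W"
  shows "good D l \<mu> (\<lambda>w. s (u @ w @ v))"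
  unfolding good_def
proof
  fix p assume p: "p \<in> rel_ideal D l \<mu>"
  have "mon u * p * mon v \<in> rel_ideal D l \<mu>"
    using assms by (intro rel_ideal_closed(2,3) p keys_single_W)
  then show "ext (\<lambda>w. s (u @ w @ v)) p = 0"
    using assms(1) by (simp add: good_def ext_mon_mult[OF rel_ideal_keys[OF p], symmetric])
qed

lemma good_kills: "good D l \<mu> s \<Longrightarrow> kills D l \<mu> s"
  unfolding kills_iff good_def using rel_ideal_gen by blast

text \<open>The elements annihilated by all two-sided translates of s form an ideal; if that ideal
  contains the relators, it contains the ideal of relations.\<close>

lemma goodI:
  assumes "\<And>u v. u \<in> W \<Longrightarrow> v \<in> W \<Longrightarrow> kills D l \<mu> (\<lambda>w. s (u @ w @ v))"
  shows "good D l \<mu> s"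
proof -
  let ?J = "{p. Poly_Mapping.keys p \<subseteq> W \<and> (\<forall>u\<in>W. \<forall>v\<in>W. ext (\<lambda>w. s (u @ w @ v)) p = 0)}"
  have "ideal ?J (free_alg D)"
  proof (rule idealI[OF ring_free_alg])
    show "subgroup ?J (add_monoid (free_alg D))"
    proof
      fix p assume p: "p \<in> ?J"
      interpret F: ring "free_alg D" by (rule ring_free_alg)
      have "\<ominus>\<^bsub>free_alg D\<^esub> p = - p"
        by (rule F.minus_equality) (use p in \<open>auto simp: keys_uminus\<close>)
      then have "inv\<^bsub>add_monoid (free_alg D)\<^esub> p = - p" by (simp add: a_inv_def)
      then show "inv\<^bsub>add_monoid (free_alg D)\<^esub> p \<in> ?J" using p by (simp add: keys_uminus)
    next
      fix p q assume "p \<in> ?J" "q \<in> ?J"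
      then have "p + q \<in> ?J" by (simp add: keys_free_alg)
      then show "p \<otimes>\<^bsub>add_monoid (free_alg D)\<^esub> q \<in> ?J" by simp
    qed auto
  next
    fix p x assume p: "p \<in> ?J" and x: "x \<in> carrier (free_alg D)"
    have "ext (\<lambda>w. s (u @ w @ v)) (x * p) = ext (\<lambda>a. 0) x" if "u \<in> W" "v \<in> W" for u v
      unfolding ext_mult
    proof (rule ext_cong)
      fix a assume "a \<in> Poly_Mapping.keys x"
      then have "u @ a \<in> W" using x that by auto
      then have "ext (\<lambda>b. s ((u @ a) @ b @ v)) p = 0" using p that by blast
      then show "ext (\<lambda>b. s (u @ (a + b) @ v)) p = 0" by simp
    qed
    moreover have "ext (\<lambda>w. s (u @ w @ v)) (p * x) = ext (\<lambda>a. 0) x" if "u \<in> W" "v \<in> W" for u v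
      unfolding ext_mult ext_swap[of _ x p]
    proof (rule ext_cong)
      fix a assume "a \<in> Poly_Mapping.keys x"
      then have "a @ v \<in> W" using x that by auto
      then have "ext (\<lambda>b. s (u @ b @ a @ v)) p = 0" using p that by blast
      then show "ext (\<lambda>b. s (u @ (b + a) @ v)) p = 0" by simp
    qed
    ultimately have "x * p \<in> ?J" "p * x \<in> ?J" using p x by (auto simp only: mem_Collect_eq ext_fun keys_free_alg free_alg_simps)
    then show "x \<otimes>\<^bsub>free_alg D\<^esub> p \<in> ?J" "p \<otimes>\<^bsub>free_alg D\<^esub> x \<in> ?J" by simp_all
  qed
  moreover have "relators D l \<mu> \<subseteq> ?J"
    using assms relators_carrier unfolding kills_iff by blast
  ultimately have "rel_ideal D l \<mu> \<subseteq> ?J"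
    unfolding rel_ideal_def by (rule ring.genideal_minimal[OF ring_free_alg])
  then have "\<forall>p\<in>rel_ideal D l \<mu>. ext (\<lambda>w. s ([] @ w @ [])) p = 0" by blast
  then show ?thesis by (simp add: good_def)
qed

lemma good_linear:
  "good D l \<mu> (\<lambda>w. 0)"
  "good D l \<mu> s \<Longrightarrow> good D l \<mu> s' \<Longrightarrow> good D l \<mu> (\<lambda>w. s w + s' w)"
  "good D l \<mu> s \<Longrightarrow> good D l \<mu> s' \<Longrightarrow> good D l \<mu> (\<lambda>w. s w - s' w)"
  "good D l \<mu> s \<Longrightarrow> good D l \<mu> (\<lambda>w. c * s w)"
  "good D l \<mu> s \<Longrightarrow> good D l \<mu> (\<lambda>w. s w * c)"
  "(\<And>i. i \<in> I \<Longrightarrow> good D l \<mu> (F i)) \<Longrightarrow> good D l \<mu> (\<lambda>w. \<Sum>i\<in>I. F i w)"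
  by (auto simp: good_def ext_fun intro!: sum.neutral)

lemma good_dsum:
  "(\<And>x y. (x, y) \<in> set xs \<Longrightarrow> good D l \<mu> (\<lambda>w. F w x y)) \<Longrightarrow> good D l \<mu> (\<lambda>w. dsum xs (F w))"
  by (induction xs) (auto intro!: good_linear)

lemma good_cong_W:
  assumes "good D l \<mu> s" "\<And>w. w \<in> W \<Longrightarrow> s w = s' w"
  shows "good D l \<mu> s'"
  unfolding good_def
proof
  fix p assume p: "p \<in> rel_ideal D l \<mu>"
  have "ext s' p = ext s p" using rel_ideal_keys[OF p] assms(2) by (intro ext_cong) (metis subsetD)
  then show "ext s' p = 0" using assms(1) p by (simp add: good_def)
qed

lemma kills_dsum:
  "(\<And>x y. (x, y) \<in> set xs \<Longrightarrow> kills D l \<mu> (\<lambda>w. F w x y)) \<Longrightarrow> kills D l \<mu> (\<lambda>w. dsum xs (F w))"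
  unfolding kills_iff ext_dsum by (auto intro!: trans[OF dsum_cong dsum_zero])

abbreviation good0 :: "('g letter list \<Rightarrow> 'k) \<Rightarrow> bool" where
  "good0 \<equiv> good D (\<lambda>_ _. 0) (\<lambda>_. 0)"

lemma good0_rules:
  assumes "good0 s" "u \<in> W" "v \<in> W"
  shows "s (u @ [Grp \<one>\<^bsub>grp D\<^esub>] @ v) = s (u @ v)"
    and "h \<in> G \<Longrightarrow> k \<in> G \<Longrightarrow> s (u @ [Grp h, Grp k] @ v) = s (u @ [Grp (h \<otimes>\<^bsub>grp D\<^esub> k)] @ v)"
    and "h \<in> G \<Longrightarrow> i < \<theta> \<Longrightarrow> s (u @ [Grp h, Var i] @ v) = \<chi> i h * s (u @ [Var i, Grp h] @ v)"
    and "i < \<theta> \<Longrightarrow> s (u @ replicate (N i) (Var i) @ v) = 0"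
    and "i < j \<Longrightarrow> j < \<theta> \<Longrightarrow> s (u @ [Var i, Var j] @ v) = \<chi> j (g i) * s (u @ [Var j, Var i] @ v)"
  using good_kills[OF good_translate[OF assms]] unfolding kills_def by auto

lemma good0_swap:
  assumes "good0 s" "u \<in> W" "v \<in> W" "h \<in> G" "k \<in> G"
  shows "s (u @ [Grp h, Grp k] @ v) = s (u @ [Grp k, Grp h] @ v)"
  using good0_rules(2)[OF assms(1-3)] assms(4,5) by (simp add: G.m_comm)

lemma good0_Grp_Vars:
  assumes "good0 s" "u \<in> W" "v \<in> W" "h \<in> G" "i < \<theta>"
  shows "s (u @ Grp h # replicate n (Var i) @ v) = \<chi> i h ^ n * s (u @ replicate n (Var i) @ Grp h # v)"
  using assms(2)
proof (induction n arbitrary: u)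
  case (Suc n)
  have r: "replicate n (Var i) \<in> W" using assms(5) by (auto simp: in_lists_conv_set)
  have "s (u @ Grp h # replicate (Suc n) (Var i) @ v) = \<chi> i h * s ((u @ [Var i]) @ Grp h # replicate n (Var i) @ v)"
    using good0_rules(3)[OF assms(1) Suc.prems, of "replicate n (Var i) @ v" h i] assms r by simp
  then show ?case using Suc.IH[of "u @ [Var i]"] Suc.prems assms by simp
qed simp

text \<open>The coproduct of \<open>x\<^sub>i\<^sup>n\<close> by the \<open>q\<close>-binomial formula; the quotient is a coalgebra because the inner
  \<open>q\<close>-binomial coefficients vanish for \<open>n = N\<^sub>i\<close>.\<close>

lemma conv_replicate_Var:
  assumes "good0 s" "good0 s'" "i < \<theta>"
  shows "(s \<diamondop>\<^bsub>g\<^esub> s') (replicate n (Var i)) =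
    (\<Sum>k\<le>n. q_binom (\<chi> i (g i)) k (n - k) *
        (s (replicate k (Var i) @ replicate (n - k) (Grp (g i))) * s' (replicate (n - k) (Var i))))"
  using assms(1,2)
proof (induction n arbitrary: s s')
  case (Suc n)
  let ?q = "\<chi> i (g i)" and ?x = "Var i" and ?g = "Grp (g i)"
  let ?t = "\<lambda>a b. s (replicate a ?x @ replicate b ?g) * s' (replicate b ?x)"
  have W: "[?x] \<in> W" "[?g] \<in> W" "[] \<in> W" using assms(3) by auto
  have good: "good0 (\<lambda>w. s (?x # w))" "good0 (\<lambda>w. s (?g # w))" "good0 (\<lambda>w. s' (?x # w))"
    using good_translate[OF Suc.prems(1) W(1,3)] good_translate[OF Suc.prems(1) W(2,3)]
      good_translate[OF Suc.prems(2) W(1,3)] by simp_all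
  have gx: "s (?g # replicate k ?x @ replicate b ?g) = ?q ^ k * s (replicate k ?x @ replicate (Suc b) ?g)" for k b
    using good0_Grp_Vars[OF Suc.prems(1) W(3), of "replicate b ?g" "g i" i k] assms(3) by (auto simp: in_lists_conv_set)
  have "(s \<diamondop>\<^bsub>g\<^esub> s') (replicate (Suc n) ?x) =
    (\<Sum>k\<le>n. q_binom ?q k (n - k) * ?t (Suc k) (n - k)) + (\<Sum>k\<le>n. ?q ^ k * q_binom ?q k (n - k) * ?t k (Suc (n - k)))"
    by (simp add: Suc.IH[OF good(1) Suc.prems(2)] Suc.IH[OF good(2,3)] gx mult_ac)
  also have "(\<Sum>k\<le>n. ?q ^ k * q_binom ?q k (n - k) * ?t k (Suc (n - k))) =
     ?t 0 (Suc n) + (\<Sum>k<n. ?q ^ Suc k * q_binom ?q (Suc k) (n - Suc k) * ?t (Suc k) (n - k))"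
  proof -
    have "(\<Sum>k\<le>n. ?q ^ k * q_binom ?q k (n - k) * ?t k (Suc (n - k))) =
       (\<Sum>k<Suc n. ?q ^ k * q_binom ?q k (n - k) * ?t k (Suc (n - k)))" by (simp add: lessThan_Suc_atMost)
    also have "\<dots> = ?t 0 (Suc n) + (\<Sum>k<n. ?q ^ Suc k * q_binom ?q (Suc k) (n - Suc k) * ?t (Suc k) (Suc (n - Suc k)))"
      by (subst sum.lessThan_Suc_shift) simp
    also have "(\<Sum>k<n. ?q ^ Suc k * q_binom ?q (Suc k) (n - Suc k) * ?t (Suc k) (Suc (n - Suc k))) =
       (\<Sum>k<n. ?q ^ Suc k * q_binom ?q (Suc k) (n - Suc k) * ?t (Suc k) (n - k))"
      by (intro sum.cong refl) (simp add: Suc_diff_Suc del: power_Suc)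
    finally show ?thesis .
  qed
  also have "(\<Sum>k\<le>n. q_binom ?q k (n - k) * ?t (Suc k) (n - k)) =
     ?t (Suc n) 0 + (\<Sum>k<n. q_binom ?q k (n - k) * ?t (Suc k) (n - k))"
    by (simp add: lessThan_Suc_atMost[symmetric])
  finally have "(s \<diamondop>\<^bsub>g\<^esub> s') (replicate (Suc n) ?x) = ?t (Suc n) 0 + ?t 0 (Suc n) +
     (\<Sum>k<n. (q_binom ?q k (n - k) + ?q ^ Suc k * q_binom ?q (Suc k) (n - Suc k)) * ?t (Suc k) (n - k))"
    by (simp add: distrib_right sum.distrib del: power_Suc replicate_Suc)
  also have "(\<Sum>k<n. (q_binom ?q k (n - k) + ?q ^ Suc k * q_binom ?q (Suc k) (n - Suc k)) * ?t (Suc k) (n - k)) =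
     (\<Sum>k<n. q_binom ?q (Suc k) (n - k) * ?t (Suc k) (n - k))"
  proof (intro sum.cong refl)
    fix k assume "k \<in> {..<n}"
    then obtain b where b: "n - k = Suc b" "n - Suc k = b" by (metis Suc_diff_Suc lessThan_iff)
    show "(q_binom ?q k (n - k) + ?q ^ Suc k * q_binom ?q (Suc k) (n - Suc k)) * ?t (Suc k) (n - k) =
       q_binom ?q (Suc k) (n - k) * ?t (Suc k) (n - k)"
      unfolding b by simp
  qed
  also have "?t (Suc n) 0 + ?t 0 (Suc n) + (\<Sum>k<n. q_binom ?q (Suc k) (n - k) * ?t (Suc k) (n - k)) =
     (\<Sum>k\<le>Suc n. q_binom ?q k (Suc n - k) * ?t k (Suc n - k))"
  proof -
    have "(\<Sum>k\<le>Suc n. q_binom ?q k (Suc n - k) * ?t k (Suc n - k)) =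
      (\<Sum>k<Suc n. q_binom ?q k (Suc n - k) * ?t k (Suc n - k)) + ?t (Suc n) 0"
      by (simp add: lessThan_Suc_atMost[symmetric] del: replicate_Suc)
    also have "(\<Sum>k<Suc n. q_binom ?q k (Suc n - k) * ?t k (Suc n - k)) =
      ?t 0 (Suc n) + (\<Sum>k<n. q_binom ?q (Suc k) (n - k) * ?t (Suc k) (n - k))"
      by (subst sum.lessThan_Suc_shift) (simp del: replicate_Suc)
    finally show ?thesis by (simp del: replicate_Suc)
  qed
  finally show ?case .
qed simp

text \<open>The relators generate a coideal. For x_i^N_i the inner Gaussian binomials vanish and the
  two outer terms are killed by s and s'; for the commutators the mixed terms cancel by the
  braiding.\<close>

lemma kills_conv:
  assumes s: "good0 s" and s': "good0 s'"
  shows "kills D (\<lambda>_ _. 0) (\<lambda>_. 0) (s \<diamondop>\<^bsub>g\<^esub> s')"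
  unfolding kills_def
proof (intro conjI ballI allI impI)
  have W: "[] \<in> W" by simp
  note R = good0_rules[OF s W W, simplified] and R' = good0_rules[OF s' W W, simplified]
  show "(s \<diamondop>\<^bsub>g\<^esub> s') [Grp \<one>\<^bsub>grp D\<^esub>] = (s \<diamondop>\<^bsub>g\<^esub> s') []"
    by (simp add: R R')
  show "(s \<diamondop>\<^bsub>g\<^esub> s') [Grp h, Grp k] = (s \<diamondop>\<^bsub>g\<^esub> s') [Grp (h \<otimes>\<^bsub>grp D\<^esub> k)]" if "h \<in> G" "k \<in> G" for h k
    using that by (simp add: R(2) R'(2))
  show "(s \<diamondop>\<^bsub>g\<^esub> s') [Grp h, Var i] = \<chi> i h * (s \<diamondop>\<^bsub>g\<^esub> s') [Var i, Grp h]" if "h \<in> G" "i < \<theta>" for h i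
    using that good0_swap[OF s W W, of h "g i"] R(3)[of h i] R'(3)[of h i] by (simp add: algebra_simps)
  show "(s \<diamondop>\<^bsub>g\<^esub> s') (replicate (N i) (Var i)) =
      0 * ((s \<diamondop>\<^bsub>g\<^esub> s') [] - (s \<diamondop>\<^bsub>g\<^esub> s') [Grp (g i [^]\<^bsub>grp D\<^esub> N i)])" if i: "i < \<theta>" for i
  proof -
    have z: "q_binom (\<chi> i (g i)) k (N i - k) *
        (s (replicate k (Var i) @ replicate (N i - k) (Grp (g i))) * s' (replicate (N i - k) (Var i))) = 0"
      if k: "k \<le> N i" for k
    proof -
      consider "k = 0" | "k = N i" | "0 < k" "k < N i" using k by (cases "k = 0"; cases "k = N i") auto
      then show ?thesis
      proof cases
        case 3
        have "q_binom (\<chi> i (g i)) k (N i - k) = 0"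
          by (rule q_binom_zero[where n = "N i"])
            (use 3 i in \<open>auto simp: q_neq_1 chi_power_eq_1 dest: dvd_imp_le\<close>)
        then show ?thesis by simp
      qed (use i R(4) R'(4) in auto)
    qed
    show ?thesis unfolding conv_replicate_Var[OF s s' i] mult_zero_left by (intro sum.neutral ballI z) simp
  qed
  show "(s \<diamondop>\<^bsub>g\<^esub> s') [Var i, Var j] = \<chi> j (g i) * (s \<diamondop>\<^bsub>g\<^esub> s') [Var j, Var i] +
       0 * ((s \<diamondop>\<^bsub>g\<^esub> s') [] - (s \<diamondop>\<^bsub>g\<^esub> s') [Grp (g i \<otimes>\<^bsub>grp D\<^esub> g j)])" if "i < j" "j < \<theta>" for i j
  proof -
    \<comment> \<open>The braiding in the form needed to cancel the mixed terms, where one of the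
      two letters lies in each leg.\<close>
    have br: "\<chi> j (g i) * (\<chi> i (g j) * x) = x" for x
      using chi_braid[of j i] that by (simp flip: mult.assoc)
    show ?thesis
      using that good0_swap[OF s W W, of "g i" "g j"] R(3)[of "g i" j] R(3)[of "g j" i] R(5) R'(5)
      by (simp add: distrib_left mult.assoc br)
  qed
qed

text \<open>A translate of a convolution is a sum of convolutions of translates, so
  \<open>kills_conv\<close> covers every context.\<close>

lemma good0_conv:
  assumes s: "good0 s" and s': "good0 s'"
  shows "good0 (s \<diamondop>\<^bsub>g\<^esub> s')"
proof (rule goodI)
  fix u v assume uv: "u \<in> W" "v \<in> W"
  have *: "(s \<diamondop>\<^bsub>g\<^esub> s') (u @ w @ v) = dsum (split g u) (\<lambda>u1 u2. dsum (split g v) (\<lambda>v1 v2.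
      ((\<lambda>w. s (u1 @ w @ v1)) \<diamondop>\<^bsub>g\<^esub> (\<lambda>w. s' (u2 @ w @ v2))) w))" for w
    unfolding conv_def dsum_split_append by (rule dsum_cong, rule dsum_swap)
  show "kills D (\<lambda>_ _. 0) (\<lambda>_. 0) (\<lambda>w. (s \<diamondop>\<^bsub>g\<^esub> s') (u @ w @ v))"
    unfolding *
  proof (intro kills_dsum)
    fix u1 u2 v1 v2 assume "(u1, u2) \<in> set (split g u)" "(v1, v2) \<in> set (split g v)"
    then show "kills D (\<lambda>_ _. 0) (\<lambda>_. 0) (\<lambda>w. ((\<lambda>w. s (u1 @ w @ v1)) \<diamondop>\<^bsub>g\<^esub> (\<lambda>w. s' (u2 @ w @ v2))) w)"
      using split_W uv by (intro kills_conv good_translate s s') blast+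
  qed
qed

end

section \<open>Normal forms\<close>

text \<open>P is 1 in degree 0. Any term in which P sees a variable evaluates s in degree below n,
  where it is zero; convolution with P therefore changes only lower-order information.\<close>

lemma conv_lead_right:
  assumes "\<And>w. deg w < n \<Longrightarrow> s w = 0" "\<And>h w. P (Grp h # w) = P w" "P [] = 1" "deg w \<le> n"
  shows "(s \<diamondop>\<^bsub>g\<^esub> P) w = s w"
  using assms(1,4)
proof (induction w arbitrary: s n)
  case (Cons x w)
  show ?case
  proof (cases x)
    case (Grp h)
    then show ?thesis using Cons.IH[of n "\<lambda>w. s (Grp h # w)"] Cons.prems by (simp add: assms(2))
  next
    case (Var i)
    then obtain m where n: "n = Suc m" "deg w \<le> m" using Cons.prems(2) by (cases n) auto
    have "((\<lambda>u. s (Grp (g i) # u)) \<diamondop>\<^bsub>g\<^esub> (\<lambda>u. P (Var i # u))) w = ((\<lambda>u. 0) \<diamondop>\<^bsub>g\<^esub> (\<lambda>u. P (Var i # u))) w"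
      using n by (intro conv_cong refl Cons.prems) (auto dest!: split_deg)
    then show ?thesis using Cons.IH[of m "\<lambda>w. s (Var i # w)"] Cons.prems n by (simp add: Var conv_linear)
  qed
qed (simp add: assms(3))

lemma conv_lead_left:
  assumes "\<And>w. deg w < n \<Longrightarrow> s w = 0" "\<And>h w. Q (Grp h # w) = Q w" "Q [] = 1" "deg w \<le> n"
  shows "(Q \<diamondop>\<^bsub>g\<^esub> s) w = s w"
  using assms(1,4)
proof (induction w arbitrary: s n)
  case (Cons x w)
  show ?case
  proof (cases x)
    case (Grp h)
    then show ?thesis using Cons.IH[of n "\<lambda>w. s (Grp h # w)"] Cons.prems by (simp add: assms(2))
  next
    case (Var i)
    then obtain m where n: "n = Suc m" "deg w \<le> m" using Cons.prems(2) by (cases n) auto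
    have "((\<lambda>u. Q (Var i # u)) \<diamondop>\<^bsub>g\<^esub> s) w = ((\<lambda>u. Q (Var i # u)) \<diamondop>\<^bsub>g\<^esub> (\<lambda>u. 0)) w"
      using n by (intro conv_cong refl Cons.prems) (auto dest!: split_deg)
    then show ?thesis using Cons.IH[of m "\<lambda>w. s (Var i # w)"] Cons.prems n by (simp add: Var conv_linear assms(2))
  qed
qed (simp add: assms(3))

section \<open>Sorting a word: exponents, group part and scalar\<close>

abbreviation occ :: "'g letter list \<Rightarrow> nat \<Rightarrow> nat" where
  "occ w \<equiv> (\<lambda>i. count_list w (Var i))"

primrec gprod :: "('g, 'k) datum \<Rightarrow> 'g letter list \<Rightarrow> 'g" where
  "gprod D [] = \<one>\<^bsub>grp D\<^esub>"
| "gprod D (s # w) = (case s of Grp h \<Rightarrow> h \<otimes>\<^bsub>grp D\<^esub> gprod D w | Var i \<Rightarrow> gprod D w)"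

text \<open>The scalar picked up in u(D,0,0) when a word is sorted into PBW order: a group letter
  passes all later variables, and x_i passes the later x_k with k < i.\<close>

primrec coef :: "('g, 'k::field) datum \<Rightarrow> 'g letter list \<Rightarrow> 'k" where
  "coef D [] = 1"
| "coef D (s # w) = (case s of
     Grp h \<Rightarrow> (\<Prod>k<theta D. chi D k h ^ occ w k) * coef D w
   | Var i \<Rightarrow> (\<Prod>k<i. chi D k (gg D i) ^ occ w k) * coef D w)"

text \<open>The functional with values v on PBW monomials, defined on all words through their sorted
  form; that it respects the relations is the content of \<open>good0_pbw_fun\<close>.\<close>

definition pbw_fun :: "('g, 'k::field) datum \<Rightarrow> ((nat \<Rightarrow> nat) \<Rightarrow> 'g \<Rightarrow> 'k) \<Rightarrow> 'g letter list \<Rightarrow> 'k" where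
  "pbw_fun D v w = coef D w * v (occ w) (gprod D w)"

definition overflow :: "('g, 'k::field) datum \<Rightarrow> (nat \<Rightarrow> nat) \<Rightarrow> bool" where
  "overflow D a \<longleftrightarrow> (\<exists>i<theta D. NN D i \<le> a i)"

definition var_word :: "nat \<Rightarrow> nat \<Rightarrow> (nat \<Rightarrow> nat) \<Rightarrow> 'g letter list" where
  "var_word m n a = concat (map (\<lambda>i. replicate (a i) (Var i)) [m..<n])"

definition pbw_word :: "('g, 'k) datum \<Rightarrow> (nat \<Rightarrow> nat) \<Rightarrow> 'g \<Rightarrow> 'g letter list" where
  "pbw_word D a h = var_word 0 (theta D) a @ [Grp h]"

lemma var_word_split: "m \<le> i \<Longrightarrow> i \<le> n \<Longrightarrow> var_word m n a = var_word m i a @ var_word i n a"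
  using upt_add_eq_append[of m i "n - i"] by (simp add: var_word_def)

lemma var_word_Cons: "m < n \<Longrightarrow> var_word m n a = replicate (a m) (Var m) @ var_word (Suc m) n a"
  by (simp add: var_word_def upt_conv_Cons)

lemma var_word_cong: "(\<And>i. m \<le> i \<Longrightarrow> i < n \<Longrightarrow> a i = b i) \<Longrightarrow> var_word m n a = var_word m n b"
  unfolding var_word_def by (intro arg_cong[where f = concat] map_cong) auto

lemma var_word_zero: "var_word m n (\<lambda>_. 0) = []"
  by (simp add: var_word_def)

lemma count_var_word: "count_list (var_word m n a) (Var i) = (if m \<le> i \<and> i < n then a i else 0)"
proof (induction n)
  case 0 show ?case by (simp add: var_word_def)
next
  case (Suc n)
  have r: "count_list (replicate c (Var n :: 'a letter)) (Var i) = (if i = n then c else 0)" for c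
    by (induction c) auto
  show ?case
  proof (cases "m \<le> n")
    case True
    then have "var_word m (Suc n) a = var_word m n a @ (replicate (a n) (Var n) :: 'a letter list)"
      by (simp add: var_word_def)
    then show ?thesis using Suc True by (auto simp: r)
  qed (simp add: var_word_def)
qed

lemma set_var_word: "set (var_word m n a) \<subseteq> Var ` {m..<n}"
  by (auto simp: var_word_def)

lemma deg_replicate_Var [simp]: "deg (replicate n (Var i)) = n"
  by (induction n) auto

lemma deg_Vars: "set w \<subseteq> Var ` A \<Longrightarrow> deg w = length w"
  by (induction w) auto

context sdatum
begin

lemma gprod_closed [simp]: "w \<in> W \<Longrightarrow> gprod D w \<in> G"
  by (induction w) (auto split: letter.split)

lemma var_word_W: "n \<le> \<theta> \<Longrightarrow> var_word m n a \<in> W"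
  by (auto simp: var_word_def in_lists_conv_set)

lemma pbw_word_W [simp]: "h \<in> G \<Longrightarrow> pbw_word D a h \<in> W"
  by (simp add: pbw_word_def var_word_W)

text \<open>Reading a letter changes only the prescribed values. Vanishing on overflowing exponents
  persists, because exponents can only grow.\<close>

lemma pbw_fun_Cons:
  assumes "\<And>a h. overflow D a \<Longrightarrow> v a h = 0" "s \<in> letters D"
  obtains v' where "\<And>a h. overflow D a \<Longrightarrow> v' a h = 0" "\<And>w. w \<in> W \<Longrightarrow> pbw_fun D v (s # w) = pbw_fun D v' w"
proof (cases s)
  case (Grp h)
  show ?thesis
    by (rule that[of "\<lambda>a k. (\<Prod>i<\<theta>. \<chi> i h ^ a i) * v a (h \<otimes>\<^bsub>grp D\<^esub> k)"])
      (use assms in \<open>auto simp: Grp pbw_fun_def\<close>)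
next
  case (Var i)
  have occ: "occ (Var i # w) = (occ w)(i := Suc (occ w i))" for w :: "'g letter list" by auto
  have "overflow D (a(i := Suc (a i)))" if "overflow D a" for a
    using that unfolding overflow_def by (auto intro: le_SucI)
  then show ?thesis
    by (intro that[of "\<lambda>a k. (\<Prod>k<i. \<chi> k (g i) ^ a k) * v (a(i := Suc (a i))) k"])
      (use assms in \<open>auto simp: Var pbw_fun_def occ simp del: count_list.simps\<close>)
qed

lemma pbw_fun_prefix:
  assumes "\<And>a h. overflow D a \<Longrightarrow> v a h = 0" "u \<in> W"
  shows "\<exists>v'. (\<forall>a h. overflow D a \<longrightarrow> v' a h = 0) \<and> (\<forall>w\<in>W. pbw_fun D v (u @ w) = pbw_fun D v' w)"
  using assms
proof (induction u arbitrary: v)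
  case (Cons s u)
  obtain v1 where v1: "\<And>a h. overflow D a \<Longrightarrow> v1 a h = 0" "\<And>w. w \<in> W \<Longrightarrow> pbw_fun D v (s # w) = pbw_fun D v1 w"
    using pbw_fun_Cons[of v s] Cons.prems by auto
  obtain v2 where v2: "\<forall>a h. overflow D a \<longrightarrow> v2 a h = 0" "\<forall>w\<in>W. pbw_fun D v1 (u @ w) = pbw_fun D v2 w"
    using Cons.IH[of v1] Cons.prems v1 by auto
  have "pbw_fun D v ((s # u) @ w) = pbw_fun D v2 w" if "w \<in> W" for w
    using v1(2)[of "u @ w"] v2(2) Cons.prems that by simp
  then show ?case using v2(1) by blast
next
  case (Nil v)
  then show ?case by (intro exI[of _ v]) simp
qed

lemma kills_cong_W:
  assumes "kills D l \<mu> s" "\<And>w. w \<in> W \<Longrightarrow> s' w = s w"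
  shows "kills D l \<mu> s'"
  unfolding kills_iff
proof
  fix r assume r: "r \<in> relators D l \<mu>"
  have "ext s' r = ext s r"
    by (rule ext_cong) (use relators_carrier[OF r] assms(2) in blast)
  then show "ext s' r = 0" using assms(1) r by (simp add: kills_iff)
qed

text \<open>The independence half of the PBW theorem for u(D,0,0): values on PBW monomials may be
  prescribed freely. The left context is absorbed into v, so each relator needs checking only in
  front of a word z.\<close>

lemma good0_pbw_fun:
  assumes v: "\<And>a h. overflow D a \<Longrightarrow> v a h = 0"
  shows "good0 (pbw_fun D v)"
proof (rule goodI)
  fix u z assume u: "u \<in> W" and z: "z \<in> W"
  obtain v' where v0: "\<forall>a h. overflow D a \<longrightarrow> v' a h = 0" "\<forall>w\<in>W. pbw_fun D v (u @ w) = pbw_fun D v' w"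
    using pbw_fun_prefix[of v u] v u by blast
  then have v': "\<And>a h. overflow D a \<Longrightarrow> v' a h = 0" "\<And>w. w \<in> W \<Longrightarrow> pbw_fun D v (u @ w) = pbw_fun D v' w"
    by auto
  have gz: "gprod D z \<in> G" using z by simp
  have "kills D (\<lambda>_ _. 0) (\<lambda>_. 0) (\<lambda>w. pbw_fun D v' (w @ z))"
    unfolding kills_def
  proof (intro conjI ballI allI impI)
    show "pbw_fun D v' ([Grp \<one>\<^bsub>grp D\<^esub>] @ z) = pbw_fun D v' ([] @ z)"
      using gz by (simp add: pbw_fun_def chi_one)
    show "pbw_fun D v' ([Grp h, Grp k] @ z) = pbw_fun D v' ([Grp (h \<otimes>\<^bsub>grp D\<^esub> k)] @ z)" if "h \<in> G" "k \<in> G" for h k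
      using gz that by (simp add: pbw_fun_def chi_mult power_mult_distrib prod.distrib G.m_assoc)
    show "pbw_fun D v' ([Grp h, Var i] @ z) = \<chi> i h * pbw_fun D v' ([Var i, Grp h] @ z)" if "h \<in> G" "i < \<theta>" for h i
    proof -
      have "(\<Prod>k<\<theta>. \<chi> k h ^ occ (Var i # z) k) = (\<Prod>k<\<theta>. (if k = i then \<chi> i h else 1) * \<chi> k h ^ occ z k)"
        by (intro prod.cong refl) auto
      also have "\<dots> = \<chi> i h * (\<Prod>k<\<theta>. \<chi> k h ^ occ z k)" using that by (simp add: prod.distrib prod.delta)
      finally show ?thesis by (simp add: pbw_fun_def cong: if_cong)
    qed
    show "pbw_fun D v' (replicate (N i) (Var i) @ z) =
        0 * (pbw_fun D v' ([] @ z) - pbw_fun D v' ([Grp (g i [^]\<^bsub>grp D\<^esub> N i)] @ z))" if "i < \<theta>" for i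
    proof -
      have "count_list (replicate n (Var i) @ z) (Var i) = n + count_list z (Var i)" for n
        by (induction n) auto
      then have "overflow D (occ (replicate (N i) (Var i) @ z))" unfolding overflow_def using that by auto
      then show ?thesis by (simp add: pbw_fun_def v' del: count_list_append)
    qed
    show "pbw_fun D v' ([Var i, Var j] @ z) = \<chi> j (g i) * pbw_fun D v' ([Var j, Var i] @ z) +
       0 * (pbw_fun D v' ([] @ z) - pbw_fun D v' ([Grp (g i \<otimes>\<^bsub>grp D\<^esub> g j)] @ z))" if "i < j" "j < \<theta>" for i j
    proof -
      have "(\<Prod>k<j. \<chi> k (g j) ^ occ (Var i # z) k) = (\<Prod>k<j. (if k = i then \<chi> i (g j) else 1) * \<chi> k (g j) ^ occ z k)"
        by (intro prod.cong refl) auto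
      also have "\<dots> = \<chi> i (g j) * (\<Prod>k<j. \<chi> k (g j) ^ occ z k)" using that by (simp add: prod.distrib prod.delta)
      finally have 1: "(\<Prod>k<j. \<chi> k (g j) ^ occ (Var i # z) k) = \<chi> i (g j) * (\<Prod>k<j. \<chi> k (g j) ^ occ z k)" .
      have 2: "(\<Prod>k<i. \<chi> k (g i) ^ occ (Var j # z) k) = (\<Prod>k<i. \<chi> k (g i) ^ occ z k)"
        using that by (intro prod.cong) auto
      have 3: "occ (Var j # Var i # z) = occ (Var i # Var j # z)" by auto
      have "\<chi> j (g i) * \<chi> i (g j) = 1" using chi_braid[of j i] that by auto
      then show ?thesis
        by (simp add: pbw_fun_def 1[simplified] 2[simplified] 3[simplified] flip: mult.assoc)
          (simp add: mult_ac)?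
    qed
  qed
  then show "kills D (\<lambda>_ _. 0) (\<lambda>_. 0) (\<lambda>w. pbw_fun D v (u @ w @ z))"
    by (rule kills_cong_W) (use v'(2)[of "_ @ z"] z in simp)
qed

lemma coef_var_word:
  assumes "\<And>k. k < n \<Longrightarrow> count_list w (Var k) = 0" "m \<le> n"
  shows "coef D (var_word m n a @ w) = coef D w"
  using assms(2)
proof (induction m rule: inc_induct)
  case base
  then show ?case by (simp add: var_word_def)
next
  case (step m)
  have "coef D (replicate c (Var m) @ var_word (Suc m) n a @ w) = coef D (var_word (Suc m) n a @ w)" for c
  proof (induction c)
    case (Suc c)
    have "count_list (replicate c (Var m) @ var_word (Suc m) n a @ w) (Var k) = 0" if "k < m" for k
    proof -
      have "count_list (replicate c (Var m)) (Var k) = 0" using that by (induction c) auto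
      then show ?thesis using that step assms(1) by (auto simp: count_var_word)
    qed
    then show ?case using Suc by simp
  qed simp
  then show ?case using step by (simp add: var_word_Cons)
qed

lemma pbw_word_nf:
  assumes "h \<in> G"
  shows "coef D (pbw_word D a h) = 1" "gprod D (pbw_word D a h) = h"
    "occ (pbw_word D a h) = (\<lambda>i. if i < \<theta> then a i else 0)"
proof -
  show "coef D (pbw_word D a h) = 1" by (simp add: pbw_word_def coef_var_word)
  have "gprod D (w @ [Grp h]) = h" if "set w \<subseteq> Var ` A" for w A
    using that assms by (induction w) auto
  then show "gprod D (pbw_word D a h) = h" unfolding pbw_word_def using set_var_word by metis
  show "occ (pbw_word D a h) = (\<lambda>i. if i < \<theta> then a i else 0)"
    by (auto simp: pbw_word_def count_var_word)
qed

lemma count_W: "w \<in> W \<Longrightarrow> \<theta> \<le> i \<Longrightarrow> count_list w (Var i) = 0"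
  by (induction w) auto

lemma deg_pbw_word: "h \<in> G \<Longrightarrow> deg (pbw_word D a h) = (\<Sum>i<\<theta>. a i)"
proof -
  have "deg (var_word 0 n a) = (\<Sum>i<n. a i)" for n
    by (induction n) (auto simp: var_word_def)
  then show ?thesis by (simp add: pbw_word_def)
qed

lemma deg_occ: "w \<in> W \<Longrightarrow> deg w = (\<Sum>i<\<theta>. occ w i)"
proof (induction w)
  case (Cons s w)
  show ?case
  proof (cases s)
    case (Var i)
    have "(\<Sum>k<\<theta>. occ (s # w) k) = (\<Sum>k<\<theta>. (if k = i then 1 else 0) + occ w k)"
      by (intro sum.cong) (auto simp: Var)
    then show ?thesis using Cons Var by (simp add: sum.distrib)
  qed (use Cons in auto)
qed simp

end

text \<open>The sorting argument for two targets at once: the homogeneous ideal of u(D,0,0), as a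
  family independent of n, and for arbitrary parameters the ideal together with all words of degree
  below n.\<close>

locale nf_family = sdatum D for D :: "('g, 'k::field_char_0) datum" +
  fixes K :: "nat \<Rightarrow> ('g letter list \<Rightarrow>\<^sub>0 'k) set"
  assumes K_zero: "0 \<in> K n"
    and K_add: "p \<in> K n \<Longrightarrow> q \<in> K n \<Longrightarrow> p + q \<in> K n"
    and K_scale: "p \<in> K n \<Longrightarrow> const c * p \<in> K n"
    and K_mult: "p \<in> K n \<Longrightarrow> u \<in> W \<Longrightarrow> v \<in> W \<Longrightarrow> mon u * p * mon v \<in> K (deg u + n + deg v)"
    and K_one: "mon [Grp \<one>\<^bsub>grp D\<^esub>] - 1 \<in> K 0"
    and K_grp: "h \<in> G \<Longrightarrow> k \<in> G \<Longrightarrow> mon [Grp h, Grp k] - mon [Grp (h \<otimes>\<^bsub>grp D\<^esub> k)] \<in> K 0"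
    and K_act: "h \<in> G \<Longrightarrow> i < \<theta> \<Longrightarrow> mon [Grp h, Var i] - const (\<chi> i h) * mon [Var i, Grp h] \<in> K 1"
    and K_pow: "i < \<theta> \<Longrightarrow> mon (replicate (N i) (Var i)) \<in> K (N i)"
    and K_comm: "i < j \<Longrightarrow> j < \<theta> \<Longrightarrow>
      mon [Var i, Var j] - const (\<chi> j (g i)) * mon [Var j, Var i] \<in> K 2"
begin

text \<open>Congruence of w to c times w' modulo level n.\<close>

definition sim :: "nat \<Rightarrow> 'g letter list \<Rightarrow> 'k \<Rightarrow> 'g letter list \<Rightarrow> bool" where
  "sim n w c w' \<longleftrightarrow> mon w - const c * mon w' \<in> K n"

lemma sim_trans [trans]:
  assumes "sim n w c w'" "sim n w' c' w''"
  shows "sim n w (c * c') w''"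
proof -
  have "mon w - const (c * c') * mon w'' = (mon w - const c * mon w') + const c * (mon w' - const c' * mon w'')"
    by (rule poly_mapping_separate) (simp add: algebra_simps)
  then show ?thesis using assms unfolding sim_def by (metis K_add K_scale)
qed

lemma sim_context:
  assumes "sim n w c w'" "u \<in> W" "v \<in> W"
  shows "sim (deg u + n + deg v) (u @ w @ v) c (u @ w' @ v)"
proof -
  have "mon (u @ w @ v) - const c * mon (u @ w' @ v) = mon u * (mon w - const c * mon w') * mon v"
    by (rule poly_mapping_separate) (simp add: ext_mult algebra_simps)
  then show ?thesis using K_mult[OF assms(1)[unfolded sim_def] assms(2,3)] by (simp add: sim_def)
qed

lemma sim_refl: "sim n w 1 w"
  by (simp add: sim_def K_zero)

text \<open>The relators cover only i < k. The opposite exchange is the relator multiplied by a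
  scalar, since the two scalars are inverse to each other.\<close>

lemma sim_swap:
  assumes "i < \<theta>" "k < \<theta>" "i \<noteq> k"
  shows "sim 2 [Var i, Var k] (\<chi> k (g i)) [Var k, Var i]"
proof (cases "i < k")
  case True
  then show ?thesis using K_comm[of i k] assms by (simp add: sim_def)
next
  case False
  have eq: "const (- \<chi> k (g i)) * (mon [Var k, Var i] - const (\<chi> i (g k)) * mon [Var i, Var k]) =
     mon [Var i, Var k] - const (\<chi> k (g i)) * mon [Var k, Var i]"
  proof (rule poly_mapping_separate)
    fix s
    show "ext s (const (- \<chi> k (g i)) * (mon [Var k, Var i] - const (\<chi> i (g k)) * mon [Var i, Var k])) =
      ext s (mon [Var i, Var k] - const (\<chi> k (g i)) * mon [Var k, Var i])"
      using chi_braid[of k i] assms by (simp add: algebra_simps)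
  qed
  show ?thesis
    unfolding sim_def eq[symmetric] by (intro K_scale K_comm) (use False assms in auto)
qed

lemma sim_Grp_Vars:
  assumes "h \<in> G" "set ks \<subseteq> {..<\<theta>}"
  shows "sim (length ks) (Grp h # map Var ks) (\<Prod>k\<leftarrow>ks. \<chi> k h) (map Var ks @ [Grp h])"
  using assms(2)
proof (induction ks)
  case Nil
  then show ?case by (simp add: sim_refl)
next
  case (Cons k ks)
  have W: "map Var ks \<in> W" "[Var k] \<in> W" "[] \<in> W" using Cons.prems by (auto simp: in_lists_conv_set)
  have d: "deg (map Var ks :: 'g letter list) = length ks" by (induction ks) auto
  have "sim 1 [Grp h, Var k] (\<chi> k h) [Var k, Grp h]"
    using K_act[OF assms(1), of k] Cons.prems by (simp add: sim_def)
  from sim_context[OF this W(3,1)]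
  have "sim (length (k # ks)) (Grp h # map Var (k # ks)) (\<chi> k h) (Var k # Grp h # map Var ks)"
    by (simp add: d)
  also have "sim (length (k # ks)) (Var k # Grp h # map Var ks) (\<Prod>k\<leftarrow>ks. \<chi> k h) (Var k # map Var ks @ [Grp h])"
    using sim_context[OF Cons.IH W(2,3)] Cons.prems by simp
  finally show ?case by simp
qed

lemma sim_Var_Vars:
  assumes "i < \<theta>" "set ks \<subseteq> {..<\<theta>} - {i}"
  shows "sim (Suc (length ks)) (Var i # map Var ks) (\<Prod>k\<leftarrow>ks. \<chi> k (g i)) (map Var ks @ [Var i])"
  using assms(2)
proof (induction ks)
  case Nil
  then show ?case by (simp add: sim_refl)
next
  case (Cons k ks)
  have W: "map Var ks \<in> W" "[Var k] \<in> W" "[] \<in> W" using Cons.prems by (auto simp: in_lists_conv_set)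
  have d: "deg (map Var ks :: 'g letter list) = length ks" by (induction ks) auto
  have "sim 2 [Var i, Var k] (\<chi> k (g i)) [Var k, Var i]"
    using Cons.prems assms(1) by (intro sim_swap) auto
  from sim_context[OF this W(3,1)]
  have "sim (Suc (length (k # ks))) (Var i # map Var (k # ks)) (\<chi> k (g i)) (Var k # Var i # map Var ks)"
    by (simp add: d)
  also have "sim (Suc (length (k # ks))) (Var k # Var i # map Var ks) (\<Prod>k\<leftarrow>ks. \<chi> k (g i)) (Var k # map Var ks @ [Var i])"
    using sim_context[OF Cons.IH W(2,3)] Cons.prems by simp
  finally show ?case by simp
qed

lemma var_word_map: "var_word m n a = map Var (concat (map (\<lambda>i. replicate (a i) i) [m..<n]))"
  by (simp add: var_word_def map_concat o_def)

lemma prod_list_powers: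
  "(\<Prod>k\<leftarrow>concat (map (\<lambda>i. replicate (a i) i) [0..<n]). f k) = (\<Prod>k<n. f k ^ a k :: 'k)"
  by (induction n) (auto simp: prod_list_replicate)

text \<open>Insertion sort: the tail is sorted first, then the new letter travels to its place, and
  the scalars met on the way are those recorded in \<open>coef\<close>.\<close>

lemma sim_normal_form:
  assumes "w \<in> W"
  shows "sim (deg w) w (coef D w) (pbw_word D (occ w) (gprod D w))"
  using assms
proof (induction w rule: list.induct)
  case Nil
  have eq: "const (- 1) * (mon [Grp \<one>\<^bsub>grp D\<^esub>] - 1) = mon [] - const 1 * mon [Grp \<one>\<^bsub>grp D\<^esub>]"
    by (rule poly_mapping_separate) simp
  have "sim 0 [] 1 [Grp \<one>\<^bsub>grp D\<^esub>]" unfolding sim_def eq[symmetric] by (intro K_scale K_one)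
  then show ?case by (simp add: pbw_word_def var_word_zero)
next
  case (Cons s w)
  let ?a = "occ w" and ?h = "gprod D w"
  have w: "w \<in> W" and s: "[s] \<in> W" and W: "[] \<in> W" using Cons.prems by simp_all
  have h: "?h \<in> G" by (rule gprod_closed[OF w])
  have len: "length (concat (map (\<lambda>i. replicate (?a i) i) [0..<n])) = (\<Sum>i<n. ?a i)" for n
    by (induction n) auto
  have degs: "deg (var_word m n ?a :: 'g letter list) = length (var_word m n ?a :: 'g letter list)" for m n
    by (rule deg_Vars[OF set_var_word])
  have dv: "deg (var_word 0 n ?a :: 'g letter list) = length (concat (map (\<lambda>i. replicate (?a i) i) [0..<n]))" for n
    by (simp only: degs) (simp only: var_word_map length_map)
  have 1: "sim (deg (s # w)) (s # w) (coef D w) (s # pbw_word D ?a ?h)"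
    using sim_context[OF Cons.IH[OF w] s W] by (cases s) simp_all
  show ?case
  proof (cases s)
    case (Grp k)
    then have k: "k \<in> G" using s by simp
    let ?ks = "concat (map (\<lambda>i. replicate (?a i) i) [0..<\<theta>])"
    have dw: "deg w = length ?ks" unfolding len by (rule deg_occ[OF w])
    have "sim (length ?ks) (Grp k # map Var ?ks) (\<Prod>k'\<leftarrow>?ks. \<chi> k' k) (map Var ?ks @ [Grp k])"
      by (rule sim_Grp_Vars[OF k]) auto
    from sim_context[OF this W, of "[Grp ?h]"] h
    have 2: "sim (deg w) (s # pbw_word D ?a ?h) (\<Prod>i<\<theta>. \<chi> i k ^ ?a i) (var_word 0 \<theta> ?a @ [Grp k, Grp ?h])"
      by (simp add: dw pbw_word_def var_word_map prod_list_powers Grp)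
    have grp: "sim 0 [Grp k, Grp ?h] 1 [Grp (k \<otimes>\<^bsub>grp D\<^esub> ?h)]" using K_grp[OF k h] by (simp add: sim_def)
    have 3: "sim (deg w) (var_word 0 \<theta> ?a @ [Grp k, Grp ?h]) 1 (var_word 0 \<theta> ?a @ [Grp (k \<otimes>\<^bsub>grp D\<^esub> ?h)])"
    proof -
      show ?thesis
        using sim_context[OF grp var_word_W[OF order.refl, of 0 ?a] W] dw by (simp add: dv)
    qed
    show ?thesis
      using sim_trans[OF sim_trans[OF _ 2] 3, of "s # w" "coef D w"] 1 Grp
      by (simp add: pbw_word_def mult.commute)
  next
    case (Var i)
    then have i: "i < \<theta>" using s by simp
    define ks where "ks = concat (map (\<lambda>i. replicate (?a i) i) [0..<i])"
    define r where "r = var_word i \<theta> ?a @ [Grp ?h]"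
    have vw: "var_word 0 i ?a = (map Var ks :: 'g letter list)" by (simp add: ks_def var_word_map)
    have pl: "(\<Prod>k\<leftarrow>ks. \<chi> k (g i)) = (\<Prod>k<i. \<chi> k (g i) ^ ?a k)" by (simp add: ks_def prod_list_powers)
    have pw: "pbw_word D ?a ?h = map Var ks @ r"
      using i by (simp add: pbw_word_def var_word_split[of 0 i \<theta>] vw r_def)
    have occ: "occ (s # w) = ?a(i := Suc (?a i))" by (auto simp: Var)
    have "deg w = deg (map Var ks :: 'g letter list) + deg r"
      using deg_pbw_word[OF h, of ?a] deg_occ[OF w] by (simp add: pw)
    then have dw: "deg w = length ks + deg r" unfolding vw[symmetric] dv ks_def[symmetric] .
    have r: "r \<in> W" using h var_word_W[OF order.refl, of i ?a] by (simp add: r_def)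
    have "set ks \<subseteq> {..<\<theta>} - {i}" using i by (auto simp: ks_def)
    from sim_context[OF sim_Var_Vars[OF i this] W r]
    have 2: "sim (deg (s # w)) (s # pbw_word D ?a ?h) (\<Prod>k<i. \<chi> k (g i) ^ ?a k) (var_word 0 i ?a @ Var i # r)"
      by (simp add: dw pw vw pl Var)
    have "pbw_word D (?a(i := Suc (?a i))) ?h = var_word 0 i ?a @ Var i # r"
    proof -
      have "(var_word 0 \<theta> (?a(i := Suc (?a i))) :: 'g letter list) = var_word 0 i (?a(i := Suc (?a i))) @ var_word i \<theta> (?a(i := Suc (?a i)))"
        using i by (intro var_word_split) auto
      also have "(var_word 0 i (?a(i := Suc (?a i))) :: 'g letter list) = var_word 0 i ?a" by (rule var_word_cong) auto
      also have "(var_word i \<theta> (?a(i := Suc (?a i))) :: 'g letter list) = Var i # var_word i \<theta> ?a"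
        using i by (simp add: var_word_Cons) (rule var_word_cong, auto)
      finally show ?thesis unfolding pbw_word_def r_def by (simp only: append_assoc append_Cons)
    qed
    then show ?thesis using sim_trans[OF 1 2] occ by (simp add: Var mult.commute)
  qed
qed

text \<open>In a sorted word equal variables are adjacent, so an overflowing exponent exhibits the
  factor x_i^N_i.\<close>

lemma K_overflow:
  assumes "overflow D a" "h \<in> G"
  shows "mon (pbw_word D a h) \<in> K (deg (pbw_word D a h))"
proof -
  obtain i where i: "i < \<theta>" "N i \<le> a i" using assms(1) by (auto simp: overflow_def)
  let ?u = "var_word 0 i a" and ?v = "replicate (a i - N i) (Var i) @ var_word (Suc i) \<theta> a @ [Grp h]"
  have uv: "?u \<in> W" "?v \<in> W" using i assms(2) by (auto simp: var_word_def in_lists_conv_set)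
  have "replicate (a i) (Var i) = replicate (N i) (Var i :: 'g letter) @ replicate (a i - N i) (Var i)"
    using i by (simp flip: replicate_add)
  then have "pbw_word D a h = ?u @ replicate (N i) (Var i) @ ?v"
    using i by (simp add: pbw_word_def var_word_split[of 0 i \<theta>] var_word_Cons[of i \<theta>])
  then show ?thesis using K_mult[OF K_pow[OF i(1)] uv] by (simp add: mon_mult add.assoc)
qed

end

section \<open>The PBW theorem: spanning and independence\<close>

context sdatum
begin

lemma relators_rel_ideal:
  "mon [Grp \<one>\<^bsub>grp D\<^esub>] - 1 \<in> rel_ideal D l \<mu>"
  "h \<in> G \<Longrightarrow> k \<in> G \<Longrightarrow> mon [Grp h, Grp k] - mon [Grp (h \<otimes>\<^bsub>grp D\<^esub> k)] \<in> rel_ideal D l \<mu>"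
  "h \<in> G \<Longrightarrow> i < \<theta> \<Longrightarrow> mon [Grp h, Var i] - const (\<chi> i h) * mon [Var i, Grp h] \<in> rel_ideal D l \<mu>"
  "i < \<theta> \<Longrightarrow> mon (replicate (N i) (Var i)) - const (\<mu> i) * (1 - mon [Grp (g i [^]\<^bsub>grp D\<^esub> N i)]) \<in> rel_ideal D l \<mu>"
  "i < j \<Longrightarrow> j < \<theta> \<Longrightarrow> mon [Var i, Var j] - const (\<chi> j (g i)) * mon [Var j, Var i]
     - const (l i j) * (1 - mon [Grp (g i \<otimes>\<^bsub>grp D\<^esub> g j)]) \<in> rel_ideal D l \<mu>"
proof -
  note gen = subsetD[OF rel_ideal_gen]
  show "mon [Grp \<one>\<^bsub>grp D\<^esub>] - 1 \<in> rel_ideal D l \<mu>"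
    by (rule gen) (simp add: relators_def)
  show "mon [Grp h, Grp k] - mon [Grp (h \<otimes>\<^bsub>grp D\<^esub> k)] \<in> rel_ideal D l \<mu>" if "h \<in> G" "k \<in> G"
  proof -
    have "mon [Grp h] * mon [Grp k] - mon [Grp (h \<otimes>\<^bsub>grp D\<^esub> k)] \<in> relators D l \<mu>"
      unfolding relators_def using that by blast
    then show ?thesis by (auto simp: mon_mult intro: gen)
  qed
  show "mon [Grp h, Var i] - const (\<chi> i h) * mon [Var i, Grp h] \<in> rel_ideal D l \<mu>" if "h \<in> G" "i < \<theta>"
  proof -
    have "mon [Grp h] * mon [Var i] - const (\<chi> i h) * mon [Var i] * mon [Grp h] \<in> relators D l \<mu>"
      unfolding relators_def using that by blast
    then show ?thesis by (auto simp: mon_mult mult.assoc intro: gen)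
  qed
  show "mon (replicate (N i) (Var i)) - const (\<mu> i) * (1 - mon [Grp (g i [^]\<^bsub>grp D\<^esub> N i)]) \<in> rel_ideal D l \<mu>" if "i < \<theta>"
  proof -
    have "mon [Var i] ^ N i - const (\<mu> i) * (1 - mon [Grp (g i [^]\<^bsub>grp D\<^esub> N i)]) \<in> relators D l \<mu>"
      unfolding relators_def using that by blast
    then show ?thesis by (auto simp: mon_power intro: gen)
  qed
  show "mon [Var i, Var j] - const (\<chi> j (g i)) * mon [Var j, Var i]
     - const (l i j) * (1 - mon [Grp (g i \<otimes>\<^bsub>grp D\<^esub> g j)]) \<in> rel_ideal D l \<mu>" if "i < j" "j < \<theta>"
  proof -
    have "mon [Var i] * mon [Var j] - const (\<chi> j (g i)) * mon [Var j] * mon [Var i]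
        - const (l i j) * (1 - mon [Grp (g i \<otimes>\<^bsub>grp D\<^esub> g j)]) \<in> relators D l \<mu>"
      unfolding relators_def using that by blast
    then show ?thesis by (auto simp: mon_mult mult.assoc intro: gen)
  qed
qed

lemma rel_ideal_zero [simp]: "0 \<in> rel_ideal D l \<mu>"
  using rel_ideal_closed(6)[OF relators_rel_ideal(1) relators_rel_ideal(1)] by simp

text \<open>Elements congruent to combinations of words of degree less than \<open>n\<close>: modulo these, words of
  degree \<open>n\<close> obey the homogeneous relations.\<close>

definition J :: "(nat \<Rightarrow> nat \<Rightarrow> 'k) \<Rightarrow> (nat \<Rightarrow> 'k) \<Rightarrow> nat \<Rightarrow> ('g letter list \<Rightarrow>\<^sub>0 'k) set" where
  "J l \<mu> n = {p. \<exists>q. Poly_Mapping.keys q \<subseteq> {w \<in> W. deg w < n} \<and> p - q \<in> rel_ideal D l \<mu>}"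

lemma JI: "p - q \<in> rel_ideal D l \<mu> \<Longrightarrow> Poly_Mapping.keys q \<subseteq> {w \<in> W. deg w < n} \<Longrightarrow> p \<in> J l \<mu> n"
  by (auto simp: J_def)

lemma nf_family_J: "nf_family D (J l \<mu>)"
proof
  fix p q n c
  show "0 \<in> J l \<mu> n" by (rule JI[of _ 0]) simp_all
  show "p + q \<in> J l \<mu> n" if pq: "p \<in> J l \<mu> n" "q \<in> J l \<mu> n"
  proof -
    obtain p' q' where "Poly_Mapping.keys p' \<subseteq> {w \<in> W. deg w < n}" "p - p' \<in> rel_ideal D l \<mu>"
      "Poly_Mapping.keys q' \<subseteq> {w \<in> W. deg w < n}" "q - q' \<in> rel_ideal D l \<mu>" using pq by (auto simp: J_def)
    then show ?thesis
      using rel_ideal_closed(1)[of "p - p'" l \<mu> "q - q'"] keys_add[of p' q']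
      by (intro JI[of _ "p' + q'"]) (auto simp: algebra_simps)
  qed
  show "const c * p \<in> J l \<mu> n" if p: "p \<in> J l \<mu> n" for c
  proof -
    obtain p' where "Poly_Mapping.keys p' \<subseteq> {w \<in> W. deg w < n}" "p - p' \<in> rel_ideal D l \<mu>"
      using p by (auto simp: J_def)
    then show ?thesis
      using rel_ideal_closed(5)[of "p - p'" l \<mu> c] keys_const_mult[of c p']
      by (intro JI[of _ "const c * p'"]) (auto simp: right_diff_distrib)
  qed
  show "mon u * p * mon v \<in> J l \<mu> (deg u + n + deg v)" if p: "p \<in> J l \<mu> n" and uv: "u \<in> W" "v \<in> W" for u v
  proof -
    obtain p' where p': "Poly_Mapping.keys p' \<subseteq> {w \<in> W. deg w < n}" "p - p' \<in> rel_ideal D l \<mu>"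
      using p by (auto simp: J_def)
    have "mon u * (p - p') * mon v \<in> rel_ideal D l \<mu>"
      by (intro rel_ideal_closed(2,3) p' keys_single_W uv)
    moreover have "Poly_Mapping.keys (mon u * p' * mon v) \<subseteq> {w \<in> W. deg w < deg u + n + deg v}"
    proof
      fix w assume "w \<in> Poly_Mapping.keys (mon u * p' * mon v)"
      then obtain w' where "w = u @ w' @ v" "w' \<in> Poly_Mapping.keys p'"
        using keys_mult[of "mon u * p'" "mon v"] keys_mult[of "mon u" p'] by fastforce
      then show "w \<in> {w \<in> W. deg w < deg u + n + deg v}" using p' uv by auto
    qed
    ultimately show ?thesis by (intro JI[of _ "mon u * p' * mon v"]) (simp_all add: algebra_simps)
  qed
next
  show "mon [Grp \<one>\<^bsub>grp D\<^esub>] - 1 \<in> J l \<mu> 0" by (rule JI[of _ 0]) (simp_all add: relators_rel_ideal)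
  show "mon [Grp h, Grp k] - mon [Grp (h \<otimes>\<^bsub>grp D\<^esub> k)] \<in> J l \<mu> 0" if "h \<in> G" "k \<in> G" for h k
    by (rule JI[of _ 0]) (simp_all add: relators_rel_ideal that)
  show "mon [Grp h, Var i] - const (\<chi> i h) * mon [Var i, Grp h] \<in> J l \<mu> 1" if "h \<in> G" "i < \<theta>" for h i
    by (rule JI[of _ 0]) (use that in \<open>simp_all add: relators_rel_ideal\<close>)
  \<comment> \<open>The right-hand sides of the root vector and linking relations have degree 0,
    below the degrees N_i and 2 of their leading words.\<close>
  have low: "Poly_Mapping.keys (const c * (1 - mon [Grp h])) \<subseteq> {w \<in> W. deg w < n}" if "h \<in> G" "0 < n" for c h n
  proof -
    have "Poly_Mapping.keys (1 - mon [Grp h]) \<subseteq> {w \<in> W. deg w < n}"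
      using keys_minus[of 1 "mon [Grp h]"] that by auto
    then show ?thesis using keys_const_mult by blast
  qed
  show "mon (replicate (N i) (Var i)) \<in> J l \<mu> (N i)" if "i < \<theta>" for i
    using N_ge[OF that] that
    by (intro JI[OF relators_rel_ideal(4)] low) auto
  show "mon [Var i, Var j] - const (\<chi> j (g i)) * mon [Var j, Var i] \<in> J l \<mu> 2" if "i < j" "j < \<theta>" for i j
    using that by (intro JI[OF relators_rel_ideal(5)] low) auto
qed

lemma nf_family_ideal: "nf_family D (\<lambda>_. rel_ideal D (\<lambda>_ _. 0) (\<lambda>_. 0))"
  by standard (use relators_rel_ideal[where l = "\<lambda>_ _. 0" and \<mu> = "\<lambda>_. 0"] in
    \<open>simp_all add: rel_ideal_closed\<close>)

text \<open>A functional on u(D,0,0) is determined by its values on the PBW words, and it vanishes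
  on words with an overflowing exponent.\<close>

lemma good0_normal_form:
  assumes "good0 s" "w \<in> W"
  shows "s w = coef D w * s (pbw_word D (occ w) (gprod D w))"
    and "overflow D (occ w) \<Longrightarrow> s w = 0"
proof -
  interpret nf_family D "\<lambda>_. rel_ideal D (\<lambda>_ _. 0) (\<lambda>_. 0)" by (rule nf_family_ideal)
  show 1: "s w = coef D w * s (pbw_word D (occ w) (gprod D w))"
    using assms(1) sim_normal_form[OF assms(2)] unfolding good_def sim_def by fastforce
  show "s w = 0" if "overflow D (occ w)"
  proof -
    have "ext s (mon (pbw_word D (occ w) (gprod D w))) = 0"
      by (rule bspec[OF assms(1)[unfolded good_def] K_overflow[OF that gprod_closed[OF assms(2)]]])
    then show ?thesis using 1 by simp
  qed
qed

text \<open>Exponents are set to 0 from \<theta> on: this makes the set finite and the exponent of a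
  PBW word unique.\<close>

definition exponents :: "(nat \<Rightarrow> nat) set" where
  "exponents = {a. (\<forall>i<\<theta>. a i < N i) \<and> (\<forall>i\<ge>\<theta>. a i = 0)}"

definition pbw_words :: "'g letter list set" where
  "pbw_words = {pbw_word D a h |a h. a \<in> exponents \<and> h \<in> G}"

lemma finite_exponents: "finite exponents"
proof (rule finite_subset)
  show "exponents \<subseteq> {f. \<forall>x. (x \<in> {..<\<theta>} \<longrightarrow> f x \<in> {..<\<Sum>i<\<theta>. N i}) \<and> (x \<notin> {..<\<theta>} \<longrightarrow> f x = 0)}"
  proof clarify
    fix a x assume a: "a \<in> exponents"
    have "a x < (\<Sum>i<\<theta>. N i)" if "x < \<theta>"
    proof -
      have "a x < N x" using a that by (auto simp: exponents_def)
      also have "N x \<le> (\<Sum>i<\<theta>. N i)" using that by (intro member_le_sum) auto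
      finally show ?thesis .
    qed
    then show "(x \<in> {..<\<theta>} \<longrightarrow> a x \<in> {..<\<Sum>i<\<theta>. N i}) \<and> (x \<notin> {..<\<theta>} \<longrightarrow> a x = 0)"
      using a by (auto simp: exponents_def)
  qed
qed (rule finite_set_of_finite_funs, auto)

lemma occ_exponents: "w \<in> W \<Longrightarrow> \<not> overflow D (occ w) \<Longrightarrow> occ w \<in> exponents"
  unfolding exponents_def overflow_def using count_W by (auto simp: not_le)

text \<open>Sorting changes a word only by words of smaller degree, so induction on the degree
  reaches the PBW words. This holds for all l and \<mu>, whether or not the quotient collapses;
  independence is supplied separately.\<close>

lemma pbw_span:
  assumes "Poly_Mapping.keys p \<subseteq> W"
  shows "\<exists>q. Poly_Mapping.keys q \<subseteq> pbw_words \<and> p - q \<in> rel_ideal D l \<mu>"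
proof -
  interpret nf_family D "J l \<mu>" by (rule nf_family_J)
  let ?P = "\<lambda>p. \<exists>q. Poly_Mapping.keys q \<subseteq> pbw_words \<and> p - q \<in> rel_ideal D l \<mu>"
  have zero: "?P 0" by (intro exI[of _ 0]) simp
  have add: "?P (p + q)" if pq: "?P p" "?P q" for p q
  proof -
    obtain p' q' where "Poly_Mapping.keys p' \<subseteq> pbw_words" "p - p' \<in> rel_ideal D l \<mu>"
      "Poly_Mapping.keys q' \<subseteq> pbw_words" "q - q' \<in> rel_ideal D l \<mu>" using pq by auto
    then show ?thesis
      using rel_ideal_closed(1)[of "p - p'" l \<mu> "q - q'"] keys_add[of p' q']
      by (intro exI[of _ "p' + q'"]) (auto simp: algebra_simps)
  qed
  have scale: "?P (const c * p)" if p: "?P p" for p c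
  proof -
    obtain p' where "Poly_Mapping.keys p' \<subseteq> pbw_words" "p - p' \<in> rel_ideal D l \<mu>" using p by auto
    then show ?thesis
      using rel_ideal_closed(5)[of "p - p'" l \<mu> c] keys_const_mult[of c p']
      by (intro exI[of _ "const c * p'"]) (auto simp: right_diff_distrib)
  qed
  have cong: "?P p" if pq: "?P q" "p - q \<in> rel_ideal D l \<mu>" for p q
  proof -
    obtain q' where "Poly_Mapping.keys q' \<subseteq> pbw_words" "q - q' \<in> rel_ideal D l \<mu>" using pq(1) by blast
    then show ?thesis using rel_ideal_closed(1)[OF pq(2), of "q - q'"] by (intro exI[of _ q']) auto
  qed
  have word: "?P (Poly_Mapping.single w c)" if "w \<in> W" for w c
    using that
  proof (induction w arbitrary: c rule: measure_induct_rule[of deg])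
    case (less w)
    let ?b = "pbw_word D (occ w) (gprod D w)"
    have b: "?b \<in> W" "deg ?b = deg w" using less.prems deg_pbw_word[of "gprod D w" "occ w"] deg_occ[of w] by auto
    have low: "?P q" if "Poly_Mapping.keys q \<subseteq> {w' \<in> W. deg w' < deg w}" for q
      using that by (induction q rule: poly_mapping_words_induct) (auto intro: zero zero[simplified] add less.IH)
    have J: "?P q" if "q \<in> J l \<mu> (deg w)" for q
      using that low cong unfolding J_def by blast
    have "?P (mon ?b)"
    proof (cases "overflow D (occ w)")
      case True
      then show ?thesis using J[of "mon ?b"] K_overflow[OF True, of "gprod D w"] less.prems b by auto
    next
      case False
      then have "?b \<in> pbw_words" 
        using occ_exponents[OF less.prems] gprod_closed[OF less.prems] unfolding pbw_words_def by blast
      then show ?thesis by (intro exI[of _ "mon ?b"]) auto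
    qed
    moreover have "?P (mon w - const (coef D w) * mon ?b)"
      using J sim_normal_form[OF less.prems] unfolding sim_def by blast
    ultimately have "?P ((mon w - const (coef D w) * mon ?b) + const (coef D w) * mon ?b)"
      by (intro add scale)
    then have "?P (const c * mon w)" by (intro scale) simp
    then show ?case by (simp add: const_mult)
  qed
  show ?thesis using assms by (induction p rule: poly_mapping_words_induct) (auto intro: zero zero[simplified] add word)
qed

text \<open>A word w0 of maximal degree in q is detected by the functional s dual to it: s vanishes
  below the degree of w0, so twisting by Q and P does not change it on the words of q.\<close>

lemma pbw_independent:
  assumes q: "Poly_Mapping.keys q \<subseteq> pbw_words"
    and P: "\<And>h w. P (Grp h # w) = P w" "P [] = 1" and Q: "\<And>h w. Q (Grp h # w) = Q w" "Q [] = 1"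
    and zero: "\<And>s. good0 s \<Longrightarrow> ext (Q \<diamondop>\<^bsub>g\<^esub> (s \<diamondop>\<^bsub>g\<^esub> P)) q = 0"
  shows "q = 0"
proof (rule ccontr)
  assume "q \<noteq> 0"
  then have "Poly_Mapping.keys q \<noteq> {}" by (metis empty_iff in_keys_iff lookup_zero poly_mapping_eqI)
  then have "Max (deg ` Poly_Mapping.keys q) \<in> deg ` Poly_Mapping.keys q" by (intro Max_in) auto
  then obtain w0 where w0: "w0 \<in> Poly_Mapping.keys q" "deg w0 = Max (deg ` Poly_Mapping.keys q)" by auto
  then have w0: "w0 \<in> Poly_Mapping.keys q" "\<And>w. w \<in> Poly_Mapping.keys q \<Longrightarrow> deg w \<le> deg w0" by auto
  obtain a h where ah: "w0 = pbw_word D a h" "a \<in> exponents" "h \<in> G" using w0 q by (auto simp: pbw_words_def)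
  define v where "v = (\<lambda>b k. if b = a \<and> k = h then 1 else 0 :: 'k)"
  \<comment> \<open>The comparison of leading terms asks for vanishing on all words of low degree,
    but \<open>pbw_fun\<close> is controlled only on W; the explicit cut-off changes nothing on
    W.\<close>
  define s where "s = (\<lambda>w. if deg w < deg w0 then 0 else pbw_fun D v w)"
  have no: "\<not> overflow D a" using ah by (auto simp: overflow_def exponents_def)
  have "good0 (pbw_fun D v)" by (rule good0_pbw_fun) (use no in \<open>auto simp: v_def\<close>)
  moreover have vs: "pbw_fun D v w = s w" if "w \<in> W" for w
    using deg_occ[OF that] deg_pbw_word[OF ah(3), of a] ah(1) by (auto simp: s_def pbw_fun_def v_def)
  ultimately have s: "good0 s" by (rule good_cong_W)
  have lead: "(Q \<diamondop>\<^bsub>g\<^esub> (s \<diamondop>\<^bsub>g\<^esub> P)) w = s w" if "w \<in> Poly_Mapping.keys q" for w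
  proof -
    have 1: "(s \<diamondop>\<^bsub>g\<^esub> P) w = s w" if "deg w \<le> deg w0" for w
      by (rule conv_lead_right[OF _ P that]) (simp add: s_def)
    have "(s \<diamondop>\<^bsub>g\<^esub> P) w = 0" if "deg w < deg w0" for w using 1[of w] that by (simp add: s_def)
    then have "(Q \<diamondop>\<^bsub>g\<^esub> (s \<diamondop>\<^bsub>g\<^esub> P)) w = (s \<diamondop>\<^bsub>g\<^esub> P) w"
      using w0(2)[OF that] by (intro conv_lead_left[OF _ Q]) auto
    then show ?thesis using 1 w0(2)[OF that] by simp
  qed
  have val: "s w = (if w = w0 then 1 else 0)" if w: "w \<in> Poly_Mapping.keys q" for w
  proof -
    obtain b k where bk: "w = pbw_word D b k" "b \<in> exponents" "k \<in> G" using w q by (auto simp: pbw_words_def)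
    have occ: "(\<lambda>i. if i < \<theta> then b i else 0) = b" using bk(2) by (auto simp: exponents_def)
    have "pbw_fun D v w = (if b = a \<and> k = h then 1 else 0)"
      using bk by (simp add: pbw_fun_def pbw_word_nf occ v_def)
    moreover have "w = w0 \<longleftrightarrow> b = a \<and> k = h"
    proof
      assume "w = w0"
      moreover have "(\<lambda>i. if i < \<theta> then a i else 0) = a" using ah(2) by (auto simp: exponents_def)
      ultimately show "b = a \<and> k = h"
        using occ pbw_word_nf(2,3)[OF bk(3), of b] pbw_word_nf(2,3)[OF ah(3), of a] bk(1) ah(1) by simp
    qed (simp add: bk ah)
    moreover have "pbw_fun D v w = s w"
      using bk by (simp add: vs)
    ultimately show ?thesis by simp
  qed
  have "0 = ext s q" using zero[OF s] ext_cong[of q "Q \<diamondop>\<^bsub>g\<^esub> (s \<diamondop>\<^bsub>g\<^esub> P)" s] lead by simp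
  also have "\<dots> = ext (\<lambda>w. if w = w0 then 1 else 0) q" by (rule ext_cong) (rule val)
  also have "\<dots> = Poly_Mapping.lookup q w0"
    by (simp add: ext_def if_distrib[of "\<lambda>x. _ * x"] w0(1) cong: if_cong)
  finally show False using w0(1) by (simp add: in_keys_iff)
qed

text \<open>Taking \<open>P = Q = eps\<close> and \<open>l = \<mu> = 0\<close>: the good functionals separate the points of \<open>u0 D\<close>.\<close>

lemma twisted_separation:
  assumes p: "Poly_Mapping.keys p \<subseteq> W"
    and P: "\<And>h w. P (Grp h # w) = P w" "P [] = 1" and Q: "\<And>h w. Q (Grp h # w) = Q w" "Q [] = 1"
    and good: "\<And>s. good0 s \<Longrightarrow> good D l \<mu> (Q \<diamondop>\<^bsub>g\<^esub> (s \<diamondop>\<^bsub>g\<^esub> P))"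
    and zero: "\<And>s. good0 s \<Longrightarrow> ext (Q \<diamondop>\<^bsub>g\<^esub> (s \<diamondop>\<^bsub>g\<^esub> P)) p = 0"
  shows "p \<in> rel_ideal D l \<mu>"
proof -
  obtain q where q: "Poly_Mapping.keys q \<subseteq> pbw_words" "p - q \<in> rel_ideal D l \<mu>" using pbw_span[OF p] by blast
  have "ext (Q \<diamondop>\<^bsub>g\<^esub> (s \<diamondop>\<^bsub>g\<^esub> P)) q = 0" if "good0 s" for s
    using good[OF that] zero[OF that] q(2) unfolding good_def by fastforce
  then have "q = 0" using pbw_independent[OF q(1) P Q] by blast
  then show ?thesis using q by simp
qed

end

section \<open>Functionals on the quotient algebras\<close>

declare in_listsD [rule del] in_listsI [rule del]

context sdatum
begin

abbreviation proj :: "(nat \<Rightarrow> nat \<Rightarrow> 'k) \<Rightarrow> (nat \<Rightarrow> 'k) \<Rightarrow> 'g letter list \<Rightarrow> ('g letter list \<Rightarrow>\<^sub>0 'k) set" where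
  "proj l \<mu> w \<equiv> cls D l \<mu> (mon w)"

abbreviation P0 :: "('g letter list \<Rightarrow>\<^sub>0 'k) set" where
  "P0 \<equiv> {p. Poly_Mapping.keys p \<subseteq> W}"

lemma cls_eq:
  assumes "p \<in> P0" "q \<in> P0"
  shows "cls D l \<mu> p = cls D l \<mu> q \<longleftrightarrow> p - q \<in> rel_ideal D l \<mu>"
  using ring.quotient_eq_iff_same_a_r_cos[OF ring_free_alg ideal_rel[of l \<mu>], of p q] assms
  by (simp add: cls_def a_minus_free_alg)

lemma u_carrier: "carrier (u_alg D l \<mu>) = cls D l \<mu> ` P0"
  by (auto simp: u_alg_def Let_def FactRing_def A_RCOSETS_def' cls_def)

lemma cls_closed [simp]: "p \<in> P0 \<Longrightarrow> cls D l \<mu> p \<in> carrier (u_alg D l \<mu>)"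
  by (simp add: u_carrier)

lemma u_mult: "p \<in> P0 \<Longrightarrow> q \<in> P0 \<Longrightarrow> cls D l \<mu> p \<otimes>\<^bsub>u_alg D l \<mu>\<^esub> cls D l \<mu> q = cls D l \<mu> (p * q)"
  using ideal.rcoset_mult_add[OF ideal_rel[of l \<mu>], of p q] by (simp add: u_alg_def Let_def FactRing_def cls_def)

lemma u_add: "p \<in> P0 \<Longrightarrow> q \<in> P0 \<Longrightarrow> cls D l \<mu> p \<oplus>\<^bsub>u_alg D l \<mu>\<^esub> cls D l \<mu> q = cls D l \<mu> (p + q)"
  using ideal.a_rcos_sum[OF ideal_rel[of l \<mu>], of p q] by (simp add: u_alg_def Let_def FactRing_def cls_def)

lemma u_zero: "\<zero>\<^bsub>u_alg D l \<mu>\<^esub> = cls D l \<mu> 0"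
  using ring.a_rcos_zero[OF ring_free_alg ideal_rel[of l \<mu>], of 0] by (simp add: u_alg_def Let_def FactRing_def cls_def)

lemma u_one: "\<one>\<^bsub>u_alg D l \<mu>\<^esub> = cls D l \<mu> 1"
  by (simp add: u_alg_def Let_def FactRing_def cls_def)

lemma const_P0: "const c \<in> P0"
  by auto

lemma P0_closed: "p \<in> P0 \<Longrightarrow> q \<in> P0 \<Longrightarrow> p + q \<in> P0" "p \<in> P0 \<Longrightarrow> q \<in> P0 \<Longrightarrow> p - q \<in> P0"
  "p \<in> P0 \<Longrightarrow> q \<in> P0 \<Longrightarrow> p * q \<in> P0" "p \<in> P0 \<Longrightarrow> const c * p \<in> P0"
  by (simp_all add: keys_free_alg)

lemma mon_P0 [simp]: "w \<in> W \<Longrightarrow> mon w \<in> P0"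
  by simp

lemma u_smult: "p \<in> P0 \<Longrightarrow> c \<odot>\<^bsub>u_alg D l \<mu>\<^esub> cls D l \<mu> p = cls D l \<mu> (const c * p)"
  using u_mult[OF const_P0, of p l \<mu> c] by (simp add: u_alg_def Let_def)

lemma some_rep:
  assumes "a \<in> carrier (u_alg D l \<mu>)"
  shows "(SOME p. p \<in> a) \<in> P0" "cls D l \<mu> (SOME p. p \<in> a) = a"
proof -
  obtain p where p: "p \<in> P0" "a = cls D l \<mu> p" using assms by (auto simp: u_carrier)
  have a: "a = {i + p |i. i \<in> rel_ideal D l \<mu>}"
    by (auto simp: p(2) cls_def a_r_coset_def' )
  have "p \<in> a" unfolding a using rel_ideal_zero[of l \<mu>] by force
  then have "(SOME p. p \<in> a) \<in> a" by (rule someI)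
  then obtain i where i: "i \<in> rel_ideal D l \<mu>" "(SOME p. p \<in> a) = i + p" unfolding a by blast
  then show *: "(SOME p. p \<in> a) \<in> P0" using rel_ideal_keys p by (simp add: keys_free_alg)
  show "cls D l \<mu> (SOME p. p \<in> a) = a" using i cls_eq[OF * p(1), of l \<mu>] p(2) by simp
qed

lemma abelian_monoid_u: "abelian_monoid (u_alg D l \<mu>)"
proof (rule abelian_monoidI)
  fix a b c assume "a \<in> carrier (u_alg D l \<mu>)" "b \<in> carrier (u_alg D l \<mu>)" "c \<in> carrier (u_alg D l \<mu>)"
  then obtain p q r where *: "p \<in> P0" "a = cls D l \<mu> p" "q \<in> P0" "b = cls D l \<mu> q" "r \<in> P0" "c = cls D l \<mu> r"
    unfolding u_carrier by blast
  show "(a \<oplus>\<^bsub>u_alg D l \<mu>\<^esub> b) \<oplus>\<^bsub>u_alg D l \<mu>\<^esub> c = a \<oplus>\<^bsub>u_alg D l \<mu>\<^esub> (b \<oplus>\<^bsub>u_alg D l \<mu>\<^esub> c)"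
    unfolding * by (simp only: u_add * P0_closed add.assoc)
next
  fix a b assume "a \<in> carrier (u_alg D l \<mu>)" "b \<in> carrier (u_alg D l \<mu>)"
  then obtain p q where *: "p \<in> P0" "a = cls D l \<mu> p" "q \<in> P0" "b = cls D l \<mu> q"
    unfolding u_carrier by blast
  show "a \<oplus>\<^bsub>u_alg D l \<mu>\<^esub> b \<in> carrier (u_alg D l \<mu>)" unfolding * by (simp only: u_add * P0_closed cls_closed)
  show "a \<oplus>\<^bsub>u_alg D l \<mu>\<^esub> b = b \<oplus>\<^bsub>u_alg D l \<mu>\<^esub> a" unfolding * by (simp only: u_add * add.commute)
next
  fix a assume "a \<in> carrier (u_alg D l \<mu>)"
  then obtain p where *: "p \<in> P0" "a = cls D l \<mu> p" unfolding u_carrier by blast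
  have "0 \<in> P0" by simp
  then show "\<zero>\<^bsub>u_alg D l \<mu>\<^esub> \<oplus>\<^bsub>u_alg D l \<mu>\<^esub> a = a" unfolding * u_zero by (simp only: u_add * add_0)
qed (simp add: u_zero)

lemma linear_form_zero: "linear_form (u_alg D l \<mu>) f \<Longrightarrow> f (cls D l \<mu> 0) = 0"
proof -
  assume f: "linear_form (u_alg D l \<mu>) f"
  have z: "0 \<in> P0" by simp
  have "f (0 \<odot>\<^bsub>u_alg D l \<mu>\<^esub> cls D l \<mu> 0) = 0 * f (cls D l \<mu> 0)"
    using f cls_closed[OF z] unfolding linear_form_def by blast
  then show ?thesis by (simp add: u_smult)
qed

lemma linear_form_ext:
  assumes f: "linear_form (u_alg D l \<mu>) f" and p: "p \<in> P0"
  shows "f (cls D l \<mu> p) = ext (\<lambda>w. f (proj l \<mu> w)) p"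
proof -
  have "p \<in> P0 \<and> f (cls D l \<mu> p) = ext (\<lambda>w. f (proj l \<mu> w)) p"
    using p[unfolded mem_Collect_eq]
  proof (induction p rule: poly_mapping_words_induct)
    case (single w c)
    then have "f (c \<odot>\<^bsub>u_alg D l \<mu>\<^esub> proj l \<mu> w) = c * f (proj l \<mu> w)"
      using f cls_closed[OF mon_P0] unfolding linear_form_def by blast
    then show ?case using single u_smult[OF mon_P0[OF single], where c = c] by (simp add: const_mult)
  next
    case (add p q)
    then have "f (cls D l \<mu> p \<oplus>\<^bsub>u_alg D l \<mu>\<^esub> cls D l \<mu> q) = f (cls D l \<mu> p) + f (cls D l \<mu> q)"
      using f cls_closed unfolding linear_form_def by blast
    then show ?case using add by (simp add: u_add keys_free_alg)
  qed (simp add: linear_form_zero[OF f])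
  then show ?thesis by simp
qed

lemma good_linear_form:
  assumes f: "linear_form (u_alg D l \<mu>) f"
  shows "good D l \<mu> (\<lambda>w. f (proj l \<mu> w))"
  unfolding good_def
proof
  fix p assume p: "p \<in> rel_ideal D l \<mu>"
  then have P: "p \<in> P0" "0 \<in> P0" using rel_ideal_keys by auto
  then have "cls D l \<mu> p = cls D l \<mu> 0" using p by (simp add: cls_eq)
  then show "ext (\<lambda>w. f (proj l \<mu> w)) p = 0"
    using linear_form_ext[OF f P(1)] linear_form_zero[OF f] by simp
qed

lemma good_ext_cong:
  assumes "good D l \<mu> s" "p \<in> P0" "q \<in> P0" "cls D l \<mu> p = cls D l \<mu> q"
  shows "ext s p = ext s q"
  using assms cls_eq[OF assms(2,3), of l \<mu>] unfolding good_def by fastforce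

section \<open>Functionals on a quotient and their pullbacks to words\<close>

definition lift :: "('g letter list \<Rightarrow> 'k) \<Rightarrow> ('g letter list \<Rightarrow>\<^sub>0 'k) set \<Rightarrow> 'k" where
  "lift s a = ext s (SOME p. p \<in> a)"

lemma lift_cls:
  assumes "good D l \<mu> s" "p \<in> P0"
  shows "lift s (cls D l \<mu> p) = ext s p"
  unfolding lift_def using some_rep[OF cls_closed[OF assms(2)]]
  by (intro good_ext_cong[OF assms(1) _ assms(2)])

text \<open>The word functional s is the pullback of f. Its values outside W are unconstrained, so
  equality of pullbacks is only ever asserted on W.\<close>

definition rep1 :: "(nat \<Rightarrow> nat \<Rightarrow> 'k) \<Rightarrow> (nat \<Rightarrow> 'k) \<Rightarrow> (('g letter list \<Rightarrow>\<^sub>0 'k) set \<Rightarrow> 'k) \<Rightarrow> ('g letter list \<Rightarrow> 'k) \<Rightarrow> bool" where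
  "rep1 l \<mu> f s \<longleftrightarrow> (\<forall>p\<in>P0. f (cls D l \<mu> p) = ext s p)"

definition rep2 :: "(nat \<Rightarrow> nat \<Rightarrow> 'k) \<Rightarrow> (nat \<Rightarrow> 'k) \<Rightarrow>
    (('g letter list \<Rightarrow>\<^sub>0 'k) set \<Rightarrow> ('g letter list \<Rightarrow>\<^sub>0 'k) set \<Rightarrow> 'k) \<Rightarrow>
    ('g letter list \<times> 'g letter list \<Rightarrow> 'k) \<Rightarrow> bool" where
  "rep2 l \<mu> \<beta> S \<longleftrightarrow> (\<forall>p\<in>P0. \<forall>q\<in>P0. \<beta> (cls D l \<mu> p) (cls D l \<mu> q) = ext (\<lambda>u. ext (\<lambda>v. S (u, v)) q) p)"

text \<open>The condition for a function on pairs of words to descend to a bilinear form on the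
  quotient.\<close>

definition bigood :: "(nat \<Rightarrow> nat \<Rightarrow> 'k) \<Rightarrow> (nat \<Rightarrow> 'k) \<Rightarrow> ('g letter list \<times> 'g letter list \<Rightarrow> 'k) \<Rightarrow> bool" where
  "bigood l \<mu> S \<longleftrightarrow> (\<forall>v\<in>W. good D l \<mu> (\<lambda>u. S (u, v))) \<and> (\<forall>u\<in>W. good D l \<mu> (\<lambda>v. S (u, v)))"

lemma rep1_linear_form: "rep1 l \<mu> f s \<Longrightarrow> linear_form (u_alg D l \<mu>) f"
  unfolding linear_form_def u_carrier rep1_def
  by (auto simp: u_add[simplified] u_smult[simplified] keys_free_alg)

lemma linear_form_rep1: "linear_form (u_alg D l \<mu>) f \<Longrightarrow> rep1 l \<mu> f (\<lambda>w. f (proj l \<mu> w))"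
  by (simp add: rep1_def linear_form_ext)

lemma rep1_word: "rep1 l \<mu> f s \<Longrightarrow> w \<in> W \<Longrightarrow> f (proj l \<mu> w) = s w"
  by (simp add: rep1_def)

lemma rep1_good: "rep1 l \<mu> f s \<Longrightarrow> good D l \<mu> s"
  by (rule good_cong_W[OF good_linear_form[OF rep1_linear_form]]) (auto simp: rep1_word)

lemma good_rep1: "good D l \<mu> s \<Longrightarrow> rep1 l \<mu> (lift s) s"
  by (simp add: rep1_def lift_cls)

lemma ext_cong_P0: "p \<in> P0 \<Longrightarrow> (\<And>w. w \<in> W \<Longrightarrow> f w = h w) \<Longrightarrow> ext f p = ext h p"
  by (intro ext_cong) auto

lemma bilinear_rep2:
  assumes "bilinear_form (u_alg D l \<mu>) \<beta>"
  shows "rep2 l \<mu> \<beta> (\<lambda>(u, v). \<beta> (proj l \<mu> u) (proj l \<mu> v))"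
  unfolding rep2_def
proof (intro ballI)
  fix p q assume p: "p \<in> P0" and q: "q \<in> P0"
  have l: "\<And>a. a \<in> carrier (u_alg D l \<mu>) \<Longrightarrow> linear_form (u_alg D l \<mu>) (\<beta> a)"
    "\<And>b. b \<in> carrier (u_alg D l \<mu>) \<Longrightarrow> linear_form (u_alg D l \<mu>) (\<lambda>a. \<beta> a b)"
    using assms by (auto simp: bilinear_form_def)
  have "\<beta> (cls D l \<mu> p) (cls D l \<mu> q) = ext (\<lambda>u. \<beta> (proj l \<mu> u) (cls D l \<mu> q)) p"
    using linear_form_ext[OF l(2)[OF cls_closed[OF q]] p] .
  also have "\<dots> = ext (\<lambda>u. ext (\<lambda>v. \<beta> (proj l \<mu> u) (proj l \<mu> v)) q) p"
    by (rule ext_cong_P0[OF p]) (rule linear_form_ext[OF l(1)[OF cls_closed[OF mon_P0]] q])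
  finally show "\<beta> (cls D l \<mu> p) (cls D l \<mu> q) = ext (\<lambda>u. ext (\<lambda>v. case (u, v) of (u, v) \<Rightarrow> \<beta> (proj l \<mu> u) (proj l \<mu> v)) q) p"
    by simp
qed

lemma rep2_bilinear:
  assumes "rep2 l \<mu> \<beta> S"
  shows "bilinear_form (u_alg D l \<mu>) \<beta>"
  unfolding bilinear_form_def
proof (intro conjI ballI)
  fix a assume "a \<in> carrier (u_alg D l \<mu>)"
  then obtain p where p: "p \<in> P0" "a = cls D l \<mu> p" by (auto simp: u_carrier)
  have "rep1 l \<mu> (\<beta> a) (\<lambda>v. ext (\<lambda>u. S (u, v)) p)"
    using assms p by (auto simp: rep1_def rep2_def ext_swap[of _ _ p])
  then show "linear_form (u_alg D l \<mu>) (\<beta> a)" by (rule rep1_linear_form)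
  have "rep1 l \<mu> (\<lambda>b. \<beta> b a) (\<lambda>u. ext (\<lambda>v. S (u, v)) p)"
    using assms p by (auto simp: rep1_def rep2_def)
  then show "linear_form (u_alg D l \<mu>) (\<lambda>b. \<beta> b a)" by (rule rep1_linear_form)
qed

lemma rep2_word: "rep2 l \<mu> \<beta> S \<Longrightarrow> u \<in> W \<Longrightarrow> v \<in> W \<Longrightarrow> \<beta> (proj l \<mu> u) (proj l \<mu> v) = S (u, v)"
  by (simp add: rep2_def)

lemma rep2_bigood:
  assumes "rep2 l \<mu> \<beta> S"
  shows "bigood l \<mu> S"
proof -
  note b = rep2_bilinear[OF assms, unfolded bilinear_form_def]
  have "good D l \<mu> (\<lambda>u. S (u, v))" if v: "v \<in> W" for v
  proof (rule good_cong_W)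
    show "good D l \<mu> (\<lambda>u. \<beta> (proj l \<mu> u) (proj l \<mu> v))"
      using b cls_closed[OF mon_P0[OF v]] by (intro good_linear_form) blast
  qed (use v rep2_word[OF assms] in auto)
  moreover have "good D l \<mu> (\<lambda>v. S (u, v))" if u: "u \<in> W" for u
  proof (rule good_cong_W)
    show "good D l \<mu> (\<lambda>v. \<beta> (proj l \<mu> u) (proj l \<mu> v))"
      using b cls_closed[OF mon_P0[OF u]] by (intro good_linear_form) blast
  qed (use u rep2_word[OF assms] in auto)
  ultimately show ?thesis by (simp add: bigood_def)
qed

lemma bigood_ext_cong:
  assumes S: "bigood l \<mu> S" and p: "p \<in> P0" "p' \<in> P0" "cls D l \<mu> p = cls D l \<mu> p'"
    and q: "q \<in> P0" "q' \<in> P0" "cls D l \<mu> q = cls D l \<mu> q'"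
  shows "ext (\<lambda>u. ext (\<lambda>v. S (u, v)) q) p = ext (\<lambda>u. ext (\<lambda>v. S (u, v)) q') p'"
proof -
  have "ext (\<lambda>u. ext (\<lambda>v. S (u, v)) q) p = ext (\<lambda>u. ext (\<lambda>v. S (u, v)) q') p"
    using S by (intro ext_cong_P0[OF p(1)] good_ext_cong[OF _ q]) (auto simp: bigood_def)
  also have "\<dots> = ext (\<lambda>v. ext (\<lambda>u. S (u, v)) p) q'" by (rule ext_swap)
  also have "\<dots> = ext (\<lambda>v. ext (\<lambda>u. S (u, v)) p') q'"
    using S by (intro ext_cong_P0[OF q(2)] good_ext_cong[OF _ p]) (auto simp: bigood_def)
  also have "\<dots> = ext (\<lambda>u. ext (\<lambda>v. S (u, v)) q') p'" by (rule ext_swap)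
  finally show ?thesis .
qed

definition lift2 :: "('g letter list \<times> 'g letter list \<Rightarrow> 'k) \<Rightarrow>
    ('g letter list \<Rightarrow>\<^sub>0 'k) set \<Rightarrow> ('g letter list \<Rightarrow>\<^sub>0 'k) set \<Rightarrow> 'k" where
  "lift2 S a b = ext (\<lambda>u. ext (\<lambda>v. S (u, v)) (SOME q. q \<in> b)) (SOME p. p \<in> a)"

lemma bigood_rep2: "bigood l \<mu> S \<Longrightarrow> rep2 l \<mu> (lift2 S) S"
  unfolding rep2_def lift2_def using some_rep[OF cls_closed] by (intro ballI bigood_ext_cong) auto

lemma rep2_cong:
  assumes "rep2 l \<mu> \<beta> S" "\<And>u v. u \<in> W \<Longrightarrow> v \<in> W \<Longrightarrow> S (u, v) = S' (u, v)"
  shows "rep2 l \<mu> \<beta> S'"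
  unfolding rep2_def
proof (intro ballI)
  fix p q assume "p \<in> P0" "q \<in> P0"
  then show "\<beta> (cls D l \<mu> p) (cls D l \<mu> q) = ext (\<lambda>u. ext (\<lambda>v. S' (u, v)) q) p"
    using assms by (auto simp: rep2_def intro!: ext_cong_P0)
qed

lemma rep1_cong:
  assumes "rep1 l \<mu> f s" "\<And>w. w \<in> W \<Longrightarrow> s w = s' w"
  shows "rep1 l \<mu> f s'"
  unfolding rep1_def
proof
  fix p assume p: "p \<in> P0"
  then show "f (cls D l \<mu> p) = ext s' p"
    using assms(1) ext_cong_P0[OF p, of s s'] assms(2) by (simp add: rep1_def)
qed

lemma rep2_tens: "rep1 l \<mu> f s \<Longrightarrow> rep1 l \<mu> h t \<Longrightarrow> rep2 l \<mu> (\<lambda>a b. f a * h b) (s \<otimes>\<^sub>t t)"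
  by (simp add: rep1_def rep2_def ext_fun)

lemma rep2_scale: "rep2 l \<mu> \<beta> S \<Longrightarrow> rep2 l \<mu> (\<lambda>a b. c * \<beta> a b) (\<lambda>z. c * S z)"
  by (simp add: rep2_def ext_fun)

lemma rep2_sum: "(\<And>i. i \<in> I \<Longrightarrow> rep2 l \<mu> (\<beta> i) (S i)) \<Longrightarrow> rep2 l \<mu> (\<lambda>a b. \<Sum>i\<in>I. \<beta> i a b) (\<lambda>z. \<Sum>i\<in>I. S i z)"
  by (simp add: rep2_def ext_fun)

lemma good_eps: "good D l \<mu> eps"
proof (rule goodI)
  fix u v :: "'g letter list"
  have "eps (replicate (N i) (Var i)) = (0 :: 'k)" if "i < \<theta>" for i
    using N_ge[OF that] by (cases "N i") auto
  then show "kills D l \<mu> (\<lambda>w. eps (u @ w @ v))" by (auto simp: kills_def)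
qed

text \<open>F is arbitrary here, so the value may depend on the chosen representative; independence
  has to come from goodness of the resulting word functional.\<close>

lemma sweedler_comult:
  assumes "a \<in> carrier (u_alg D l \<mu>)"
  shows "sweedler (comult (u_alg D l \<mu>) a) F =
     ext (\<lambda>w. dsum (split g w) (\<lambda>u v. F (proj l \<mu> u) (proj l \<mu> v))) (SOME p. p \<in> a)"
  by (simp add: sweedler_ext u_alg_def Let_def case_prod_unfold ext_free_comult)

lemma counit_u: "counit (u_alg D l \<mu>) a = lift eps a"
  by (simp add: u_alg_def Let_def lift_def free_counit_ext)

lemma rep1_counit: "rep1 l \<mu> (counit (u_alg D l \<mu>)) eps"
  using good_rep1[OF good_eps] by (simp add: rep1_def counit_u)

section \<open>Convolution on u(D,0,0) computed on words\<close>

abbreviation rep1_0 where "rep1_0 \<equiv> rep1 (\<lambda>_ _. 0) (\<lambda>_. 0)"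
abbreviation rep2_0 where "rep2_0 \<equiv> rep2 (\<lambda>_ _. 0) (\<lambda>_. 0)"
abbreviation bigood0 where "bigood0 \<equiv> bigood (\<lambda>_ _. 0) (\<lambda>_. 0)"

lemma rep1_conv1:
  assumes f: "rep1_0 f s" and h: "rep1_0 h t"
  shows "rep1_0 (conv1 (u0 D) f h) (s \<diamondop>\<^bsub>g\<^esub> t)"
  unfolding rep1_def
proof
  fix p assume p: "p \<in> P0"
  let ?c = "cls D (\<lambda>_ _. 0) (\<lambda>_. 0)"
  let ?p = "SOME p'. p' \<in> ?c p"
  note r = some_rep[OF cls_closed[OF p], of "\<lambda>_ _. 0" "\<lambda>_. 0"]
  have "conv1 (u0 D) f h (?c p) = ext (s \<diamondop>\<^bsub>g\<^esub> t) ?p"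
    unfolding conv1_def sweedler_comult[OF cls_closed[OF p]] conv_def
    by (intro ext_cong_P0[OF r(1)] dsum_cong) (metis rep1_word[OF f] rep1_word[OF h] split_W)
  also have "\<dots> = ext (s \<diamondop>\<^bsub>g\<^esub> t) p"
    by (rule good_ext_cong[OF good0_conv[OF rep1_good[OF f] rep1_good[OF h]] r(1) p r(2)])
  finally show "conv1 (u0 D) f h (?c p) = ext (s \<diamondop>\<^bsub>g\<^esub> t) p" .
qed

lemma bigood0_conv:
  assumes S: "bigood0 S" and T: "bigood0 T"
  shows "bigood0 (S \<bullet>\<^bsub>g\<^esub> T)"
  unfolding bigood_def
proof (intro conjI ballI)
  fix v assume v: "v \<in> W"
  have "good0 (\<lambda>u. dsum (split g v) (\<lambda>v1 v2. ((\<lambda>u. S (u, v1)) \<diamondop>\<^bsub>g\<^esub> (\<lambda>u. T (u, v2))) u))"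
    using S T v split_W unfolding bigood_def by (intro good_dsum good0_conv) blast+
  moreover have "(S \<bullet>\<^bsub>g\<^esub> T) (u, v) = dsum (split g v) (\<lambda>v1 v2. ((\<lambda>u. S (u, v1)) \<diamondop>\<^bsub>g\<^esub> (\<lambda>u. T (u, v2))) u)" for u
    unfolding conv_prod_coalg unfolding conv_def by (rule dsum_swap)
  ultimately show "good0 (\<lambda>u. (S \<bullet>\<^bsub>g\<^esub> T) (u, v))" by (simp only:)
next
  fix u assume u: "u \<in> W"
  have "good0 (\<lambda>v. dsum (split g u) (\<lambda>u1 u2. ((\<lambda>v. S (u1, v)) \<diamondop>\<^bsub>g\<^esub> (\<lambda>v. T (u2, v))) v))"
    using S T u split_W unfolding bigood_def by (intro good_dsum good0_conv) blast+
  then show "good0 (\<lambda>v. (S \<bullet>\<^bsub>g\<^esub> T) (u, v))"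
    unfolding conv_prod_coalg unfolding conv_def .
qed

lemma conv2_eval:
  assumes a: "a \<in> carrier (u0 D)" and b: "b \<in> carrier (u0 D)"
    and S: "\<And>u v. u \<in> W \<Longrightarrow> v \<in> W \<Longrightarrow> \<beta> (proj (\<lambda>_ _. 0) (\<lambda>_. 0) u) (proj (\<lambda>_ _. 0) (\<lambda>_. 0) v) = S (u, v)"
    and T: "\<And>u v. u \<in> W \<Longrightarrow> v \<in> W \<Longrightarrow> \<gamma> (proj (\<lambda>_ _. 0) (\<lambda>_. 0) u) (proj (\<lambda>_ _. 0) (\<lambda>_. 0) v) = T (u, v)"
  shows "conv2 (u0 D) \<beta> \<gamma> a b = ext (\<lambda>u. ext (\<lambda>v. (S \<bullet>\<^bsub>g\<^esub> T) (u, v)) (SOME q. q \<in> b)) (SOME p. p \<in> a)"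
proof -
  have "dsum (split g u) (\<lambda>u1 u2. ext (\<lambda>v. dsum (split g v) (\<lambda>v1 v2.
      \<beta> (proj (\<lambda>_ _. 0) (\<lambda>_. 0) u1) (proj (\<lambda>_ _. 0) (\<lambda>_. 0) v1) *
      \<gamma> (proj (\<lambda>_ _. 0) (\<lambda>_. 0) u2) (proj (\<lambda>_ _. 0) (\<lambda>_. 0) v2))) (SOME q. q \<in> b)) =
    ext (\<lambda>v. (S \<bullet>\<^bsub>g\<^esub> T) (u, v)) (SOME q. q \<in> b)" if u: "u \<in> W" for u
    unfolding conv_prod_coalg ext_dsum
    by (intro dsum_cong ext_cong_P0[OF some_rep(1)[OF b]]) (metis S T split_W u)
  then show ?thesis
    unfolding conv2_def sweedler_comult[OF a] sweedler_comult[OF b]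
    by (intro ext_cong_P0[OF some_rep(1)[OF a]])
qed

lemma rep2_conv2:
  assumes S: "rep2_0 \<beta> S" and T: "rep2_0 \<gamma> T"
  shows "rep2_0 (conv2 (u0 D) \<beta> \<gamma>) (S \<bullet>\<^bsub>g\<^esub> T)"
  unfolding rep2_def
proof (intro ballI)
  fix p q assume p: "p \<in> P0" and q: "q \<in> P0"
  let ?c = "cls D (\<lambda>_ _. 0) (\<lambda>_. 0)"
  note rp = some_rep[OF cls_closed[OF p], of "\<lambda>_ _. 0" "\<lambda>_. 0"]
  note rq = some_rep[OF cls_closed[OF q], of "\<lambda>_ _. 0" "\<lambda>_. 0"]
  have "bigood0 (S \<bullet>\<^bsub>g\<^esub> T)" using S T by (intro bigood0_conv rep2_bigood)
  then have "ext (\<lambda>u. ext (\<lambda>v. (S \<bullet>\<^bsub>g\<^esub> T) (u, v)) (SOME q'. q' \<in> ?c q)) (SOME p'. p' \<in> ?c p) =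
      ext (\<lambda>u. ext (\<lambda>v. (S \<bullet>\<^bsub>g\<^esub> T) (u, v)) q) p"
    by (rule bigood_ext_cong[OF _ rp(1) p rp(2) rq(1) q rq(2)])
  moreover have "conv2 (u0 D) \<beta> \<gamma> (?c p) (?c q) =
      ext (\<lambda>u. ext (\<lambda>v. (S \<bullet>\<^bsub>g\<^esub> T) (u, v)) (SOME q'. q' \<in> ?c q)) (SOME p'. p' \<in> ?c p)"
    by (rule conv2_eval[OF cls_closed[OF p] cls_closed[OF q]]) (use S T rep2_word in auto)
  ultimately show "conv2 (u0 D) \<beta> \<gamma> (?c p) (?c q) = ext (\<lambda>u. ext (\<lambda>v. (S \<bullet>\<^bsub>g\<^esub> T) (u, v)) q) p"
    by simp
qed

lemma rep2_unit: "rep2_0 (conv2_unit (u0 D)) eps2"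
  using rep2_tens[OF rep1_counit rep1_counit] by (simp add: conv2_unit_def[abs_def])

lemma rep2_power: "rep2_0 \<beta> S \<Longrightarrow> rep2_0 (conv2_power (u0 D) \<beta> n) (cpow g S n)"
  unfolding conv2_power_def by (induction n) (auto simp: rep2_unit rep2_conv2)

lemma rep2_exp:
  assumes "rep2_0 \<beta> S" "\<And>z. deg (fst z) + deg (snd z) = 0 \<Longrightarrow> S z = 0"
  shows "rep2_0 (conv2_exp (u0 D) \<beta>) (exp_w g S)"
  unfolding rep2_def
proof (intro ballI)
  fix p q assume p: "p \<in> P0" and q: "q \<in> P0"
  let ?c = "cls D (\<lambda>_ _. 0) (\<lambda>_. 0)"
  \<comment> \<open>A bound on the total degree over all words of p and q, so that the same finite
    number of powers suffices for every pair of words.\<close>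
  define M where "M = Max (insert 0 (deg ` Poly_Mapping.keys p)) + Max (insert 0 (deg ` Poly_Mapping.keys q))"
  have M: "deg u + deg v \<le> M" if "u \<in> Poly_Mapping.keys p" "v \<in> Poly_Mapping.keys q" for u v
    unfolding M_def using that by (intro add_mono Max_ge) auto
  have val: "conv2_power (u0 D) \<beta> n (?c p) (?c q) = ext (\<lambda>u. ext (\<lambda>v. cpow g S n (u, v)) q) p" for n
    using rep2_power[OF assms(1), of n] p q by (simp add: rep2_def)
  have van: "conv2_power (u0 D) \<beta> n (?c p) (?c q) = 0" if "M < n" for n
  proof -
    have "ext (\<lambda>u. ext (\<lambda>v. cpow g S n (u, v)) q) p = ext (\<lambda>u. ext (\<lambda>v. 0) q) p"
      by (intro ext_cong cpow_vanish) (use assms(2) M that in fastforce)+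
    then show ?thesis by (simp add: val ext_fun)
  qed
  have "conv2_exp (u0 D) \<beta> (?c p) (?c q) = (\<Sum>n\<le>M. conv2_power (u0 D) \<beta> n (?c p) (?c q) / fact n)"
    unfolding conv2_exp_def
    by (rule Sum_any.expand_superset) (use van in \<open>auto simp: not_le intro: leI\<close>)
  also have "\<dots> = ext (\<lambda>u. ext (\<lambda>v. \<Sum>n\<le>M. inverse (fact n) * cpow g S n (u, v)) q) p"
    by (simp add: val ext_fun divide_inverse mult.commute)
  also have "\<dots> = ext (\<lambda>u. ext (\<lambda>v. exp_w g S (u, v)) q) p"
  proof (intro ext_cong)
    fix u v assume "u \<in> Poly_Mapping.keys p" "v \<in> Poly_Mapping.keys q"
    then show "(\<Sum>n\<le>M. inverse (fact n) * cpow g S n (u, v)) = exp_w g S (u, v)"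
      using exp_w_bound[of S "(u, v)" M g] assms(2) M by (simp add: divide_inverse mult.commute)
  qed
  finally show "conv2_exp (u0 D) \<beta> (?c p) (?c q) = ext (\<lambda>u. ext (\<lambda>v. exp_w g S (u, v)) q) p" .
qed

lemma rep2_q_exp:
  assumes "rep2_0 \<beta> S"
  shows "rep2_0 (conv2_q_exp (u0 D) q \<beta>) (q_exp_w g q (group.ord kstar q) S)"
proof -
  have "rep2_0 (\<lambda>a b. \<Sum>m<group.ord kstar q. inverse (q_fact q m) * conv2_power (u0 D) \<beta> m a b)
     (\<lambda>z. \<Sum>m<group.ord kstar q. inverse (q_fact q m) * cpow g S m z)"
    by (intro rep2_sum rep2_scale rep2_power assms)
  then show ?thesis by (simp add: conv2_q_exp_def[abs_def] q_exp_w_def[abs_def] divide_inverse mult.commute)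
qed

section \<open>Functionals prescribed on the PBW basis\<close>

lemma pbw_cls: "pbw D a h = proj (\<lambda>_ _. 0) (\<lambda>_. 0) (pbw_word D a h)"
  by (simp add: pbw_def pbw_word_def var_word_def)

text \<open>Overflowing monomials are zero in u(D,0,0), so the prescribed values must be zero there;
  \<open>pbw_form\<close> leaves them open.\<close>

definition cut :: "((nat \<Rightarrow> nat) \<Rightarrow> 'g \<Rightarrow> 'k) \<Rightarrow> (nat \<Rightarrow> nat) \<Rightarrow> 'g \<Rightarrow> 'k" where
  "cut v a h = (if overflow D a then 0 else v a h)"

lemma good0_pbw_fun_cut: "good0 (pbw_fun D (cut v))"
  by (rule good0_pbw_fun) (simp add: cut_def)

text \<open>The lift of \<open>pbw_fun\<close> shows that the choice in \<open>pbw_form\<close> has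
  a witness, and the normal form shows that any witness has this pullback. The hypothesis on v is
  needed because a PBW monomial does not see exponents from \<theta> on.\<close>

lemma rep1_pbw_form:
  assumes v: "\<And>a b h. (\<And>i. i < \<theta> \<Longrightarrow> a i = b i) \<Longrightarrow> v a h = v b h"
  shows "rep1_0 (pbw_form D v) (pbw_fun D (cut v))"
proof -
  let ?Q = "\<lambda>f. linear_form (u0 D) f \<and> (\<forall>a h. pbw_exponent D a \<and> h \<in> G \<longrightarrow> f (pbw D a h) = v a h)"
  let ?s = "pbw_fun D (cut v)"
  have "lift ?s (pbw D a h) = v a h" if "pbw_exponent D a" "h \<in> G" for a h
  proof -
    have "lift ?s (pbw D a h) = ?s (pbw_word D a h)"
      unfolding pbw_cls using lift_cls[OF good0_pbw_fun_cut, of "mon (pbw_word D a h)" v] that by simp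
    also have "\<dots> = cut v (\<lambda>i. if i < \<theta> then a i else 0) h"
      by (simp add: pbw_fun_def pbw_word_nf that)
    also have "\<dots> = v (\<lambda>i. if i < \<theta> then a i else 0) h"
      using that by (auto simp: cut_def overflow_def pbw_exponent_def)
    also have "\<dots> = v a h" by (rule v) simp
    finally show ?thesis .
  qed
  then have Q0: "?Q (lift ?s)" using rep1_linear_form[OF good_rep1[OF good0_pbw_fun_cut]] by blast
  have Q: "?Q (pbw_form D v)" unfolding pbw_form_def by (rule someI[of ?Q, OF Q0])
  let ?f = "\<lambda>w. pbw_form D v (proj (\<lambda>_ _. 0) (\<lambda>_. 0) w)"
  have "?f w = ?s w" if w: "w \<in> W" for w
  proof -
    have g: "good0 ?f" using Q by (intro good_linear_form) blast
    show ?thesis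
    proof (cases "overflow D (occ w)")
      case True
      then show ?thesis using good0_normal_form(2)[OF g w] by (simp add: pbw_fun_def cut_def)
    next
      case False
      then have "pbw_exponent D (occ w)" by (auto simp: pbw_exponent_def overflow_def not_le)
      then have "?f (pbw_word D (occ w) (gprod D w)) = v (occ w) (gprod D w)"
        using Q gprod_closed[OF w] unfolding pbw_cls by blast
      then show ?thesis using good0_normal_form(1)[OF g w] False by (simp add: pbw_fun_def cut_def)
    qed
  qed
  moreover have "rep1_0 (pbw_form D v) ?f" using Q by (intro linear_form_rep1) blast
  ultimately show ?thesis by (rule rep1_cong[rotated])
qed

text \<open>The one-variable argument applied in each variable; the pullback nests one
  \<open>pbw_fun\<close> in the values of the other.\<close>

lemma rep2_pbw_form2:
  assumes v: "\<And>a b h a' b' h'. (\<And>i. i < \<theta> \<Longrightarrow> a i = b i) \<Longrightarrow> (\<And>i. i < \<theta> \<Longrightarrow> a' i = b' i) \<Longrightarrow> v a h a' h' = v b h b' h'"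
  shows "rep2_0 (pbw_form2 D v)
    (\<lambda>(x, y). pbw_fun D (cut (\<lambda>a h. pbw_fun D (cut (v a h)) y)) x)"
proof -
  let ?Q = "\<lambda>\<beta>. bilinear_form (u0 D) \<beta> \<and> (\<forall>a h b k. pbw_exponent D a \<and> h \<in> G \<and> pbw_exponent D b \<and> k \<in> G
     \<longrightarrow> \<beta> (pbw D a h) (pbw D b k) = v a h b k)"
  let ?S = "\<lambda>(x, y). pbw_fun D (cut (\<lambda>a h. pbw_fun D (cut (v a h)) y)) x"
  have "good0 (\<lambda>y. ?S (x, y))" for x
  proof (cases "overflow D (occ x)")
    case True
    then show ?thesis by (simp add: pbw_fun_def cut_def good_linear)
  next
    case False
    then have "?S (x, y) = coef D x * pbw_fun D (cut (v (occ x) (gprod D x))) y" for y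
      by (simp add: pbw_fun_def[of D _ x] cut_def)
    then show ?thesis by (auto intro!: good_linear good0_pbw_fun_cut)
  qed
  then have bg: "bigood0 ?S" unfolding bigood_def by (auto simp: good0_pbw_fun_cut)
  have exp0: "pbw_exponent D a \<Longrightarrow> \<not> overflow D (\<lambda>i. if i < \<theta> then a i else 0)" for a
    by (auto simp: overflow_def pbw_exponent_def)
  have "lift2 ?S (pbw D a h) (pbw D b k) = v a h b k"
    if "pbw_exponent D a" "h \<in> G" "pbw_exponent D b" "k \<in> G" for a h b k
  proof -
    have "lift2 ?S (pbw D a h) (pbw D b k) = ?S (pbw_word D a h, pbw_word D b k)"
      unfolding pbw_cls by (rule rep2_word[OF bigood_rep2[OF bg]]) (use that in auto)
    also have "\<dots> = v (\<lambda>i. if i < \<theta> then a i else 0) h (\<lambda>i. if i < \<theta> then b i else 0) k"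
      by (simp add: pbw_fun_def pbw_word_nf that cut_def exp0)
    also have "\<dots> = v a h b k" by (rule v) simp_all
    finally show ?thesis .
  qed
  then have Q0: "?Q (lift2 ?S)" using rep2_bilinear[OF bigood_rep2[OF bg]] by blast
  have Q: "?Q (pbw_form2 D v)" unfolding pbw_form2_def by (rule someI[of ?Q, OF Q0])
  let ?f = "\<lambda>(x, y). pbw_form2 D v (proj (\<lambda>_ _. 0) (\<lambda>_. 0) x) (proj (\<lambda>_ _. 0) (\<lambda>_. 0) y)"
  have r: "rep2_0 (pbw_form2 D v) ?f" using Q by (intro bilinear_rep2) blast
  note bgf = rep2_bigood[OF r, unfolded bigood_def]
  have "?f (x, y) = ?S (x, y)" if x: "x \<in> W" and y: "y \<in> W" for x y
  proof -
    have gx: "good0 (\<lambda>x. ?f (x, y))" if "y \<in> W" for y using bgf that by blast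
    have gy: "good0 (\<lambda>y. ?f (x, y))" if "x \<in> W" for x using bgf that by blast
    let ?bx = "pbw_word D (occ x) (gprod D x)" and ?by = "pbw_word D (occ y) (gprod D y)"
    have bW: "?bx \<in> W" "?by \<in> W" using x y by auto
    show ?thesis
    proof (cases "overflow D (occ x) \<or> overflow D (occ y)")
      case True
      then show ?thesis
        using good0_normal_form(2)[OF gx[OF y] x] good0_normal_form(2)[OF gy[OF x] y]
        by (auto simp: pbw_fun_def cut_def)
    next
      case False
      then have e: "pbw_exponent D (occ x)" "pbw_exponent D (occ y)"
        by (auto simp: pbw_exponent_def overflow_def not_le)
      have "?f (?bx, ?by) = v (occ x) (gprod D x) (occ y) (gprod D y)"
        using Q e gprod_closed[OF x] gprod_closed[OF y] unfolding pbw_cls by simp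
      then show ?thesis
        using good0_normal_form(1)[OF gx[OF y] x] good0_normal_form(1)[OF gy[OF bW(1)] y] False
        by (simp add: pbw_fun_def cut_def)
    qed
  qed
  then show ?thesis by (intro rep2_cong[OF r])
qed

end

section \<open>Coboundary deformations\<close>

lemma conv_tens_eps:
  "((f \<otimes>\<^sub>t eps) \<bullet>\<^bsub>g\<^esub> T) (u, w) = (f \<diamondop>\<^bsub>g\<^esub> (\<lambda>u. T (u, w))) u"
  "((eps \<otimes>\<^sub>t f) \<bullet>\<^bsub>g\<^esub> T) (u, w) = (f \<diamondop>\<^bsub>g\<^esub> (\<lambda>w. T (u, w))) w"
  "(T \<bullet>\<^bsub>g\<^esub> (f \<otimes>\<^sub>t eps)) (u, w) = ((\<lambda>u. T (u, w)) \<diamondop>\<^bsub>g\<^esub> f) u"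
  "(T \<bullet>\<^bsub>g\<^esub> (eps \<otimes>\<^sub>t f)) (u, w) = ((\<lambda>w. T (u, w)) \<diamondop>\<^bsub>g\<^esub> f) w"
proof -
  have "((f \<otimes>\<^sub>t eps) \<bullet>\<^bsub>g\<^esub> T) (u, w) = dsum (split g u) (\<lambda>x y. f x * dsum (split g w) (\<lambda>x' y'. eps x' * T (y, y')))"
    unfolding conv_prod_coalg by (simp add: mult_ac flip: dsum_mult_left)
  then show "((f \<otimes>\<^sub>t eps) \<bullet>\<^bsub>g\<^esub> T) (u, w) = (f \<diamondop>\<^bsub>g\<^esub> (\<lambda>u. T (u, w))) u"
    by (simp add: cw.counit_left conv_def)
  have "((eps \<otimes>\<^sub>t f) \<bullet>\<^bsub>g\<^esub> T) (u, w) = dsum (split g u) (\<lambda>x y. eps x * dsum (split g w) (\<lambda>x' y'. f x' * T (y, y')))"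
    unfolding conv_prod_coalg by (simp add: mult_ac flip: dsum_mult_left)
  then show "((eps \<otimes>\<^sub>t f) \<bullet>\<^bsub>g\<^esub> T) (u, w) = (f \<diamondop>\<^bsub>g\<^esub> (\<lambda>w. T (u, w))) w"
    by (simp add: cw.counit_left conv_def)
  have "(T \<bullet>\<^bsub>g\<^esub> (f \<otimes>\<^sub>t eps)) (u, w) = dsum (split g u) (\<lambda>x y. dsum (split g w) (\<lambda>x' y'. T (x, x') * eps y') * f y)"
    unfolding conv_prod_coalg by (simp add: mult_ac flip: dsum_mult_left)
  then show "(T \<bullet>\<^bsub>g\<^esub> (f \<otimes>\<^sub>t eps)) (u, w) = ((\<lambda>u. T (u, w)) \<diamondop>\<^bsub>g\<^esub> f) u"
    by (simp add: cw.counit_right conv_def)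
  have "(T \<bullet>\<^bsub>g\<^esub> (eps \<otimes>\<^sub>t f)) (u, w) = dsum (split g u) (\<lambda>x y. dsum (split g w) (\<lambda>x' y'. T (x, x') * f y') * eps y)"
    unfolding conv_prod_coalg by (simp add: mult_ac flip: dsum_mult_left)
  then show "(T \<bullet>\<^bsub>g\<^esub> (eps \<otimes>\<^sub>t f)) (u, w) = ((\<lambda>w. T (u, w)) \<diamondop>\<^bsub>g\<^esub> f) w"
    by (simp add: cw.counit_right conv_def)
qed

lemma eps_append2: "(\<lambda>(u, v). eps (u @ v)) = eps2"
  by auto

text \<open>The transpose of s \<mapsto> Q * s * P: the outer two legs of the double coproduct are
  evaluated by Q and P, the middle one is kept.\<close>

definition tw_word :: "(nat \<Rightarrow> 'g) \<Rightarrow> ('g letter list \<Rightarrow> 'k::field) \<Rightarrow> ('g letter list \<Rightarrow> 'k) \<Rightarrow>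
    'g letter list \<Rightarrow> ('g letter list \<Rightarrow>\<^sub>0 'k)" where
  "tw_word g Q P w = (\<Sum>(a, b)\<leftarrow>split g w. \<Sum>(c, d)\<leftarrow>split g b. Poly_Mapping.single c (Q a * P d))"

definition tw :: "(nat \<Rightarrow> 'g) \<Rightarrow> ('g letter list \<Rightarrow> 'k::field) \<Rightarrow> ('g letter list \<Rightarrow> 'k) \<Rightarrow>
    ('g letter list \<Rightarrow>\<^sub>0 'k) \<Rightarrow> ('g letter list \<Rightarrow>\<^sub>0 'k)" where
  "tw g Q P p = (\<Sum>w\<in>Poly_Mapping.keys p. const (Poly_Mapping.lookup p w) * tw_word g Q P w)"

lemma ext_sum_list: "ext s (\<Sum>(x, y)\<leftarrow>xs. F x y) = dsum xs (\<lambda>x y. ext s (F x y))"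
  by (induction xs) auto

lemma ext_tw: "ext s (tw g Q P p) = ext (Q \<diamondop>\<^bsub>g\<^esub> (s \<diamondop>\<^bsub>g\<^esub> P)) p"
proof -
  have "ext s (tw_word g Q P w) = (Q \<diamondop>\<^bsub>g\<^esub> (s \<diamondop>\<^bsub>g\<^esub> P)) w" for w
    unfolding tw_word_def ext_sum_list conv_def by (simp add: mult_ac flip: dsum_mult_left)
  then show ?thesis unfolding tw_def ext_sum by (simp add: ext_def[of _ p])
qed

lemma keys_sum_list:
  "(\<And>x y. (x, y) \<in> set xs \<Longrightarrow> Poly_Mapping.keys (F x y) \<subseteq> A) \<Longrightarrow> Poly_Mapping.keys (\<Sum>(x, y)\<leftarrow>xs. F x y) \<subseteq> A"
proof (induction xs)
  case (Cons z xs)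
  then show ?case
    using keys_add[of "F (fst z) (snd z)" "\<Sum>(x, y)\<leftarrow>xs. F x y"] by (cases z) fastforce
qed simp

lemma keys_sum_subset:
  "(\<And>i. i \<in> I \<Longrightarrow> Poly_Mapping.keys (F i) \<subseteq> A) \<Longrightarrow> Poly_Mapping.keys (\<Sum>i\<in>I. F i) \<subseteq> A"
proof (induction I rule: infinite_finite_induct)
  case (insert i I)
  then show ?case using keys_add[of "F i" "sum F I"] by auto
qed auto

lemma lookup_ext: "Poly_Mapping.lookup p z = ext (\<lambda>x. if x = z then 1 else 0) p"
  by (simp add: ext_def if_distrib[of "\<lambda>x. _ * x"] in_keys_iff cong: if_cong)

section \<open>Tensor decompositions and the deformed product tested by linear forms\<close>

context sdatum
begin

lemma tw_P0 [simp]: "p \<in> P0 \<Longrightarrow> tw g Q P p \<in> P0"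
proof -
  assume p: "p \<in> P0"
  have kw: "Poly_Mapping.keys (tw_word g Q P w) \<subseteq> W" if "w \<in> W" for w
    unfolding tw_word_def
  proof (intro keys_sum_list)
    fix a b c d assume "(a, b) \<in> set (split g w)" "(c, d) \<in> set (split g b)"
    then have "c \<in> W" using that split_W by blast
    then show "Poly_Mapping.keys (Poly_Mapping.single c (Q a * P d)) \<subseteq> W" by simp
  qed
  show "tw g Q P p \<in> P0" unfolding mem_Collect_eq tw_def
    by (intro keys_sum_subset subset_trans[OF keys_const_mult] kw) (use p in blast)
qed

lemma cls0_eqI:
  assumes "p \<in> P0" "q \<in> P0" "\<And>s. good0 s \<Longrightarrow> ext s p = ext s q"
  shows "cls D (\<lambda>_ _. 0) (\<lambda>_. 0) p = cls D (\<lambda>_ _. 0) (\<lambda>_. 0) q"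
proof -
  have "p - q \<in> rel_ideal D (\<lambda>_ _. 0) (\<lambda>_. 0)"
    by (rule twisted_separation[where P = eps and Q = eps]) (use assms P0_closed(2)[of p q] in auto)
  then show ?thesis using cls_eq assms by blast
qed

lemma bigood0_diff: "bigood l \<mu> S \<Longrightarrow> bigood l \<mu> T \<Longrightarrow> bigood l \<mu> (\<lambda>z. S z - T z)"
  by (simp add: bigood_def good_linear)

lemma bigood0_eps2: "bigood0 eps2"
  by (rule rep2_bigood[OF rep2_unit])

lemma bigood0_cpow: "bigood0 S \<Longrightarrow> bigood0 (cpow g S n)"
  by (induction n) (auto simp: bigood0_eps2 bigood0_conv)

text \<open>The inverse is the geometric series in \<open>eps2 - S\<close>, which is locally finite.\<close>

lemma bigood0_inverse:
  assumes S: "bigood0 S" and R: "S \<bullet>\<^bsub>g\<^esub> R = eps2" and one: "\<And>z. deg (fst z) + deg (snd z) = 0 \<Longrightarrow> S z = 1"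
  shows "bigood0 R"
proof -
  let ?n = "\<lambda>z. eps2 z - S z"
  have n: "?n z = 0" if "deg (fst z) + deg (snd z) = 0" for z
    using that one[of z] by (simp add: tens_def eps_deg)
  have "(\<lambda>z. eps2 z - S z) \<bullet>\<^bsub>g\<^esub> R = (\<lambda>z. R z - eps2 z)" by (simp add: conv_linear R)
  then have R_eq: "R = (\<lambda>z. eps2 z + (?n \<bullet>\<^bsub>g\<^esub> R) z)" by simp
  have comm: "cpow g ?n k \<bullet>\<^bsub>g\<^esub> ?n = cpow g ?n (Suc k)" for k
    using cw2.conv_commute_pow[of ?n g ?n 1 k] by simp
  have step: "(cpow g ?n k \<bullet>\<^bsub>g\<^esub> R) z = cpow g ?n k z + (cpow g ?n (Suc k) \<bullet>\<^bsub>g\<^esub> R) z" for k z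
  proof -
    have "cpow g ?n k \<bullet>\<^bsub>g\<^esub> R = cpow g ?n k \<bullet>\<^bsub>g\<^esub> (\<lambda>z. eps2 z + (?n \<bullet>\<^bsub>g\<^esub> R) z)" by (subst R_eq) simp
    also have "\<dots> = (\<lambda>z. cpow g ?n k z + ((cpow g ?n k \<bullet>\<^bsub>g\<^esub> ?n) \<bullet>\<^bsub>g\<^esub> R) z)"
      unfolding conv_linear(7) cw2.conv_assoc by simp
    finally show ?thesis unfolding comm by metis
  qed
  have series: "R z = (\<Sum>k<M. cpow g ?n k z) + (cpow g ?n M \<bullet>\<^bsub>g\<^esub> R) z" for M z
  proof (induction M)
    case (Suc M)
    then show ?case using step[of M z] by (simp del: funpow.simps)
  qed simp
  have R: "R z = (\<Sum>k<M. cpow g ?n k z)" if "deg (fst z) + deg (snd z) < M" for M z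
  proof -
    have "(cpow g ?n M \<bullet>\<^bsub>g\<^esub> R) z = ((\<lambda>z. 0) \<bullet>\<^bsub>g\<^esub> R) z"
    proof (rule conv_cong)
      fix x y assume "(x, y) \<in> set ((split g \<otimes>\<^sub>c split g) z)"
      then show "cpow g ?n M x = 0" using split2_deg that n by (intro cpow_vanish) fastforce+
    qed simp
    then show ?thesis using series[of z M] by (simp add: conv_linear)
  qed
  have good_n: "bigood0 (cpow g ?n k)" for k by (intro bigood0_cpow bigood0_diff bigood0_eps2 S)
  show ?thesis unfolding bigood_def good_def
  proof (intro conjI ballI)
    fix v p assume v: "v \<in> W" and p: "p \<in> rel_ideal D (\<lambda>_ _. 0) (\<lambda>_. 0)"
    define M where "M = Suc (Max (insert 0 (deg ` Poly_Mapping.keys p)) + deg v)"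
    have "deg u + deg v < M" if "u \<in> Poly_Mapping.keys p" for u
      unfolding M_def less_Suc_eq_le using that by (intro add_right_mono Max_ge) auto
    then have "ext (\<lambda>u. R (u, v)) p = ext (\<lambda>u. \<Sum>k<M. cpow g ?n k (u, v)) p" by (intro ext_cong R) auto
    then show "ext (\<lambda>u. R (u, v)) p = 0"
      using good_n v p unfolding ext_fun bigood_def good_def by simp
  next
    fix u p assume u: "u \<in> W" and p: "p \<in> rel_ideal D (\<lambda>_ _. 0) (\<lambda>_. 0)"
    define M where "M = Suc (deg u + Max (insert 0 (deg ` Poly_Mapping.keys p)))"
    have "deg u + deg v < M" if "v \<in> Poly_Mapping.keys p" for v
      unfolding M_def less_Suc_eq_le using that by (intro add_left_mono Max_ge) auto
    then have "ext (\<lambda>v. R (u, v)) p = ext (\<lambda>v. \<Sum>k<M. cpow g ?n k (u, v)) p" by (intro ext_cong R) auto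
    then show "ext (\<lambda>v. R (u, v)) p = 0"
      using good_n u p unfolding ext_fun bigood_def good_def by simp
  qed
qed

lemma bigood0_append: "good0 s \<Longrightarrow> bigood0 (\<lambda>(u, v). s (u @ v))"
  unfolding bigood_def using good_translate[of _ _ s "[]"] good_translate[of _ _ s _ "[]"] by auto

lemma rep2_mult: "rep1_0 f s \<Longrightarrow> rep2_0 (\<lambda>a b. f (a \<otimes>\<^bsub>u0 D\<^esub> b)) (\<lambda>(u, v). s (u @ v))"
  unfolding rep1_def rep2_def by (simp add: u_mult[simplified] P0_closed[simplified] ext_mult)

text \<open>u(D,0,0) is finite-dimensional. Here \<open>d k\<close> is the dual PBW basis and
  \<open>b k\<close> is B with the corresponding PBW word in its first argument.\<close>

lemma bigood0_decomp:
  assumes B: "bigood0 B"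
  obtains d b where "\<And>k. good0 (d k)" "\<And>k. k \<in> exponents \<times> G \<Longrightarrow> good0 (b k)"
    "\<And>u v. u \<in> W \<Longrightarrow> v \<in> W \<Longrightarrow> B (u, v) = (\<Sum>k\<in>exponents \<times> G. d k u * b k v)"
proof -
  define d where "d k = pbw_fun D (cut (\<lambda>a h. if (a, h) = k then 1 else 0))" for k
  define b where "b k v = B (pbw_word D (fst k) (snd k), v)" for k v
  show ?thesis
  proof (rule that[of d b])
    show "good0 (d k)" for k unfolding d_def by (rule good0_pbw_fun_cut)
    show "good0 (b k)" if "k \<in> exponents \<times> G" for k
      using B that unfolding b_def bigood_def by auto
    fix u v assume u: "u \<in> W" and v: "v \<in> W"
    have gB: "good0 (\<lambda>u. B (u, v))" using B v by (simp add: bigood_def)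
    show "B (u, v) = (\<Sum>k\<in>exponents \<times> G. d k u * b k v)"
    proof (cases "overflow D (occ u)")
      case True
      then show ?thesis using good0_normal_form(2)[OF gB u] by (simp add: d_def pbw_fun_def cut_def)
    next
      case False
      let ?k = "(occ u, gprod D u)"
      have k: "?k \<in> exponents \<times> G" using occ_exponents[OF u False] u by auto
      have "d k u * b k v = (if k = ?k then coef D u * b ?k v else 0)" for k
        using False by (auto simp: d_def pbw_fun_def cut_def)
      then have "(\<Sum>k\<in>exponents \<times> G. d k u * b k v) = coef D u * b ?k v"
        using k finite_exponents finite_G by simp
      then show ?thesis using good0_normal_form(1)[OF gB u] by (simp add: b_def)
    qed
  qed
qed

text \<open>Well-definedness of the coproduct when paired with an arbitrary bilinear form, reduced
  to convolutions of good functionals by the decomposition into tensors.\<close>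

lemma good0_comult:
  assumes B: "bigood0 B"
  shows "good0 (\<lambda>w. dsum (split g w) (\<lambda>u v. B (u, v)))"
proof -
  obtain d b where db: "\<And>k. good0 (d k)" "\<And>k. k \<in> exponents \<times> G \<Longrightarrow> good0 (b k)"
    "\<And>u v. u \<in> W \<Longrightarrow> v \<in> W \<Longrightarrow> B (u, v) = (\<Sum>k\<in>exponents \<times> G. d k u * b k v)"
    using bigood0_decomp[OF B] by blast
  show ?thesis
  proof (rule good_cong_W)
    show "good0 (\<lambda>w. \<Sum>k\<in>exponents \<times> G. (d k \<diamondop>\<^bsub>g\<^esub> b k) w)"
      by (intro good_linear good0_conv db)
    fix w assume w: "w \<in> W"
    have "(\<Sum>k\<in>exponents \<times> G. (d k \<diamondop>\<^bsub>g\<^esub> b k) w) = dsum (split g w) (\<lambda>u v. \<Sum>k\<in>exponents \<times> G. d k u * b k v)"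
      unfolding conv_def dsum_sum ..
    also have "\<dots> = dsum (split g w) (\<lambda>u v. B (u, v))"
      using split_W[OF _ w] by (intro dsum_cong db(3)[symmetric]) blast+
    finally show "(\<Sum>k\<in>exponents \<times> G. (d k \<diamondop>\<^bsub>g\<^esub> b k) w) = dsum (split g w) (\<lambda>u v. B (u, v))" .
  qed
qed

text \<open>Sums and products in the Sweedler expressions are controlled only on the carrier, so the
  legs of a coproduct must be known to lie there.\<close>

lemma comult_keys:
  assumes a: "a \<in> carrier (u_alg D l \<mu>)" and z: "z \<in> Poly_Mapping.keys (comult (u_alg D l \<mu>) a)"
  shows "fst z \<in> carrier (u_alg D l \<mu>)" "snd z \<in> carrier (u_alg D l \<mu>)"
proof -
  \<comment> \<open>Pairing the coproduct with the indicator of z reads off the coefficient of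
    z.\<close>
  let ?i = "\<lambda>x. if x = z then 1 else 0 :: 'k"
  have "ext ?i (comult (u_alg D l \<mu>) a) \<noteq> 0" using z by (simp add: in_keys_iff lookup_ext[symmetric])
  then have ne: "ext (\<lambda>w. dsum (split g w) (\<lambda>u v. ?i (proj l \<mu> u, proj l \<mu> v))) (SOME p. p \<in> a) \<noteq> 0"
    using sweedler_comult[OF a, of "\<lambda>x y. ?i (x, y)"] by (simp add: sweedler_ext)
  have "\<exists>u\<in>W. \<exists>v\<in>W. z = (proj l \<mu> u, proj l \<mu> v)"
  proof (rule ccontr)
    assume no: "\<not> ?thesis"
    have "ext (\<lambda>w. dsum (split g w) (\<lambda>u v. ?i (proj l \<mu> u, proj l \<mu> v))) (SOME p. p \<in> a) = ext (\<lambda>w. 0) (SOME p. p \<in> a)"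
    proof (rule ext_cong_P0[OF some_rep(1)[OF a]])
      fix w assume w: "w \<in> W"
      have "dsum (split g w) (\<lambda>u v. ?i (proj l \<mu> u, proj l \<mu> v)) = dsum (split g w) (\<lambda>u v. 0)"
      proof (rule dsum_cong)
        fix u v assume "(u, v) \<in> set (split g w)"
        then have "u \<in> W" "v \<in> W" using split_W w by blast+
        then show "?i (proj l \<mu> u, proj l \<mu> v) = 0" using no by metis
      qed
      then show "dsum (split g w) (\<lambda>u v. ?i (proj l \<mu> u, proj l \<mu> v)) = 0" by simp
    qed
    then show False using ne by (simp add: ext_fun)
  qed
  then show "fst z \<in> carrier (u_alg D l \<mu>)" "snd z \<in> carrier (u_alg D l \<mu>)" using mon_P0 cls_closed by auto
qed

lemma sweedler_in_closed:
  assumes "\<And>z. z \<in> Poly_Mapping.keys t \<Longrightarrow> F (fst z) (snd z) \<in> carrier (u0 D)"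
  shows "sweedler_in (u0 D) t F \<in> carrier (u0 D)"
    and "linear_form (u0 D) f \<Longrightarrow> f (sweedler_in (u0 D) t F) = sweedler t (\<lambda>x y. f (F x y))"
proof -
  interpret M: abelian_monoid "u0 D" by (rule abelian_monoid_u)
  have sm: "c \<odot>\<^bsub>u0 D\<^esub> a \<in> carrier (u0 D)" if "a \<in> carrier (u0 D)" for c a
    using that P0_closed(4) by (auto simp: u_carrier u_smult[simplified])
  let ?H = "\<lambda>z. Poly_Mapping.lookup t z \<odot>\<^bsub>u0 D\<^esub> F (fst z) (snd z)"
  have H: "?H z \<in> carrier (u0 D)" if "z \<in> Poly_Mapping.keys t" for z using assms that sm by blast
  then show "sweedler_in (u0 D) t F \<in> carrier (u0 D)"
    unfolding sweedler_in_def by (intro M.finsum_closed) auto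
  show "f (sweedler_in (u0 D) t F) = sweedler t (\<lambda>x y. f (F x y))" if f: "linear_form (u0 D) f"
  proof -
    have "f (\<Oplus>\<^bsub>u0 D\<^esub>z\<in>A. ?H z) = (\<Sum>z\<in>A. Poly_Mapping.lookup t z * f (F (fst z) (snd z)))"
      if "finite A" "A \<subseteq> Poly_Mapping.keys t" for A
      using that
    proof (induction A)
      case empty
      then show ?case using linear_form_zero[OF f] by (simp add: u_zero)
    next
      case (insert z A)
      have c: "?H z \<in> carrier (u0 D)" "(\<Oplus>\<^bsub>u0 D\<^esub>z\<in>A. ?H z) \<in> carrier (u0 D)"
        using insert H by (auto intro!: M.finsum_closed)
      have "f (\<Oplus>\<^bsub>u0 D\<^esub>z\<in>insert z A. ?H z) = f (?H z \<oplus>\<^bsub>u0 D\<^esub> (\<Oplus>\<^bsub>u0 D\<^esub>z\<in>A. ?H z))"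
        using insert H by (subst M.finsum_insert) auto
      also have "\<dots> = f (?H z) + f (\<Oplus>\<^bsub>u0 D\<^esub>z\<in>A. ?H z)"
        using f c unfolding linear_form_def by blast
      also have "f (?H z) = Poly_Mapping.lookup t z * f (F (fst z) (snd z))"
        using f assms insert unfolding linear_form_def by blast
      finally show ?case using insert by simp
    qed
    then show ?thesis by (simp add: sweedler_in_def sweedler_def)
  qed
qed

text \<open>A linear form passes through the four nested sums of the deformed product and turns it
  into the scalar convolution of \<sigma>, f after multiplication, and the inverse of
  \<sigma>.\<close>

lemma twist_mult:
  assumes a: "a \<in> carrier (u0 D)" and b: "b \<in> carrier (u0 D)"
  shows "a \<otimes>\<^bsub>twist (u0 D) \<sigma>\<^esub> b \<in> carrier (u0 D)"
    and "linear_form (u0 D) f \<Longrightarrow> f (a \<otimes>\<^bsub>twist (u0 D) \<sigma>\<^esub> b) =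
      conv2 (u0 D) \<sigma> (conv2 (u0 D) (\<lambda>x y. f (x \<otimes>\<^bsub>u0 D\<^esub> y)) (conv2_inverse (u0 D) \<sigma>)) a b"
proof -
  let ?\<tau> = "conv2_inverse (u0 D) \<sigma>"
  let ?F = "\<lambda>a1 b1 a3 b3 a2 b2. (\<sigma> a1 b1 * ?\<tau> a3 b3) \<odot>\<^bsub>u0 D\<^esub> (a2 \<otimes>\<^bsub>u0 D\<^esub> b2)"
  have mult: "x \<otimes>\<^bsub>u0 D\<^esub> y \<in> carrier (u0 D)" if "x \<in> carrier (u0 D)" "y \<in> carrier (u0 D)" for x y
    using that P0_closed(3) by (auto simp: u_carrier u_mult[simplified])
  have sm: "c \<odot>\<^bsub>u0 D\<^esub> a \<in> carrier (u0 D)" if "a \<in> carrier (u0 D)" for c a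
    using that P0_closed(4) by (auto simp: u_carrier u_smult[simplified])
  have def: "a \<otimes>\<^bsub>twist (u0 D) \<sigma>\<^esub> b = sweedler_in (u0 D) (comult (u0 D) a) (\<lambda>a1 a'. sweedler_in (u0 D) (comult (u0 D) a') (\<lambda>a2 a3.
       sweedler_in (u0 D) (comult (u0 D) b) (\<lambda>b1 b'. sweedler_in (u0 D) (comult (u0 D) b') (\<lambda>b2 b3.
         ?F a1 b1 a3 b3 a2 b2))))"
    by (simp add: twist_def)
  have 4: "sweedler_in (u0 D) (comult (u0 D) b') (\<lambda>b2 b3. ?F a1 b1 a3 b3 a2 b2) \<in> carrier (u0 D)"
    if "a2 \<in> carrier (u0 D)" "b' \<in> carrier (u0 D)" for a1 b1 a3 a2 b'
    using that by (intro sweedler_in_closed(1) sm mult comult_keys(1))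
  have 3: "sweedler_in (u0 D) (comult (u0 D) b) (\<lambda>b1 b'. sweedler_in (u0 D) (comult (u0 D) b') (\<lambda>b2 b3. ?F a1 b1 a3 b3 a2 b2)) \<in> carrier (u0 D)"
    if "a2 \<in> carrier (u0 D)" for a1 a3 a2
    using that b by (intro sweedler_in_closed(1) 4 comult_keys(2))
  have 2: "sweedler_in (u0 D) (comult (u0 D) a') (\<lambda>a2 a3.
       sweedler_in (u0 D) (comult (u0 D) b) (\<lambda>b1 b'. sweedler_in (u0 D) (comult (u0 D) b') (\<lambda>b2 b3. ?F a1 b1 a3 b3 a2 b2))) \<in> carrier (u0 D)"
    if "a' \<in> carrier (u0 D)" for a1 a'
    using that by (intro sweedler_in_closed(1) 3 comult_keys(1))
  show "a \<otimes>\<^bsub>twist (u0 D) \<sigma>\<^esub> b \<in> carrier (u0 D)"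
    unfolding def using a by (intro sweedler_in_closed(1) 2 comult_keys(2))
  assume f: "linear_form (u0 D) f"
  have cong: "sweedler t F = sweedler t F'" if "\<And>z. z \<in> Poly_Mapping.keys t \<Longrightarrow> F (fst z) (snd z) = F' (fst z) (snd z)"
    for t :: "(('g letter list \<Rightarrow>\<^sub>0 'k) set \<times> ('g letter list \<Rightarrow>\<^sub>0 'k) set) \<Rightarrow>\<^sub>0 'k" and F F'
    unfolding sweedler_ext by (rule ext_cong) (use that in auto)
  have f4: "f (sweedler_in (u0 D) (comult (u0 D) b') (\<lambda>b2 b3. ?F a1 b1 a3 b3 a2 b2)) =
     sweedler (comult (u0 D) b') (\<lambda>b2 b3. \<sigma> a1 b1 * ?\<tau> a3 b3 * f (a2 \<otimes>\<^bsub>u0 D\<^esub> b2))"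
    if "a2 \<in> carrier (u0 D)" "b' \<in> carrier (u0 D)" for a1 b1 a3 a2 b'
  proof -
    have "f (sweedler_in (u0 D) (comult (u0 D) b') (\<lambda>b2 b3. ?F a1 b1 a3 b3 a2 b2)) =
      sweedler (comult (u0 D) b') (\<lambda>b2 b3. f (?F a1 b1 a3 b3 a2 b2))"
      using that by (intro sweedler_in_closed(2) sm mult comult_keys(1) f)
    also have "\<dots> = sweedler (comult (u0 D) b') (\<lambda>b2 b3. \<sigma> a1 b1 * ?\<tau> a3 b3 * f (a2 \<otimes>\<^bsub>u0 D\<^esub> b2))"
    proof (rule cong)
      fix z assume "z \<in> Poly_Mapping.keys (comult (u0 D) b')"
      then have "a2 \<otimes>\<^bsub>u0 D\<^esub> fst z \<in> carrier (u0 D)" using that by (intro mult comult_keys(1))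
      then show "f (?F a1 b1 a3 (snd z) a2 (fst z)) = \<sigma> a1 b1 * ?\<tau> a3 (snd z) * f (a2 \<otimes>\<^bsub>u0 D\<^esub> fst z)"
        using f unfolding linear_form_def by blast
    qed
    finally show ?thesis .
  qed
  have f3: "f (sweedler_in (u0 D) (comult (u0 D) b) (\<lambda>b1 b'. sweedler_in (u0 D) (comult (u0 D) b') (\<lambda>b2 b3. ?F a1 b1 a3 b3 a2 b2))) =
     sweedler (comult (u0 D) b) (\<lambda>b1 b'. sweedler (comult (u0 D) b') (\<lambda>b2 b3. \<sigma> a1 b1 * ?\<tau> a3 b3 * f (a2 \<otimes>\<^bsub>u0 D\<^esub> b2)))"
    if "a2 \<in> carrier (u0 D)" for a1 a3 a2
    by (subst sweedler_in_closed(2)[OF _ f], intro 4 that comult_keys(2)[OF b], assumption)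
      (intro cong f4 that comult_keys(2)[OF b])
  have f2: "f (sweedler_in (u0 D) (comult (u0 D) a') (\<lambda>a2 a3.
       sweedler_in (u0 D) (comult (u0 D) b) (\<lambda>b1 b'. sweedler_in (u0 D) (comult (u0 D) b') (\<lambda>b2 b3. ?F a1 b1 a3 b3 a2 b2)))) =
     sweedler (comult (u0 D) a') (\<lambda>a2 a3. sweedler (comult (u0 D) b) (\<lambda>b1 b'. sweedler (comult (u0 D) b') (\<lambda>b2 b3. \<sigma> a1 b1 * ?\<tau> a3 b3 * f (a2 \<otimes>\<^bsub>u0 D\<^esub> b2))))"
    if a': "a' \<in> carrier (u0 D)" for a1 a'
    by (subst sweedler_in_closed(2)[OF _ f], intro 3 comult_keys(1)[OF a'], assumption)
      (intro cong f3 comult_keys(1)[OF a'])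
  have "f (a \<otimes>\<^bsub>twist (u0 D) \<sigma>\<^esub> b) = sweedler (comult (u0 D) a) (\<lambda>a1 a'. sweedler (comult (u0 D) a') (\<lambda>a2 a3.
       sweedler (comult (u0 D) b) (\<lambda>b1 b'. sweedler (comult (u0 D) b') (\<lambda>b2 b3. \<sigma> a1 b1 * ?\<tau> a3 b3 * f (a2 \<otimes>\<^bsub>u0 D\<^esub> b2)))))"
    unfolding def by (subst sweedler_in_closed(2)[OF _ f], intro 2 comult_keys(2)[OF a], assumption)
      (intro cong f2 comult_keys(2)[OF a])
  \<comment> \<open>The definition of the deformation finishes splitting a before it touches b,
    whereas nested convolution alternates; the exchange of two sums reconciles them.\<close>
  also have "\<dots> = conv2 (u0 D) \<sigma> (conv2 (u0 D) (\<lambda>x y. f (x \<otimes>\<^bsub>u0 D\<^esub> y)) ?\<tau>) a b"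
    unfolding conv2_def sweedler_ext
    by (subst ext_swap) (simp add: mult_ac flip: ext_fun(5))
  finally show "f (a \<otimes>\<^bsub>twist (u0 D) \<sigma>\<^esub> b) = conv2 (u0 D) \<sigma> (conv2 (u0 D) (\<lambda>x y. f (x \<otimes>\<^bsub>u0 D\<^esub> y)) ?\<tau>) a b" .
qed

end

text \<open>The two sides of the cocycle identity are natural for different bracketings of the
  threefold tensor product; this lemma passes between them.\<close>

lemma conv3_reassoc:
  "(F \<star>\<^bsub>split g \<otimes>\<^sub>c split g \<otimes>\<^sub>c split g\<^esub> H) (u, v, w) =
   ((\<lambda>((u, v), w). F (u, v, w)) \<star>\<^bsub>(split g \<otimes>\<^sub>c split g) \<otimes>\<^sub>c split g\<^esub> (\<lambda>((u, v), w). H (u, v, w))) ((u, v), w)"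
  by (simp add: conv_prod_coalg dsum_prod_coalg)

lemma conv3_append_right:
  "(\<lambda>(u, v, w). S (u, v @ w)) \<star>\<^bsub>split g \<otimes>\<^sub>c split g \<otimes>\<^sub>c split g\<^esub> (\<lambda>(u, v, w). T (u, v @ w)) =
   (\<lambda>(u, v, w). (S \<bullet>\<^bsub>g\<^esub> T) (u, v @ w))"
  by (auto simp: fun_eq_iff conv_prod_coalg dsum_prod_coalg dsum_split_append)

lemma conv3_append_left:
  "(\<lambda>((u, v), w). S (u @ v, w)) \<star>\<^bsub>(split g \<otimes>\<^sub>c split g) \<otimes>\<^sub>c split g\<^esub> (\<lambda>((u, v), w). T (u @ v, w)) =
   (\<lambda>((u, v), w). (S \<bullet>\<^bsub>g\<^esub> T) (u @ v, w))"
  by (auto simp: fun_eq_iff conv_prod_coalg dsum_prod_coalg dsum_split_append)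

interpretation cw3: coalg "split g \<otimes>\<^sub>c split g \<otimes>\<^sub>c split g" "eps \<otimes>\<^sub>t eps2" for g
  by (intro coalg_prod coalg_split)

interpretation cw3': coalg "(split g \<otimes>\<^sub>c split g) \<otimes>\<^sub>c split g" "eps2 \<otimes>\<^sub>t eps" for g
  by (intro coalg_prod coalg_split)

section \<open>Coboundaries are cocycles\<close>

definition coboundary :: "(nat \<Rightarrow> 'g) \<Rightarrow> ('g letter list \<Rightarrow> 'k::field) \<Rightarrow> ('g letter list \<Rightarrow> 'k) \<Rightarrow>
    'g letter list \<times> 'g letter list \<Rightarrow> 'k" where
  "coboundary g P Q = (P \<otimes>\<^sub>t P) \<bullet>\<^bsub>g\<^esub> (\<lambda>(u, v). Q (u @ v))"

text \<open>Both sides equal P \<otimes> P \<otimes> P convolved with Q on the concatenation of all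
  three words: on each side the inner Q on a product of two words cancels the P on the same
  product.\<close>

lemma coboundary_cocycle:
  assumes QP: "Q \<diamondop>\<^bsub>g\<^esub> P = eps"
  defines "S \<equiv> coboundary g P Q"
  shows "((\<lambda>(u, v, w). eps u * S (v, w)) \<star>\<^bsub>split g \<otimes>\<^sub>c split g \<otimes>\<^sub>c split g\<^esub> (\<lambda>(u, v, w). S (u, v @ w))) (u, v, w) =
    ((\<lambda>(u, v, w). S (u, v) * eps w) \<star>\<^bsub>split g \<otimes>\<^sub>c split g \<otimes>\<^sub>c split g\<^esub> (\<lambda>(u, v, w). S (u @ v, w))) (u, v, w)"
proof -
  let ?D = "split g \<otimes>\<^sub>c split g \<otimes>\<^sub>c split g" and ?D' = "(split g \<otimes>\<^sub>c split g) \<otimes>\<^sub>c split g"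
  let ?Q2 = "\<lambda>(u, v). Q (u @ v)" and ?Q3 = "\<lambda>(u, v, w). Q (u @ v @ w)" and ?Q3' = "\<lambda>((u, v), w). Q (u @ v @ w)"
  have Qm: "?Q2 \<bullet>\<^bsub>g\<^esub> (\<lambda>(u, v). P (u @ v)) = eps2" by (simp only: conv_append QP eps_append2)
  have "(\<lambda>(u, v, w). eps u * S (v, w)) = (eps \<otimes>\<^sub>t (P \<otimes>\<^sub>t P)) \<star>\<^bsub>?D\<^esub> (eps \<otimes>\<^sub>t ?Q2)"
    by (simp add: conv_tens S_def coboundary_def) (auto simp: tens_def)
  moreover have "(\<lambda>(u, v, w). S (u, v @ w)) = (P \<otimes>\<^sub>t (\<lambda>(u, v). P (u @ v))) \<star>\<^bsub>?D\<^esub> ?Q3"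
  proof -
    have "(P \<otimes>\<^sub>t (\<lambda>(u, v). P (u @ v))) = (\<lambda>(u, v, w). (P \<otimes>\<^sub>t P) (u, v @ w))" by (auto simp: tens_def)
    moreover have "?Q3 = (\<lambda>(u, v, w). ?Q2 (u, v @ w))" by auto
    ultimately show ?thesis unfolding S_def coboundary_def by (simp only: conv3_append_right)
  qed
  ultimately have "(\<lambda>(u, v, w). eps u * S (v, w)) \<star>\<^bsub>?D\<^esub> (\<lambda>(u, v, w). S (u, v @ w)) =
      (eps \<otimes>\<^sub>t (P \<otimes>\<^sub>t P)) \<star>\<^bsub>?D\<^esub> (((eps \<otimes>\<^sub>t ?Q2) \<star>\<^bsub>?D\<^esub> (P \<otimes>\<^sub>t (\<lambda>(u, v). P (u @ v)))) \<star>\<^bsub>?D\<^esub> ?Q3)"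
    by (simp only: cw3.conv_assoc)
  also have "\<dots> = (eps \<otimes>\<^sub>t (P \<otimes>\<^sub>t P)) \<star>\<^bsub>?D\<^esub> ((P \<otimes>\<^sub>t eps2) \<star>\<^bsub>?D\<^esub> ?Q3)"
    by (simp only: conv_tens Qm cw.conv_unit)
  also have "\<dots> = ((eps \<otimes>\<^sub>t (P \<otimes>\<^sub>t P)) \<star>\<^bsub>?D\<^esub> (P \<otimes>\<^sub>t eps2)) \<star>\<^bsub>?D\<^esub> ?Q3"
    by (rule cw3.conv_assoc[symmetric])
  also have "\<dots> = (P \<otimes>\<^sub>t P \<otimes>\<^sub>t P) \<star>\<^bsub>?D\<^esub> ?Q3"
    by (simp only: conv_tens cw.conv_unit cw2.conv_unit)
  finally have L: "(\<lambda>(u, v, w). eps u * S (v, w)) \<star>\<^bsub>?D\<^esub> (\<lambda>(u, v, w). S (u, v @ w)) = (P \<otimes>\<^sub>t P \<otimes>\<^sub>t P) \<star>\<^bsub>?D\<^esub> ?Q3" .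
  have "(\<lambda>((u, v), w). S (u, v) * eps w) = ((P \<otimes>\<^sub>t P) \<otimes>\<^sub>t eps) \<star>\<^bsub>?D'\<^esub> (?Q2 \<otimes>\<^sub>t eps)"
    by (simp add: conv_tens S_def coboundary_def) (auto simp: tens_def)
  moreover have "(\<lambda>((u, v), w). S (u @ v, w)) = ((\<lambda>(u, v). P (u @ v)) \<otimes>\<^sub>t P) \<star>\<^bsub>?D'\<^esub> ?Q3'"
  proof -
    have "((\<lambda>(u, v). P (u @ v)) \<otimes>\<^sub>t P) = (\<lambda>((u, v), w). (P \<otimes>\<^sub>t P) (u @ v, w))" by (auto simp: tens_def)
    moreover have "?Q3' = (\<lambda>((u, v), w). ?Q2 (u @ v, w))" by auto
    ultimately show ?thesis unfolding S_def coboundary_def by (simp only: conv3_append_left)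
  qed
  ultimately have "(\<lambda>((u, v), w). S (u, v) * eps w) \<star>\<^bsub>?D'\<^esub> (\<lambda>((u, v), w). S (u @ v, w)) =
      ((P \<otimes>\<^sub>t P) \<otimes>\<^sub>t eps) \<star>\<^bsub>?D'\<^esub> (((?Q2 \<otimes>\<^sub>t eps) \<star>\<^bsub>?D'\<^esub> ((\<lambda>(u, v). P (u @ v)) \<otimes>\<^sub>t P)) \<star>\<^bsub>?D'\<^esub> ?Q3')"
    by (simp only: cw3'.conv_assoc)
  also have "\<dots> = ((P \<otimes>\<^sub>t P) \<otimes>\<^sub>t eps) \<star>\<^bsub>?D'\<^esub> ((eps2 \<otimes>\<^sub>t P) \<star>\<^bsub>?D'\<^esub> ?Q3')"
    by (simp only: conv_tens Qm cw.conv_unit)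
  also have "\<dots> = (((P \<otimes>\<^sub>t P) \<otimes>\<^sub>t eps) \<star>\<^bsub>?D'\<^esub> (eps2 \<otimes>\<^sub>t P)) \<star>\<^bsub>?D'\<^esub> ?Q3'"
    by (rule cw3'.conv_assoc[symmetric])
  also have "\<dots> = ((P \<otimes>\<^sub>t P) \<otimes>\<^sub>t P) \<star>\<^bsub>?D'\<^esub> ?Q3'"
    by (simp only: conv_tens cw.conv_unit cw2.conv_unit)
  finally have R: "(\<lambda>((u, v), w). S (u, v) * eps w) \<star>\<^bsub>?D'\<^esub> (\<lambda>((u, v), w). S (u @ v, w)) = ((P \<otimes>\<^sub>t P) \<otimes>\<^sub>t P) \<star>\<^bsub>?D'\<^esub> ?Q3'" .
  have P3: "(\<lambda>((u, v), w). (P \<otimes>\<^sub>t P \<otimes>\<^sub>t P) (u, v, w)) = (P \<otimes>\<^sub>t P) \<otimes>\<^sub>t P" by (auto simp: tens_def mult.assoc)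
  show ?thesis
    unfolding L unfolding conv3_reassoc prod.case P3 using R by simp
qed

text \<open>Conjugation by P \<otimes> P may be done one variable at a time, in either order,
  because the factors P \<otimes> eps and eps \<otimes> P commute.\<close>

lemma tens_split:
  "((Q \<otimes>\<^sub>t Q) \<bullet>\<^bsub>g\<^esub> (Y \<bullet>\<^bsub>g\<^esub> (P \<otimes>\<^sub>t P))) (u, w) = (Q \<diamondop>\<^bsub>g\<^esub> ((\<lambda>w. (Q \<diamondop>\<^bsub>g\<^esub> ((\<lambda>u. Y (u, w)) \<diamondop>\<^bsub>g\<^esub> P)) u) \<diamondop>\<^bsub>g\<^esub> P)) w"
  "((Q \<otimes>\<^sub>t Q) \<bullet>\<^bsub>g\<^esub> (Y \<bullet>\<^bsub>g\<^esub> (P \<otimes>\<^sub>t P))) (u, w) = (Q \<diamondop>\<^bsub>g\<^esub> ((\<lambda>u. (Q \<diamondop>\<^bsub>g\<^esub> ((\<lambda>w. Y (u, w)) \<diamondop>\<^bsub>g\<^esub> P)) w) \<diamondop>\<^bsub>g\<^esub> P)) u"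
proof -
  have "(Q \<otimes>\<^sub>t Q) \<bullet>\<^bsub>g\<^esub> (Y \<bullet>\<^bsub>g\<^esub> (P \<otimes>\<^sub>t P)) =
    (eps \<otimes>\<^sub>t Q) \<bullet>\<^bsub>g\<^esub> (((Q \<otimes>\<^sub>t eps) \<bullet>\<^bsub>g\<^esub> (Y \<bullet>\<^bsub>g\<^esub> (P \<otimes>\<^sub>t eps))) \<bullet>\<^bsub>g\<^esub> (eps \<otimes>\<^sub>t P))"
  proof -
    have "Q \<otimes>\<^sub>t Q = (eps \<otimes>\<^sub>t Q) \<bullet>\<^bsub>g\<^esub> (Q \<otimes>\<^sub>t eps)" "P \<otimes>\<^sub>t P = (P \<otimes>\<^sub>t eps) \<bullet>\<^bsub>g\<^esub> (eps \<otimes>\<^sub>t P)"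
      by (simp_all add: conv_tens)
    then show ?thesis by (simp only: cw2.conv_assoc)
  qed
  then show "((Q \<otimes>\<^sub>t Q) \<bullet>\<^bsub>g\<^esub> (Y \<bullet>\<^bsub>g\<^esub> (P \<otimes>\<^sub>t P))) (u, w) = (Q \<diamondop>\<^bsub>g\<^esub> ((\<lambda>w. (Q \<diamondop>\<^bsub>g\<^esub> ((\<lambda>u. Y (u, w)) \<diamondop>\<^bsub>g\<^esub> P)) u) \<diamondop>\<^bsub>g\<^esub> P)) w"
    by (simp add: conv_tens_eps)
  have "(Q \<otimes>\<^sub>t Q) \<bullet>\<^bsub>g\<^esub> (Y \<bullet>\<^bsub>g\<^esub> (P \<otimes>\<^sub>t P)) =
    (Q \<otimes>\<^sub>t eps) \<bullet>\<^bsub>g\<^esub> (((eps \<otimes>\<^sub>t Q) \<bullet>\<^bsub>g\<^esub> (Y \<bullet>\<^bsub>g\<^esub> (eps \<otimes>\<^sub>t P))) \<bullet>\<^bsub>g\<^esub> (P \<otimes>\<^sub>t eps))"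
  proof -
    have "Q \<otimes>\<^sub>t Q = (Q \<otimes>\<^sub>t eps) \<bullet>\<^bsub>g\<^esub> (eps \<otimes>\<^sub>t Q)" "P \<otimes>\<^sub>t P = (eps \<otimes>\<^sub>t P) \<bullet>\<^bsub>g\<^esub> (P \<otimes>\<^sub>t eps)"
      by (simp_all add: conv_tens)
    then show ?thesis by (simp only: cw2.conv_assoc)
  qed
  then show "((Q \<otimes>\<^sub>t Q) \<bullet>\<^bsub>g\<^esub> (Y \<bullet>\<^bsub>g\<^esub> (P \<otimes>\<^sub>t P))) (u, w) = (Q \<diamondop>\<^bsub>g\<^esub> ((\<lambda>u. (Q \<diamondop>\<^bsub>g\<^esub> ((\<lambda>w. Y (u, w)) \<diamondop>\<^bsub>g\<^esub> P)) w) \<diamondop>\<^bsub>g\<^esub> P)) u"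
    by (simp add: conv_tens_eps)
qed

lemma ext2_tw:
  "ext (\<lambda>u. ext (\<lambda>v. T (u, v)) (tw g Q P q)) (tw g Q P p) =
   ext (\<lambda>u. ext (\<lambda>v. ((Q \<otimes>\<^sub>t Q) \<bullet>\<^bsub>g\<^esub> (T \<bullet>\<^bsub>g\<^esub> (P \<otimes>\<^sub>t P))) (u, v)) q) p"
proof -
  have "ext (\<lambda>u. ext (\<lambda>v. T (u, v)) (tw g Q P q)) (tw g Q P p) =
     ext (\<lambda>u. ext (\<lambda>v. (Q \<diamondop>\<^bsub>g\<^esub> ((\<lambda>v. T (u, v)) \<diamondop>\<^bsub>g\<^esub> P)) v) q) (tw g Q P p)" by (simp only: ext_tw)
  also have "\<dots> = ext (\<lambda>v. ext (\<lambda>u. (Q \<diamondop>\<^bsub>g\<^esub> ((\<lambda>v. T (u, v)) \<diamondop>\<^bsub>g\<^esub> P)) v) (tw g Q P p)) q" by (rule ext_swap)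
  also have "\<dots> = ext (\<lambda>v. ext (\<lambda>u. (Q \<diamondop>\<^bsub>g\<^esub> ((\<lambda>u. (Q \<diamondop>\<^bsub>g\<^esub> ((\<lambda>v. T (u, v)) \<diamondop>\<^bsub>g\<^esub> P)) v) \<diamondop>\<^bsub>g\<^esub> P)) u) p) q" by (simp only: ext_tw)
  also have "\<dots> = ext (\<lambda>u. ext (\<lambda>v. (Q \<diamondop>\<^bsub>g\<^esub> ((\<lambda>u. (Q \<diamondop>\<^bsub>g\<^esub> ((\<lambda>v. T (u, v)) \<diamondop>\<^bsub>g\<^esub> P)) v) \<diamondop>\<^bsub>g\<^esub> P)) u) q) p" by (rule ext_swap)
  finally show ?thesis by (simp only: tens_split(2))
qed

text \<open>The target relations enter only through \<open>kills_twist\<close>, a finite list of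
  evaluations. The locale serves twice: with l = 0 to make the identification of u(D,0,\<mu>)
  explicit, and for the final form.\<close>

locale coboundary_twist = sdatum D for D :: "('g, 'k::field_char_0) datum" +
  fixes l :: "nat \<Rightarrow> nat \<Rightarrow> 'k" and \<mu> :: "nat \<Rightarrow> 'k" and P Q :: "'g letter list \<Rightarrow> 'k"
    and \<sigma> :: "('g letter list \<Rightarrow>\<^sub>0 'k) set \<Rightarrow> ('g letter list \<Rightarrow>\<^sub>0 'k) set \<Rightarrow> 'k"
  assumes PQ: "P \<diamondop>\<^bsub>g\<^esub> Q = eps" and QP: "Q \<diamondop>\<^bsub>g\<^esub> P = eps"
    and P_Grp: "P (Grp h # w) = P w" and P_Nil: "P [] = 1" and P_Var: "P [Var i] = 0"
    and Q_Grp: "Q (Grp h # w) = Q w" and Q_Nil: "Q [] = 1" and Q_Var: "Q [Var i] = 0"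
    and sigma: "rep2_0 \<sigma> (coboundary g P Q)"
    and kills_twist: "good0 s \<Longrightarrow> kills D l \<mu> (Q \<diamondop>\<^bsub>g\<^esub> (s \<diamondop>\<^bsub>g\<^esub> P))"
begin

abbreviation S where "S \<equiv> coboundary g P Q"
abbreviation R where "R \<equiv> (\<lambda>(u, v). P (u @ v)) \<bullet>\<^bsub>g\<^esub> (Q \<otimes>\<^sub>t Q)"
abbreviation X :: "('g letter list \<Rightarrow> 'k) \<Rightarrow> 'g letter list \<Rightarrow> 'k" where "X s \<equiv> Q \<diamondop>\<^bsub>g\<^esub> (s \<diamondop>\<^bsub>g\<^esub> P)"
abbreviation cls0 where "cls0 \<equiv> cls D (\<lambda>_ _. 0) (\<lambda>_. 0)"
abbreviation K where "K \<equiv> twist (u0 D) \<sigma>"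

lemma tens_inv: "(P \<otimes>\<^sub>t P) \<bullet>\<^bsub>g\<^esub> (Q \<otimes>\<^sub>t Q) = eps2" "(Q \<otimes>\<^sub>t Q) \<bullet>\<^bsub>g\<^esub> (P \<otimes>\<^sub>t P) = eps2"
  by (simp_all add: conv_tens PQ QP)

lemma append_inv:
  "(\<lambda>(u, v). P (u @ v)) \<bullet>\<^bsub>g\<^esub> (\<lambda>(u, v). Q (u @ v)) = eps2"
  "(\<lambda>(u, v). Q (u @ v)) \<bullet>\<^bsub>g\<^esub> (\<lambda>(u, v). P (u @ v)) = eps2"
  by (simp_all only: conv_append PQ QP eps_append2)

lemma SR: "S \<bullet>\<^bsub>g\<^esub> R = eps2" and RS: "R \<bullet>\<^bsub>g\<^esub> S = eps2"
proof -
  have "S \<bullet>\<^bsub>g\<^esub> R = (P \<otimes>\<^sub>t P) \<bullet>\<^bsub>g\<^esub> (((\<lambda>(u, v). Q (u @ v)) \<bullet>\<^bsub>g\<^esub> (\<lambda>(u, v). P (u @ v))) \<bullet>\<^bsub>g\<^esub> (Q \<otimes>\<^sub>t Q))"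
    unfolding coboundary_def by (simp only: cw2.conv_assoc)
  then show "S \<bullet>\<^bsub>g\<^esub> R = eps2" by (simp only: append_inv cw2.conv_unit tens_inv)
  have "R \<bullet>\<^bsub>g\<^esub> S = (\<lambda>(u, v). P (u @ v)) \<bullet>\<^bsub>g\<^esub> (((Q \<otimes>\<^sub>t Q) \<bullet>\<^bsub>g\<^esub> (P \<otimes>\<^sub>t P)) \<bullet>\<^bsub>g\<^esub> (\<lambda>(u, v). Q (u @ v)))"
    unfolding coboundary_def by (simp only: cw2.conv_assoc)
  then show "R \<bullet>\<^bsub>g\<^esub> S = eps2" by (simp only: append_inv cw2.conv_unit tens_inv)
qed

lemma P_deg0: "deg w = 0 \<Longrightarrow> P w = 1" and Q_deg0: "deg w = 0 \<Longrightarrow> Q w = 1"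
  by (induction w; auto simp: P_Grp P_Nil Q_Grp Q_Nil split: letter.splits)+

lemma bigood_S: "bigood0 S"
  by (rule rep2_bigood[OF sigma])

text \<open>R is built from functionals that do not descend, so its formula does not show that it
  descends; it does because it is inverse to S, whose inverse is a locally finite series in
  S.\<close>

lemma bigood_R: "bigood0 R"
proof (rule bigood0_inverse[OF bigood_S SR])
  fix z :: "'g letter list \<times> 'g letter list" assume z: "deg (fst z) + deg (snd z) = 0"
  obtain u v where uv: "z = (u, v)" by fastforce
  have "S z = eps2 z"
  proof -
    have "S z = (eps2 \<bullet>\<^bsub>g\<^esub> eps2) z"
      unfolding coboundary_def
    proof (rule conv_cong)
      fix x y assume *: "(x, y) \<in> set ((split g \<otimes>\<^sub>c split g) z)"
      then have "deg (fst x) = 0" "deg (snd x) = 0" "deg (fst y) = 0" "deg (snd y) = 0"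
        using split2_deg[OF *] z by auto
      then show "(P \<otimes>\<^sub>t P) x = eps2 x" "(case y of (u, v) \<Rightarrow> Q (u @ v)) = eps2 y"
        by (auto simp: tens_def P_deg0 Q_deg0 eps_deg split: prod.split)
    qed
    then show ?thesis by simp
  qed
  then show "S z = 1" using z by (simp add: tens_def eps_deg)
qed

text \<open>The inverse in the deformation is a chosen one. R provides a witness, and any other
  inverse T agrees with it by the usual uniqueness argument R * (S * T) = (R * S) * T.\<close>

lemma rep2_inverse: "rep2_0 (conv2_inverse (u0 D) \<sigma>) R" and inverse_ex: "\<exists>\<tau>. is_conv2_inverse (u0 D) \<sigma> \<tau>"
proof -
  have eq: "\<beta> a b = \<gamma> a b" if "rep2_0 \<beta> T" "rep2_0 \<gamma> T" "a \<in> carrier (u0 D)" "b \<in> carrier (u0 D)" for \<beta> \<gamma> T a b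
    using that unfolding u_carrier rep2_def by auto
  have R: "rep2_0 (lift2 R) R" by (rule bigood_rep2[OF bigood_R])
  have "is_conv2_inverse (u0 D) \<sigma> (lift2 R)"
    unfolding is_conv2_inverse_def
  proof (intro conjI ballI)
    show "bilinear_form (u0 D) (lift2 R)" by (rule rep2_bilinear[OF R])
    fix a b assume ab: "a \<in> carrier (u0 D)" "b \<in> carrier (u0 D)"
    have "rep2_0 (conv2 (u0 D) \<sigma> (lift2 R)) eps2" "rep2_0 (conv2 (u0 D) (lift2 R) \<sigma>) eps2"
      using rep2_conv2[OF sigma R] rep2_conv2[OF R sigma] by (simp_all only: SR RS)
    then show "conv2 (u0 D) \<sigma> (lift2 R) a b = conv2_unit (u0 D) a b"
      "conv2 (u0 D) (lift2 R) \<sigma> a b = conv2_unit (u0 D) a b"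
      using eq[OF _ rep2_unit ab] by blast+
  qed
  then show ex: "\<exists>\<tau>. is_conv2_inverse (u0 D) \<sigma> \<tau>" by blast
  define \<tau> where "\<tau> = conv2_inverse (u0 D) \<sigma>"
  have inv: "is_conv2_inverse (u0 D) \<sigma> \<tau>" unfolding \<tau>_def conv2_inverse_def by (rule someI_ex[OF ex])
  define T where "T = (\<lambda>(u, v). \<tau> (cls0 (mon u)) (cls0 (mon v)))"
  have T: "rep2_0 \<tau> T" unfolding T_def using inv by (intro bilinear_rep2) (simp add: is_conv2_inverse_def)
  have ST: "(S \<bullet>\<^bsub>g\<^esub> T) (u, v) = eps2 (u, v)" if "u \<in> W" "v \<in> W" for u v
  proof -
    have c: "cls0 (mon u) \<in> carrier (u0 D)" "cls0 (mon v) \<in> carrier (u0 D)" using that by (auto intro!: cls_closed mon_P0)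
    have "(S \<bullet>\<^bsub>g\<^esub> T) (u, v) = conv2 (u0 D) \<sigma> \<tau> (cls0 (mon u)) (cls0 (mon v))"
      by (rule rep2_word[OF rep2_conv2[OF sigma T] that, symmetric])
    also have "\<dots> = conv2_unit (u0 D) (cls0 (mon u)) (cls0 (mon v))"
      using inv c unfolding is_conv2_inverse_def by blast
    also have "\<dots> = eps2 (u, v)" by (rule rep2_word[OF rep2_unit that])
    finally show ?thesis .
  qed
  have "T (u, v) = R (u, v)" if uv: "u \<in> W" "v \<in> W" for u v
  proof -
    \<comment> \<open>S * T is known only on words in W, which suffices because the legs of u and v
      stay in W.\<close>
    have "(R \<bullet>\<^bsub>g\<^esub> (S \<bullet>\<^bsub>g\<^esub> T)) (u, v) = (R \<bullet>\<^bsub>g\<^esub> eps2) (u, v)"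
    proof (rule conv_cong)
      fix x y assume "(x, y) \<in> set ((split g \<otimes>\<^sub>c split g) (u, v))"
      then have "fst y \<in> W" "snd y \<in> W"
        using split_W uv by (cases x; cases y; force simp: set_prod_coalg)+
      then show "(S \<bullet>\<^bsub>g\<^esub> T) y = eps2 y" using ST[of "fst y" "snd y"] by simp
    qed simp
    moreover have "R \<bullet>\<^bsub>g\<^esub> (S \<bullet>\<^bsub>g\<^esub> T) = T"
      unfolding cw2.conv_assoc[of R g S T, symmetric] RS by simp
    ultimately show ?thesis by simp
  qed
  then show "rep2_0 (conv2_inverse (u0 D) \<sigma>) R"
    using rep2_cong[OF T] unfolding \<tau>_def by blast
qed

text \<open>The product of words seen through X is the product deformed by S: the outer factors of S
  and R cancel against Q \<otimes> Q and P \<otimes> P, leaving Q and P on concatenations.\<close>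

lemma X_append: "(\<lambda>(u, v). X s (u @ v)) =
   (Q \<otimes>\<^sub>t Q) \<bullet>\<^bsub>g\<^esub> ((S \<bullet>\<^bsub>g\<^esub> ((\<lambda>(u, v). s (u @ v)) \<bullet>\<^bsub>g\<^esub> R)) \<bullet>\<^bsub>g\<^esub> (P \<otimes>\<^sub>t P))"
proof -
  have "(Q \<otimes>\<^sub>t Q) \<bullet>\<^bsub>g\<^esub> S = (\<lambda>(u, v). Q (u @ v))"
    unfolding coboundary_def cw2.conv_assoc[symmetric] tens_inv by simp
  moreover have "R \<bullet>\<^bsub>g\<^esub> (P \<otimes>\<^sub>t P) = (\<lambda>(u, v). P (u @ v))"
    unfolding cw2.conv_assoc tens_inv by simp
  ultimately have "(Q \<otimes>\<^sub>t Q) \<bullet>\<^bsub>g\<^esub> ((S \<bullet>\<^bsub>g\<^esub> ((\<lambda>(u, v). s (u @ v)) \<bullet>\<^bsub>g\<^esub> R)) \<bullet>\<^bsub>g\<^esub> (P \<otimes>\<^sub>t P)) =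
     (\<lambda>(u, v). Q (u @ v)) \<bullet>\<^bsub>g\<^esub> ((\<lambda>(u, v). s (u @ v)) \<bullet>\<^bsub>g\<^esub> (\<lambda>(u, v). P (u @ v)))"
    by (metis cw2.conv_assoc)
  then show ?thesis by (simp add: conv_append)
qed

lemma good0_X_arg:
  assumes "u \<in> W"
  shows "(\<And>x. x \<in> W \<Longrightarrow> good0 (\<lambda>w. Y x w)) \<Longrightarrow> good0 (\<lambda>w. X (\<lambda>x. Y x w) u)"
proof -
  assume Y: "\<And>x. x \<in> W \<Longrightarrow> good0 (\<lambda>w. Y x w)"
  have "good0 (\<lambda>w. dsum (split g u) (\<lambda>a b. Q a * dsum (split g b) (\<lambda>c d. Y c w * P d)))"
    by (intro good_dsum good_linear Y) (use assms split_W in blast)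
  then show ?thesis by (simp add: conv_def)
qed

text \<open>A left or right context can be absorbed into s: by \<open>X_append\<close> the translate
  of X s is X of another good functional. Hence checking the relators without context is
  enough.\<close>

lemma good_X:
  assumes s: "good0 s"
  shows "good D l \<mu> (X s)"
proof (rule goodI)
  fix u v assume u: "u \<in> W" and v: "v \<in> W"
  have Y: "bigood0 (S \<bullet>\<^bsub>g\<^esub> ((\<lambda>(u, v). s (u @ v)) \<bullet>\<^bsub>g\<^esub> R))" if "good0 s" for s
    by (intro bigood0_conv bigood_S bigood_R bigood0_append that)
  let ?s1 = "\<lambda>w. X (\<lambda>u. (S \<bullet>\<^bsub>g\<^esub> ((\<lambda>(u, v). s (u @ v)) \<bullet>\<^bsub>g\<^esub> R)) (u, w)) u"
  have s1: "good0 ?s1" using Y[OF s] by (intro good0_X_arg u) (simp add: bigood_def)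
  have 1: "X s (u @ w) = X ?s1 w" for w
    using fun_cong[OF X_append[of s], of "(u, w)"] by (simp add: tens_split(1))
  let ?s2 = "\<lambda>w. X (\<lambda>v. (S \<bullet>\<^bsub>g\<^esub> ((\<lambda>(u, v). ?s1 (u @ v)) \<bullet>\<^bsub>g\<^esub> R)) (w, v)) v"
  have s2: "good0 ?s2" using Y[OF s1] by (intro good0_X_arg v) (simp add: bigood_def)
  have 2: "X ?s1 (w @ v) = X ?s2 w" for w
    using fun_cong[OF X_append[of ?s1], of "(w, v)"] by (simp add: tens_split(2))
  show "kills D l \<mu> (\<lambda>w. X s (u @ w @ v))" unfolding 1 2 by (rule kills_twist[OF s2])
qed

text \<open>The transpose of X, that is, conjugation of words by P, computed on a representative;
  \<open>good_X\<close> makes it independent of the choice.\<close>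

definition \<Phi> :: "('g letter list \<Rightarrow>\<^sub>0 'k) set \<Rightarrow> ('g letter list \<Rightarrow>\<^sub>0 'k) set" where
  "\<Phi> a = cls0 (tw g Q P (SOME p. p \<in> a))"

lemma Phi_cls: "p \<in> P0 \<Longrightarrow> \<Phi> (cls D l \<mu> p) = cls0 (tw g Q P p)"
  unfolding \<Phi>_def
proof (rule cls0_eqI)
  assume p: "p \<in> P0"
  note r = some_rep[OF cls_closed[OF p], of l \<mu>]
  show "tw g Q P (SOME pa. pa \<in> cls D l \<mu> p) \<in> P0" "tw g Q P p \<in> P0" by (intro tw_P0 r p)+
  show "ext s (tw g Q P (SOME pa. pa \<in> cls D l \<mu> p)) = ext s (tw g Q P p)" if "good0 s" for s
    unfolding ext_tw by (rule good_ext_cong[OF good_X[OF that] r(1) p r(2)])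
qed

lemma tw_inverse: "tw g Q P (tw g P Q p) = p"
proof (rule poly_mapping_separate)
  fix s
  have "P \<diamondop>\<^bsub>g\<^esub> ((Q \<diamondop>\<^bsub>g\<^esub> (s \<diamondop>\<^bsub>g\<^esub> P)) \<diamondop>\<^bsub>g\<^esub> Q) = (P \<diamondop>\<^bsub>g\<^esub> Q) \<diamondop>\<^bsub>g\<^esub> (s \<diamondop>\<^bsub>g\<^esub> (P \<diamondop>\<^bsub>g\<^esub> Q))"
    by (simp only: cw.conv_assoc)
  then show "ext s (tw g Q P (tw g P Q p)) = ext s p" by (simp add: ext_tw PQ)
qed

lemma separate:
  assumes "a \<in> carrier (u0 D)" "b \<in> carrier (u0 D)" "\<And>f s. rep1_0 f s \<Longrightarrow> f a = f b"
  shows "a = b"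
proof -
  obtain p q where pq: "p \<in> P0" "a = cls0 p" "q \<in> P0" "b = cls0 q" using assms unfolding u_carrier by blast
  have "ext s p = ext s q" if "good0 s" for s
    using assms(3)[OF good_rep1[OF that]] good_rep1[OF that] pq unfolding rep1_def by metis
  then show ?thesis unfolding pq(2,4) by (intro cls0_eqI pq)
qed

lemma K_simps [simp]: "carrier K = carrier (u0 D)" "add K = add (u0 D)" "one K = one (u0 D)" "zero K = zero (u0 D)"
  "module.smult K = module.smult (u0 D)" "comult K = comult (u0 D)" "counit K = counit (u0 D)"
  by (simp_all add: twist_def)

lemma K_bilinear [simp]: "bilinear_form K = bilinear_form (u0 D)"
  by (simp add: fun_eq_iff bilinear_form_def linear_form_def)

text \<open>Tested by functionals: the deformed product becomes S * (s on concatenations) * R, which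
  conjugation by P \<otimes> P turns into X s on concatenations.\<close>

lemma Phi_mult:
  assumes p: "p \<in> P0" and q: "q \<in> P0"
  shows "cls0 (tw g Q P p) \<otimes>\<^bsub>K\<^esub> cls0 (tw g Q P q) = cls0 (tw g Q P (p * q))"
proof (rule separate)
  have c: "cls0 (tw g Q P p) \<in> carrier (u0 D)" "cls0 (tw g Q P q) \<in> carrier (u0 D)"
    by (intro cls_closed tw_P0 p q)+
  show "cls0 (tw g Q P p) \<otimes>\<^bsub>K\<^esub> cls0 (tw g Q P q) \<in> carrier (u0 D)" by (rule twist_mult(1)[OF c])
  show "cls0 (tw g Q P (p * q)) \<in> carrier (u0 D)" by (intro cls_closed tw_P0 P0_closed p q)
  fix f s assume f: "rep1_0 f s"
  let ?T = "S \<bullet>\<^bsub>g\<^esub> ((\<lambda>(u, v). s (u @ v)) \<bullet>\<^bsub>g\<^esub> R)"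
  have T: "rep2_0 (conv2 (u0 D) \<sigma> (conv2 (u0 D) (\<lambda>x y. f (x \<otimes>\<^bsub>u0 D\<^esub> y)) (conv2_inverse (u0 D) \<sigma>))) ?T"
    by (intro rep2_conv2 sigma rep2_mult f rep2_inverse)
  have "f (cls0 (tw g Q P p) \<otimes>\<^bsub>K\<^esub> cls0 (tw g Q P q)) = ext (\<lambda>u. ext (\<lambda>v. ?T (u, v)) (tw g Q P q)) (tw g Q P p)"
    unfolding twist_mult(2)[OF c rep1_linear_form[OF f]]
    using T tw_P0[OF p] tw_P0[OF q] unfolding rep2_def by blast
  also have "\<dots> = ext (\<lambda>u. ext (\<lambda>v. X s (u @ v)) q) p"
    unfolding ext2_tw X_append[symmetric] by simp
  also have "\<dots> = ext (X s) (p * q)" by (simp add: ext_mult)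
  also have "\<dots> = f (cls0 (tw g Q P (p * q)))"
    using f tw_P0[OF P0_closed(3)[OF p q]] unfolding rep1_def by (simp add: ext_tw)
  finally show "f (cls0 (tw g Q P p) \<otimes>\<^bsub>K\<^esub> cls0 (tw g Q P q)) = f (cls0 (tw g Q P (p * q)))" .
qed

lemma X_eps: "X eps = eps"
  by (simp add: QP)

lemma X_letters:
  assumes "s \<in> letters D"
  shows "X f [s] = f [s]"
  by (cases s) (simp_all add: P_Grp P_Nil P_Var Q_Grp Q_Nil Q_Var)

lemma tw_linear:
  "tw g Q P (p + q) = tw g Q P p + tw g Q P q" "tw g Q P (const c * p) = const c * tw g Q P p" "tw g Q P 1 = 1"
  by (rule poly_mapping_separate, simp add: ext_tw P_Nil Q_Nil)+

lemma ring_iso_Phi: "\<Phi> \<in> ring_iso (u_alg D l \<mu>) K"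
proof (rule ring_iso_memI)
  note u = u_carrier[of l \<mu>]
  show "\<Phi> a \<in> carrier K" if "a \<in> carrier (u_alg D l \<mu>)" for a
    unfolding K_simps \<Phi>_def using some_rep(1)[OF that] by (intro cls_closed tw_P0)
  fix a b assume a: "a \<in> carrier (u_alg D l \<mu>)" and b: "b \<in> carrier (u_alg D l \<mu>)"
  then obtain p q where pq: "p \<in> P0" "a = cls D l \<mu> p" "q \<in> P0" "b = cls D l \<mu> q" unfolding u by blast
  show "\<Phi> (a \<otimes>\<^bsub>u_alg D l \<mu>\<^esub> b) = \<Phi> a \<otimes>\<^bsub>K\<^esub> \<Phi> b"
    unfolding pq u_mult[OF pq(1,3)] Phi_cls[OF pq(1)] Phi_cls[OF pq(3)] Phi_cls[OF P0_closed(3)[OF pq(1,3)]]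
    by (rule Phi_mult[symmetric, OF pq(1,3)])
  show "\<Phi> (a \<oplus>\<^bsub>u_alg D l \<mu>\<^esub> b) = \<Phi> a \<oplus>\<^bsub>K\<^esub> \<Phi> b"
    unfolding pq u_add[OF pq(1,3)] Phi_cls[OF pq(1)] Phi_cls[OF pq(3)] Phi_cls[OF P0_closed(1)[OF pq(1,3)]] K_simps
      u_add[OF tw_P0[OF pq(1)] tw_P0[OF pq(3)]] tw_linear ..
next
  have one: "(1 :: 'g letter list \<Rightarrow>\<^sub>0 'k) \<in> P0" by simp
  show "\<Phi> \<one>\<^bsub>u_alg D l \<mu>\<^esub> = \<one>\<^bsub>K\<^esub>"
    unfolding u_one Phi_cls[OF one] K_simps tw_linear ..
next
  show "bij_betw \<Phi> (carrier (u_alg D l \<mu>)) (carrier K)"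
    unfolding bij_betw_def
  proof
    show "inj_on \<Phi> (carrier (u_alg D l \<mu>))"
    proof (rule inj_onI)
      fix a b assume ab: "a \<in> carrier (u_alg D l \<mu>)" "b \<in> carrier (u_alg D l \<mu>)" "\<Phi> a = \<Phi> b"
      then obtain p q where pq: "p \<in> P0" "a = cls D l \<mu> p" "q \<in> P0" "b = cls D l \<mu> q" unfolding u_carrier by blast
      have eq: "cls0 (tw g Q P p) = cls0 (tw g Q P q)"
        using ab(3) unfolding pq Phi_cls[OF pq(1)] Phi_cls[OF pq(3)] .
      \<comment> \<open>Injectivity: the deformed algebra has no relations beyond those of u(D, l,
        \<mu>).\<close>
      have "p - q \<in> rel_ideal D l \<mu>"
      proof (rule twisted_separation[where P = P and Q = Q])
        show "Poly_Mapping.keys (p - q) \<subseteq> W" using P0_closed(2)[OF pq(1,3)] by simp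
        show "ext (X s) (p - q) = 0" if "good0 s" for s
          using good_ext_cong[OF that tw_P0[OF pq(1)] tw_P0[OF pq(3)] eq] by (simp add: ext_tw)
      qed (auto simp: P_Grp P_Nil Q_Grp Q_Nil good_X)
      then show "a = b" unfolding pq using cls_eq pq by blast
    qed
    show "\<Phi> ` carrier (u_alg D l \<mu>) = carrier K"
    proof (intro equalityI subsetI)
      fix b assume "b \<in> \<Phi> ` carrier (u_alg D l \<mu>)"
      then show "b \<in> carrier K"
        unfolding K_simps \<Phi>_def using some_rep(1) by (auto intro!: cls_closed tw_P0)
    next
      fix b assume "b \<in> carrier K"
      then obtain p where p: "p \<in> P0" "b = cls0 p" unfolding K_simps u_carrier by blast
      have "\<Phi> (cls D l \<mu> (tw g P Q p)) = b"
        unfolding Phi_cls[OF tw_P0[OF p(1)]] tw_inverse p ..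
      then show "b \<in> \<Phi> ` carrier (u_alg D l \<mu>)" using cls_closed[OF tw_P0[OF p(1)]] by blast
    qed
  qed
qed

text \<open>Conjugation is a coalgebra map: in X d * X b the inner P * Q is eps, so the product is X
  (d * b). A general bilinear form is reduced to such pairs by its tensor decomposition.\<close>

lemma comult_Phi:
  assumes a: "a \<in> carrier (u_alg D l \<mu>)"
  shows "tensor_eq K (comult K (\<Phi> a)) (push (map_prod \<Phi> \<Phi>) (comult (u_alg D l \<mu>) a))"
  unfolding tensor_eq_def K_simps K_bilinear
proof (intro allI impI)
  fix \<beta> assume bil: "bilinear_form (u0 D) \<beta>"
  define B where "B = (\<lambda>(u, v). \<beta> (cls0 (mon u)) (cls0 (mon v)))"
  have rB: "rep2_0 \<beta> B" unfolding B_def by (rule bilinear_rep2[OF bil])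
  note gB = rep2_bigood[OF rB]
  let ?p = "SOME p. p \<in> a"
  note p = some_rep[OF a]
  have c: "cls0 (tw g Q P ?p) \<in> carrier (u0 D)" by (intro cls_closed tw_P0 p)
  obtain d b where db: "\<And>k. good0 (d k)" "\<And>k. k \<in> exponents \<times> G \<Longrightarrow> good0 (b k)"
    "\<And>u v. u \<in> W \<Longrightarrow> v \<in> W \<Longrightarrow> B (u, v) = (\<Sum>k\<in>exponents \<times> G. d k u * b k v)"
    using bigood0_decomp[OF gB] by blast
  let ?I = "exponents \<times> G"
  have "sweedler (comult (u0 D) (\<Phi> a)) \<beta> = ext (\<lambda>w. dsum (split g w) (\<lambda>u v. B (u, v))) (SOME q. q \<in> cls0 (tw g Q P ?p))"
    unfolding \<Phi>_def sweedler_comult[OF c] B_def prod.case ..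
  also have "\<dots> = ext (\<lambda>w. dsum (split g w) (\<lambda>u v. B (u, v))) (tw g Q P ?p)"
    by (intro good_ext_cong[OF good0_comult[OF gB]] some_rep[OF c] tw_P0 p)
  also have "\<dots> = ext (\<lambda>w. \<Sum>k\<in>?I. (d k \<diamondop>\<^bsub>g\<^esub> b k) w) (tw g Q P ?p)"
  proof (rule ext_cong_P0[OF tw_P0[OF p(1)]])
    fix w assume w: "w \<in> W"
    have "dsum (split g w) (\<lambda>u v. B (u, v)) = dsum (split g w) (\<lambda>u v. \<Sum>k\<in>?I. d k u * b k v)"
      using split_W[OF _ w] by (intro dsum_cong db(3)) blast+
    then show "dsum (split g w) (\<lambda>u v. B (u, v)) = (\<Sum>k\<in>?I. (d k \<diamondop>\<^bsub>g\<^esub> b k) w)"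
      unfolding conv_def dsum_sum .
  qed
  also have "\<dots> = ext (\<lambda>w. \<Sum>k\<in>?I. (X (d k) \<diamondop>\<^bsub>g\<^esub> X (b k)) w) ?p"
  proof -
    have "X (d k) \<diamondop>\<^bsub>g\<^esub> X (b k) = Q \<diamondop>\<^bsub>g\<^esub> (d k \<diamondop>\<^bsub>g\<^esub> ((P \<diamondop>\<^bsub>g\<^esub> Q) \<diamondop>\<^bsub>g\<^esub> (b k \<diamondop>\<^bsub>g\<^esub> P)))" for k
      by (simp only: cw.conv_assoc)
    then show ?thesis by (simp add: ext_fun ext_tw PQ cw.conv_assoc)
  qed
  also have "\<dots> = ext (\<lambda>w. dsum (split g w) (\<lambda>u v. \<beta> (\<Phi> (proj l \<mu> u)) (\<Phi> (proj l \<mu> v)))) ?p"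
  proof (rule ext_cong_P0[OF p(1)])
    fix w assume w: "w \<in> W"
    have val: "\<beta> (\<Phi> (proj l \<mu> u)) (\<Phi> (proj l \<mu> v)) = (\<Sum>k\<in>?I. X (d k) u * X (b k) v)" if uv: "u \<in> W" "v \<in> W" for u v
    proof -
      have t: "tw g Q P (mon u) \<in> P0" "tw g Q P (mon v) \<in> P0" 
        by (intro tw_P0 mon_P0 uv)+
      have "\<beta> (\<Phi> (proj l \<mu> u)) (\<Phi> (proj l \<mu> v)) = ext (\<lambda>x. ext (\<lambda>y. B (x, y)) (tw g Q P (mon v))) (tw g Q P (mon u))"
        unfolding Phi_cls[OF mon_P0[OF uv(1)]] Phi_cls[OF mon_P0[OF uv(2)]] using rB t unfolding rep2_def by blast
      also have "\<dots> = ext (\<lambda>x. ext (\<lambda>y. \<Sum>k\<in>?I. d k x * b k y) (tw g Q P (mon v))) (tw g Q P (mon u))"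
        by (intro ext_cong_P0 t db(3))
      also have "\<dots> = (\<Sum>k\<in>?I. X (d k) u * X (b k) v)"
        by (simp add: ext_fun ext_tw)
      finally show ?thesis .
    qed
    have "(\<Sum>k\<in>?I. (X (d k) \<diamondop>\<^bsub>g\<^esub> X (b k)) w) = dsum (split g w) (\<lambda>u v. \<Sum>k\<in>?I. X (d k) u * X (b k) v)"
      unfolding dsum_sum by (intro sum.cong refl conv_def)
    also have "\<dots> = dsum (split g w) (\<lambda>u v. \<beta> (\<Phi> (proj l \<mu> u)) (\<Phi> (proj l \<mu> v)))"
      using split_W[OF _ w] by (intro dsum_cong val[symmetric]) blast+
    finally show "(\<Sum>k\<in>?I. (X (d k) \<diamondop>\<^bsub>g\<^esub> X (b k)) w) = dsum (split g w) (\<lambda>u v. \<beta> (\<Phi> (proj l \<mu> u)) (\<Phi> (proj l \<mu> v)))" .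
  qed
  also have "\<dots> = sweedler (push (map_prod \<Phi> \<Phi>) (comult (u_alg D l \<mu>) a)) \<beta>"
    using sweedler_comult[OF a, of "\<lambda>x y. \<beta> (\<Phi> x) (\<Phi> y)"] by (simp add: sweedler_ext)
  finally show "sweedler (comult (u0 D) (\<Phi> a)) \<beta> = sweedler (push (map_prod \<Phi> \<Phi>) (comult (u_alg D l \<mu>) a)) \<beta>" .
qed

theorem canonical_iso_Phi: "canonical_iso D l \<mu> K \<Phi>"
  unfolding canonical_iso_def bialgebra_iso_def
proof (intro conjI allI ballI ring_iso_Phi comult_Phi)
  fix c a assume "a \<in> carrier (u_alg D l \<mu>)"
  then obtain p where p: "p \<in> P0" "a = cls D l \<mu> p" unfolding u_carrier by blast
  show "\<Phi> (c \<odot>\<^bsub>u_alg D l \<mu>\<^esub> a) = c \<odot>\<^bsub>K\<^esub> \<Phi> a"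
    unfolding p u_smult[OF p(1)] Phi_cls[OF p(1)] Phi_cls[OF P0_closed(4)[OF p(1)]] K_simps
      u_smult[OF tw_P0[OF p(1)]] tw_linear ..
next
  fix a assume "a \<in> carrier (u_alg D l \<mu>)"
  then obtain p where p: "p \<in> P0" "a = cls D l \<mu> p" unfolding u_carrier by blast
  have "counit (u0 D) (cls0 (tw g Q P p)) = ext (X eps) p"
    using rep1_counit[of "\<lambda>_ _. 0" "\<lambda>_. 0"] tw_P0[OF p(1)] unfolding rep1_def by (simp only: ext_tw)
  then show "counit K (\<Phi> a) = counit (u_alg D l \<mu>) a"
    using rep1_counit[of l \<mu>] p unfolding p Phi_cls[OF p(1)] K_simps rep1_def X_eps by simp
next
  fix s assume s: "s \<in> letters D"
  then have m: "mon [s] \<in> P0" by (intro mon_P0) simp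
  have "cls0 (tw g Q P (mon [s])) = cls0 (mon [s])"
    by (rule cls0_eqI[OF tw_P0[OF m] m]) (simp only: ext_tw ext_single X_letters[OF s])
  then show "\<Phi> (cls D l \<mu> (mon [s])) = cls0 (mon [s])" unfolding Phi_cls[OF m] .
qed

text \<open>An algebra map is determined on the generators. This pins down
  \<open>root_ident\<close>, which is defined by choice, as conjugation.\<close>

lemma canonical_iso_unique:
  assumes \<phi>: "canonical_iso D l \<mu> K \<phi>" and p: "p \<in> P0"
  shows "\<phi> (cls D l \<mu> p) = cls0 (tw g Q P p)"
proof -
  let ?H = "u_alg D l \<mu>"
  have hom: "\<phi> \<in> ring_hom ?H K" using \<phi> by (auto simp: canonical_iso_def bialgebra_iso_def ring_iso_def)
  have sm: "\<phi> (c \<odot>\<^bsub>?H\<^esub> a) = c \<odot>\<^bsub>u0 D\<^esub> \<phi> a" if "a \<in> carrier ?H" for c a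
    using \<phi> that unfolding canonical_iso_def bialgebra_iso_def K_simps by blast
  have letter: "\<phi> (cls D l \<mu> (mon [s])) = cls0 (tw g Q P (mon [s]))" if s: "s \<in> letters D" for s
  proof -
    have m: "mon [s] \<in> P0" using s by (intro mon_P0) simp
    have "\<phi> (cls D l \<mu> (mon [s])) = cls0 (mon [s])" using \<phi> s unfolding canonical_iso_def by blast
    also have "\<dots> = \<Phi> (cls D l \<mu> (mon [s]))" using canonical_iso_Phi s unfolding canonical_iso_def by metis
    finally show ?thesis unfolding Phi_cls[OF m] .
  qed
  have word: "\<phi> (cls D l \<mu> (mon w)) = cls0 (tw g Q P (mon w))" if "w \<in> W" for w
    using that
  proof (induction w rule: list.induct)
    case Nil
    then show ?case using ring_hom_one[OF hom] by (simp add: u_one tw_linear)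
  next
    case (Cons s w)
    then have s: "s \<in> letters D" and w: "w \<in> W" by simp_all
    then have m: "mon [s] \<in> P0" "mon w \<in> P0" by (intro mon_P0; simp)+
    have "\<phi> (cls D l \<mu> (mon (s # w))) = \<phi> (cls D l \<mu> (mon [s]) \<otimes>\<^bsub>?H\<^esub> cls D l \<mu> (mon w))"
      unfolding u_mult[OF m] by (simp add: mon_mult)
    also have "\<dots> = cls0 (tw g Q P (mon [s])) \<otimes>\<^bsub>K\<^esub> cls0 (tw g Q P (mon w))"
      unfolding ring_hom_mult[OF hom cls_closed[OF m(1)] cls_closed[OF m(2)]] letter[OF s] Cons.IH[OF w] ..
    also have "\<dots> = cls0 (tw g Q P (mon (s # w)))"
      unfolding Phi_mult[OF m] by (simp add: mon_mult)
    finally show ?case .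
  qed
  have "p \<in> P0 \<and> \<phi> (cls D l \<mu> p) = cls0 (tw g Q P p)"
    using p[unfolded mem_Collect_eq]
  proof (induction p rule: poly_mapping_words_induct)
    \<comment> \<open>The zero class is reached as the scalar multiple 0 of a class, since \<phi> is
      known to respect scalars.\<close>
    case zero
    have z: "(0 :: 'g letter list \<Rightarrow>\<^sub>0 'k) \<in> P0" by simp
    obtain r where r: "r \<in> P0" "\<phi> (cls D l \<mu> 0) = cls0 r"
      using ring_hom_closed[OF hom cls_closed[OF z]] unfolding K_simps u_carrier by blast
    have "0 \<odot>\<^bsub>?H\<^esub> cls D l \<mu> 0 = cls D l \<mu> 0" "0 \<odot>\<^bsub>u0 D\<^esub> cls0 r = cls0 0"
      by (simp_all add: u_smult[OF z] u_smult[OF r(1)])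
    then have "\<phi> (cls D l \<mu> 0) = cls0 0" using sm[OF cls_closed[OF z], of 0] r(2) by metis
    then show ?case by (simp add: tw_def)
  next
    case (single w c)
    have m: "mon w \<in> P0" using single by (rule mon_P0)
    have "\<phi> (c \<odot>\<^bsub>?H\<^esub> cls D l \<mu> (mon w)) = c \<odot>\<^bsub>u0 D\<^esub> cls0 (tw g Q P (mon w))"
      unfolding sm[OF cls_closed[OF m]] word[OF single] ..
    then have "\<phi> (cls D l \<mu> (const c * mon w)) = cls0 (tw g Q P (const c * mon w))"
      unfolding u_smult[OF m] u_smult[OF tw_P0[OF m]] tw_linear .
    then show ?case using single by (simp add: const_mult)
  next
    case (add p q)
    then have pq: "p \<in> P0" "q \<in> P0" by simp_all
    have "\<phi> (cls D l \<mu> p \<oplus>\<^bsub>?H\<^esub> cls D l \<mu> q) = \<phi> (cls D l \<mu> p) \<oplus>\<^bsub>u0 D\<^esub> \<phi> (cls D l \<mu> q)"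
      using ring_hom_add[OF hom cls_closed[OF pq(1)] cls_closed[OF pq(2)]] by simp
    then have "\<phi> (cls D l \<mu> (p + q)) = cls0 (tw g Q P (p + q))"
      using add unfolding u_add[OF pq] tw_linear by (simp add: u_add[OF tw_P0[OF pq(1)] tw_P0[OF pq(2)]])
    then show ?case using P0_closed(1)[OF pq] by simp
  qed
  then show ?thesis by simp
qed

lemma conv3_eval:
  assumes a: "a \<in> carrier (u0 D)" and b: "b \<in> carrier (u0 D)" and c: "c \<in> carrier (u0 D)"
    and F: "\<And>u v w. u \<in> W \<Longrightarrow> v \<in> W \<Longrightarrow> w \<in> W \<Longrightarrow> F' (cls0 (mon u)) (cls0 (mon v)) (cls0 (mon w)) = F (u, v, w)"
    and H: "\<And>u v w. u \<in> W \<Longrightarrow> v \<in> W \<Longrightarrow> w \<in> W \<Longrightarrow> H' (cls0 (mon u)) (cls0 (mon v)) (cls0 (mon w)) = H (u, v, w)"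
  shows "conv3 (u0 D) F' H' a b c = ext (\<lambda>u. ext (\<lambda>v. ext (\<lambda>w. (F \<star>\<^bsub>split g \<otimes>\<^sub>c split g \<otimes>\<^sub>c split g\<^esub> H) (u, v, w))
     (SOME r. r \<in> c)) (SOME q. q \<in> b)) (SOME p. p \<in> a)"
  unfolding conv3_def sweedler_comult[OF a] sweedler_comult[OF b] sweedler_comult[OF c] conv_prod_coalg dsum_prod_coalg ext_dsum
proof (intro ext_cong_P0[OF some_rep(1)[OF a]] dsum_cong ext_cong_P0[OF some_rep(1)[OF b]] ext_cong_P0[OF some_rep(1)[OF c]])
  fix u u1 u2 v v1 v2 w w1 w2
  assume "u \<in> W" "(u1, u2) \<in> set (split g u)" "v \<in> W" "(v1, v2) \<in> set (split g v)" "w \<in> W" "(w1, w2) \<in> set (split g w)"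
  then have "u1 \<in> W" "u2 \<in> W" "v1 \<in> W" "v2 \<in> W" "w1 \<in> W" "w2 \<in> W" using split_W by blast+
  then show "F' (cls0 (mon u1)) (cls0 (mon v1)) (cls0 (mon w1)) * H' (cls0 (mon u2)) (cls0 (mon v2)) (cls0 (mon w2)) =
      F (u1, v1, w1) * H (u2, v2, w2)" by (simp only: F H)
qed

theorem cocycle: "multiplicative_cocycle (u0 D) \<sigma>"
  unfolding multiplicative_cocycle_def
proof (intro conjI ballI)
  show "bilinear_form (u0 D) \<sigma>" by (rule rep2_bilinear[OF sigma])
  show "\<exists>\<tau>. is_conv2_inverse (u0 D) \<sigma> \<tau>" by (rule inverse_ex)
next
  fix a b c assume abc: "a \<in> carrier (u0 D)" "b \<in> carrier (u0 D)" "c \<in> carrier (u0 D)"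
  have cou: "counit (u0 D) (cls0 (mon w)) = eps w" if "w \<in> W" for w by (rule rep1_word[OF rep1_counit that])
  have S: "\<sigma> (cls0 (mon u)) (cls0 (mon v)) = S (u, v)" if "u \<in> W" "v \<in> W" for u v by (rule rep2_word[OF sigma that])
  have m: "cls0 (mon u) \<otimes>\<^bsub>u0 D\<^esub> cls0 (mon v) = cls0 (mon (u @ v))" if "u \<in> W" "v \<in> W" for u v
    using u_mult[OF mon_P0[OF that(1)] mon_P0[OF that(2)]] by (simp add: mon_mult)
  have app: "u @ v \<in> W" if "u \<in> W" "v \<in> W" for u v using that by simp
  have L: "conv3 (u0 D) (\<lambda>x y z. counit (u0 D) x * \<sigma> y z) (\<lambda>x y z. \<sigma> x (y \<otimes>\<^bsub>u0 D\<^esub> z)) a b c =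
     ext (\<lambda>u. ext (\<lambda>v. ext (\<lambda>w. ((\<lambda>(u, v, w). eps u * S (v, w)) \<star>\<^bsub>split g \<otimes>\<^sub>c split g \<otimes>\<^sub>c split g\<^esub> (\<lambda>(u, v, w). S (u, v @ w))) (u, v, w))
     (SOME r. r \<in> c)) (SOME q. q \<in> b)) (SOME p. p \<in> a)"
    by (rule conv3_eval[OF abc]) (simp_all only: cou S m app prod.case)
  have R: "conv3 (u0 D) (\<lambda>x y z. \<sigma> x y * counit (u0 D) z) (\<lambda>x y z. \<sigma> (x \<otimes>\<^bsub>u0 D\<^esub> y) z) a b c =
     ext (\<lambda>u. ext (\<lambda>v. ext (\<lambda>w. ((\<lambda>(u, v, w). S (u, v) * eps w) \<star>\<^bsub>split g \<otimes>\<^sub>c split g \<otimes>\<^sub>c split g\<^esub> (\<lambda>(u, v, w). S (u @ v, w))) (u, v, w))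
     (SOME r. r \<in> c)) (SOME q. q \<in> b)) (SOME p. p \<in> a)"
    by (rule conv3_eval[OF abc]) (simp_all only: cou S m app prod.case)
  show "conv3 (u0 D) (\<lambda>x y z. counit (u0 D) x * \<sigma> y z) (\<lambda>x y z. \<sigma> x (y \<otimes>\<^bsub>u0 D\<^esub> z)) a b c =
     conv3 (u0 D) (\<lambda>x y z. \<sigma> x y * counit (u0 D) z) (\<lambda>x y z. \<sigma> (x \<otimes>\<^bsub>u0 D\<^esub> y) z) a b c"
    unfolding L R coboundary_cocycle[OF QP] ..
next
  fix b assume "b \<in> carrier (u0 D)"
  then obtain q where q: "q \<in> P0" "b = cls0 q" unfolding u_carrier by blast
  have one: "(1 :: 'g letter list \<Rightarrow>\<^sub>0 'k) \<in> P0" by simp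
  have 1: "S ([], v) = eps v" "S (v, []) = eps v" for v
    unfolding PQ[symmetric] coboundary_def conv_prod_coalg by (simp_all add: conv_def P_Nil)
  have cou: "counit (u0 D) (cls0 q) = ext eps q" using rep1_counit q(1) unfolding rep1_def by blast
  show "\<sigma> \<one>\<^bsub>u0 D\<^esub> b = counit (u0 D) b" "\<sigma> b \<one>\<^bsub>u0 D\<^esub> = counit (u0 D) b"
    unfolding u_one q(2) cou using sigma one q(1) unfolding rep2_def by (simp_all add: 1)
qed

end

section \<open>The functionals of the root vector and linking parts\<close>

lemma dp_deg: "dp c i a \<omega> w \<noteq> 0 \<Longrightarrow> deg w = a"
  by (induction w arbitrary: a) (auto split: letter.splits if_splits)

context sdatum
begin

text \<open>The word-level lemmas require the characters to satisfy their identities at every \<open>h\<close>, not just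
  at elements of the group.\<close>

definition cx :: "nat \<Rightarrow> 'g \<Rightarrow> 'k" where
  "cx i h = (if i < \<theta> \<and> h \<in> G then \<chi> i h else 1)"

lemma cx [simp]: "i < \<theta> \<Longrightarrow> h \<in> G \<Longrightarrow> cx i h = \<chi> i h"
  by (simp add: cx_def)

sublocale qls: qls g cx \<theta> N
proof
  fix i assume i: "i < \<theta>"
  show "cx i (g i) ^ N i = 1" using i by (simp add: chi_power_eq_1)
  show "cx i (g i) \<noteq> 1" using i by (simp add: q_neq_1)
  show "1 < N i" using N_ge[OF i] by simp
  show "cx i (g i) ^ k \<noteq> 1" if "0 < k" "k < N i" for k
    using i that by (auto simp: chi_power_eq_1 dest: dvd_imp_le)
qed (simp add: chi_braid)

text \<open>Identifies the recursive functionals with PBW functionals supported on the exponent a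
  e_i; for that \<omega> has to be multiplicative on the group.\<close>

lemma dp_pbw:
  assumes "w \<in> W" "i < \<theta>" and \<omega>: "\<And>h k. h \<in> G \<Longrightarrow> k \<in> G \<Longrightarrow> \<omega> (h \<otimes>\<^bsub>grp D\<^esub> k) = \<omega> h * \<omega> k" "\<omega> \<one>\<^bsub>grp D\<^esub> = 1"
  shows "dp cx i a \<omega> w = (if occ w = (\<lambda>k. if k = i then a else 0) then coef D w * \<omega> (gprod D w) else 0)"
  using assms(1)
proof (induction w arbitrary: a rule: list.induct)
  case Nil
  then show ?case by (auto simp: fun_eq_iff \<omega>(2))
next
  case (Cons s w)
  then have w: "w \<in> W" and s: "s \<in> letters D" by simp_all
  show ?case
  proof (cases s)
    case (Grp h)
    have "(\<Prod>k<\<theta>. \<chi> k h ^ (if k = i then a else 0)) = (\<Prod>k<\<theta>. if k = i then \<chi> i h ^ a else 1)"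
      by (intro prod.cong) auto
    then have "(\<Prod>k<\<theta>. \<chi> k h ^ (if k = i then a else 0)) = \<chi> i h ^ a" using assms(2) by simp
    moreover have "h \<in> G" using s Grp by simp
    ultimately show ?thesis using Cons.IH[OF w, of a] assms(2) w by (auto simp: Grp \<omega>(1) fun_eq_iff)
  next
    case (Var k)
    show ?thesis
    proof (cases "k = i \<and> 0 < a")
      case True
      then obtain b where b: "a = Suc b" by (cases a) auto
      have o: "occ (s # w) = (\<lambda>k. if k = i then a else 0) \<longleftrightarrow> occ w = (\<lambda>k. if k = i then b else 0)"
        using True by (auto simp: Var b fun_eq_iff)
      have "coef D (s # w) = coef D w" if "occ w = (\<lambda>k. if k = i then b else 0)"
        using True that by (auto simp: Var fun_eq_iff intro!: prod.neutral)
      then show ?thesis using Cons.IH[OF w, of b] True unfolding o by (auto simp: Var b)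
    next
      case False
      then have "occ (s # w) k \<noteq> (if k = i then a else 0)" by (auto simp: Var)
      then have "occ (s # w) \<noteq> (\<lambda>k. if k = i then a else 0)" by metis
      moreover have "dp cx i a \<omega> (s # w) = 0" using False by (auto simp: Var)
      ultimately show ?thesis by simp
    qed
  qed
qed

lemma occ_eq:
  assumes "w \<in> W"
  shows "occ w = (\<lambda>k. if k = i then a else 0) \<longleftrightarrow> (\<forall>k<\<theta>. occ w k = (if k = i then a else 0)) \<and> (i < \<theta> \<or> a = 0)"
proof -
  have z: "occ w k = 0" if "\<not> k < \<theta>" for k using count_W[OF assms] that by simp
  show ?thesis
  proof
    assume *: "occ w = (\<lambda>k. if k = i then a else 0)"
    show "(\<forall>k<\<theta>. occ w k = (if k = i then a else 0)) \<and> (i < \<theta> \<or> a = 0)"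
      using z[of i] fun_cong[OF *] by auto
  next
    assume *: "(\<forall>k<\<theta>. occ w k = (if k = i then a else 0)) \<and> (i < \<theta> \<or> a = 0)"
    show "occ w = (\<lambda>k. if k = i then a else 0)"
    proof
      fix k show "occ w k = (if k = i then a else 0)" using * z[of k] by (cases "k < \<theta>") auto
    qed
  qed
qed

lemma overflow_unit: "a < N i \<Longrightarrow> i < \<theta> \<Longrightarrow> \<not> overflow D (\<lambda>k. if k = i then a else 0)"
  unfolding overflow_def
proof (intro notI, elim exE conjE)
  fix k assume "a < N i" "k < \<theta>" "N k \<le> (if k = i then a else 0)"
  then show False using N_ge[of k] by (auto split: if_splits)
qed

lemma rep1_d_fun: "i < \<theta> \<Longrightarrow> rep1_0 (d_fun D i) (dp cx i 1 (\<lambda>_. 1))"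
  unfolding d_fun_def
proof (rule rep1_cong[OF rep1_pbw_form])
  fix w assume i: "i < \<theta>" and w: "w \<in> W"
  let ?e = "\<lambda>k. if k = i then 1 else (0 :: nat)"
  have no: "\<not> overflow D ?e" by (rule overflow_unit[OF _ i]) (use N_ge[OF i] in simp)
  have o: "occ w = ?e \<longleftrightarrow> (\<forall>k<\<theta>. occ w k = ?e k)" using occ_eq[OF w, of i 1] i by simp
  have d: "dp cx i 1 (\<lambda>_. 1) w = (if occ w = ?e then coef D w else 0)"
    using dp_pbw[OF w i, of "\<lambda>_. 1" 1] by simp
  show "pbw_fun D (cut (\<lambda>a h. if \<forall>j<\<theta>. a j = ?e j then 1 else 0)) w = dp cx i 1 (\<lambda>_. 1) w"
  proof (cases "occ w = ?e")
    case True
    then have "\<not> overflow D (occ w)" using no by simp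
    then show ?thesis unfolding d unfolding o pbw_fun_def cut_def
      by (simp only: if_False if_distrib[of "(*) _"] mult_1_right mult_zero_right)
  next
    case False
    then show ?thesis unfolding d unfolding o pbw_fun_def cut_def
      by (simp only: if_False if_cancel mult_zero_right)
  qed
qed simp

lemma rep1_chi_fun: "i < \<theta> \<Longrightarrow> rep1_0 (chi_fun D i) (dp cx i 0 (cx i))"
  unfolding chi_fun_def
proof (rule rep1_cong[OF rep1_pbw_form])
  fix w assume i: "i < \<theta>" and w: "w \<in> W"
  have no: "\<not> overflow D (\<lambda>k. 0)" using overflow_unit[of 0 i] N_ge[OF i] i by simp
  have o: "occ w = (\<lambda>k. 0) \<longleftrightarrow> (\<forall>k<\<theta>. occ w k = 0)" using occ_eq[OF w, of i 0] by simp
  have "dp cx i 0 (cx i) w = (if occ w = (\<lambda>k. 0) then coef D w * cx i (gprod D w) else 0)"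
    by (subst dp_pbw[OF w i]) (simp_all add: chi_mult chi_one i)
  then show "pbw_fun D (cut (\<lambda>a h. if \<forall>j<\<theta>. a j = 0 then \<chi> i h else 0)) w = dp cx i 0 (cx i) w"
    unfolding o pbw_fun_def cut_def using no i w o by (cases "\<forall>k<\<theta>. occ w k = 0") auto
qed simp

lemma rep2_eta:
  assumes "i < \<theta>" "j < \<theta>"
  shows "rep2_0 (eta D i j) (qls.eta_w i j)"
proof -
  have "dp cx i 1 (\<lambda>_. 1) \<diamondop>\<^bsub>g\<^esub> dp cx j 0 (cx j) = dp cx i 1 (cx j)"
    by (simp add: dp_0_index[of cx j _ i] dp_same)
  then have "rep1_0 (conv1 (u0 D) (d_fun D i) (chi_fun D j)) (dp cx i 1 (cx j))"
    using rep1_conv1[OF rep1_d_fun[OF assms(1)] rep1_chi_fun[OF assms(2)]] by simp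
  from rep2_tens[OF this rep1_d_fun[OF assms(2)]] show ?thesis
    unfolding qls.eta_w_def eta_def[abs_def] .
qed

lemma rep2_zeta:
  assumes i: "i < \<theta>"
  shows "rep2_0 (zeta D i) (\<lambda>z. \<Sum>b\<in>{1..<N i}. (dp cx i (N i - b) (\<lambda>h. cx i h ^ b) \<otimes>\<^sub>t dp cx i b (\<lambda>_. 1)) z)"
  unfolding zeta_def
proof (rule rep2_cong[OF rep2_pbw_form2])
  fix x y assume x: "x \<in> W" and y: "y \<in> W"
  let ?v = "\<lambda>a h b k. if (\<forall>j<\<theta>. j \<noteq> i \<longrightarrow> a j = 0 \<and> b j = 0) \<and> a i + b i = N i then \<chi> i h ^ b i else 0"
  let ?b = "occ y i"
  let ?u = "\<lambda>a k. if k = i then a else (0 :: nat)"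
  have d1: "dp cx i (N i - b) (\<lambda>h. cx i h ^ b) x = (if occ x = ?u (N i - b) then coef D x * cx i (gprod D x) ^ b else 0)" for b
    by (rule dp_pbw[OF x i]) (simp_all add: chi_mult chi_one i power_mult_distrib)
  have d2: "dp cx i b (\<lambda>_. 1) y = (if occ y = ?u b then coef D y else 0)" for b
    using dp_pbw[OF y i, of "\<lambda>_. 1" b] by simp
  \<comment> \<open>The word y determines its exponent, so at most one summand is nonzero.\<close>
  have "(\<Sum>b\<in>{1..<N i}. dp cx i (N i - b) (\<lambda>h. cx i h ^ b) x * dp cx i b (\<lambda>_. 1) y) =
    (\<Sum>b\<in>{1..<N i}. if b = ?b then (if occ x = ?u (N i - ?b) \<and> occ y = ?u ?b
       then coef D x * cx i (gprod D x) ^ ?b * coef D y else 0) else 0)"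
  proof (rule sum.cong[OF refl])
    fix b
    show "dp cx i (N i - b) (\<lambda>h. cx i h ^ b) x * dp cx i b (\<lambda>_. 1) y =
      (if b = ?b then (if occ x = ?u (N i - ?b) \<and> occ y = ?u ?b
       then coef D x * cx i (gprod D x) ^ ?b * coef D y else 0) else 0)"
    proof (cases "b = ?b")
      case True
      show ?thesis unfolding d1 d2 True[symmetric]
        by (cases "occ x = ?u (N i - b)"; cases "occ y = ?u b")
          (simp_all only: if_True if_False simp_thms mult_zero_left mult_zero_right)
    next
      case False
      then have "occ y \<noteq> ?u b" by (metis (full_types))
      then show ?thesis unfolding d2 using False by (simp only: if_False mult_zero_right)
    qed
  qed
  also have "\<dots> = (if 1 \<le> ?b \<and> ?b < N i \<and> occ x = ?u (N i - ?b) \<and> occ y = ?u ?b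
       then coef D x * cx i (gprod D x) ^ ?b * coef D y else 0)"
    unfolding sum.delta[OF finite_atLeastLessThan] sum.delta'[OF finite_atLeastLessThan] by (simp only: atLeastLessThan_iff if_if_eq_conj conj_assoc)
  also have "\<dots> = coef D x * cut (\<lambda>a h. pbw_fun D (cut (?v a h)) y) (occ x) (gprod D x)"
  proof (cases "1 \<le> ?b \<and> ?b < N i \<and> occ x = ?u (N i - ?b) \<and> occ y = ?u ?b")
    case True
    have "\<not> overflow D (?u (N i - ?b))" by (rule overflow_unit) (use True i in auto)
    moreover have "\<not> overflow D (?u ?b)" by (rule overflow_unit) (use True i in auto)
    ultimately have no: "\<not> overflow D (occ x)" "\<not> overflow D (occ y)" using True by metis+
    have ox: "occ x = ?u (N i - ?b)" and oy: "occ y = ?u ?b" and b: "1 \<le> ?b" "?b < N i" using True by blast+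
    have "occ x i + ?b = N i" using fun_cong[OF ox, of i] b by simp
    moreover have "\<forall>j<\<theta>. j \<noteq> i \<longrightarrow> occ x j = 0 \<and> occ y j = 0"
    proof (intro allI impI)
      fix j assume "j \<noteq> i"
      then show "occ x j = 0 \<and> occ y j = 0" using fun_cong[OF ox, of j] fun_cong[OF oy, of j] by simp
    qed
    ultimately have "?v (occ x) (gprod D x) (occ y) (gprod D y) = cx i (gprod D x) ^ ?b"
      using x i by simp
    then show ?thesis unfolding cut_def pbw_fun_def[of D _ y] if_P[OF True] using no by (simp only: if_False mult_ac)
  next
    case False
    \<comment> \<open>Outside the range 1 to N_i - 1 of b, the condition that the exponents add to
      N_i makes one of them reach N_i.\<close>
    have "overflow D (occ x) \<or> overflow D (occ y) \<or> ?v (occ x) (gprod D x) (occ y) (gprod D y) = 0"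
    proof (rule ccontr)
      assume "\<not> ?thesis"
      then have no: "\<not> overflow D (occ x)" "\<not> overflow D (occ y)"
        and v: "?v (occ x) (gprod D x) (occ y) (gprod D y) \<noteq> 0" by blast+
      have *: "\<forall>j<\<theta>. j \<noteq> i \<longrightarrow> occ x j = 0 \<and> occ y j = 0" "occ x i + ?b = N i"
        using v by (meson)+
      have "occ x i < N i" "?b < N i" using no i unfolding overflow_def not_ex de_Morgan_conj not_le by blast+
      moreover have "occ x k = ?u (N i - ?b) k \<and> occ y k = ?u ?b k" if "k < \<theta>" for k
        using * that by (cases "k = i") auto
      then have "occ x = ?u (N i - ?b)" "occ y = ?u ?b" unfolding occ_eq[OF x] occ_eq[OF y] using i by blast+
      ultimately show False using False *(2) by linarith
    qed
    then show ?thesis unfolding cut_def pbw_fun_def[of D _ y] if_not_P[OF False]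
      by (elim disjE) (simp_all only: if_True if_cancel mult_zero_right)
  qed
  finally show "(case (x, y) of (x, y) \<Rightarrow> pbw_fun D (cut (\<lambda>a h. pbw_fun D (cut (?v a h)) y)) x) =
     (\<Sum>b\<in>{1..<N i}. (dp cx i (N i - b) (\<lambda>h. cx i h ^ b) \<otimes>\<^sub>t dp cx i b (\<lambda>_. 1)) (x, y))"
    by (simp add: pbw_fun_def[of D _ x])
qed (use i in auto)

lemma rep2_exp_zeta: "rep2_0 (exp_zeta D \<mu>) (exp_w g (qls.zeta_w \<mu>))"
  unfolding exp_zeta_def
proof (rule rep2_exp)
  show "rep2_0 (\<lambda>a b. \<Sum>i<\<theta>. \<mu> i * zeta D i a b) (qls.zeta_w \<mu>)"
    unfolding qls.zeta_w_def[abs_def] by (intro rep2_sum rep2_scale rep2_zeta) simp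
  fix z :: "'g letter list \<times> 'g letter list" assume "deg (fst z) + deg (snd z) = 0"
  then have "dp cx i b (\<lambda>_. 1) (snd z) = 0" if "0 < b" for i b using that dp_deg[of cx i b "\<lambda>_. 1" "snd z"] by auto
  then show "qls.zeta_w \<mu> z = 0" by (simp add: qls.zeta_w_def tens_def)
qed

end

section \<open>Coboundaries realizing given relations\<close>

text \<open>Variables are restricted but group letters are not: splitting a power of x_i produces
  letters g_i, and the class must be closed under it.\<close>

abbreviation flat :: "nat set \<Rightarrow> 'g letter list set" where
  "flat I \<equiv> lists (range Grp \<union> Var ` I)"

lemma flat_UNIV: "w \<in> flat UNIV"
  by (induction w) (metis lists.simps letter.exhaust rangeI UnI1 UnI2)+

lemma split_flat: "(u, v) \<in> set (split g w) \<Longrightarrow> w \<in> flat I \<Longrightarrow> u \<in> flat I \<and> v \<in> flat I"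
  by (rule split_letters) auto

lemma conv_flat_zero:
  assumes "w \<in> flat I"
  shows "(\<And>u. u \<in> flat I \<Longrightarrow> deg u \<le> deg w \<Longrightarrow> f u = 0) \<Longrightarrow> (f \<diamondop>\<^bsub>g\<^esub> h) w = 0"
    and "(\<And>u. u \<in> flat I \<Longrightarrow> deg u \<le> deg w \<Longrightarrow> h u = 0) \<Longrightarrow> (f \<diamondop>\<^bsub>g\<^esub> h) w = 0"
proof -
  have *: "u \<in> flat I \<and> v \<in> flat I \<and> deg u \<le> deg w \<and> deg v \<le> deg w" if "(u, v) \<in> set (split g w)" for u v
    using split_flat[OF that assms] split_deg[OF that] by simp
  show "(f \<diamondop>\<^bsub>g\<^esub> h) w = 0" if "\<And>u. u \<in> flat I \<Longrightarrow> deg u \<le> deg w \<Longrightarrow> f u = 0"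
  proof -
    have "(f \<diamondop>\<^bsub>g\<^esub> h) w = ((\<lambda>_. 0) \<diamondop>\<^bsub>g\<^esub> h) w" using * that by (intro conv_cong refl) blast
    then show ?thesis by (simp add: conv_linear)
  qed
  show "(f \<diamondop>\<^bsub>g\<^esub> h) w = 0" if "\<And>u. u \<in> flat I \<Longrightarrow> deg u \<le> deg w \<Longrightarrow> h u = 0"
  proof -
    have "(f \<diamondop>\<^bsub>g\<^esub> h) w = (f \<diamondop>\<^bsub>g\<^esub> (\<lambda>_. 0)) w" using * that by (intro conv_cong refl) blast
    then show ?thesis by (simp add: conv_linear)
  qed
qed

lemma conv_flat_eps:
  assumes "w \<in> flat I" "\<And>u. u \<in> flat I \<Longrightarrow> deg u \<le> deg w \<Longrightarrow> p u = eps u"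
  shows "(f \<diamondop>\<^bsub>g\<^esub> p) w = f w" and "(p \<diamondop>\<^bsub>g\<^esub> f) w = f w"
proof -
  have *: "p u = eps u \<and> p v = eps v" if "(u, v) \<in> set (split g w)" for u v
    using split_flat[OF that assms(1)] split_deg[OF that] assms(2) by simp
  have "(f \<diamondop>\<^bsub>g\<^esub> p) w = (f \<diamondop>\<^bsub>g\<^esub> eps) w" "(p \<diamondop>\<^bsub>g\<^esub> f) w = (eps \<diamondop>\<^bsub>g\<^esub> f) w"
    using * by (intro conv_cong refl; blast)+
  then show "(f \<diamondop>\<^bsub>g\<^esub> p) w = f w" "(p \<diamondop>\<^bsub>g\<^esub> f) w = f w" by simp_all
qed

text \<open>Below degree m the right leg contributes nothing, so only the extreme term g_i^m
  \<otimes> x_i^m of the coproduct survives. The left version keeps x_i^m \<otimes> 1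
  instead.\<close>

lemma conv_replicate_right:
  assumes "\<And>w. w \<in> flat {i} \<Longrightarrow> deg w < m \<Longrightarrow> p w = 0"
  shows "(f \<diamondop>\<^bsub>g\<^esub> p) (replicate m (Var i)) = f (replicate m (Grp (g i))) * p (replicate m (Var i))"
  using assms
proof (induction m arbitrary: f p)
  case (Suc m)
  have r: "replicate m (Var i) \<in> flat {i}" by (auto simp: in_lists_conv_set)
  have "((\<lambda>u. f (Var i # u)) \<diamondop>\<^bsub>g\<^esub> p) (replicate m (Var i)) = 0"
    by (rule conv_flat_zero(2)[OF r]) (use Suc.prems in auto)
  moreover have "((\<lambda>u. f (Grp (g i) # u)) \<diamondop>\<^bsub>g\<^esub> (\<lambda>u. p (Var i # u))) (replicate m (Var i)) =
      f (Grp (g i) # replicate m (Grp (g i))) * p (Var i # replicate m (Var i))"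
    by (rule Suc.IH) (use Suc.prems in auto)
  ultimately show ?case by simp
qed simp

lemma conv_replicate_left:
  assumes "\<And>w. w \<in> flat {i} \<Longrightarrow> deg w < m \<Longrightarrow> q w = 0"
  shows "(q \<diamondop>\<^bsub>g\<^esub> f) (replicate m (Var i)) = q (replicate m (Var i)) * f []"
  using assms
proof (induction m arbitrary: q f)
  case (Suc m)
  have r: "replicate m (Var i) \<in> flat {i}" by (auto simp: in_lists_conv_set)
  have "((\<lambda>u. q (Grp (g i) # u)) \<diamondop>\<^bsub>g\<^esub> (\<lambda>u. f (Var i # u))) (replicate m (Var i)) = 0"
    by (rule conv_flat_zero(1)[OF r]) (use Suc.prems in auto)
  moreover have "((\<lambda>u. q (Var i # u)) \<diamondop>\<^bsub>g\<^esub> f) (replicate m (Var i)) = q (Var i # replicate m (Var i)) * f []"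
    by (rule Suc.IH) (use Suc.prems in auto)
  ultimately show ?case by simp
qed simp

text \<open>The recursion evaluates d_i on legs of the rest of the word, which have degree below n
  and variables in I.\<close>

lemma cob_flat_zero:
  assumes "\<And>i u. i \<in> I \<Longrightarrow> u \<in> flat I \<Longrightarrow> deg u < n \<Longrightarrow> d i u = 0"
  shows "w \<in> flat I \<Longrightarrow> 0 < deg w \<Longrightarrow> deg w \<le> n \<Longrightarrow> cob g d w = 0"
    and "w \<in> flat I \<Longrightarrow> 0 < deg w \<Longrightarrow> deg w \<le> n \<Longrightarrow> cob' g d w = 0"
proof -
  have "cob g d w = 0 \<and> cob' g d w = 0" if "w \<in> flat I" "0 < deg w" "deg w \<le> n"
    using that
  proof (induction w rule: list.induct)
    case (Cons s w)
    show ?case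
    proof (cases s)
      case (Var i)
      then have "i \<in> I" "w \<in> flat I" "deg w < n" using Cons.prems by auto
      then have "(d i \<diamondop>\<^bsub>g\<^esub> cob g d) w = 0" "(cob' g d \<diamondop>\<^bsub>g\<^esub> d i) w = 0"
        using assms by (intro conv_flat_zero(1)[where I = I] conv_flat_zero(2)[where I = I]; auto)+
      then show ?thesis by (simp add: Var)
    qed (use Cons in auto)
  qed simp
  then show "w \<in> flat I \<Longrightarrow> 0 < deg w \<Longrightarrow> deg w \<le> n \<Longrightarrow> cob g d w = 0"
    "w \<in> flat I \<Longrightarrow> 0 < deg w \<Longrightarrow> deg w \<le> n \<Longrightarrow> cob' g d w = 0" by blast+
qed

lemma cob_deg_0: "deg w = 0 \<Longrightarrow> cob g d w = 1" "deg w = 0 \<Longrightarrow> cob' g d w = 1"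
  by (induction w) (auto split: letter.splits)

lemma cob_flat_eps:
  assumes "\<And>i u. i \<in> I \<Longrightarrow> u \<in> flat I \<Longrightarrow> deg u < n \<Longrightarrow> d i u = 0" "w \<in> flat I" "deg w \<le> n"
  shows "cob g d w = eps w" "cob' g d w = eps w"
  using cob_flat_zero[where I = I and n = n and d = d and w = w and g = g, OF assms(1)] cob_deg_0[of w g d] assms(2,3)
  by (cases "deg w = 0"; simp add: eps_deg)+

lemma cob_replicate:
  assumes "\<And>u. u \<in> flat {i} \<Longrightarrow> deg u < m \<Longrightarrow> d i u = 0"
  shows "cob g d (replicate (Suc m) (Var i)) = - d i (replicate m (Var i))"
    and "cob' g d (replicate (Suc m) (Var i)) = d i (replicate m (Var i))"
proof -
  have "deg (replicate m (Grp h)) = 0" for h :: 'a by (induction m) auto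
  then have "cob' g d (replicate m (Grp (g i))) = 1" by (rule cob_deg_0)
  then show "cob g d (replicate (Suc m) (Var i)) = - d i (replicate m (Var i))"
    "cob' g d (replicate (Suc m) (Var i)) = d i (replicate m (Var i))"
    using conv_replicate_left[of i m "d i" g "cob g d", OF assms] conv_replicate_right[of i m "d i" "cob' g d" g, OF assms]
    by simp_all
qed

lemma (in sdatum) good0_replicate_Grp:
  assumes "good0 s" "h \<in> G"
  shows "s (replicate n (Grp h)) = s [Grp (h [^]\<^bsub>grp D\<^esub> n)]"
  using assms(1)
proof (induction n arbitrary: s)
  case 0
  then show ?case using good0_rules(1)[of s "[]" "[]"] by simp
next
  case (Suc n)
  have "good0 (\<lambda>w. s (Grp h # w))"
    using good_translate[OF Suc.prems, of "[Grp h]" "[]"] assms(2) by simp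
  from Suc.IH[OF this] show ?case
    using good0_rules(2)[OF Suc.prems, of "[]" "[]" h "h [^]\<^bsub>grp D\<^esub> n"] assms(2)
    by (simp add: G.m_comm)
qed

text \<open>On x_i^N_i only three terms survive: Q(x_i^N_i) s(1), s(x_i^N_i) = 0 and s(g_i^N_i)
  P(x_i^N_i); with the values \<mu>_i and -\<mu>_i they form the deformed relation. On x_i x_j the
  values l_ij and -l_ij act the same way.\<close>

lemma (in sdatum) kills_twistI:
  fixes P Q s :: "'g letter list \<Rightarrow> 'k"
  assumes P: "\<And>h w. P (Grp h # w) = P w" "P [] = 1" and Q: "\<And>h w. Q (Grp h # w) = Q w" "Q [] = 1"
    and deg1: "\<And>w. deg w = 1 \<Longrightarrow> P w = 0 \<and> Q w = 0"
    and link: "\<And>i j. i < j \<Longrightarrow> j < \<theta> \<Longrightarrow> P [Var i, Var j] = - l i j \<and> Q [Var i, Var j] = l i j"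
      "\<And>i j. i < j \<Longrightarrow> j < \<theta> \<Longrightarrow> P [Var j, Var i] = 0 \<and> Q [Var j, Var i] = 0"
    and gap: "\<And>i w. i < \<theta> \<Longrightarrow> w \<in> flat {i} \<Longrightarrow> 0 < deg w \<Longrightarrow> deg w < N i \<Longrightarrow> P w = 0 \<and> Q w = 0"
    and root: "\<And>i. i < \<theta> \<Longrightarrow> P (replicate (N i) (Var i)) = - \<mu> i \<and> Q (replicate (N i) (Var i)) = \<mu> i"
    and s: "good0 s"
  shows "kills D l \<mu> (Q \<diamondop>\<^bsub>g\<^esub> (s \<diamondop>\<^bsub>g\<^esub> P))"
  unfolding kills_def
proof (intro conjI ballI allI impI)
  let ?Y = "Q \<diamondop>\<^bsub>g\<^esub> (s \<diamondop>\<^bsub>g\<^esub> P)"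
  have W: "[] \<in> W" by simp
  note R = good0_rules[OF s W W, simplified]
  note v = P Q deg1[of "[Var _]"] deg1[of "[Var _, Grp _]"]
  show "?Y [Grp \<one>\<^bsub>grp D\<^esub>] = ?Y []" by (simp add: P Q R)
  show "?Y [Grp h, Grp k] = ?Y [Grp (h \<otimes>\<^bsub>grp D\<^esub> k)]" if "h \<in> G" "k \<in> G" for h k
    using that by (simp add: P Q R(2))
  show "?Y [Grp h, Var i] = \<chi> i h * ?Y [Var i, Grp h]" if "h \<in> G" "i < \<theta>" for h i
    using that R(3) by (simp add: v)
  have YN: "?Y [] = s []" "?Y [Grp h] = s [Grp h]" for h by (simp_all add: P Q)
  show "?Y [Var i, Var j] = \<chi> j (g i) * ?Y [Var j, Var i] + l i j * (?Y [] - ?Y [Grp (g i \<otimes>\<^bsub>grp D\<^esub> g j)])"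
    if "i < j" "j < \<theta>" for i j
    using that link R(2)[of "g i" "g j"] R(5)[OF that] unfolding YN by (simp add: v algebra_simps)
  show "?Y (replicate (N i) (Var i)) = \<mu> i * (?Y [] - ?Y [Grp (g i [^]\<^bsub>grp D\<^esub> N i)])" if i: "i < \<theta>" for i
  proof -
    let ?x = "replicate (N i) (Var i) :: 'g letter list"
    have N: "0 < N i" using N_ge[OF i] by simp
    have e: "eps ?x = (0 :: 'k)" using N by (cases "N i") auto
    have PQ0: "P w = 1" "Q w = 1" if "deg w = 0" for w
      using that by (induction w; auto simp: P Q split: letter.splits)+
    \<comment> \<open>P and Q themselves do not vanish in degree 0; subtracting eps makes them
      vanish below degree N_i, as the evaluation on x_i^N_i requires.\<close>
    have zero: "P w - eps w = 0" "Q w - eps w = 0" if "w \<in> flat {i}" "deg w < N i" for w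
      using gap[OF i that(1)] that(2) PQ0[of w] by (cases "deg w = 0"; simp add: eps_deg)+
    have "(s \<diamondop>\<^bsub>g\<^esub> P) ?x = s ?x + (s \<diamondop>\<^bsub>g\<^esub> (\<lambda>w. P w - eps w)) ?x" by (simp add: conv_linear)
    also have "(s \<diamondop>\<^bsub>g\<^esub> (\<lambda>w. P w - eps w)) ?x = s (replicate (N i) (Grp (g i))) * (P ?x - eps ?x)"
      by (rule conv_replicate_right) (rule zero)
    finally have sP: "(s \<diamondop>\<^bsub>g\<^esub> P) ?x = - \<mu> i * s [Grp (g i [^]\<^bsub>grp D\<^esub> N i)]"
      using R(4)[OF i] root[OF i] e good0_replicate_Grp[OF s g_closed[OF i]] by simp
    have "?Y ?x = (s \<diamondop>\<^bsub>g\<^esub> P) ?x + ((\<lambda>w. Q w - eps w) \<diamondop>\<^bsub>g\<^esub> (s \<diamondop>\<^bsub>g\<^esub> P)) ?x" by (simp add: conv_linear)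
    also have "((\<lambda>w. Q w - eps w) \<diamondop>\<^bsub>g\<^esub> (s \<diamondop>\<^bsub>g\<^esub> P)) ?x = (Q ?x - eps ?x) * (s \<diamondop>\<^bsub>g\<^esub> P) []"
      by (rule conv_replicate_left) (rule zero)
    finally show ?thesis using root[OF i] e unfolding YN sP by (simp add: P algebra_simps)
  qed
qed

section \<open>The root vector functional F and the identification of u(D,0,\<mu>)\<close>

locale root_datum = sdatum D for D :: "('g, 'k::field_char_0) datum" +
  fixes \<mu> :: "nat \<Rightarrow> 'k"
  assumes \<mu>: "root_vector_parameters D \<mu>"
begin

abbreviation F where "F \<equiv> cob g (qls.d_root \<mu>)"
abbreviation F' where "F' \<equiv> cob' g (qls.d_root \<mu>)"

text \<open>\<open>root_coboundary\<close>, multiplied from the right by the inverse of F on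
  concatenations. The extended characters satisfy the power condition even off the group.\<close>

lemma exp_zeta_coboundary: "exp_w g (qls.zeta_w \<mu>) = coboundary g F F'"
proof -
  let ?E = "exp_w g (qls.zeta_w \<mu>)"
  have "?E \<bullet>\<^bsub>g\<^esub> (\<lambda>(u, v). F (u @ v)) = F \<otimes>\<^sub>t F"
  proof (rule qls.root_coboundary)
    fix i h assume "i < \<theta>" "\<mu> i \<noteq> 0"
    then show "cx i h ^ N i = 1" using \<mu> unfolding root_vector_parameters_def cx_def by auto
  qed
  then have "coboundary g F F' = (?E \<bullet>\<^bsub>g\<^esub> (\<lambda>(u, v). F (u @ v))) \<bullet>\<^bsub>g\<^esub> (\<lambda>(u, v). F' (u @ v))"
    by (simp only: coboundary_def)
  then show ?thesis by (simp only: cw2.conv_assoc conv_append cob_cob' eps_append2 cw2.conv_unit)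
qed

lemma d_root_zero: "deg u < 2 \<Longrightarrow> qls.d_root \<mu> i u = 0" "deg u < N i - 1 \<Longrightarrow> qls.d_root \<mu> i u = 0"
  using dp_deg[of cx i "N i - 1" "\<lambda>_. 1" u] N_ge[of i] by (auto simp: qls.d_root_def)

text \<open>As N_i \<ge> 3, the functionals d^(N_i - 1) need degree at least 2, so F first differs
  from eps in degree 3 and leaves the commutators alone.\<close>

lemma F_low: "deg w \<le> 2 \<Longrightarrow> F w = eps w" "deg w \<le> 2 \<Longrightarrow> F' w = eps w"
proof -
  have w: "w \<in> flat UNIV" by (rule flat_UNIV)
  show "deg w \<le> 2 \<Longrightarrow> F w = eps w" "deg w \<le> 2 \<Longrightarrow> F' w = eps w"
    by (rule cob_flat_eps[OF _ w]; simp add: d_root_zero)+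
qed

lemma F_gap:
  assumes "w \<in> flat {i}" "0 < deg w" "deg w < N i"
  shows "F w = 0" "F' w = 0"
  using assms by (intro cob_flat_zero[where I = "{i}" and n = "N i - 1"]; simp add: d_root_zero)+

lemma F_root:
  assumes "i < \<theta>"
  shows "F (replicate (N i) (Var i)) = - \<mu> i" "F' (replicate (N i) (Var i)) = \<mu> i"
proof -
  obtain m where m: "N i = Suc m" using N_ge[OF assms] by (cases "N i") auto
  have "dp cx i n (\<lambda>_. 1) (replicate n (Var i)) = 1" for n by (induction n) auto
  then have "qls.d_root \<mu> i (replicate m (Var i)) = \<mu> i" using assms by (simp add: qls.d_root_def m)
  then show "F (replicate (N i) (Var i)) = - \<mu> i" "F' (replicate (N i) (Var i)) = \<mu> i"
    unfolding m using cob_replicate[of i m "qls.d_root \<mu>" g] d_root_zero(2)[of _ i] m by simp_all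
qed

text \<open>The deformation by \<open>exp_zeta\<close> alone; it provides the witness for the choice
  in \<open>root_ident\<close> and the conjugation formula for it.\<close>

sublocale root: coboundary_twist D "\<lambda>_ _. 0" \<mu> F F' "exp_zeta D \<mu>"
proof
  show "F \<diamondop>\<^bsub>g\<^esub> F' = eps" "F' \<diamondop>\<^bsub>g\<^esub> F = eps" by (rule cob_cob' cob'_cob)+
  show "rep2_0 (exp_zeta D \<mu>) (coboundary g F F')"
    using rep2_exp_zeta[of \<mu>] unfolding exp_zeta_coboundary .
  show "F [Var i] = 0" "F' [Var i] = 0" for i using F_low[of "[Var i]"] by simp_all
  fix s assume s: "good0 s"
  show "kills D (\<lambda>_ _. 0) \<mu> (F' \<diamondop>\<^bsub>g\<^esub> (s \<diamondop>\<^bsub>g\<^esub> F))"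
  proof (rule kills_twistI[OF _ _ _ _ _ _ _ _ _ s])
    show "F w = 0 \<and> F' w = 0" if "deg w = 1" for w using F_low[of w] that by (simp add: eps_deg)
    show "F [Var i, Var j] = - 0 \<and> F' [Var i, Var j] = 0" for i j
      using F_low[of "[Var i, Var j]"] by simp
    show "F [Var j, Var i] = 0 \<and> F' [Var j, Var i] = 0" for i j
      using F_low[of "[Var j, Var i]"] by simp
    show "F w = 0 \<and> F' w = 0" if "w \<in> flat {i}" "0 < deg w" "deg w < N i" for i w
      using F_gap[OF that] by simp
    show "F (replicate (N i) (Var i)) = - \<mu> i \<and> F' (replicate (N i) (Var i)) = \<mu> i" if "i < \<theta>" for i
      using F_root[OF that] by simp
  qed simp_all
qed simp_all

lemma root_ident:
  assumes "p \<in> P0"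
  shows "root_ident D \<mu> (cls D (\<lambda>_ _. 0) \<mu> p) = cls D (\<lambda>_ _. 0) (\<lambda>_. 0) (tw g F' F p)"
proof (rule root.canonical_iso_unique[OF _ assms])
  show "canonical_iso D (\<lambda>_ _. 0) \<mu> (twist (u0 D) (exp_zeta D \<mu>)) (root_ident D \<mu>)"
    unfolding root_ident_def
    by (rule someI[where P = "canonical_iso D (\<lambda>_ _. 0) \<mu> (twist (u0 D) (exp_zeta D \<mu>))", OF root.canonical_iso_Phi])
qed

text \<open>The inverse of conjugation by F is conjugation by F'.\<close>

lemma inv_root_ident:
  assumes p: "p \<in> P0"
  shows "inv_into (carrier (u_alg D (\<lambda>_ _. 0) \<mu>)) (root_ident D \<mu>) (cls D (\<lambda>_ _. 0) (\<lambda>_. 0) p) =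
    cls D (\<lambda>_ _. 0) \<mu> (tw g F F' p)"
proof -
  have "canonical_iso D (\<lambda>_ _. 0) \<mu> (twist (u0 D) (exp_zeta D \<mu>)) (root_ident D \<mu>)"
    unfolding root_ident_def
    by (rule someI[where P = "canonical_iso D (\<lambda>_ _. 0) \<mu> (twist (u0 D) (exp_zeta D \<mu>))", OF root.canonical_iso_Phi])
  then have inj: "inj_on (root_ident D \<mu>) (carrier (u_alg D (\<lambda>_ _. 0) \<mu>))"
    by (simp add: canonical_iso_def bialgebra_iso_def ring_iso_def bij_betw_def)
  have "root_ident D \<mu> (cls D (\<lambda>_ _. 0) \<mu> (tw g F F' p)) = cls D (\<lambda>_ _. 0) (\<lambda>_. 0) p"
    unfolding root_ident[OF tw_P0[OF p]] root.tw_inverse ..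
  then show ?thesis
    using inv_into_f_f[OF inj cls_closed[OF tw_P0[OF p]]] by metis
qed

end

section \<open>The quotient datum\<close>

context sdatum
begin

definition cosetw :: "'g letter list \<Rightarrow> 'g set letter list" where
  "cosetw = map (map_letter (\<lambda>h. G0 D #>\<^bsub>grp D\<^esub> h))"

lemma cosetw_simps [simp]:
  "cosetw [] = []" "cosetw (Grp h # w) = Grp (G0 D #>\<^bsub>grp D\<^esub> h) # cosetw w"
  "cosetw (Var i # w) = Var i # cosetw w" "cosetw (u @ v) = cosetw u @ cosetw v"
  "cosetw (replicate n (Var i)) = replicate n (Var i)"
  by (simp_all add: cosetw_def)

lemma quot_simps [simp]:
  "grp (quot_datum D) = grp D Mod G0 D" "theta (quot_datum D) = \<theta>"
  by (simp_all add: quot_datum_def)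

lemma gg_quot: "gg (quot_datum D) i = G0 D #>\<^bsub>grp D\<^esub> g i"
  by (simp add: quot_datum_def)

text \<open>For i \<noteq> j the braiding makes \<chi>_i(g_j)^N_j inverse to \<chi>_j(g_i)^N_j,
  which is 1; so every character is trivial on the generators of G0.\<close>

lemma chi_G0_gen:
  assumes "i < \<theta>" "j < \<theta>" "\<And>h. h \<in> G \<Longrightarrow> \<chi> j h ^ N j = 1"
  shows "\<chi> i (g j [^]\<^bsub>grp D\<^esub> N j) = 1"
proof (cases "i = j")
  case True
  then show ?thesis using assms by (simp add: chi_pow)
next
  case False
  have "\<chi> i (g j) ^ N j * \<chi> j (g i) ^ N j = 1"
    using chi_braid[OF assms(1,2) False] by (simp flip: power_mult_distrib)
  then show ?thesis using assms by (simp add: chi_pow)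
qed

lemma G0_subgroup: "subgroup (G0 D) (grp D)"
  unfolding G0_def by (rule G.generate_is_subgroup) auto

lemma G0_normal: "normal (G0 D) (grp D)"
  by (rule G.subgroup_imp_normal[OF G0_subgroup])

lemma G0_G: "h \<in> G0 D \<Longrightarrow> h \<in> G"
  using subgroup.subset[OF G0_subgroup] by blast

lemma chi_G0:
  assumes "i < \<theta>" "h \<in> G0 D"
  shows "\<chi> i h = 1"
  using assms(2) unfolding G0_def
proof (induction h rule: generate.induct)
  case one
  then show ?case using assms(1) by (simp add: chi_one)
next
  case (incl h)
  then show ?case using chi_G0_gen[OF assms(1)] by auto
next
  case (inv h)
  then have h: "h \<in> G" "\<chi> i h = 1" using chi_G0_gen[OF assms(1)] by auto
  have "\<chi> i (inv\<^bsub>grp D\<^esub> h) * \<chi> i h = 1"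
    using h(1) assms(1) by (simp add: chi_mult[symmetric] chi_one)
  then show ?case using h by simp
next
  case (eng h k)
  then have "h \<in> G" "k \<in> G" using G0_G unfolding G0_def by blast+
  then show ?case using eng assms(1) by (simp add: chi_mult)
qed

lemma chi_quot [simp]:
  assumes "i < \<theta>" "h \<in> G"
  shows "chi (quot_datum D) i (G0 D #>\<^bsub>grp D\<^esub> h) = \<chi> i h"
proof -
  have "h \<in> G0 D #>\<^bsub>grp D\<^esub> h" by (rule G.rcos_self[OF assms(2) G0_subgroup])
  then have "(SOME k. k \<in> G0 D #>\<^bsub>grp D\<^esub> h) \<in> G0 D #>\<^bsub>grp D\<^esub> h" by (rule someI)
  then obtain k where "k \<in> G0 D" "(SOME k. k \<in> G0 D #>\<^bsub>grp D\<^esub> h) = k \<otimes>\<^bsub>grp D\<^esub> h"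
    unfolding r_coset_def by blast
  then show ?thesis using assms G0_G by (simp add: quot_datum_def chi_mult chi_G0)
qed

lemma NN_quot: "i < \<theta> \<Longrightarrow> NN (quot_datum D) i = N i"
  by (simp add: NN_def gg_quot)

lemma coset_mult:
  assumes "h \<in> G" "k \<in> G"
  shows "(G0 D #>\<^bsub>grp D\<^esub> h) <#>\<^bsub>grp D\<^esub> (G0 D #>\<^bsub>grp D\<^esub> k) = G0 D #>\<^bsub>grp D\<^esub> (h \<otimes>\<^bsub>grp D\<^esub> k)"
  by (rule normal.rcos_sum[OF G0_normal assms])

lemma special_quot: "special_datum (quot_datum D)"
  unfolding special_datum_def
proof (intro conjI allI impI)
  show "comm_group (grp (quot_datum D))" using G.abelian_FactGroup[OF G0_subgroup] by simp
  show "finite (carrier (grp (quot_datum D)))" using finite_G by (simp add: carrier_FactGroup)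
  fix i assume "i < theta (quot_datum D)"
  then have i: "i < \<theta>" by simp
  show "gg (quot_datum D) i \<in> carrier (grp (quot_datum D))" using i by (simp add: carrier_FactGroup gg_quot)
  show "chi (quot_datum D) i \<in> hom (grp (quot_datum D)) kstar"
    unfolding quot_simps
  proof (rule homI)
    fix A assume "A \<in> carrier (grp D Mod G0 D)"
    then obtain h where h: "h \<in> G" "A = G0 D #>\<^bsub>grp D\<^esub> h" by (auto simp: carrier_FactGroup)
    then show "chi (quot_datum D) i A \<in> carrier kstar" using i chi_nonzero[OF i h(1)] by (simp add: kstar_def)
    fix B assume "B \<in> carrier (grp D Mod G0 D)"
    then obtain k where k: "k \<in> G" "B = G0 D #>\<^bsub>grp D\<^esub> k" by (auto simp: carrier_FactGroup)
    show "chi (quot_datum D) i (A \<otimes>\<^bsub>grp D Mod G0 D\<^esub> B) = chi (quot_datum D) i A \<otimes>\<^bsub>kstar\<^esub> chi (quot_datum D) i B"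
      using h k i by (simp add: coset_mult chi_mult kstar_def)
  qed
  show "chi (quot_datum D) i (gg (quot_datum D) i) \<noteq> 1" using i q_neq_1 by (simp add: gg_quot)
  show "odd (NN (quot_datum D) i)" using i special by (simp add: NN_quot special_datum_def)
  fix j assume "j < theta (quot_datum D)" "i \<noteq> j"
  then show "chi (quot_datum D) i (gg (quot_datum D) j) * chi (quot_datum D) j (gg (quot_datum D) i) = 1"
    using i by (simp add: chi_braid gg_quot)
qed

interpretation D': sdatum "quot_datum D"
  by standard (rule special_quot)

lemma cosetw_W: "w \<in> W \<Longrightarrow> cosetw w \<in> D'.W"
  by (induction w) (auto simp: letters_def carrier_FactGroup)

lemma push_cosetw_P0:
  assumes "p \<in> P0"
  shows "push cosetw p \<in> D'.P0"
proof -
  have "Poly_Mapping.keys (push cosetw p) \<subseteq> D'.W"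
    unfolding push_def by (rule keys_sum_subset) (use assms cosetw_W in auto)
  then show ?thesis by simp
qed

lemma split_cosetw: "split (gg (quot_datum D)) (cosetw w) = map (\<lambda>(u, v). (cosetw u, cosetw v)) (split g w)"
proof (induction w)
  case (Cons s w)
  then show ?case by (cases s) (simp_all add: gg_quot o_def case_prod_unfold)
qed simp

definition pulls_back :: "('g set letter list \<times> 'g set letter list \<Rightarrow> 'k) \<Rightarrow>
    ('g letter list \<times> 'g letter list \<Rightarrow> 'k) \<Rightarrow> bool" where
  "pulls_back S' S \<longleftrightarrow> (\<forall>u\<in>W. \<forall>v\<in>W. S' (cosetw u, cosetw v) = S (u, v))"

lemma pulls_back_conv:
  assumes "pulls_back S' S" "pulls_back T' T"
  shows "pulls_back (S' \<bullet>\<^bsub>gg (quot_datum D)\<^esub> T') (S \<bullet>\<^bsub>g\<^esub> T)"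
  unfolding pulls_back_def conv_prod_coalg split_cosetw dsum_map
proof (intro ballI dsum_cong)
  fix u v x y x' y' assume "u \<in> W" "v \<in> W" "(x, y) \<in> set (split g u)" "(x', y') \<in> set (split g v)"
  then have "x \<in> W" "y \<in> W" "x' \<in> W" "y' \<in> W" using split_W by blast+
  then show "S' (cosetw x, cosetw x') * T' (cosetw y, cosetw y') = S (x, x') * T (y, y')"
    using assms by (simp add: pulls_back_def)
qed

lemma eps_cosetw: "eps (cosetw w) = eps w"
  by (induction w) (auto split: letter.split simp: cosetw_def)

lemma pulls_back_eps2: "pulls_back eps2 eps2"
  by (simp add: pulls_back_def eps_cosetw)

lemma pulls_back_cpow:
  assumes "pulls_back S' S"
  shows "pulls_back (cpow (gg (quot_datum D)) S' n) (cpow g S n)"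
  by (induction n) (use assms in \<open>auto simp: pulls_back_eps2 pulls_back_conv\<close>)

lemma pulls_back_q_exp:
  assumes "pulls_back S' S"
  shows "pulls_back (q_exp_w (gg (quot_datum D)) q n S') (q_exp_w g q n S)"
  using pulls_back_cpow[OF assms] by (simp add: pulls_back_def q_exp_w_def)

lemma dp_cosetw:
  assumes "w \<in> W" "\<And>h. h \<in> G \<Longrightarrow> \<omega>' (G0 D #>\<^bsub>grp D\<^esub> h) = \<omega> h" "i < \<theta>"
  shows "dp D'.cx i a \<omega>' (cosetw w) = dp cx i a \<omega> w"
  using assms(1)
proof (induction w arbitrary: a rule: list.induct)
  case (Cons s w)
  then show ?case
    using assms(2,3) by (cases s) (auto simp: carrier_FactGroup)
qed simp

lemma cx_quot: "i < \<theta> \<Longrightarrow> h \<in> G \<Longrightarrow> D'.cx i (G0 D #>\<^bsub>grp D\<^esub> h) = cx i h"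
  by (simp add: carrier_FactGroup)

lemma pulls_back_link_w:
  assumes "\<And>i j. (i, j) \<in> set ps \<Longrightarrow> i < \<theta> \<and> j < \<theta>"
  shows "pulls_back (D'.qls.link_w l ps) (qls.link_w l ps)"
  using assms
proof (induction ps)
  case Nil
  then show ?case by (simp add: D'.qls.link_w_def qls.link_w_def pulls_back_eps2)
next
  case (Cons p ps)
  obtain i j where p: "p = (i, j)" by fastforce
  then have ij: "i < \<theta>" "j < \<theta>" using Cons.prems by auto
  have eta: "pulls_back (\<lambda>z. l i j * D'.qls.eta_w i j z) (\<lambda>z. l i j * qls.eta_w i j z)"
    unfolding pulls_back_def D'.qls.eta_w_def qls.eta_w_def tens_apply
    using dp_cosetw[of _ "D'.cx j" "cx j" i 1] dp_cosetw[of _ "\<lambda>_. 1" "\<lambda>_. 1" j 1] ij cx_quot by simp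
  have "pulls_back (D'.qls.link_factor l p) (qls.link_factor l p)"
    unfolding D'.qls.link_factor_def qls.link_factor_def p prod.case NN_quot[OF ij(2)] gg_quot[of i] cx_quot[OF ij(2) g_closed[OF ij(1)]]
    using pulls_back_q_exp[OF eta] by simp
  moreover have "pulls_back (D'.qls.link_w l ps) (qls.link_w l ps)" by (rule Cons.IH) (use Cons.prems in auto)
  ultimately show ?case
    using pulls_back_conv by (simp add: D'.qls.link_w_def qls.link_w_def)
qed

text \<open>The projection maps u(D,0,\<mu>) to the undeformed algebra: where \<mu>_i \<noteq> 0,
  the element g_i^N_i lies in G0 and becomes 1, so the right-hand side of the root vector relation
  vanishes.\<close>

lemma good_cosetw:
  assumes \<mu>: "root_vector_parameters D \<mu>" and s: "D'.good0 s"
  shows "good D (\<lambda>_ _. 0) \<mu> (\<lambda>w. s (cosetw w))"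
proof (rule goodI)
  fix u v assume uv: "u \<in> W" "v \<in> W"
  note R = D'.good0_rules[OF s cosetw_W[OF uv(1)] cosetw_W[OF uv(2)]]
  have closed: "G0 D #>\<^bsub>grp D\<^esub> h \<in> carrier (grp (quot_datum D))" if "h \<in> G" for h
    using that by (simp add: carrier_FactGroup)
  have one: "G0 D #>\<^bsub>grp D\<^esub> h = G0 D" if "h \<in> G0 D" for h
    using G.coset_join2[OF G0_G[OF that] G0_subgroup that] .
  show "kills D (\<lambda>_ _. 0) \<mu> (\<lambda>w. s (cosetw (u @ w @ v)))"
    unfolding kills_def
  proof (intro conjI ballI allI impI)
    show "s (cosetw (u @ [Grp \<one>\<^bsub>grp D\<^esub>] @ v)) = s (cosetw (u @ [] @ v))"
      using R(1) one[OF subgroup.one_closed[OF G0_subgroup]] by simp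
    show "s (cosetw (u @ [Grp h, Grp k] @ v)) = s (cosetw (u @ [Grp (h \<otimes>\<^bsub>grp D\<^esub> k)] @ v))" if "h \<in> G" "k \<in> G" for h k
      using R(2)[OF closed closed] that by (simp add: coset_mult)
    show "s (cosetw (u @ [Grp h, Var i] @ v)) = \<chi> i h * s (cosetw (u @ [Var i, Grp h] @ v))" if "h \<in> G" "i < \<theta>" for h i
      using R(3)[OF closed, of h i] that by simp
    show "s (cosetw (u @ replicate (N i) (Var i) @ v)) =
        \<mu> i * (s (cosetw (u @ [] @ v)) - s (cosetw (u @ [Grp (g i [^]\<^bsub>grp D\<^esub> N i)] @ v)))" if i: "i < \<theta>" for i
    proof (cases "\<mu> i = 0")
      case True
      then show ?thesis using R(4)[of i] i by (simp add: NN_quot)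
    next
      case False
      then have "\<forall>h\<in>G. \<chi> i h ^ N i = 1" using \<mu> i by (auto simp: root_vector_parameters_def)
      \<comment> \<open>G0 is generated only by the nontrivial powers; a trivial one lies in it as
        the unit.\<close>
      then have "g i [^]\<^bsub>grp D\<^esub> N i \<in> G0 D"
        using i subgroup.one_closed[OF G0_subgroup] unfolding G0_def
        by (cases "g i [^]\<^bsub>grp D\<^esub> N i = \<one>\<^bsub>grp D\<^esub>") (auto intro: generate.incl)
      then show ?thesis using R(1) R(4)[of i] i one by (simp add: NN_quot)
    qed
    show "s (cosetw (u @ [Var i, Var j] @ v)) = \<chi> j (g i) * s (cosetw (u @ [Var j, Var i] @ v)) +
        0 * (s (cosetw (u @ [] @ v)) - s (cosetw (u @ [Grp (g i \<otimes>\<^bsub>grp D\<^esub> g j)] @ v)))" if "i < j" "j < \<theta>" for i j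
      using R(5)[of i j] that by (simp add: gg_quot)
  qed
qed

section \<open>Linkable pairs and the linking form on words\<close>

definition link_list :: "(nat \<times> nat) list" where
  "link_list = [(i, j). j \<leftarrow> [0..<\<theta>], i \<leftarrow> [0..<j], linkable D i j]"

lemma set_link_list: "(i, j) \<in> set link_list \<longleftrightarrow> i < j \<and> j < \<theta> \<and> linkable D i j"
  by (auto simp: link_list_def)

lemma linkable_sym: "linkable D i j \<longleftrightarrow> linkable D j i"
  by (auto simp: linkable_def G.m_comm mult.commute)

text \<open>The partners \<open>j\<close>, \<open>k\<close> of \<open>i\<close> have \<open>\<chi>\<^sub>j = \<chi>\<^sub>k\<close>, so \<open>j \<noteq> k\<close> would give \<open>\<chi>\<^sub>i(g\<^sub>i)\<^sup>2 = 1\<close>.\<close>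

lemma linkable_unique:
  assumes "linkable D i j" "linkable D i k"
  shows "j = k"
proof (rule ccontr)
  assume jk: "j \<noteq> k"
  have l: "i < \<theta>" "j < \<theta>" "k < \<theta>" "i \<noteq> j" "i \<noteq> k"
    "\<And>h. h \<in> G \<Longrightarrow> \<chi> i h * \<chi> j h = 1" "\<And>h. h \<in> G \<Longrightarrow> \<chi> i h * \<chi> k h = 1"
    using assms by (auto simp: linkable_def)
  have inv: "\<chi> j h = inverse (\<chi> i h)" "\<chi> k h = inverse (\<chi> i h)" if "h \<in> G" for h
    using l(6,7)[OF that] by (auto intro: inverse_unique[symmetric])
  have "\<chi> j (g i) * \<chi> i (g j) = 1" "\<chi> k (g i) * \<chi> i (g k) = 1" "\<chi> j (g k) * \<chi> k (g j) = 1"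
    using l jk chi_braid by (auto simp: mult.commute)
  then have "\<chi> i (g j) = \<chi> i (g i)" "\<chi> i (g k) = \<chi> i (g i)" "inverse (\<chi> i (g k)) * inverse (\<chi> i (g j)) = 1"
    using l chi_nonzero[OF l(1)] by (auto simp: inv field_simps)
  then have "\<chi> i (g i) ^ 2 = 1" using chi_nonzero[OF l(1) g_closed[OF l(1)]] by (simp add: field_simps power2_eq_square)
  then have "N i dvd 2" using chi_power_eq_1[OF l(1)] by blast
  then show False using N_ge[OF l(1)] by (auto dest: dvd_imp_le)
qed

text \<open>Since linkability is symmetric and partners are unique, two linkable pairs sharing an
  index coincide; the order i < j excludes the reversed pair.\<close>

lemma link_pairs_link_list: "qls.link_pairs link_list"
  unfolding qls.link_pairs_def
proof (intro conjI ballI)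
  have *: "concat (map (\<lambda>i. if linkable D i j then [(i, j)] else []) xs) = map (\<lambda>i. (i, j)) (filter (\<lambda>i. linkable D i j) xs)" for j xs
    by (induction xs) auto
  have "distinct [(i, j). j \<leftarrow> [0..<n], i \<leftarrow> [0..<j], linkable D i j]" for n
    by (induction n) (auto simp: * distinct_map inj_on_def)
  then show "distinct link_list" unfolding link_list_def .
  show "qls.link_pair p" if "p \<in> set link_list" for p
  proof -
    obtain i j where "p = (i, j)" by fastforce
    then show ?thesis using that by (auto simp: set_link_list qls.link_pair_def linkable_def cx_def simp del: list.set)
  qed
  fix p q assume p: "p \<in> set link_list" and q: "q \<in> set link_list"
  obtain i j k m where pq: "p = (i, j)" "q = (k, m)" by fastforce
  then have "linkable D i j" "linkable D k m" "i < j" "k < m" using p q by (simp_all add: set_link_list)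
  moreover from this have "linkable D j i" "linkable D m k" by (simp_all add: linkable_sym[of j i] linkable_sym[of m k])
  ultimately show "p = q \<or> {fst p, snd p} \<inter> {fst q, snd q} = {}"
    unfolding pq using linkable_unique by (auto dest: linkable_unique less_asym)
qed

lemma rep2_sigma_link: "D'.rep2_0 (sigma_link D l) (D'.qls.link_w l link_list)"
proof -
  have *: "D'.rep2_0 (foldr (\<lambda>(i, j). conv2 (u0 (quot_datum D))
        (conv2_q_exp (u0 (quot_datum D)) (\<chi> j (g i)) (\<lambda>a b. l i j * eta (quot_datum D) i j a b)))
       ps (conv2_unit (u0 (quot_datum D)))) (D'.qls.link_w l ps)" if "set ps \<subseteq> set link_list" for ps
    using that
  proof (induction ps)
    case Nil
    then show ?case by (simp add: D'.qls.link_w_def D'.rep2_unit)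
  next
    case (Cons p ps)
    obtain i j where p: "p = (i, j)" by fastforce
    then have ij: "i < \<theta>" "j < \<theta>" "linkable D i j" using Cons.prems by (auto simp: set_link_list)
    have "qls.link_pair (i, j)" using ij by (auto simp: qls.link_pair_def linkable_def cx_def)
    \<comment> \<open>The q-exponential is truncated at the order of \<chi>_j(g_i), the word version
      at N_j; these agree because the two scalars do.\<close>
    then have "\<chi> j (g i) = \<chi> j (g j)" using qls.link_pair_q[of i j] ij by simp
    then have ord: "group.ord kstar (\<chi> j (g i)) = NN (quot_datum D) j" using ij NN_quot[of j] by (simp add: NN_def)
    have "D'.rep2_0 (\<lambda>a b. l i j * eta (quot_datum D) i j a b) (\<lambda>z. l i j * D'.qls.eta_w i j z)"
      by (intro D'.rep2_scale D'.rep2_eta) (use ij in auto)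
    from D'.rep2_q_exp[OF this, of "\<chi> j (g i)"]
    have "D'.rep2_0 (conv2_q_exp (u0 (quot_datum D)) (\<chi> j (g i)) (\<lambda>a b. l i j * eta (quot_datum D) i j a b))
        (D'.qls.link_factor l (i, j))"
      unfolding ord D'.qls.link_factor_def using ij by (simp add: carrier_FactGroup gg_quot[of i])
    from D'.rep2_conv2[OF this Cons.IH] Cons.prems show ?case
      by (simp add: p D'.qls.link_w_def)
  qed
  show ?thesis unfolding sigma_link_def link_list_def[symmetric] by (rule *) simp
qed

text \<open>Pulled back along the projection, the linking form of the quotient datum is on words the
  linking form built from D itself. It descends to u(D,0,\<mu>) because pullbacks of good
  functionals are good there.\<close>

lemma rep2_sigma_link_mu:
  assumes \<mu>: "root_vector_parameters D \<mu>"
  shows "rep2 (\<lambda>_ _. 0) \<mu> (sigma_link_mu D l \<mu>) (qls.link_w l link_list)"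
  unfolding rep2_def
proof (intro ballI)
  let ?c = "cls D (\<lambda>_ _. 0) \<mu>" and ?c' = "cls (quot_datum D) (\<lambda>_ _. 0) (\<lambda>_. 0)"
  let ?S = "qls.link_w l link_list" and ?S' = "D'.qls.link_w l link_list"
  have pb: "?S' (cosetw u, cosetw v) = ?S (u, v)" if "u \<in> W" "v \<in> W" for u v
    using pulls_back_link_w[of link_list l] that by (auto simp: set_link_list pulls_back_def)
  have S': "D'.bigood0 ?S'" by (rule D'.rep2_bigood[OF rep2_sigma_link])
  have S: "bigood (\<lambda>_ _. 0) \<mu> ?S"
    unfolding bigood_def
  proof (intro conjI ballI)
    fix v assume v: "v \<in> W"
    have "D'.good0 (\<lambda>u. ?S' (u, cosetw v))" using S' cosetw_W[OF v] unfolding D'.bigood_def by blast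
    from good_cosetw[OF \<mu> this] show "good D (\<lambda>_ _. 0) \<mu> (\<lambda>u. ?S (u, v))"
      by (rule good_cong_W) (rule pb[OF _ v])
    have "D'.good0 (\<lambda>u. ?S' (cosetw v, u))" using S' cosetw_W[OF v] unfolding D'.bigood_def by blast
    from good_cosetw[OF \<mu> this] show "good D (\<lambda>_ _. 0) \<mu> (\<lambda>u. ?S (v, u))"
      by (rule good_cong_W) (rule pb[OF v])
  qed
  fix p q assume p: "p \<in> P0" and q: "q \<in> P0"
  let ?p = "SOME r. r \<in> ?c p" and ?q = "SOME r. r \<in> ?c q"
  note rp = some_rep[OF cls_closed[OF p], of "\<lambda>_ _. 0" \<mu>] and rq = some_rep[OF cls_closed[OF q], of "\<lambda>_ _. 0" \<mu>]
  have "sigma_link_mu D l \<mu> (?c p) (?c q) = sigma_link D l (?c' (push cosetw ?p)) (?c' (push cosetw ?q))"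
    unfolding sigma_link_mu_def proj_mu_def cosetw_def ..
  also have "\<dots> = ext (\<lambda>u. ext (\<lambda>v. ?S' (u, v)) (push cosetw ?q)) (push cosetw ?p)"
    using rep2_sigma_link push_cosetw_P0[OF rp(1)] push_cosetw_P0[OF rq(1)] unfolding D'.rep2_def by blast
  also have "\<dots> = ext (\<lambda>u. ext (\<lambda>v. ?S' (cosetw u, cosetw v)) ?q) ?p"
    by (simp add: ext_push)
  also have "\<dots> = ext (\<lambda>u. ext (\<lambda>v. ?S (u, v)) ?q) ?p"
    by (intro ext_cong_P0 rp rq pb)
  also have "\<dots> = ext (\<lambda>u. ext (\<lambda>v. ?S (u, v)) q) p"
    by (rule bigood_ext_cong[OF S rp(1) p rp(2) rq(1) q rq(2)])
  finally show "sigma_link_mu D l \<mu> (?c p) (?c q) = ext (\<lambda>u. ext (\<lambda>v. ?S (u, v)) q) p" .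
qed

end

section \<open>The main theorem\<close>

locale link_datum = root_datum D \<mu> for D :: "('g, 'k::field_char_0) datum" and \<mu> +
  fixes l :: "nat \<Rightarrow> nat \<Rightarrow> 'k"
  assumes l: "linking_parameters D l"
begin

abbreviation L where "L \<equiv> cob g (qls.d_link l link_list)"
abbreviation L' where "L' \<equiv> cob' g (qls.d_link l link_list)"

lemma link_coboundary: "qls.link_w l link_list = coboundary g L L'"
proof -
  let ?S = "qls.link_w l link_list"
  have "?S \<bullet>\<^bsub>g\<^esub> (\<lambda>(u, v). L (u @ v)) = L \<otimes>\<^sub>t L" by (rule qls.link_coboundary[OF link_pairs_link_list])
  then have "coboundary g L L' = (?S \<bullet>\<^bsub>g\<^esub> (\<lambda>(u, v). L (u @ v))) \<bullet>\<^bsub>g\<^esub> (\<lambda>(u, v). L' (u @ v))"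
    by (simp only: coboundary_def)
  then show ?thesis by (simp only: cw2.conv_assoc conv_append cob_cob' eps_append2 cw2.conv_unit)
qed

text \<open>The inverse identification conjugates by F, so the linking form becomes (F \<otimes> F)
  * S * (F' \<otimes> F') for its word version S. Its last factor cancels the F \<otimes> F at the
  start of the coboundary of F, and what remains is the coboundary of F * L.\<close>

lemma rep2_sigma: "rep2_0 (sigma D l \<mu>) (coboundary g (F \<diamondop>\<^bsub>g\<^esub> L) (L' \<diamondop>\<^bsub>g\<^esub> F'))"
proof -
  let ?\<psi> = "inv_into (carrier (u_alg D (\<lambda>_ _. 0) \<mu>)) (root_ident D \<mu>)"
  let ?T = "(F \<otimes>\<^sub>t F) \<bullet>\<^bsub>g\<^esub> (qls.link_w l link_list \<bullet>\<^bsub>g\<^esub> (F' \<otimes>\<^sub>t F'))"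
  let ?Lm = "\<lambda>(u, v). L' (u @ v)" and ?Fm = "\<lambda>(u, v). F' (u @ v)"
  have "rep2_0 (\<lambda>a b. sigma_link_mu D l \<mu> (?\<psi> a) (?\<psi> b)) ?T"
    unfolding rep2_def
  proof (intro ballI)
    fix p q assume p: "p \<in> P0" and q: "q \<in> P0"
    have "sigma_link_mu D l \<mu> (cls D (\<lambda>_ _. 0) \<mu> (tw g F F' p)) (cls D (\<lambda>_ _. 0) \<mu> (tw g F F' q)) =
      ext (\<lambda>u. ext (\<lambda>v. qls.link_w l link_list (u, v)) (tw g F F' q)) (tw g F F' p)"
      using rep2_sigma_link_mu[OF \<mu>, of l] tw_P0[OF p] tw_P0[OF q] unfolding rep2_def by blast
    then show "sigma_link_mu D l \<mu> (?\<psi> (cls D (\<lambda>_ _. 0) (\<lambda>_. 0) p)) (?\<psi> (cls D (\<lambda>_ _. 0) (\<lambda>_. 0) q)) =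
      ext (\<lambda>u. ext (\<lambda>v. ?T (u, v)) q) p"
      unfolding inv_root_ident[OF p] inv_root_ident[OF q] ext2_tw .
  qed
  then have "rep2_0 (sigma D l \<mu>) (?T \<bullet>\<^bsub>g\<^esub> coboundary g F F')"
    unfolding sigma_def Let_def by (rule rep2_conv2) (rule root.sigma)
  moreover have "?T \<bullet>\<^bsub>g\<^esub> coboundary g F F' = coboundary g (F \<diamondop>\<^bsub>g\<^esub> L) (L' \<diamondop>\<^bsub>g\<^esub> F')"
  proof -
    have "?T \<bullet>\<^bsub>g\<^esub> coboundary g F F' =
      ((F \<otimes>\<^sub>t F) \<bullet>\<^bsub>g\<^esub> (L \<otimes>\<^sub>t L)) \<bullet>\<^bsub>g\<^esub> (?Lm \<bullet>\<^bsub>g\<^esub> (((F' \<otimes>\<^sub>t F') \<bullet>\<^bsub>g\<^esub> (F \<otimes>\<^sub>t F)) \<bullet>\<^bsub>g\<^esub> ?Fm))"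
      unfolding link_coboundary unfolding coboundary_def by (simp only: cw2.conv_assoc)
    also have "\<dots> = coboundary g (F \<diamondop>\<^bsub>g\<^esub> L) (L' \<diamondop>\<^bsub>g\<^esub> F')"
      unfolding root.tens_inv unfolding coboundary_def by (simp only: cw2.conv_unit conv_tens conv_append)
    finally show ?thesis .
  qed
  ultimately show ?thesis by simp
qed

lemma d_link_pair:
  "deg w = 0 \<Longrightarrow> qls.d_link l link_list i w = 0"
  "i < j \<Longrightarrow> j < \<theta> \<Longrightarrow> qls.d_link l link_list i [Var j] = l i j"
  "i < j \<Longrightarrow> qls.d_link l link_list j [Var i] = 0"
proof -
  have z: "qls.d_link l ps i w = 0" if "\<And>j. (i, j) \<in> set ps \<Longrightarrow> dp cx j 1 (\<lambda>_. 1) w = 0" for ps i w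
    using that by (induction ps) (auto simp: qls.d_link_def simp del: One_nat_def)
  show "qls.d_link l link_list i w = 0" if "deg w = 0"
    by (rule z) (use that dp_deg[of cx _ 1 "\<lambda>_. 1" w] in auto)
  show "qls.d_link l link_list j [Var i] = 0" if "i < j"
    by (rule z) (use that in \<open>auto simp: set_link_list\<close>)
  assume ij: "i < j" "j < \<theta>"
  have "qls.d_link l ps i [Var j] = (if (i, j) \<in> set ps then l i j else 0)" if "distinct ps" for ps
    using that
  proof (induction ps)
    case (Cons p ps)
    obtain a b where "p = (a, b)" by fastforce
    then show ?case using Cons by (auto simp: qls.d_link_def)
  qed (simp add: qls.d_link_def)
  moreover have "distinct link_list" using link_pairs_link_list unfolding qls.link_pairs_def by blast
  ultimately show "qls.d_link l link_list i [Var j] = l i j"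
    using ij l by (auto simp: set_link_list linking_parameters_def)
qed

text \<open>The functional attached to x_i involves only x_j with j > i, so on words whose only
  variable is x_i it vanishes and L is eps.\<close>

lemma L_flat:
  assumes "w \<in> flat {i}"
  shows "L w = eps w" "L' w = eps w"
proof -
  have z: "qls.d_link l ps i u = 0" if "u \<in> flat {i}" "\<And>j. (i, j) \<in> set ps \<Longrightarrow> j \<noteq> i" for ps u
  proof -
    have "dp cx j 1 (\<lambda>_. 1) u = 0" if "j \<noteq> i" for j
      using \<open>u \<in> flat {i}\<close> that by (induction u) auto
    then show ?thesis using that(2) by (induction ps) (auto simp: qls.d_link_def simp del: One_nat_def)
  qed
  have "qls.d_link l link_list i u = 0" if "u \<in> flat {i}" for u
    by (rule z[OF that]) (auto simp: set_link_list)
  then show "L w = eps w" "L' w = eps w"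
    by (intro cob_flat_eps[where I = "{i}" and n = "deg w"] assms; auto)+
qed

lemma L_low: "deg w \<le> 1 \<Longrightarrow> L w = eps w" "deg w \<le> 1 \<Longrightarrow> L' w = eps w"
proof -
  have w: "w \<in> flat UNIV" by (rule flat_UNIV)
  show "deg w \<le> 1 \<Longrightarrow> L w = eps w" "deg w \<le> 1 \<Longrightarrow> L' w = eps w"
    by (rule cob_flat_eps[OF _ w]; simp add: d_link_pair)+
qed

text \<open>F is eps up to degree 2, so the linking relations are decided by L alone; on words in a
  single x_i it is L that drops out.\<close>

lemma FL_low:
  assumes "deg w \<le> 2"
  shows "(F \<diamondop>\<^bsub>g\<^esub> L) w = L w" "(L' \<diamondop>\<^bsub>g\<^esub> F') w = L' w"
  using assms by (intro conv_flat_eps[where I = UNIV] flat_UNIV; simp add: F_low)+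

lemma FL_flat:
  assumes "w \<in> flat {i}"
  shows "(F \<diamondop>\<^bsub>g\<^esub> L) w = F w" "(L' \<diamondop>\<^bsub>g\<^esub> F') w = F' w"
  using assms by (intro conv_flat_eps[where I = "{i}"]; simp add: L_flat)+

text \<open>F * L inherits the values of L on words of degree 2 and those of F on powers of a single
  x_i, so both families of relations are deformed independently.\<close>

sublocale link: coboundary_twist D l \<mu> "F \<diamondop>\<^bsub>g\<^esub> L" "L' \<diamondop>\<^bsub>g\<^esub> F'" "sigma D l \<mu>"
proof
  have "(F \<diamondop>\<^bsub>g\<^esub> L) \<diamondop>\<^bsub>g\<^esub> (L' \<diamondop>\<^bsub>g\<^esub> F') = F \<diamondop>\<^bsub>g\<^esub> ((L \<diamondop>\<^bsub>g\<^esub> L') \<diamondop>\<^bsub>g\<^esub> F')"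
    by (simp only: cw.conv_assoc)
  then show "(F \<diamondop>\<^bsub>g\<^esub> L) \<diamondop>\<^bsub>g\<^esub> (L' \<diamondop>\<^bsub>g\<^esub> F') = eps" by (simp only: cob_cob' cw.conv_unit)
  have "(L' \<diamondop>\<^bsub>g\<^esub> F') \<diamondop>\<^bsub>g\<^esub> (F \<diamondop>\<^bsub>g\<^esub> L) = L' \<diamondop>\<^bsub>g\<^esub> ((F' \<diamondop>\<^bsub>g\<^esub> F) \<diamondop>\<^bsub>g\<^esub> L)"
    by (simp only: cw.conv_assoc)
  then show "(L' \<diamondop>\<^bsub>g\<^esub> F') \<diamondop>\<^bsub>g\<^esub> (F \<diamondop>\<^bsub>g\<^esub> L) = eps" by (simp only: cob'_cob cw.conv_unit)
  show "rep2_0 (sigma D l \<mu>) (coboundary g (F \<diamondop>\<^bsub>g\<^esub> L) (L' \<diamondop>\<^bsub>g\<^esub> F'))" by (rule rep2_sigma)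
  show "(F \<diamondop>\<^bsub>g\<^esub> L) [Var i] = 0" "(L' \<diamondop>\<^bsub>g\<^esub> F') [Var i] = 0" for i
    by (simp_all add: FL_low L_low del: conv_letter cob_Var cob'_Var)
  fix s assume s: "good0 s"
  show "kills D l \<mu> ((L' \<diamondop>\<^bsub>g\<^esub> F') \<diamondop>\<^bsub>g\<^esub> (s \<diamondop>\<^bsub>g\<^esub> (F \<diamondop>\<^bsub>g\<^esub> L)))"
  proof (rule kills_twistI[OF _ _ _ _ _ _ _ _ _ s])
    show "(F \<diamondop>\<^bsub>g\<^esub> L) w = 0 \<and> (L' \<diamondop>\<^bsub>g\<^esub> F') w = 0" if "deg w = 1" for w
      using that by (simp add: FL_low L_low eps_deg)
    have v: "L [Var i, Var j] = - qls.d_link l link_list i [Var j]" "L' [Var i, Var j] = qls.d_link l link_list i [Var j]" for i j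
      by (simp_all add: d_link_pair)
    show "(F \<diamondop>\<^bsub>g\<^esub> L) [Var i, Var j] = - l i j \<and> (L' \<diamondop>\<^bsub>g\<^esub> F') [Var i, Var j] = l i j"
      "(F \<diamondop>\<^bsub>g\<^esub> L) [Var j, Var i] = 0 \<and> (L' \<diamondop>\<^bsub>g\<^esub> F') [Var j, Var i] = 0" if "i < j" "j < \<theta>" for i j
      using that FL_low[of "[Var i, Var j]"] FL_low[of "[Var j, Var i]"]
      unfolding v by (simp_all add: d_link_pair del: conv_letter)
    show "(F \<diamondop>\<^bsub>g\<^esub> L) w = 0 \<and> (L' \<diamondop>\<^bsub>g\<^esub> F') w = 0" if "w \<in> flat {i}" "0 < deg w" "deg w < N i" for i w
      using F_gap[OF that] FL_flat[OF that(1)] by simp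
    fix i assume i: "i < \<theta>"
    have r: "replicate (N i) (Var i) \<in> flat {i}" by (auto simp: in_lists_conv_set)
    show "(F \<diamondop>\<^bsub>g\<^esub> L) (replicate (N i) (Var i)) = - \<mu> i \<and> (L' \<diamondop>\<^bsub>g\<^esub> F') (replicate (N i) (Var i)) = \<mu> i"
      using F_root[OF i] FL_flat[OF r] by simp
  qed simp_all
qed simp_all

end

theorem theorem4p9:
  fixes D :: "('g, 'k::{alg_closed_field, field_char_0}) datum"
    and l :: "nat \<Rightarrow> nat \<Rightarrow> 'k" and \<mu> :: "nat \<Rightarrow> 'k"
  assumes "special_datum D"
    and "root_vector_parameters D \<mu>"
    and "linking_parameters D l"
  shows "multiplicative_cocycle (u0 D) (sigma D l \<mu>) \<and>
         (\<exists>\<phi>. canonical_iso D l \<mu> (twist (u0 D) (sigma D l \<mu>)) \<phi>)"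
proof -
  interpret link_datum D \<mu> l
    by unfold_locales (fact assms)+
  show ?thesis using link.cocycle link.canonical_iso_Phi by blast
qed

end
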